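(* Let $n\ge 2$ and let $\beta:\rho\to\rho'$ be a nonsingular $\mathrm{SL}_2(\mathbb C)^*$-colored (in particular admissible) braid on $n$ strands. Write $(\chi_1,\dots,\chi_n)$ for the $\mathcal Z_0$-characters corresponding to $\rho$ and $(\chi_1',\dots,\chi_n')$ for those corresponding to $\rho'$. For a nonsingular object $\rho$ let $$\phi_\rho:H_1^{\mathrm{lf}}(D_n;\rho)\to\mathfrak H_n/\ker(\chi_1\otimes\cdots\otimes\chi_n),\qquad \phi_\rho(v_j^\nu)=\beta_j^\nu\quad(1\le j\le n-1,\ \nu=1,2).$$ Then: (1) The linear maps $\phi_\rho$ are injective, and the diagram formed by $\phi_\rho$, $\phi_{\rho'}$, $\mathcal B(\beta)$ and $\mathcal A(\beta)$ commutes: $$\phi_{\rho'}\circ\mathcal B(\beta)=\mathcal A(\beta)\circ\phi_\rho ,$$ where $\mathcal B(\beta):H_1^{\mathrm{lf}}(D_n;\rho)\to H_1^{\mathrm{lf}}(D_n;\rho')$ is the reduced twisted Burau representation and $\mathcal A(\beta):\mathfrak H_n/\ker(\chi_1\otimes\cdots\otimes\chi_n)\to\mathfrak H_n/\ker(\chi_1'\otimes\cdots\otimes\chi_n')$ is the braid action induced by $\check{\mathcal R}$. (2) The subspace $\mathfrak H_n$ generates a Clifford algebra $\mathfrak C_n$ inside $\mathcal U[\Omega^{-1}]^{\otimes n}$ which super-commutes with $\Delta(\mathcal U)$, the image of $\mathcal U$ in $\mathcal U^{\otimes n}$ under the (iterated) coproduct.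
   Context: **Algebra.** $\mathcal U=\mathcal U_i(\mathfrak{sl}_2)$ is the $\mathbb C$-algebra with generators $E,F,K^{\pm1}$ and relations $KE=-EK$, $KF=-FK$, $EF-FE=2i(K-K^{-1})$. It is a Hopf algebra with $\Delta E=1\otimes E+E\otimes K$, $\Delta F=K^{-1}\otimes F+F\otimes1$, $\Delta K=K\otimes K$, $S(E)=-EK^{-1}$, $S(F)=-KF$, $S(K)=K^{-1}$. Put $\tilde F=iKF$ and $\Omega=iEF+K-K^{-1}=K-K^{-1}(1+E\tilde F)$, which is central. $\mathcal Z_0=\mathbb C[K^{\pm2},E^2,F^2]$ is a central subalgebra, and $\Omega^2=(K-K^{-1})^2-E^2F^2\in\mathcal Z_0$. $\mathcal U$ is a superalgebra ($\mathbb Z/2$-graded) with $|E|=|\tilde F|=0$, $|K|=|\Omega|=1$; $x,y$ super-commute if $xy=(-1)^{|x||y|}yx$. The Clifford algebra on a module $V$ over a commutative ring $Z$ with a symmetric $Z$-valued bilinear form $\eta$ is the quotient of the tensor algebra by $vw+wv=\eta(v,w)$; elements of $V$ are odd. Writing $X_j$ for $X$ placed in the $j$th tensor factor, for $1\le j\le n$ put $\alpha_j^1=K_1\cdots K_{j-1}E_j\Omega_j^{-1}$, $\alpha_j^2=K_1\cdots K_{j-1}\tilde F_j\Omega_j^{-1}$, and for $1\le j\le n-1$ put $\beta_j^\nu=\alpha_j^\nu-\alpha_{j+1}^\nu$. $\mathfrak H_n\subset(\mathcal U[\Omega^{-1}])^{\otimes n}$ is the $(\mathcal Z_0[\Omega^{-2}])^{\otimes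 n}$-span of the $\beta_j^\nu$, and $\mathfrak C_n$ is the subalgebra it generates; the base ring of the Clifford algebra is $(\mathcal Z_0[\Omega^{-2}])^{\otimes n}$. **Characters.** A $\mathcal Z_0$-character is an algebra homomorphism $\chi:\mathcal Z_0\to\mathbb C$; with $\kappa=\chi(K^2)$, $\epsilon=\chi(E^2)$, $\phi=\kappa\chi(F^2)$ it is identified with the element $(\chi^+,\chi^-)=\left(\begin{pmatrix}\kappa&0\\ \phi&1\end{pmatrix},\begin{pmatrix}1&\epsilon\\0&\kappa\end{pmatrix}\right)$ of the group $\mathrm{SL}_2(\mathbb C)^*\subset\mathrm{GL}_2(\mathbb C)\times\mathrm{GL}_2(\mathbb C)$ of all such pairs. Put $\psi(\chi)=\chi^+(\chi^-)^{-1}\in\mathrm{SL}_2(\mathbb C)$. $\chi$ is nonsingular if $\chi(\Omega^2)\ne0$, equivalently $1$ is not an eigenvalue of $\psi(\chi)$. **Colored braids.** $\mathbb B(\mathrm{SL}_2(\mathbb C)^* )$ is the groupoid whose objects are tuples of $\mathcal Z_0$-characters and whose morphisms are the $\mathrm{SL}_2(\mathbb C)^*$-colored (admissible) braids: products (composed left to right) of admissible colored generators $\sigma_i^{\pm1}$, where $\sigma:(\chi_1,\chi_2)\to(\chi_4,\chi_3)$ is admissible if the equations $\chi_1^+\chi_2^+=\chi_4^+\chi_3^+$, $\chi_1^-\chi_2^-=\chi_4^-\chi_3^-$, $\chi_1^-\chi_2^+=\chi_4^+\chi_3^-$ have a (then unique) solution $(\chi_4,\chi_3)$; $\sigma_i$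 acts this way on entries $i,i+1$. An object is nonsingular if all its characters are; a braid is nonsingular if its source and target are. An object $\rho=(\chi_1,\dots,\chi_n)$ determines a representation, also denoted $\rho$, of $\pi_1(D_n)$ ($D_n$ the $n$-punctured disc, $\pi_1(D_n)$ free on loops $x_1,\dots,x_n$ around the punctures) by $\rho(x_j)=(\chi_1^+\cdots\chi_{j-1}^+)\,\psi(\chi_j)\,(\chi_1^+\cdots\chi_{j-1}^+)^{-1}$. **Braid action on $\mathcal U^{\otimes n}$.** With $\mathsf w=1+K^2F^2\otimes K^{-2}E^2$, $\check{\mathcal R}$ is the unique automorphism of $\mathcal U\otimes\mathcal U[\mathsf w^{-1}]$ with $\check{\mathcal R}(E\otimes1)=K\otimes E$, $\check{\mathcal R}(1\otimes F)=F\otimes K^{-1}$, $\check{\mathcal R}(K\otimes1)=1\otimes K-iKF\otimes E$, $\check{\mathcal R}(\Delta u)=\Delta u$ for all $u\in\mathcal U$. It satisfies $(\chi_4\otimes\chi_3)\check{\mathcal R}=\chi_1\otimes\chi_2$ for $\sigma:(\chi_1,\chi_2)\to(\chi_4,\chi_3)$ and exchanges $\Omega\otimes1$ and $1\otimes\Omega$. $\mathcal A(\sigma_i)$ is $\check{\mathcal R}$ acting in factors $i,i+1$, as a map $\mathcal U^{\otimes n}/\ker(\chi_1\otimes\cdots\otimes\chi_n)\to\mathcal U^{\otimes n}/\ker(\chi_1'\otimes\cdots\otimes\chi_n')$ (quotients by the ideals generated by the kernels; the $\Omega_j$ are invertible there in the nonsingular case); $\mathfrak H_n/\ker(\cdots)$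 denotes the image of $\mathfrak H_n$. **Burau representation.** $H_1^{\mathrm{lf}}(D_n;\rho)$ denotes the locally finite (Borel–Moore) homology of $D_n$ with coefficients twisted by $\rho^\vee$, $\rho^\vee(x)=(\rho(x)^{-1})^T$; it is dual, by the intersection pairing, to the twisted homology $H_1(D_n,\partial D_n;\rho)$. $\mathcal B$ is the functor given by the action of braids on $D_n$ by homeomorphisms. With $y_j=x_j\cdots x_1$, let $z_j\otimes e^\mu$ ($1\le j\le n-1$, $\mu=1,2$) be the basis dual to the basis $y_j\otimes e_\mu$ of $H_1(D_n,\partial D_n;\rho)$. The basis $v_j^\nu=v_j^\nu(\rho)$ is obtained from it by the change of basis matrices $p_j=(\chi_1^+\cdots\chi_j^+)^T$: the first and second rows of $p_j$ give the coefficients of $v_j^2$ and $v_j^1$ in $z_j\otimes e^1,z_j\otimes e^2$. With respect to the ordered bases $(v_1^2,v_1^1,\dots,v_{n-1}^2,v_{n-1}^1)$, matrices acting on row vectors from the right, $\mathcal B(\sigma_i):H_1^{\mathrm{lf}}(D_n;\rho)\to H_1^{\mathrm{lf}}(D_n;\rho')$ has the matrix that is the identity except in the $2\times2$ block rows and columns $i-1,i,i+1$ (block indices $0$ and $n$ omitted), where it is $$\begin{bmatrix}I_2&P&0\\0&N&0\\0&R&I_2\end{bmatrix},\quad P=\begin{pmatrix}\kappa_i^{-1}&-\phi_i\kappa_i^{-1}\\0&1\end{pmatrix},\ N=\begin{pmatrix}-\kappa_i^{-1}&\phi_i\kappa_i^{-1}\\-\epsilon_{i+1}&-\kappa_{i+1}\end{pmatrix},\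 R=\begin{pmatrix}1&0\\ \epsilon_{i+1}&\kappa_{i+1}\end{pmatrix},$$ $\kappa_j,\epsilon_j,\phi_j$ being the coordinates of the characters of the target $\rho'$.
   Formalization: With the stated conventions the square fails for n=2 (A sends β_1^1 to ε_2β_1^2−κ_2β_1^1, B sends v_1^1 to −ε_2v_1^2−κ_2v_1^1), so φ_ρ(v_j^2)=−β_j^2 is used, φ_ρ(v_j^1)=β_j^1 kept; Ř is a homomorphism from U⊗U into its localization at w. *)

theory Defs
  imports
    "HOL-Analysis.Cartesian_Space"
    "HOL-Algebra.QuotRing"
    "HOL-Algebra.Product_Groups"
    "HOL-Algebra.UnivPoly"
begin

section \<open>Algebras\<close>

text \<open>
  A \<open>k\<close>-algebra, not necessarily commutative, is a record of type \<^typ>\<open>('k, 'a) module\<close>: a ring with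
  a scalar multiplication (the locale \<^locale>\<open>algebra\<close> is for commutative algebras only).
  Homomorphisms, and vectors that are functions, are extensional, so that the definite descriptions
  below determine them uniquely.
\<close>

definition complex_alg :: "(complex, complex) module" where
  "complex_alg = \<lparr>carrier = UNIV, mult = (*), one = 1, zero = 0, add = (+), smult = (*)\<rparr>"

definition lin_hom :: "(complex, 'a, 'm) module_scheme \<Rightarrow> (complex, 'b, 'n) module_scheme \<Rightarrow> ('a \<Rightarrow> 'b) set" where
  "lin_hom M N = {h \<in> carrier M \<rightarrow>\<^sub>E carrier N.
     (\<forall>x\<in>carrier M. \<forall>y\<in>carrier M. h (x \<oplus>\<^bsub>M\<^esub> y) = h x \<oplus>\<^bsub>N\<^esub> h y) \<and>
     (\<forall>c. \<forall>x\<in>carrier M. h (c \<odot>\<^bsub>M\<^esub> x) = c \<odot>\<^bsub>N\<^esub> h x)}"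

definition alg_hom :: "(complex, 'a, 'm) module_scheme \<Rightarrow> (complex, 'b, 'n) module_scheme \<Rightarrow> ('a \<Rightarrow> 'b) set" where
  "alg_hom A B = ring_hom A B \<inter> lin_hom A B"

inductive_set subalg_gen :: "(complex, 'a, 'm) module_scheme \<Rightarrow> 'a set \<Rightarrow> 'a set"
  for A :: "(complex, 'a, 'm) module_scheme" and S :: "'a set" where
  incl: "x \<in> S \<Longrightarrow> x \<in> subalg_gen A S"
| one: "\<one>\<^bsub>A\<^esub> \<in> subalg_gen A S"
| add: "x \<in> subalg_gen A S \<Longrightarrow> y \<in> subalg_gen A S \<Longrightarrow> x \<oplus>\<^bsub>A\<^esub> y \<in> subalg_gen A S"
| mult: "x \<in> subalg_gen A S \<Longrightarrow> y \<in> subalg_gen A S \<Longrightarrow> x \<otimes>\<^bsub>A\<^esub> y \<in> subalg_gen A S"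
| smult: "x \<in> subalg_gen A S \<Longrightarrow> c \<odot>\<^bsub>A\<^esub> x \<in> subalg_gen A S"

definition quot_alg :: "('k, 'a, 'm) module_scheme \<Rightarrow> 'a set \<Rightarrow> ('k, 'a set) module" where
  "quot_alg A I = \<lparr>carrier = carrier (A Quot I), mult = mult (A Quot I), one = one (A Quot I),
     zero = zero (A Quot I), add = add (A Quot I),
     smult = (\<lambda>c X. \<Union>x\<in>X. I +>\<^bsub>A\<^esub> (c \<odot>\<^bsub>A\<^esub> x))\<rparr>"

text \<open>The monoid algebra \<open>R[M]\<close>: finitely supported functions on \<open>M\<close> under convolution.\<close>

definition monoid_alg :: "('r, 's) ring_scheme \<Rightarrow> ('m, 't) monoid_scheme \<Rightarrow> ('r, 'm \<Rightarrow> 'r) module" where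
  "monoid_alg R M =
     \<lparr>carrier = {f. (\<forall>m\<in>carrier M. f m \<in> carrier R) \<and> (\<forall>m. m \<notin> carrier M \<longrightarrow> f m = \<zero>\<^bsub>R\<^esub>) \<and>
                     finite {m. f m \<noteq> \<zero>\<^bsub>R\<^esub>}},
      mult = (\<lambda>f g m. finsum R (\<lambda>(a, b). f a \<otimes>\<^bsub>R\<^esub> g b)
        {(a, b). f a \<noteq> \<zero>\<^bsub>R\<^esub> \<and> g b \<noteq> \<zero>\<^bsub>R\<^esub> \<and> a \<otimes>\<^bsub>M\<^esub> b = m}),
      one = (\<lambda>m. if m = \<one>\<^bsub>M\<^esub> then \<one>\<^bsub>R\<^esub> else \<zero>\<^bsub>R\<^esub>),
      zero = (\<lambda>m. \<zero>\<^bsub>R\<^esub>),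
      add = (\<lambda>f g m. f m \<oplus>\<^bsub>R\<^esub> g m),
      smult = (\<lambda>r f m. r \<otimes>\<^bsub>R\<^esub> f m)\<rparr>"

definition basis_elt :: "('r, 's) ring_scheme \<Rightarrow> 'm \<Rightarrow> 'm \<Rightarrow> 'r" where
  "basis_elt R a = (\<lambda>m. if m = a then \<one>\<^bsub>R\<^esub> else \<zero>\<^bsub>R\<^esub>)"

definition free_monoid :: "'x set \<Rightarrow> 'x list monoid" where
  "free_monoid X = \<lparr>carrier = lists X, mult = (@), one = []\<rparr>"

text \<open>
  The tensor power \<open>A\<^sup>\<otimes>\<^sup>n\<close> over the complex numbers, with factors numbered \<open>1, \<dots>, n\<close>: the monoid
  algebra of the multiplicative monoid of \<open>n\<close>-tuples, modulo multilinearity.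
\<close>

definition tuples_alg :: "nat \<Rightarrow> (complex, 'a, 'm) module_scheme \<Rightarrow> (complex, (nat \<Rightarrow> 'a) \<Rightarrow> complex) module" where
  "tuples_alg n A = monoid_alg complex_alg (product_group {1..n} (\<lambda>_. A))"

definition multilinear_rels :: "nat \<Rightarrow> (complex, 'a, 'm) module_scheme \<Rightarrow> ((nat \<Rightarrow> 'a) \<Rightarrow> complex) set" where
  "multilinear_rels n A =
     (let P = tuples_alg n A; T = {1..n} \<rightarrow>\<^sub>E carrier A; \<delta> = basis_elt complex_alg in
      {\<delta> (t(j := x \<oplus>\<^bsub>A\<^esub> y)) \<ominus>\<^bsub>P\<^esub> (\<delta> (t(j := x)) \<oplus>\<^bsub>P\<^esub> \<delta> (t(j := y))) | t j x y.
         t \<in> T \<and> j \<in> {1..n} \<and> x \<in> carrier A \<and> y \<in> carrier A} \<union>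
      {\<delta> (t(j := c \<odot>\<^bsub>A\<^esub> x)) \<ominus>\<^bsub>P\<^esub> (c \<odot>\<^bsub>P\<^esub> \<delta> (t(j := x))) | t j c x.
         t \<in> T \<and> j \<in> {1..n} \<and> x \<in> carrier A})"

definition tensor_ideal :: "nat \<Rightarrow> (complex, 'a, 'm) module_scheme \<Rightarrow> ((nat \<Rightarrow> 'a) \<Rightarrow> complex) set" where
  "tensor_ideal n A = Idl\<^bsub>tuples_alg n A\<^esub> (multilinear_rels n A)"

definition tensor_pow ::
    "nat \<Rightarrow> (complex, 'a, 'm) module_scheme \<Rightarrow> (complex, ((nat \<Rightarrow> 'a) \<Rightarrow> complex) set) module" where
  "tensor_pow n A = quot_alg (tuples_alg n A) (tensor_ideal n A)"

definition in_factor ::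
    "nat \<Rightarrow> (complex, 'a, 'm) module_scheme \<Rightarrow> nat \<Rightarrow> 'a \<Rightarrow> ((nat \<Rightarrow> 'a) \<Rightarrow> complex) set" where
  "in_factor n A j x = tensor_ideal n A +>\<^bsub>tuples_alg n A\<^esub>
     basis_elt complex_alg (\<lambda>k\<in>{1..n}. if k = j then x else \<one>\<^bsub>A\<^esub>)"

text \<open>For homomorphisms \<open>f j : A \<rightarrow> B\<close> with commuting images:
  \<open>x\<^sub>1 \<otimes> \<dots> \<otimes> x\<^sub>n \<mapsto> f 1 x\<^sub>1 \<cdots> f n x\<^sub>n\<close>.\<close>

definition tensor_lift :: "nat \<Rightarrow> (complex, 'a, 'm) module_scheme \<Rightarrow> (complex, 'b, 'p) module_scheme \<Rightarrow>
    (nat \<Rightarrow> 'a \<Rightarrow> 'b) \<Rightarrow> ((nat \<Rightarrow> 'a) \<Rightarrow> complex) set \<Rightarrow> 'b" where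
  "tensor_lift n A B f = (THE h. h \<in> alg_hom (tensor_pow n A) B \<and>
     (\<forall>j\<in>{1..n}. \<forall>a\<in>carrier A. h (in_factor n A j a) = f j a))"

text \<open>The localization \<open>A[s\<^sup>-\<^sup>1] = A[t]/(st - 1)\<close> at a central element \<open>s\<close>.\<close>

definition poly_alg :: "(complex, 'a, 'm) module_scheme \<Rightarrow> (complex, nat \<Rightarrow> 'a) module" where
  "poly_alg A = \<lparr>carrier = carrier (UP A), mult = mult (UP A), one = one (UP A),
     zero = zero (UP A), add = add (UP A), smult = (\<lambda>c p n. c \<odot>\<^bsub>A\<^esub> p n)\<rparr>"

definition loc_ideal :: "(complex, 'a, 'm) module_scheme \<Rightarrow> 'a \<Rightarrow> (nat \<Rightarrow> 'a) set" where
  "loc_ideal A s = Idl\<^bsub>poly_alg A\<^esub> {up_ring.monom (UP A) s 1 \<ominus>\<^bsub>poly_alg A\<^esub> \<one>\<^bsub>poly_alg A\<^esub>}"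

definition localize :: "(complex, 'a, 'm) module_scheme \<Rightarrow> 'a \<Rightarrow> (complex, (nat \<Rightarrow> 'a) set) module" where
  "localize A s = quot_alg (poly_alg A) (loc_ideal A s)"

definition to_loc :: "(complex, 'a, 'm) module_scheme \<Rightarrow> 'a \<Rightarrow> 'a \<Rightarrow> (nat \<Rightarrow> 'a) set" where
  "to_loc A s a = loc_ideal A s +>\<^bsub>poly_alg A\<^esub> up_ring.monom (UP A) a 0"

text \<open>The extension to \<open>A[s\<^sup>-\<^sup>1]\<close> of a homomorphism \<open>f : A \<rightarrow> B\<close> that makes \<open>s\<close> invertible.\<close>

definition loc_lift :: "(complex, 'a, 'm) module_scheme \<Rightarrow> 'a \<Rightarrow> (complex, 'b, 'n) module_scheme \<Rightarrow>
    ('a \<Rightarrow> 'b) \<Rightarrow> (nat \<Rightarrow> 'a) set \<Rightarrow> 'b" where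
  "loc_lift A s B f = (THE h. h \<in> alg_hom (localize A s) B \<and> (\<forall>a\<in>carrier A. h (to_loc A s a) = f a))"


section \<open>Clifford algebras\<close>

text \<open>Here \<open>Z\<close> is a commutative ring and \<open>V\<close> a \<open>Z\<close>-module, whose ring multiplication is not used.\<close>

definition words_alg :: "('z, 's) ring_scheme \<Rightarrow> ('z, 'v, 'm) module_scheme \<Rightarrow> ('z, 'v list \<Rightarrow> 'z) module" where
  "words_alg Z V = monoid_alg Z (free_monoid (carrier V))"

definition tensor_algebra_ideal :: "('z, 's) ring_scheme \<Rightarrow> ('z, 'v, 'm) module_scheme \<Rightarrow> ('v list \<Rightarrow> 'z) set" where
  "tensor_algebra_ideal Z V = (let W = words_alg Z V; \<delta> = basis_elt Z in
     Idl\<^bsub>W\<^esub> ({\<delta> [v \<oplus>\<^bsub>V\<^esub> w] \<ominus>\<^bsub>W\<^esub> (\<delta> [v] \<oplus>\<^bsub>W\<^esub> \<delta> [w]) | v w. v \<in> carrier V \<and> w \<in> carrier V} \<union>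
           {\<delta> [z \<odot>\<^bsub>V\<^esub> v] \<ominus>\<^bsub>W\<^esub> (z \<odot>\<^bsub>W\<^esub> \<delta> [v]) | z v. z \<in> carrier Z \<and> v \<in> carrier V}))"

definition tensor_algebra :: "('z, 's) ring_scheme \<Rightarrow> ('z, 'v, 'm) module_scheme \<Rightarrow> ('z, ('v list \<Rightarrow> 'z) set) module" where
  "tensor_algebra Z V = quot_alg (words_alg Z V) (tensor_algebra_ideal Z V)"

definition to_tensor_algebra :: "('z, 's) ring_scheme \<Rightarrow> ('z, 'v, 'm) module_scheme \<Rightarrow> 'v \<Rightarrow> ('v list \<Rightarrow> 'z) set" where
  "to_tensor_algebra Z V v = tensor_algebra_ideal Z V +>\<^bsub>words_alg Z V\<^esub> basis_elt Z [v]"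

definition symmetric_bilinear_form ::
    "('z, 's) ring_scheme \<Rightarrow> ('z, 'v, 'm) module_scheme \<Rightarrow> ('v \<Rightarrow> 'v \<Rightarrow> 'z) \<Rightarrow> bool" where
  "symmetric_bilinear_form Z V \<eta> \<longleftrightarrow>
     (\<forall>v\<in>carrier V. \<forall>w\<in>carrier V. \<eta> v w \<in> carrier Z \<and> \<eta> v w = \<eta> w v) \<and>
     (\<forall>u\<in>carrier V. \<forall>v\<in>carrier V. \<forall>w\<in>carrier V. \<eta> (u \<oplus>\<^bsub>V\<^esub> v) w = \<eta> u w \<oplus>\<^bsub>Z\<^esub> \<eta> v w) \<and>
     (\<forall>z\<in>carrier Z. \<forall>v\<in>carrier V. \<forall>w\<in>carrier V. \<eta> (z \<odot>\<^bsub>V\<^esub> v) w = z \<otimes>\<^bsub>Z\<^esub> \<eta> v w)"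

definition clifford_ideal :: "('z, 's) ring_scheme \<Rightarrow> ('z, 'v, 'm) module_scheme \<Rightarrow> ('v \<Rightarrow> 'v \<Rightarrow> 'z) \<Rightarrow>
    ('v list \<Rightarrow> 'z) set set" where
  "clifford_ideal Z V \<eta> = (let T = tensor_algebra Z V; \<tau> = to_tensor_algebra Z V in
     Idl\<^bsub>T\<^esub> {((\<tau> v \<otimes>\<^bsub>T\<^esub> \<tau> w) \<oplus>\<^bsub>T\<^esub> (\<tau> w \<otimes>\<^bsub>T\<^esub> \<tau> v)) \<ominus>\<^bsub>T\<^esub> (\<eta> v w \<odot>\<^bsub>T\<^esub> \<one>\<^bsub>T\<^esub>) | v w.
            v \<in> carrier V \<and> w \<in> carrier V})"

definition clifford_algebra :: "('z, 's) ring_scheme \<Rightarrow> ('z, 'v, 'm) module_scheme \<Rightarrow> ('v \<Rightarrow> 'v \<Rightarrow> 'z) \<Rightarrow>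
    ('z, ('v list \<Rightarrow> 'z) set set) module" where
  "clifford_algebra Z V \<eta> = quot_alg (tensor_algebra Z V) (clifford_ideal Z V \<eta>)"

definition to_clifford :: "('z, 's) ring_scheme \<Rightarrow> ('z, 'v, 'm) module_scheme \<Rightarrow> ('v \<Rightarrow> 'v \<Rightarrow> 'z) \<Rightarrow>
    'v \<Rightarrow> ('v list \<Rightarrow> 'z) set set" where
  "to_clifford Z V \<eta> v = clifford_ideal Z V \<eta> +>\<^bsub>tensor_algebra Z V\<^esub> to_tensor_algebra Z V v"

text \<open>
  Let \<open>R\<close> be a ring, \<open>Z\<close> a central subring and \<open>H\<close> a \<open>Z\<close>-submodule of \<open>R\<close>. The predicate says that
  the \<open>Z\<close>-subalgebra \<open>C\<close> of \<open>R\<close> is a Clifford algebra on \<open>H\<close>: the inclusion of \<open>H\<close> extends to an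
  isomorphism of \<open>Z\<close>-algebras from the Clifford algebra of some form onto \<open>C\<close>.
\<close>

definition submodule_of :: "('r, 's) ring_scheme \<Rightarrow> 'r set \<Rightarrow> ('r, 'r) module" where
  "submodule_of R H = \<lparr>carrier = H, mult = mult R, one = one R, zero = zero R, add = add R, smult = mult R\<rparr>"

definition is_clifford_algebra_on :: "('r, 's) ring_scheme \<Rightarrow> 'r set \<Rightarrow> 'r set \<Rightarrow> 'r set \<Rightarrow> bool" where
  "is_clifford_algebra_on R Z H C \<longleftrightarrow>
     (\<exists>\<eta>. symmetric_bilinear_form (R\<lparr>carrier := Z\<rparr>) (submodule_of R H) \<eta> \<and>
       (let Cl = clifford_algebra (R\<lparr>carrier := Z\<rparr>) (submodule_of R H) \<eta> in
        \<exists>h\<in>ring_iso Cl (R\<lparr>carrier := C\<rparr>).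
          (\<forall>z\<in>Z. h (z \<odot>\<^bsub>Cl\<^esub> \<one>\<^bsub>Cl\<^esub>) = z) \<and>
          (\<forall>v\<in>H. h (to_clifford (R\<lparr>carrier := Z\<rparr>) (submodule_of R H) \<eta> v) = v)))"


section \<open>The quantum group at a fourth root of unity\<close>

datatype gen = GenE | GenF | GenK | GenKinv

type_synonym qelt = "(gen list \<Rightarrow> complex) set"
type_synonym qtensor = "((nat \<Rightarrow> qelt) \<Rightarrow> complex) set"

definition free_alg :: "(complex, gen list \<Rightarrow> complex) module" where
  "free_alg = monoid_alg complex_alg (free_monoid UNIV)"

definition qrels :: "(gen list \<Rightarrow> complex) set" where
  "qrels = (let A = free_alg; \<delta> = basis_elt complex_alg in
     {\<delta> [GenK, GenKinv] \<ominus>\<^bsub>A\<^esub> \<one>\<^bsub>A\<^esub>,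
      \<delta> [GenKinv, GenK] \<ominus>\<^bsub>A\<^esub> \<one>\<^bsub>A\<^esub>,
      \<delta> [GenK, GenE] \<oplus>\<^bsub>A\<^esub> \<delta> [GenE, GenK],
      \<delta> [GenK, GenF] \<oplus>\<^bsub>A\<^esub> \<delta> [GenF, GenK],
      (\<delta> [GenE, GenF] \<ominus>\<^bsub>A\<^esub> \<delta> [GenF, GenE]) \<ominus>\<^bsub>A\<^esub> ((2 * \<i>) \<odot>\<^bsub>A\<^esub> (\<delta> [GenK] \<ominus>\<^bsub>A\<^esub> \<delta> [GenKinv]))})"

definition qideal :: "(gen list \<Rightarrow> complex) set" where
  "qideal = Idl\<^bsub>free_alg\<^esub> qrels"

definition UQ :: "(complex, qelt) module" where
  "UQ = quot_alg free_alg qideal"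

definition qgen :: "gen \<Rightarrow> qelt" where
  "qgen g = qideal +>\<^bsub>free_alg\<^esub> basis_elt complex_alg [g]"

abbreviation "qE \<equiv> qgen GenE"
abbreviation "qF \<equiv> qgen GenF"
abbreviation "qK \<equiv> qgen GenK"
abbreviation "qKinv \<equiv> qgen GenKinv"

definition qFt :: qelt where
  "qFt = \<i> \<odot>\<^bsub>UQ\<^esub> (qK \<otimes>\<^bsub>UQ\<^esub> qF)"

definition qOmega :: qelt where
  "qOmega = ((\<i> \<odot>\<^bsub>UQ\<^esub> (qE \<otimes>\<^bsub>UQ\<^esub> qF)) \<oplus>\<^bsub>UQ\<^esub> qK) \<ominus>\<^bsub>UQ\<^esub> qKinv"

definition Z0 :: "qelt set" where
  "Z0 = subalg_gen UQ {qK [^]\<^bsub>UQ\<^esub> (2::nat), qKinv [^]\<^bsub>UQ\<^esub> (2::nat), qE [^]\<^bsub>UQ\<^esub> (2::nat), qF [^]\<^bsub>UQ\<^esub> (2::nat)}"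

text \<open>The \<open>\<int>/2\<close>-grading of the quantum group; \<^const>\<open>True\<close> is the odd degree. Thus \<open>F\<close> is odd.\<close>

inductive q_homog :: "bool \<Rightarrow> qelt \<Rightarrow> bool" where
  "q_homog False qE"
| "q_homog False qFt"
| "q_homog True qK"
| "q_homog True qKinv"
| "q_homog False \<one>\<^bsub>UQ\<^esub>"
| "q_homog d x \<Longrightarrow> q_homog d y \<Longrightarrow> q_homog d (x \<oplus>\<^bsub>UQ\<^esub> y)"
| "q_homog d x \<Longrightarrow> q_homog d (c \<odot>\<^bsub>UQ\<^esub> x)"
| "q_homog d x \<Longrightarrow> q_homog e y \<Longrightarrow> q_homog (d \<noteq> e) (x \<otimes>\<^bsub>UQ\<^esub> y)"

abbreviation UQn :: "nat \<Rightarrow> (complex, qtensor) module" where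
  "UQn n \<equiv> tensor_pow n UQ"

abbreviation fac :: "nat \<Rightarrow> nat \<Rightarrow> qelt \<Rightarrow> qtensor" where
  "fac n \<equiv> in_factor n UQ"

definition coproduct :: "qelt \<Rightarrow> qtensor" where
  "coproduct = (THE h. h \<in> alg_hom UQ (UQn 2) \<and>
     h qE = fac 2 2 qE \<oplus>\<^bsub>UQn 2\<^esub> (fac 2 1 qE \<otimes>\<^bsub>UQn 2\<^esub> fac 2 2 qK) \<and>
     h qF = (fac 2 1 qKinv \<otimes>\<^bsub>UQn 2\<^esub> fac 2 2 qF) \<oplus>\<^bsub>UQn 2\<^esub> fac 2 1 qF \<and>
     h qK = fac 2 1 qK \<otimes>\<^bsub>UQn 2\<^esub> fac 2 2 qK)"

text \<open>
  \<open>coproduct_upto m\<close> is the iterated coproduct with values in the tensor power with \<open>m + 1\<close> factors: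
  \<open>\<Delta>\<^sup>(\<^sup>m\<^sup>+\<^sup>2\<^sup>) = (\<Delta>\<^sup>(\<^sup>m\<^sup>+\<^sup>1\<^sup>) \<otimes> id) \<circ> \<Delta>\<close>.
\<close>

primrec coproduct_upto :: "nat \<Rightarrow> qelt \<Rightarrow> qtensor" where
  "coproduct_upto 0 = fac 1 1"
| "coproduct_upto (Suc m) = (\<lambda>u. tensor_lift 2 UQ (UQn (m + 2))
     (\<lambda>k. if k = 1 then tensor_lift (m + 1) UQ (UQn (m + 2)) (fac (m + 2)) \<circ> coproduct_upto m
          else fac (m + 2) (m + 2))
     (coproduct u))"


section \<open>The elements \<open>\<alpha>\<close> and \<open>\<beta>\<close> and their span\<close>

text \<open>
  These are defined in any algebra \<open>R\<close> with homomorphisms \<open>f j\<close> (\<open>1 \<le> j \<le> n\<close>, ``the \<open>j\<close>th tensor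
  factor'') from the quantum group to \<open>R\<close> such that the \<open>f j \<Omega>\<close> are invertible. This applies both
  to \<open>U[\<Omega>\<^sup>-\<^sup>1]\<^sup>\<otimes>\<^sup>n\<close> and to \<open>U\<^sup>\<otimes>\<^sup>n/ker(\<chi>\<^sub>1 \<otimes> \<dots> \<otimes> \<chi>\<^sub>n)\<close>; in the latter \<open>span_beta\<close> is the image of the
  former \<open>span_beta\<close>.
\<close>

definition K_prefix :: "('r, 's) monoid_scheme \<Rightarrow> (nat \<Rightarrow> qelt \<Rightarrow> 'r) \<Rightarrow> nat \<Rightarrow> 'r" where
  "K_prefix R f j = foldr (\<lambda>k x. f k qK \<otimes>\<^bsub>R\<^esub> x) [1..<j] \<one>\<^bsub>R\<^esub>"

definition alpha :: "('r, 's) monoid_scheme \<Rightarrow> (nat \<Rightarrow> qelt \<Rightarrow> 'r) \<Rightarrow> nat \<Rightarrow> nat \<Rightarrow> 'r" where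
  "alpha R f j \<nu> = K_prefix R f j \<otimes>\<^bsub>R\<^esub> f j (if \<nu> = 1 then qE else qFt) \<otimes>\<^bsub>R\<^esub> m_inv R (f j qOmega)"

definition beta :: "('r, 's) ring_scheme \<Rightarrow> (nat \<Rightarrow> qelt \<Rightarrow> 'r) \<Rightarrow> nat \<Rightarrow> nat \<Rightarrow> 'r" where
  "beta R f j \<nu> = alpha R f j \<nu> \<ominus>\<^bsub>R\<^esub> alpha R f (j + 1) \<nu>"

text \<open>The image of \<open>(Z\<^sub>0[\<Omega>\<^sup>-\<^sup>2])\<^sup>\<otimes>\<^sup>n\<close> in \<open>R\<close>.\<close>

definition base_ring :: "(complex, 'r, 's) module_scheme \<Rightarrow> (nat \<Rightarrow> qelt \<Rightarrow> 'r) \<Rightarrow> nat \<Rightarrow> 'r set" where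
  "base_ring R f n = subalg_gen R
     (\<Union>j\<in>{1..n}. f j ` Z0 \<union> {m_inv R (f j qOmega) [^]\<^bsub>R\<^esub> (2::nat)})"

definition span_beta :: "(complex, 'r, 's) module_scheme \<Rightarrow> (nat \<Rightarrow> qelt \<Rightarrow> 'r) \<Rightarrow> nat \<Rightarrow> 'r set" where
  "span_beta R f n = {finsum R (\<lambda>(j, \<nu>). z j \<nu> \<otimes>\<^bsub>R\<^esub> beta R f j \<nu>) ({1..<n} \<times> {1, 2}) | z.
     \<forall>j \<nu>. z j \<nu> \<in> base_ring R f n}"

text \<open>The algebra \<open>U[\<Omega>\<^sup>-\<^sup>1]\<^sup>\<otimes>\<^sup>n\<close>, with the span of the \<open>\<beta>\<close> in it and the algebra generated by it.\<close>

abbreviation UQloc :: "(complex, (nat \<Rightarrow> qelt) set) module" where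
  "UQloc \<equiv> localize UQ qOmega"

abbreviation UQlocn :: "nat \<Rightarrow> (complex, ((nat \<Rightarrow> (nat \<Rightarrow> qelt) set) \<Rightarrow> complex) set) module" where
  "UQlocn n \<equiv> tensor_pow n UQloc"

definition atloc :: "nat \<Rightarrow> nat \<Rightarrow> qelt \<Rightarrow> ((nat \<Rightarrow> (nat \<Rightarrow> qelt) set) \<Rightarrow> complex) set" where
  "atloc n j u = in_factor n UQloc j (to_loc UQ qOmega u)"

definition Zn :: "nat \<Rightarrow> ((nat \<Rightarrow> (nat \<Rightarrow> qelt) set) \<Rightarrow> complex) set set" where
  "Zn n = base_ring (UQlocn n) (atloc n) n"

definition Hn :: "nat \<Rightarrow> ((nat \<Rightarrow> (nat \<Rightarrow> qelt) set) \<Rightarrow> complex) set set" where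
  "Hn n = span_beta (UQlocn n) (atloc n) n"

definition Cn :: "nat \<Rightarrow> ((nat \<Rightarrow> (nat \<Rightarrow> qelt) set) \<Rightarrow> complex) set set" where
  "Cn n = subalg_gen (UQlocn n) (Zn n \<union> Hn n)"

text \<open>The grading of the Clifford algebra; the elements of \<^const>\<open>Hn\<close> are odd.\<close>

inductive Cn_homog :: "nat \<Rightarrow> bool \<Rightarrow> ((nat \<Rightarrow> (nat \<Rightarrow> qelt) set) \<Rightarrow> complex) set \<Rightarrow> bool" for n :: nat where
  "z \<in> Zn n \<Longrightarrow> Cn_homog n False z"
| "v \<in> Hn n \<Longrightarrow> Cn_homog n True v"
| "Cn_homog n d x \<Longrightarrow> Cn_homog n d y \<Longrightarrow> Cn_homog n d (x \<oplus>\<^bsub>UQlocn n\<^esub> y)"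
| "Cn_homog n d x \<Longrightarrow> Cn_homog n e y \<Longrightarrow> Cn_homog n (d \<noteq> e) (x \<otimes>\<^bsub>UQlocn n\<^esub> y)"

text \<open>The iterated coproduct (\<open>n \<ge> 1\<close>), with values in \<open>U[\<Omega>\<^sup>-\<^sup>1]\<^sup>\<otimes>\<^sup>n\<close>.\<close>

definition coproduct_loc :: "nat \<Rightarrow> qelt \<Rightarrow> ((nat \<Rightarrow> (nat \<Rightarrow> qelt) set) \<Rightarrow> complex) set" where
  "coproduct_loc n u = tensor_lift n UQ (UQlocn n) (atloc n) (coproduct_upto (n - 1) u)"

definition supercommute :: "('r, 's) ring_scheme \<Rightarrow> bool \<Rightarrow> bool \<Rightarrow> 'r \<Rightarrow> 'r \<Rightarrow> bool" where
  "supercommute R d e x y \<longleftrightarrow>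
     x \<otimes>\<^bsub>R\<^esub> y = (if d \<and> e then \<ominus>\<^bsub>R\<^esub> (y \<otimes>\<^bsub>R\<^esub> x) else y \<otimes>\<^bsub>R\<^esub> x)"


section \<open>Characters and colored braids\<close>

definition characters :: "(qelt \<Rightarrow> complex) set" where
  "characters = alg_hom (UQ\<lparr>carrier := Z0\<rparr>) complex_alg"

definition chi_kappa :: "(qelt \<Rightarrow> complex) \<Rightarrow> complex" where
  "chi_kappa x = x (qK [^]\<^bsub>UQ\<^esub> (2::nat))"

definition chi_epsilon :: "(qelt \<Rightarrow> complex) \<Rightarrow> complex" where
  "chi_epsilon x = x (qE [^]\<^bsub>UQ\<^esub> (2::nat))"

definition chi_phi :: "(qelt \<Rightarrow> complex) \<Rightarrow> complex" where
  "chi_phi x = chi_kappa x * x (qF [^]\<^bsub>UQ\<^esub> (2::nat))"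

definition chi_plus :: "(qelt \<Rightarrow> complex) \<Rightarrow> complex^2^2" where
  "chi_plus x = vector [vector [chi_kappa x, 0], vector [chi_phi x, 1]]"

definition chi_minus :: "(qelt \<Rightarrow> complex) \<Rightarrow> complex^2^2" where
  "chi_minus x = vector [vector [1, chi_epsilon x], vector [0, chi_kappa x]]"

definition psi :: "(qelt \<Rightarrow> complex) \<Rightarrow> complex^2^2" where
  "psi x = chi_plus x ** matrix_inv (chi_minus x)"

type_synonym obj = "nat \<Rightarrow> qelt \<Rightarrow> complex"

definition objects :: "nat \<Rightarrow> obj set" where
  "objects n = {1..n} \<rightarrow>\<^sub>E characters"

definition nonsingular :: "nat \<Rightarrow> obj \<Rightarrow> bool" where
  "nonsingular n \<rho> \<longleftrightarrow> (\<forall>j\<in>{1..n}. \<rho> j (qOmega [^]\<^bsub>UQ\<^esub> (2::nat)) \<noteq> 0)"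

datatype braid_gen = Crossing nat | CrossingInv nat

text \<open>\<open>sigma_colored n i \<rho> \<rho>'\<close>: there is a colored generator \<open>\<sigma>\<^sub>i : \<rho> \<rightarrow> \<rho>'\<close>.\<close>

definition sigma_colored :: "nat \<Rightarrow> nat \<Rightarrow> obj \<Rightarrow> obj \<Rightarrow> bool" where
  "sigma_colored n i \<rho> \<rho>' \<longleftrightarrow> 1 \<le> i \<and> i < n \<and> \<rho> \<in> objects n \<and> \<rho>' \<in> objects n \<and>
     (\<forall>j. j \<noteq> i \<longrightarrow> j \<noteq> i + 1 \<longrightarrow> \<rho>' j = \<rho> j) \<and>
     (let x1 = \<rho> i; x2 = \<rho> (i + 1); x4 = \<rho>' i; x3 = \<rho>' (i + 1) in
      chi_plus x1 ** chi_plus x2 = chi_plus x4 ** chi_plus x3 \<and>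
      chi_minus x1 ** chi_minus x2 = chi_minus x4 ** chi_minus x3 \<and>
      chi_minus x1 ** chi_plus x2 = chi_plus x4 ** chi_minus x3)"

definition gen_colored :: "nat \<Rightarrow> obj \<Rightarrow> braid_gen \<Rightarrow> obj \<Rightarrow> bool" where
  "gen_colored n \<rho> g \<rho>' =
     (case g of Crossing i \<Rightarrow> sigma_colored n i \<rho> \<rho>' | CrossingInv i \<Rightarrow> sigma_colored n i \<rho>' \<rho>)"

text \<open>
  A colored braid is given by a word: a list of composable colored generators, each with its source
  and target, composed from left to right. Different words may represent the same braid.
\<close>

type_synonym braid_word = "(obj \<times> braid_gen \<times> obj) list"

fun colored_braid :: "nat \<Rightarrow> obj \<Rightarrow> braid_word \<Rightarrow> obj \<Rightarrow> bool" where
  "colored_braid n \<rho> [] \<rho>' \<longleftrightarrow> \<rho> \<in> objects n \<and> \<rho>' = \<rho>"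
| "colored_braid n \<rho> ((\<rho>1, g, \<rho>2) # w) \<rho>' \<longleftrightarrow>
     \<rho>1 = \<rho> \<and> gen_colored n \<rho>1 g \<rho>2 \<and> colored_braid n \<rho>2 w \<rho>'"


section \<open>The braid action on tensor powers of the quantum group\<close>

definition qw :: qtensor where
  "qw = \<one>\<^bsub>UQn 2\<^esub> \<oplus>\<^bsub>UQn 2\<^esub>
     (fac 2 1 ((qK [^]\<^bsub>UQ\<^esub> (2::nat)) \<otimes>\<^bsub>UQ\<^esub> (qF [^]\<^bsub>UQ\<^esub> (2::nat))) \<otimes>\<^bsub>UQn 2\<^esub>
      fac 2 2 ((qKinv [^]\<^bsub>UQ\<^esub> (2::nat)) \<otimes>\<^bsub>UQ\<^esub> (qE [^]\<^bsub>UQ\<^esub> (2::nat))))"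

text \<open>
  \<open>Rcheck\<close> is a homomorphism \<open>U \<otimes> U \<rightarrow> (U \<otimes> U)[w\<^sup>-\<^sup>1]\<close>. It maps \<open>w\<close> to an element that is not
  invertible, so it does not extend to an endomorphism of \<open>(U \<otimes> U)[w\<^sup>-\<^sup>1]\<close>.
\<close>

definition Rcheck :: "qtensor \<Rightarrow> (nat \<Rightarrow> qtensor) set" where
  "Rcheck = (let T = UQn 2; l = to_loc T qw in
     THE h. h \<in> alg_hom T (localize T qw) \<and>
       h (fac 2 1 qE) = l (fac 2 1 qK \<otimes>\<^bsub>T\<^esub> fac 2 2 qE) \<and>
       h (fac 2 2 qF) = l (fac 2 1 qF \<otimes>\<^bsub>T\<^esub> fac 2 2 qKinv) \<and>
       h (fac 2 1 qK) = l (fac 2 2 qK \<ominus>\<^bsub>T\<^esub> (\<i> \<odot>\<^bsub>T\<^esub> (fac 2 1 (qK \<otimes>\<^bsub>UQ\<^esub> qF) \<otimes>\<^bsub>T\<^esub> fac 2 2 qE))) \<and>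
       (\<forall>u\<in>carrier UQ. h (coproduct u) = l (coproduct u)))"

definition char_ideal :: "nat \<Rightarrow> obj \<Rightarrow> qtensor set" where
  "char_ideal n \<rho> = Idl\<^bsub>UQn n\<^esub> (\<Union>j\<in>{1..n}. fac n j ` {z \<in> Z0. \<rho> j z = 0})"

definition UQchar :: "nat \<Rightarrow> obj \<Rightarrow> (complex, qtensor set) module" where
  "UQchar n \<rho> = quot_alg (UQn n) (char_ideal n \<rho>)"

definition atchar :: "nat \<Rightarrow> obj \<Rightarrow> nat \<Rightarrow> qelt \<Rightarrow> qtensor set" where
  "atchar n \<rho> j u = char_ideal n \<rho> +>\<^bsub>UQn n\<^esub> fac n j u"

text \<open>The image of \<^const>\<open>Hn\<close> in \<^const>\<open>UQchar\<close>, for nonsingular \<open>\<rho>\<close>.\<close>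

definition Hchar :: "nat \<Rightarrow> obj \<Rightarrow> qtensor set set" where
  "Hchar n \<rho> = span_beta (UQchar n \<rho>) (atchar n \<rho>) n"

text \<open>
  \<open>eval_at n i \<rho>\<close> is the map \<open>(U \<otimes> U)[w\<^sup>-\<^sup>1] \<rightarrow> U\<^sup>\<otimes>\<^sup>n/ker(\<chi>\<^sub>1 \<otimes> \<dots> \<otimes> \<chi>\<^sub>n)\<close> that places the two tensor factors
  at the positions \<open>i\<close> and \<open>i + 1\<close>.
\<close>

definition eval_at :: "nat \<Rightarrow> nat \<Rightarrow> obj \<Rightarrow> (nat \<Rightarrow> qtensor) set \<Rightarrow> qtensor set" where
  "eval_at n i \<rho> = loc_lift (UQn 2) qw (UQchar n \<rho>)
     (tensor_lift 2 UQ (UQchar n \<rho>) (\<lambda>k. atchar n \<rho> (if k = 1 then i else i + 1)))"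

definition A_sigma :: "nat \<Rightarrow> nat \<Rightarrow> obj \<Rightarrow> obj \<Rightarrow> qtensor set \<Rightarrow> qtensor set" where
  "A_sigma n i \<rho> \<rho>' = (THE h. h \<in> alg_hom (UQchar n \<rho>) (UQchar n \<rho>') \<and>
     (\<forall>u\<in>carrier UQ.
        h (atchar n \<rho> i u) = eval_at n i \<rho>' (Rcheck (fac 2 1 u)) \<and>
        h (atchar n \<rho> (i + 1) u) = eval_at n i \<rho>' (Rcheck (fac 2 2 u)) \<and>
        (\<forall>j\<in>{1..n} - {i, i + 1}. h (atchar n \<rho> j u) = atchar n \<rho>' j u)))"

fun A_gen :: "nat \<Rightarrow> obj \<times> braid_gen \<times> obj \<Rightarrow> qtensor set \<Rightarrow> qtensor set" where
  "A_gen n (\<rho>, Crossing i, \<rho>') = A_sigma n i \<rho> \<rho>'"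
| "A_gen n (\<rho>, CrossingInv i, \<rho>') = inv_into (carrier (UQchar n \<rho>')) (A_sigma n i \<rho>' \<rho>)"

primrec A_braid :: "nat \<Rightarrow> braid_word \<Rightarrow> qtensor set \<Rightarrow> qtensor set" where
  "A_braid n [] = id"
| "A_braid n (g # w) = A_braid n w \<circ> A_gen n g"


section \<open>The twisted Burau representation\<close>

text \<open>The free group on \<open>X\<close>: words in \<open>X \<times> {\<plusminus>1}\<close> (\<^const>\<open>True\<close> for \<open>+1\<close>) modulo cancellation.\<close>

definition cancel_step :: "'x set \<Rightarrow> (('x \<times> bool) list \<times> ('x \<times> bool) list) set" where
  "cancel_step X = {(u @ [(x, b), (x, \<not> b)] @ v, u @ v) | u v x b.
     u \<in> lists (X \<times> UNIV) \<and> v \<in> lists (X \<times> UNIV) \<and> x \<in> X}"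

definition free_rel :: "'x set \<Rightarrow> (('x \<times> bool) list \<times> ('x \<times> bool) list) set" where
  "free_rel X = (cancel_step X \<union> (cancel_step X)\<inverse>)\<^sup>* \<inter> (lists (X \<times> UNIV) \<times> lists (X \<times> UNIV))"

definition free_group :: "'x set \<Rightarrow> ('x \<times> bool) list set monoid" where
  "free_group X = \<lparr>carrier = lists (X \<times> UNIV) // free_rel X,
     mult = (\<lambda>A B. \<Union>a\<in>A. \<Union>b\<in>B. free_rel X `` {a @ b}),
     one = free_rel X `` {[]}\<rparr>"

definition pi1 :: "nat \<Rightarrow> (nat \<times> bool) list set monoid" where
  "pi1 n = free_group {1..n}"

definition loop_x :: "nat \<Rightarrow> nat \<Rightarrow> (nat \<times> bool) list set" where
  "loop_x n j = free_rel {1..n} `` {[(j, True)]}"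

text \<open>\<open>y\<^sub>k = x\<^sub>k \<cdots> x\<^sub>1\<close>; in particular \<open>y\<^sub>n\<close> is the boundary loop.\<close>

primrec loop_y :: "nat \<Rightarrow> nat \<Rightarrow> (nat \<times> bool) list set" where
  "loop_y n 0 = \<one>\<^bsub>pi1 n\<^esub>"
| "loop_y n (Suc k) = loop_x n (Suc k) \<otimes>\<^bsub>pi1 n\<^esub> loop_y n k"

definition GL2 :: "(complex^2^2) monoid" where
  "GL2 = \<lparr>carrier = {A. invertible A}, mult = (**), one = mat 1\<rparr>"

primrec plus_prefix :: "obj \<Rightarrow> nat \<Rightarrow> complex^2^2" where
  "plus_prefix \<rho> 0 = mat 1"
| "plus_prefix \<rho> (Suc k) = plus_prefix \<rho> k ** chi_plus (\<rho> (Suc k))"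

definition holonomy :: "nat \<Rightarrow> obj \<Rightarrow> (nat \<times> bool) list set \<Rightarrow> complex^2^2" where
  "holonomy n \<rho> = (THE h. h \<in> hom (pi1 n) GL2 \<inter> extensional (carrier (pi1 n)) \<and>
     (\<forall>j\<in>{1..n}. h (loop_x n j) =
        plus_prefix \<rho> (j - 1) ** psi (\<rho> j) ** matrix_inv (plus_prefix \<rho> (j - 1))))"

text \<open>
  \<open>H\<^sub>1\<^sup>l\<^sup>f(D\<^sub>n; \<rho>)\<close> is the dual of \<open>H\<^sub>1(D\<^sub>n, \<partial>D\<^sub>n; \<rho>)\<close>, by the intersection pairing. With the base point
  on the boundary circle (\<open>D\<^sub>n\<close> is aspherical with free fundamental group \<open>\<pi>\<close>), the latter is spanned
  by the classes \<open>g \<otimes> e\<close>, for \<open>g \<in> \<pi>\<close> and a row vector \<open>e\<close>, which are linear in \<open>e\<close> and subject to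
  \<open>gh \<otimes> e = g \<otimes> e + h \<otimes> e\<rho>(g)\<close> and \<open>y\<^sub>n \<otimes> e = 0\<close>. So a linear functional on it is a map \<open>c\<close> from \<open>\<pi>\<close>
  to the column vectors, with \<open>g \<otimes> e \<mapsto> e c(g)\<close>, such that \<open>c(gh) = c(g) + \<rho>(g) c(h)\<close> and
  \<open>c(y\<^sub>n) = 0\<close>: a crossed homomorphism relative to the boundary. The ring structure is not used.
\<close>

type_synonym cocycle = "(nat \<times> bool) list set \<Rightarrow> complex^2"

definition Hlf :: "nat \<Rightarrow> obj \<Rightarrow> (complex, cocycle) module" where
  "Hlf n \<rho> = \<lparr>carrier = {c \<in> carrier (pi1 n) \<rightarrow>\<^sub>E UNIV.
       (\<forall>g\<in>carrier (pi1 n). \<forall>h\<in>carrier (pi1 n). c (g \<otimes>\<^bsub>pi1 n\<^esub> h) = c g + holonomy n \<rho> g *v c h) \<and>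
       c (loop_y n n) = 0},
     mult = undefined, one = undefined,
     zero = (\<lambda>g\<in>carrier (pi1 n). 0),
     add = (\<lambda>c d. \<lambda>g\<in>carrier (pi1 n). c g + d g),
     smult = (\<lambda>a c. \<lambda>g\<in>carrier (pi1 n). a *s c g)\<rparr>"

text \<open>\<open>dual_basis n \<rho> j \<mu>\<close> is \<open>z\<^sub>j \<otimes> e\<^sup>\<mu>\<close>, dual to \<open>y\<^sub>j \<otimes> e\<^sub>\<mu>\<close>.\<close>

definition dual_basis :: "nat \<Rightarrow> obj \<Rightarrow> nat \<Rightarrow> 2 \<Rightarrow> cocycle" where
  "dual_basis n \<rho> j \<mu> = (THE c. c \<in> carrier (Hlf n \<rho>) \<and>
     (\<forall>k\<in>{1..<n}. c (loop_y n k) = (if k = j then axis \<mu> 1 else 0)))"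

text \<open>The vectors \<open>v\<^sub>j\<^sup>\<nu>\<close>, \<open>\<nu> \<in> {1, 2}\<close>; note that \<open>v\<^sub>j\<^sup>2\<close> belongs to the first row of \<open>p\<^sub>j\<close>.\<close>

definition v_basis :: "nat \<Rightarrow> obj \<Rightarrow> nat \<Rightarrow> nat \<Rightarrow> cocycle" where
  "v_basis n \<rho> j \<nu> =
     (let p = row (if \<nu> = 2 then 1 else 2) (transpose (plus_prefix \<rho> j)) in
      (p $ 1 \<odot>\<^bsub>Hlf n \<rho>\<^esub> dual_basis n \<rho> j 1) \<oplus>\<^bsub>Hlf n \<rho>\<^esub> (p $ 2 \<odot>\<^bsub>Hlf n \<rho>\<^esub> dual_basis n \<rho> j 2))"

text \<open>
  The automorphism of \<open>\<pi>\<close> attached to \<open>\<sigma>\<^sub>i\<close> and its inverse. If \<open>\<sigma>\<^sub>i : \<rho> \<rightarrow> \<rho>'\<close> then the holonomy of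
  \<open>\<rho>'\<close> is that of \<open>\<rho>\<close> composed with \<open>artin n (Crossing i)\<close>. So this automorphism induces a map
  \<open>H\<^sub>1(D\<^sub>n, \<partial>D\<^sub>n; \<rho>') \<rightarrow> H\<^sub>1(D\<^sub>n, \<partial>D\<^sub>n; \<rho>)\<close>, whose transpose is the Burau map from \<open>\<rho>\<close> to \<open>\<rho>'\<close>. It fixes
  \<open>y\<^sub>k\<close> for \<open>k \<noteq> i\<close> and maps \<open>y\<^sub>i\<close> to \<open>y\<^sub>i\<^sub>-\<^sub>1 y\<^sub>i\<^sup>-\<^sup>1 y\<^sub>i\<^sub>+\<^sub>1\<close>. In the bases \<open>(v\<^sub>1\<^sup>2, v\<^sub>1\<^sup>1, v\<^sub>2\<^sup>2, v\<^sub>2\<^sup>1, \<dots>)\<close> the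
  resulting matrix for \<open>\<sigma>\<^sub>i\<close>, acting on row vectors, is the identity outside the block rows and
  columns \<open>i-1, i, i+1\<close>, where it is \<open>[I P 0; 0 N 0; 0 R I]\<close> with
  \<open>P = [\<kappa>\<^sub>i\<^sup>-\<^sup>1, -\<phi>\<^sub>i\<kappa>\<^sub>i\<^sup>-\<^sup>1; 0, 1]\<close>, \<open>N = [-\<kappa>\<^sub>i\<^sup>-\<^sup>1, \<phi>\<^sub>i\<kappa>\<^sub>i\<^sup>-\<^sup>1; -\<epsilon>\<^sub>i\<^sub>+\<^sub>1, -\<kappa>\<^sub>i\<^sub>+\<^sub>1]\<close> and
  \<open>R = [1, 0; \<epsilon>\<^sub>i\<^sub>+\<^sub>1, \<kappa>\<^sub>i\<^sub>+\<^sub>1]\<close>, in the coordinates of \<open>\<rho>'\<close>.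
\<close>

fun artin_image :: "nat \<Rightarrow> braid_gen \<Rightarrow> nat \<Rightarrow> (nat \<times> bool) list set" where
  "artin_image n (Crossing i) j =
     (if j = i then m_inv (pi1 n) (loop_x n i) \<otimes>\<^bsub>pi1 n\<^esub> loop_x n (i + 1) \<otimes>\<^bsub>pi1 n\<^esub> loop_x n i
      else if j = i + 1 then loop_x n i else loop_x n j)"
| "artin_image n (CrossingInv i) j =
     (if j = i then loop_x n (i + 1)
      else if j = i + 1 then loop_x n (i + 1) \<otimes>\<^bsub>pi1 n\<^esub> loop_x n i \<otimes>\<^bsub>pi1 n\<^esub> m_inv (pi1 n) (loop_x n (i + 1))
      else loop_x n j)"

definition artin :: "nat \<Rightarrow> braid_gen \<Rightarrow> (nat \<times> bool) list set \<Rightarrow> (nat \<times> bool) list set" where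
  "artin n g = (THE h. h \<in> hom (pi1 n) (pi1 n) \<inter> extensional (carrier (pi1 n)) \<and>
     (\<forall>j\<in>{1..n}. h (loop_x n j) = artin_image n g j))"

definition B_gen :: "nat \<Rightarrow> obj \<times> braid_gen \<times> obj \<Rightarrow> cocycle \<Rightarrow> cocycle" where
  "B_gen n = (\<lambda>(\<rho>, g, \<rho>') c. \<lambda>a\<in>carrier (pi1 n). c (artin n g a))"

primrec B_braid :: "nat \<Rightarrow> braid_word \<Rightarrow> cocycle \<Rightarrow> cocycle" where
  "B_braid n [] = id"
| "B_braid n (g # w) = B_braid n w \<circ> B_gen n g"

text \<open>
  The sign for \<open>\<nu> = 2\<close> is needed for \<open>phi\<close> to intertwine \<open>B_braid\<close> and \<open>A_braid\<close>, with the other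
  conventions as they stand: for \<open>n = 2\<close> the map \<open>A_sigma\<close> sends \<open>\<beta>\<^sub>1\<^sup>1\<close> to \<open>\<epsilon>\<^sub>2 \<beta>\<^sub>1\<^sup>2 - \<kappa>\<^sub>2 \<beta>\<^sub>1\<^sup>1\<close>, whereas the
  Burau map sends \<open>v\<^sub>1\<^sup>1\<close> to \<open>-\<epsilon>\<^sub>2 v\<^sub>1\<^sup>2 - \<kappa>\<^sub>2 v\<^sub>1\<^sup>1\<close>.
\<close>

definition phi :: "nat \<Rightarrow> obj \<Rightarrow> cocycle \<Rightarrow> qtensor set" where
  "phi n \<rho> = (let Q = UQchar n \<rho> in
     THE f. f \<in> lin_hom (Hlf n \<rho>) (Q\<lparr>carrier := Hchar n \<rho>\<rparr>) \<and>
       (\<forall>j\<in>{1..<n}. f (v_basis n \<rho> j 1) = beta Q (atchar n \<rho>) j 1 \<and>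
                   f (v_basis n \<rho> j 2) = \<ominus>\<^bsub>Q\<^esub> beta Q (atchar n \<rho>) j 2))"

end

theory Submission
  imports Defs "HOL-Algebra.Multiplicative_Group"
begin

text \<open>
  For \<open>x = E\<close> or \<open>x = iKF\<close> let \<open>\<epsilon>\<^sub>k\<close> be the sum of the \<open>x\<^sub>i K\<^sub>i\<^sub>+\<^sub>1 \<cdots> K\<^sub>n\<close> over \<open>i \<le> k\<close>; thus \<open>\<epsilon>\<^sub>n = \<Delta>(x)\<close>. The commutator of
  \<open>\<beta>\<^sub>j\<close> with the \<open>\<epsilon>\<^sub>k\<close> of the other type is \<open>\<plusminus>2K\<^sub>1 \<cdots> K\<^sub>n\<close> if \<open>j = k\<close>, and all other commutators vanish. So
  \<open>\<epsilon>\<^sub>k\<close> contracts with \<open>\<beta>\<^sub>k\<close>. This shows that the ordered products of the \<open>\<beta>\<^sub>j\<close> are independent, without a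
  basis of the quantum group: the Clifford algebra embeds and \<open>\<phi>\<close> is injective. The case \<open>k = n\<close> gives
  supercommutation with the coproduct.

  The braiding is given by explicit formulas in \<open>E\<close>, \<open>iKF\<close> and \<open>K\<close>, whose denominator is the square of
  \<open>K\<^sub>2 - iK\<^sub>1F\<^sub>1E\<^sub>2\<close>. For a cocycle \<open>c\<close> put \<open>a\<^sub>j = (\<chi>\<^sub>1\<^sup>+ \<cdots> \<chi>\<^sub>j\<^sup>+)\<^sup>-\<^sup>1 c(y\<^sub>j)\<close>. Then \<open>\<phi>(c)\<close> is the sum of the
  \<open>a\<^sub>j(2) \<beta>\<^sub>j\<^sup>1 - a\<^sub>j(1) \<beta>\<^sub>j\<^sup>2\<close>, and both actions of \<open>\<sigma>\<^sub>i\<close> change only \<open>a\<^sub>i\<close>, into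
  \<open>(\<chi>\<^sub>4\<^sup>+)\<^sup>-\<^sup>1(a\<^sub>i\<^sub>-\<^sub>1 - \<chi>\<^sub>1\<^sup>- a\<^sub>i) + \<chi>\<^sub>3\<^sup>- a\<^sub>i\<^sub>+\<^sub>1\<close>.
\<close>

\<comment> \<open>Nearly every map here is a definite description. Each is made usable by a
  universal property: existence supplies the witness, and agreement on generators supplies
  uniqueness. Since no basis of the quantum group is available, nothing guarantees at first that the
  quotient at a character is not the zero ring. This is the one place where a model is needed: a
  two-dimensional representation for every tensor factor (\<open>op_rep\<close>,
  \<open>nontrivial\<close>). It makes contraction by the \<epsilon> imply that complex coefficients
  vanish. In the Clifford part the coefficients are elements of the same ring, and contraction alone
  suffices.

  The braiding takes values in a localized tensor product, which is awkward to compute in. It is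
  therefore recast as a relation \<open>braided\<close> between two commuting pairs of homomorphisms
  into one algebra. The relation survives composition and determines the second pair, so one set of
  polynomial identities serves for the localization, for the quotient at a character and, after
  exchanging E and iKF, for the inverse crossing.\<close>
text \<open>Operations in a structure \<open>R\<close> are written \<open>x .*~R y\<close>, \<open>x .+~R y\<close>, \<open>c *.~R x\<close>, and \<open>x .: R\<close> is membership in its carrier.\<close>

syntax "_index" :: "logic \<Rightarrow> index"  ("~_" [1000] 1000)
notation (input) mult (infixl ".*\<index>" 70)
notation (input) add (infixl ".+\<index>" 65)
notation (input) a_minus ("(_ .-\<index>/ _)" [65, 66] 65)
notation (input) a_inv (".-\<index> _" [81] 80)
notation (input) smult (infixl "*.\<index>" 70)
abbreviation (input) in_carrier :: "'a \<Rightarrow> ('a, 'm) partial_object_scheme \<Rightarrow> bool"  (infix ".:" 50)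
  where "x .: A \<equiv> x \<in> carrier A"

section \<open>Algebras, quotients and monoid algebras\<close>

text \<open>Records such as \<open>quot_alg\<close>, \<open>poly_alg\<close> and
  \<open>submodule_of\<close> repackage the operations of a known ring. The ring laws mention only
  these operations; negatives are taken from \<open>R\<close>.\<close>

lemma ring_cong_record:
 assumes "ring R" "carrier S = carrier R" "mult S = mult R" "one S = one R" "zero S = zero R" "add S = add R"
 shows "ring S"
proof -
 interpret ring R by fact
 show ?thesis
 proof (rule ringI)
  show "abelian_group S"
  proof (rule abelian_groupI)
   fix x assume "x .: S"
   then show "\<exists>y\<in>carrier S. y .+~S x = \<zero>~S"
    unfolding assms(2-) by (intro bexI[of _ ".-~R x"]) (auto simp: l_neg)
  qed (auto simp: assms(2-) a_assoc intro: a_comm)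
  show "Group.monoid S"
   by (rule monoidI) (auto simp: assms(2-) m_assoc)
 qed (auto simp: assms(2-) l_distr r_distr)
qed

text \<open>A noncommutative algebra over any commutative ring. Most algebras below are complex, but
  the Clifford algebra lives over the base ring of the localized tensor power, so \<open>K\<close>
  is kept general.\<close>

locale kalg = module K A + A?: ring A for K and A (structure) +
 assumes smult_assoc2:
   "[| a .: K; x .: A; y .: A |] ==> (a *.~A x) .*~A y = a *.~A (x .*~A y)"
  and smult_assoc3:
   "[| a .: K; x .: A; y .: A |] ==> x .*~A (a *.~A y) = a *.~A (x .*~A y)"

lemma kalgI:
 assumes "cring K" "ring A"
  "!!a x. [| a .: K; x .: A |] ==> a *.~A x .: A"
  "!!a b x. [| a .: K; b .: K; x .: A |] ==> (a .+~K b) *.~A x = a *.~A x .+~A b *.~A x"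
  "!!a x y. [| a .: K; x .: A; y .: A |] ==> a *.~A (x .+~A y) = a *.~A x .+~A a *.~A y"
  "!!a b x. [| a .: K; b .: K; x .: A |] ==> (a .*~K b) *.~A x = a *.~A (b *.~A x)"
  "!!x. x .: A ==> \<one>~K *.~A x = x"
  "!!a x y. [| a .: K; x .: A; y .: A |] ==> (a *.~A x) .*~A y = a *.~A (x .*~A y)"
  "!!a x y. [| a .: K; x .: A; y .: A |] ==> x .*~A (a *.~A y) = a *.~A (x .*~A y)"
 shows "kalg K A"
proof -
 interpret ring A by fact
 have "module K A"
  by (rule moduleI) (use assms is_abelian_group in auto)
 then show ?thesis
  by (intro kalg.intro assms(2) kalg_axioms.intro) (use assms in auto)
qed

text \<open>In contrast to \<open>alg_hom\<close> there is no extensionality, so that composites are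
  again homomorphisms. The link between the two notions is \<open>alg_hom_iff\<close>.\<close>

definition kalg_hom :: "('k, 's) ring_scheme => ('k, 'a, 'm) module_scheme => ('k, 'b, 'n) module_scheme => ('a => 'b) set" where
 "kalg_hom K A B = {h \<in> ring_hom A B. \<forall>c\<in>carrier K. \<forall>x\<in>carrier A. h (c *.~A x) = c *.~B h x}"

lemma kalg_homI:
 assumes "!!x. x .: A ==> h x .: B"
  "!!x y. [| x .: A; y .: A |] ==> h (x .*~A y) = h x .*~B h y"
  "!!x y. [| x .: A; y .: A |] ==> h (x .+~A y) = h x .+~B h y"
  "h \<one>~A = \<one>~B"
  "!!c x. [| c .: K; x .: A |] ==> h (c *.~A x) = c *.~B h x"
 shows "h \<in> kalg_hom K A B"
 using assms by (auto simp: kalg_hom_def ring_hom_def)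

lemma kalg_homD:
 assumes "h \<in> kalg_hom K A B"
 shows "!!x. x .: A ==> h x .: B"
  "!!x y. [| x .: A; y .: A |] ==> h (x .*~A y) = h x .*~B h y"
  "!!x y. [| x .: A; y .: A |] ==> h (x .+~A y) = h x .+~B h y"
  "h \<one>~A = \<one>~B"
  "!!c x. [| c .: K; x .: A |] ==> h (c *.~A x) = c *.~B h x"
 using assms by (auto simp: kalg_hom_def ring_hom_def)

lemma kalg_hom_ring_hom_ring:
 assumes "h \<in> kalg_hom K A B" "ring A" "ring B"
 shows "ring_hom_ring A B h"
 using assms by (auto simp: kalg_hom_def intro: ring_hom_ringI2)

lemma kalg_hom_zero:
 assumes "h \<in> kalg_hom K A B" "ring A" "ring B"
 shows "h \<zero>~A = \<zero>~B"
 by (rule ring_hom_zero) (use assms in \<open>auto simp: kalg_hom_def\<close>)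

lemma kalg_hom_uminus:
 assumes "h \<in> kalg_hom K A B" "ring A" "ring B" "x .: A"
 shows "h (.-~A x) = .-~B h x"
proof -
 interpret ring_hom_ring A B h using assms kalg_hom_ring_hom_ring by blast
 show ?thesis using assms by simp
qed

lemma kalg_hom_minus:
 assumes "h \<in> kalg_hom K A B" "ring A" "ring B" "x .: A" "y .: A"
 shows "h (x .-~A y) = h x .-~B h y"
proof -
 interpret A: ring A by fact
 show ?thesis
  using assms kalg_homD[OF assms(1)] kalg_hom_uminus[OF assms(1-3)] by (simp add: a_minus_def)
qed

lemma kalg_hom_comp:
 assumes "f \<in> kalg_hom K A B" "g \<in> kalg_hom K B C"
 shows "g \<circ> f \<in> kalg_hom K A C"
 using kalg_homD[OF assms(1)] kalg_homD[OF assms(2)] by (intro kalg_homI) auto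

lemma kalg_hom_cong:
 assumes "f \<in> kalg_hom K A B" "!!x. x .: A ==> f x = g x" "kalg K A"
 shows "g \<in> kalg_hom K A B"
proof -
 interpret kalg K A by fact
 show ?thesis
  by (rule kalg_homI) (simp_all only: assms(2)[symmetric] kalg_homD[OF assms(1)] m_closed add.m_closed one_closed smult_closed)
qed

section \<open>Quotient algebras and their universal property\<close>

context kalg
begin

text \<open>A scalar acts as multiplication by its multiple of the unit, so ring ideals are
  automatically stable under scalars.\<close>

lemma ideal_smult_closed:
 assumes "ideal I A" "c .: K" "x \<in> I"
 shows "c *. x \<in> I"
proof -
 interpret ideal I A by fact
 have "c *. x = (c *. \<one>) .* x"
  using assms a_Hcarr by (simp add: smult_assoc2)
 then show ?thesis using assms I_l_closed by simp
qed

lemma coset_eq_iff: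
 assumes "ideal I A" "x .: A" "y .: A"
 shows "I +>~A x = I +>~A y \<longleftrightarrow> x .- y \<in> I"
 using quotient_eq_iff_same_a_r_cos[OF assms] by simp

lemma quot_alg_sel:
 "carrier (quot_alg A I) = (%x. I +>~A x) ` carrier A"
 "\<one>~(quot_alg A I) = I +>~A \<one>"
 "\<zero>~(quot_alg A I) = I"
 by (auto simp: quot_alg_def FactRing_simps)

lemma quot_alg_ops:
 assumes I: "ideal I A" and x: "x .: A" and y: "y .: A"
 shows "(I +>~A x) .*~(quot_alg A I) (I +>~A y) = I +>~A (x .* y)"
  "(I +>~A x) .+~(quot_alg A I) (I +>~A y) = I +>~A (x .+ y)"
  "c .: K ==> c *.~(quot_alg A I) (I +>~A x) = I +>~A (c *. x)"
proof -
 interpret I: ideal I A by fact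
 show "(I +>~A x) .*~(quot_alg A I) (I +>~A y) = I +>~A (x .* y)"
  "(I +>~A x) .+~(quot_alg A I) (I +>~A y) = I +>~A (x .+ y)"
  using x y by (auto simp: quot_alg_def FactRing_simps I.rcoset_mult_add I.a_rcos_sum)
 assume c: "c .: K"
 \<comment> \<open>The scalar action of \<open>quot_alg\<close> is a union over all representatives
   of a coset, so the cosets in this union must be shown to coincide.\<close>
 have *: "I +>~A (c *. z) = I +>~A (c *. x)" if "z \<in> I +>~A x" for z
 proof -
  from that obtain h where h: "h \<in> I" "z = h .+ x"
   by (auto simp: a_r_coset_def r_coset_def)
  have hc: "h .: A" using h I.a_Hcarr by blast
  have e: "c *. z .- c *. x = c *. h"
   using hc c x by (simp add: h(2) smult_r_distr a_minus_def a_assoc r_neg)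
  have "c *. z .: A" using h hc c x by simp
  then show ?thesis
   using coset_eq_iff[OF I _ smult_closed[OF c x], of "c *. z"] ideal_smult_closed[OF I c h(1)] e by simp
 qed
 have "x \<in> I +>~A x" using x I.a_rcos_self by blast
 then have "(\<Union>z\<in>I +>~A x. I +>~A (c *. x)) = I +>~A (c *. x)" by blast
 moreover have "(\<Union>z\<in>I +>~A x. I +>~A (c *. z)) = (\<Union>z\<in>I +>~A x. I +>~A (c *. x))"
  by (rule SUP_cong[OF refl]) (rule *)
 ultimately show "c *.~(quot_alg A I) (I +>~A x) = I +>~A (c *. x)"
  by (simp add: quot_alg_def)
qed

lemma quot_alg_kalg:
 assumes I: "ideal I A" shows "kalg K (quot_alg A I)"
proof -
 interpret I: ideal I A by fact
 have "ring (quot_alg A I)"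
  by (rule ring_cong_record[OF I.quotient_is_ring]) (auto simp: quot_alg_def)
 then show ?thesis
  by (intro kalgI R.is_cring)
   (auto simp: quot_alg_sel quot_alg_ops[OF I] smult_assoc1 smult_assoc2 smult_assoc3 smult_l_distr smult_r_distr)
qed

lemma quot_proj_hom:
 assumes I: "ideal I A" shows "(%x. I +>~A x) \<in> kalg_hom K A (quot_alg A I)"
 by (rule kalg_homI) (auto simp: quot_alg_sel quot_alg_ops[OF I])

lemma quot_proj_zero_iff:
 assumes I: "ideal I A" "x .: A" shows "I +>~A x = \<zero>~(quot_alg A I) \<longleftrightarrow> x \<in> I"
proof -
 interpret I: ideal I A by fact
 have "I +>~A \<zero> = I" using I.a_rcos_const[OF I.zero_closed] .
 then show ?thesis using coset_eq_iff[OF I zero_closed] I(2) by (simp add: quot_alg_sel a_minus_def)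
qed

text \<open>Differences of representatives lie in \<open>I\<close>, where \<open>f\<close> vanishes,
  so an arbitrarily chosen representative may be used.\<close>

lemma quot_lift:
 assumes I: "ideal I A" and B: "ring B" and f: "f \<in> kalg_hom K A B" and z: "!!x. x \<in> I ==> f x = \<zero>~B"
 shows "\<exists>h \<in> kalg_hom K (quot_alg A I) B. \<forall>x\<in>carrier A. h (I +>~A x) = f x"
proof -
 interpret I: ideal I A by fact
 interpret B: ring B by fact
 define h where "h X = f (SOME x. x .: A \<and> X = I +>~A x)" for X
 have h: "h (I +>~A x) = f x" if x: "x .: A" for x
 proof -
  define y where "y = (SOME y. y .: A \<and> I +>~A x = I +>~A y)"
  have y: "y .: A \<and> I +>~A x = I +>~A y"
   unfolding y_def by (rule someI[of _ x]) (simp add: x)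
  then have xy: "y .: A" "x .- y \<in> I" using coset_eq_iff[OF I x, of y] by simp_all
  have "f x .-~B f y = f (x .- y)"
   using kalg_hom_minus[OF f ring_axioms B x xy(1)] by (rule sym)
  also have "\<dots> = \<zero>~B" using z[OF xy(2)] .
  finally have "f x = f y" using kalg_homD(1)[OF f x] kalg_homD(1)[OF f xy(1)] B.r_right_minus_eq by blast
  then show ?thesis unfolding h_def y_def[symmetric] by (rule sym)
 qed
 have "h \<in> kalg_hom K (quot_alg A I) B"
  by (rule kalg_homI; (unfold quot_alg_sel)?; (elim imageE, hypsubst)?;
   simp only: quot_alg_ops[OF I] h kalg_homD[OF f] m_closed add.m_closed one_closed smult_closed)
 with h show ?thesis by blast
qed

text \<open>The kernel of \<open>f\<close> is an ideal containing \<open>S\<close>, and the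
  generated ideal is the least such.\<close>

lemma hom_kills_genideal:
 assumes B: "ring B" and f: "f \<in> kalg_hom K A B" and S: "S \<subseteq> carrier A" and z: "!!x. x \<in> S ==> f x = \<zero>~B"
  and x: "x \<in> Idl~A S"
 shows "f x = \<zero>~B"
proof -
 have "ideal (a_kernel A B f) A"
  using kalg_hom_ring_hom_ring[OF f ring_axioms B] by (rule ring_hom_ring.kernel_is_ideal)
 moreover have "S \<subseteq> a_kernel A B f"
  using S z by (auto simp: a_kernel_def')
 ultimately have "x \<in> a_kernel A B f"
  using genideal_minimal[of "a_kernel A B f" S] x by (metis subsetD)
 then show ?thesis unfolding a_kernel_def' by blast
qed

text \<open>The common source of all maps out of an algebra with relations: the quantum group,
  tensor powers, localizations, Clifford algebras and quotients at characters are each handled by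
  checking the generating relations.\<close>

lemma quot_gen_lift:
 assumes B: "ring B" and f: "f \<in> kalg_hom K A B" and S: "S \<subseteq> carrier A" and z: "!!x. x \<in> S ==> f x = \<zero>~B"
 shows "\<exists>h \<in> kalg_hom K (quot_alg A (Idl~A S)) B. \<forall>x\<in>carrier A. h ((Idl~A S) +>~A x) = f x"
 by (rule quot_lift[OF genideal_ideal[OF S] B f]) (rule hom_kills_genideal[OF assms])

end

section \<open>Monoid algebras\<close>

locale monoid_algebra = K?: cring K + M?: Group.monoid M
 for K :: "('k, 's) ring_scheme" and M :: "('m, 't) monoid_scheme"
begin

abbreviation X where "X \<equiv> monoid_alg K M"
abbreviation supp where "supp f \<equiv> {m. f m \<noteq> \<zero>~K}"
abbreviation \<delta> where "\<delta> \<equiv> basis_elt K"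

lemma X_carrier:
 "f .: X \<longleftrightarrow> (\<forall>m\<in>carrier M. f m .: K) \<and> (\<forall>m. m \<notin> carrier M \<longrightarrow> f m = \<zero>~K) \<and> finite (supp f)"
 by (simp add: monoid_alg_def)

lemma X_val: "f .: X ==> f m .: K"
 by (cases "m .: M") (auto simp: X_carrier)

lemma X_supp: "f .: X ==> supp f \<subseteq> carrier M" "f .: X ==> finite (supp f)"
 by (auto simp: X_carrier)

lemma X_ops:
 "(f .+~X g) = (%m. f m .+~K g m)" "\<zero>~X = (%m. \<zero>~K)" "(c *.~X f) = (%m. c .*~K f m)"
 "\<one>~X = \<delta> \<one>~M"
 by (auto simp: monoid_alg_def basis_elt_def)

lemma X_add_closed: "f .: X ==> g .: X ==> f .+~X g .: X"
proof -
 assume fg: "f .: X" "g .: X"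
 have "supp (%m. f m .+~K g m) \<subseteq> supp f \<union> supp g" using fg X_val by auto
 then have "finite (supp (%m. f m .+~K g m))" using fg X_supp by (meson finite_UnI finite_subset)
 then show ?thesis using fg by (simp add: X_ops X_carrier)
qed

lemma X_smult_closed: "c .: K ==> f .: X ==> c *.~X f .: X"
proof -
 assume fg: "c .: K" "f .: X"
 have "supp (%m. c .*~K f m) \<subseteq> supp f" using fg by auto
 then have "finite (supp (%m. c .*~K f m))" using fg X_supp by (meson finite_subset)
 then show ?thesis using fg by (simp add: X_ops X_carrier)
qed

lemma delta_closed: "m .: M ==> \<delta> m .: X"
proof -
 assume "m .: M"
 moreover have "supp (\<delta> m) \<subseteq> {m}" by (auto simp: basis_elt_def)
 ultimately show ?thesis
  using finite_subset[of "supp (\<delta> m)" "{m}"] by (auto simp: X_carrier basis_elt_def)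
qed

text \<open>Induction on the size of the support, removing one term at a time. It reduces
  multilinear identities to basis elements.\<close>

lemma X_induct [consumes 1, case_names zero add scaled]:
 assumes f: "f .: X" and z: "P \<zero>~X"
  and a: "!!f g. [| f .: X; g .: X; P f; P g |] ==> P (f .+~X g)"
  and s: "!!c m. [| c .: K; m .: M |] ==> P (c *.~X \<delta> m)"
 shows "P f"
 using f
proof (induction "card (supp f)" arbitrary: f)
 case 0
 then have "f = \<zero>~X" using X_supp[of f] by (auto simp: X_ops)
 then show ?case using z by simp
next
 case (Suc k)
 then obtain m where m: "f m \<noteq> \<zero>~K"
  by (metis (mono_tags, lifting) card.empty empty_Collect_eq nat.distinct(1))
 then have mM: "m .: M" using Suc.prems by (auto simp: X_carrier)
 define g where "g = f(m := \<zero>~K)"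
 have sg: "supp g = supp f - {m}" by (auto simp: g_def)
 then have "card (supp g) = k" using Suc.hyps(2) m X_supp[OF Suc.prems] by simp
 moreover have gX: "g .: X"
  using Suc.prems mM sg by (auto simp: X_carrier g_def)
 ultimately have "P g" using Suc.hyps(1) by blast
 moreover have "f = g .+~X (f m *.~X \<delta> m)"
  using X_val[OF Suc.prems] by (auto simp: X_ops g_def basis_elt_def)
 ultimately show ?case
  using a[OF gX _ _ s[OF X_val[OF Suc.prems] mM]] X_smult_closed[OF X_val[OF Suc.prems] delta_closed[OF mM]] s[OF X_val[OF Suc.prems] mM]
  by metis
qed

text \<open>The definition sums over the exact supports, which may shrink when elements are added.
  Enlarging the index set by zero terms allows the same set to be used for all summands of an
  identity.\<close>

lemma X_mult_eq:
 assumes f: "f .: X" and g: "g .: X" and A: "finite A" "supp f \<subseteq> A"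
  and B: "finite B" "supp g \<subseteq> B"
 shows "(f .*~X g) m = finsum K (%(a, b). f a .*~K g b) {(a, b) \<in> A \<times> B. a .*~M b = m}"
proof -
 have "(f .*~X g) m = finsum K (%(a, b). f a .*~K g b) {(a, b). f a \<noteq> \<zero>~K \<and> g b \<noteq> \<zero>~K \<and> a .*~M b = m}"
  by (simp add: monoid_alg_def)
 also have "\<dots> = finsum K (%(a, b). f a .*~K g b) {(a, b) \<in> A \<times> B. a .*~M b = m}"
 proof (rule K.add.finprod_mono_neutral_cong_left)
  show "finite {(a, b) \<in> A \<times> B. a .*~M b = m}"
   by (rule finite_subset[of _ "A \<times> B"]) (use A B in auto)
 qed (use A B X_val[OF f] X_val[OF g] in auto)
 finally show ?thesis .
qed

lemma X_mult_closed:
 assumes f: "f .: X" and g: "g .: X"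
 shows "f .*~X g .: X"
proof -
 note e = X_mult_eq[OF f g X_supp(2)[OF f] order_refl X_supp(2)[OF g] order_refl]
 have c: "(f .*~X g) m .: K" for m
  unfolding e by (rule K.finsum_closed) (use X_val[OF f] X_val[OF g] in auto)
 have z: "(f .*~X g) m = \<zero>~K" if "m \<notin> (%(a, b). a .*~M b) ` (supp f \<times> supp g)" for m
 proof -
  have "{(a, b) \<in> supp f \<times> supp g. a .*~M b = m} = {}" using that by auto
  then show ?thesis unfolding e by (simp only: K.finsum_empty)
 qed
 have "supp (f .*~X g) \<subseteq> (%(a, b). a .*~M b) ` (supp f \<times> supp g)" using z by blast
 then have "finite (supp (f .*~X g))"
  by (rule finite_subset) (use X_supp[OF f] X_supp[OF g] in auto)
 moreover have "(%(a, b). a .*~M b) ` (supp f \<times> supp g) \<subseteq> carrier M"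
  using X_supp[OF f] X_supp[OF g] by auto
 ultimately have "finite (supp (f .*~X g))" "m \<notin> carrier M ==> (f .*~X g) m = \<zero>~K" for m
  using z[of m] by blast+
 then show ?thesis using c unfolding X_carrier by blast
qed

lemma X_l_distr:
 assumes f: "f .: X" and g: "g .: X" and h: "h .: X"
 shows "(f .+~X g) .*~X h = f .*~X h .+~X g .*~X h"
proof
 fix m
 let ?A = "supp f \<union> supp g"
 let ?S = "{(a, b) \<in> ?A \<times> supp h. a .*~M b = m}"
 have A: "finite ?A" "supp (f .+~X g) \<subseteq> ?A" using X_supp(2)[OF f] X_supp(2)[OF g] X_val[OF f] X_val[OF g] by (auto simp: X_ops)
 note v = X_val[OF f] X_val[OF g] X_val[OF h]
 have "((f .+~X g) .*~X h) m = finsum K (%(a, b). (f a .+~K g a) .*~K h b) ?S"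
  using X_mult_eq[OF X_add_closed[OF f g] h A X_supp(2)[OF h] order_refl] by (simp add: X_ops)
 also have "\<dots> = finsum K (%p. (case p of (a, b) => f a .*~K h b) .+~K (case p of (a, b) => g a .*~K h b)) ?S"
  by (rule K.finsum_cong') (use v in \<open>auto simp: K.l_distr\<close>)
 also have "\<dots> = finsum K (%(a, b). f a .*~K h b) ?S .+~K finsum K (%(a, b). g a .*~K h b) ?S"
  by (rule K.finsum_addf) (use v in auto)
 also have "\<dots> = (f .*~X h) m .+~K (g .*~X h) m"
  using X_mult_eq[OF f h A(1) _ X_supp(2)[OF h] order_refl] X_mult_eq[OF g h A(1) _ X_supp(2)[OF h] order_refl] by auto
 finally show "((f .+~X g) .*~X h) m = (f .*~X h .+~X g .*~X h) m" by (simp add: X_ops)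
qed

lemma X_r_distr:
 assumes f: "f .: X" and g: "g .: X" and h: "h .: X"
 shows "h .*~X (f .+~X g) = h .*~X f .+~X h .*~X g"
proof
 fix m
 let ?A = "supp f \<union> supp g"
 let ?S = "{(a, b) \<in> supp h \<times> ?A. a .*~M b = m}"
 have A: "finite ?A" "supp (f .+~X g) \<subseteq> ?A" using X_supp(2)[OF f] X_supp(2)[OF g] X_val[OF f] X_val[OF g] by (auto simp: X_ops)
 note v = X_val[OF f] X_val[OF g] X_val[OF h]
 have "(h .*~X (f .+~X g)) m = finsum K (%(a, b). h a .*~K (f b .+~K g b)) ?S"
  using X_mult_eq[OF h X_add_closed[OF f g] X_supp(2)[OF h] order_refl A] by (simp add: X_ops)
 also have "\<dots> = finsum K (%p. (case p of (a, b) => h a .*~K f b) .+~K (case p of (a, b) => h a .*~K g b)) ?S"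
  by (rule K.finsum_cong') (use v in \<open>auto simp: K.r_distr\<close>)
 also have "\<dots> = finsum K (%(a, b). h a .*~K f b) ?S .+~K finsum K (%(a, b). h a .*~K g b) ?S"
  by (rule K.finsum_addf) (use v in auto)
 also have "\<dots> = (h .*~X f) m .+~K (h .*~X g) m"
  using X_mult_eq[OF h f X_supp(2)[OF h] order_refl A(1)] X_mult_eq[OF h g X_supp(2)[OF h] order_refl A(1)] by auto
 finally show "(h .*~X (f .+~X g)) m = (h .*~X f .+~X h .*~X g) m" by (simp add: X_ops)
qed

lemma X_smult_mult:
 assumes f: "f .: X" and g: "g .: X" and c: "c .: K"
 shows "(c *.~X f) .*~X g = c *.~X (f .*~X g)" (is ?t1)
  and "f .*~X (c *.~X g) = c *.~X (f .*~X g)" (is ?t2)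
proof -
 note v = X_val[OF f] X_val[OF g]
 have s1: "supp (c *.~X f) \<subseteq> supp f" and s2: "supp (c *.~X g) \<subseteq> supp g" using c by (auto simp: X_ops)
 let ?S = "%m. {(a, b) \<in> supp f \<times> supp g. a .*~M b = m}"
 have fin: "finite (?S m)" for m
  by (rule finite_subset[of _ "supp f \<times> supp g"]) (use X_supp[OF f] X_supp[OF g] in auto)
 have mem: "(%(a, b). f a .*~K g b) \<in> ?S m \<rightarrow> carrier K" for m using v by auto
 have e: "(c *.~X (f .*~X g)) m = finsum K (%p. c .*~K (case p of (a, b) => f a .*~K g b)) (?S m)" for m
  unfolding X_ops X_mult_eq[OF f g X_supp(2)[OF f] order_refl X_supp(2)[OF g] order_refl]
  by (rule K.finsum_rdistr[OF fin c mem])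
 show ?t1
 proof
  fix m
  show "((c *.~X f) .*~X g) m = (c *.~X (f .*~X g)) m"
   unfolding e X_mult_eq[OF X_smult_closed[OF c f] g X_supp(2)[OF f] s1 X_supp(2)[OF g] order_refl]
   by (rule K.finsum_cong') (use v c in \<open>auto simp: X_ops K.m_assoc\<close>)
 qed
 show ?t2
 proof
  fix m
  show "(f .*~X (c *.~X g)) m = (c *.~X (f .*~X g)) m"
   unfolding e X_mult_eq[OF f X_smult_closed[OF c g] X_supp(2)[OF f] order_refl X_supp(2)[OF g] s2]
   by (rule K.finsum_cong') (use v c in \<open>auto simp: X_ops K.m_lcomm\<close>)
 qed
qed

lemma delta_mult:
 assumes a: "a .: M" and b: "b .: M"
 shows "\<delta> a .*~X \<delta> b = \<delta> (a .*~M b)"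
proof
 fix m
 have e: "(\<delta> a .*~X \<delta> b) m = finsum K (%(x, y). \<delta> a x .*~K \<delta> b y) {(x, y) \<in> {a} \<times> {b}. x .*~M y = m}"
  by (rule X_mult_eq[OF delta_closed[OF a] delta_closed[OF b]]) (auto simp: basis_elt_def)
 show "(\<delta> a .*~X \<delta> b) m = \<delta> (a .*~M b) m"
 proof (cases "m = a .*~M b")
  case True
  then have s: "{(x, y) \<in> {a} \<times> {b}. x .*~M y = m} = {(a, b)}" by auto
  show ?thesis unfolding e s using True by (subst K.finsum_insert) (auto simp: basis_elt_def)
 next
  case False
  then have s: "{(x, y) \<in> {a} \<times> {b}. x .*~M y = m} = {}" by auto
  show ?thesis unfolding e s using False by (simp add: basis_elt_def)
 qed
qed

lemma X_abelian_group: "abelian_group X"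
proof (rule abelian_groupI)
 fix f assume f: "f .: X"
 have "supp (%m. .-~K f m) \<subseteq> supp f" by auto
 then have "finite (supp (%m. .-~K f m))" using X_supp[OF f] finite_subset by blast
 then have "(%m. .-~K f m) .: X" using f by (auto simp: X_carrier)
 moreover have "(%m. .-~K f m) .+~X f = \<zero>~X" using X_val[OF f] by (auto simp: X_ops K.l_neg)
 ultimately show "\<exists>g\<in>carrier X. g .+~X f = \<zero>~X" by blast
next
 show "\<zero>~X .: X" by (auto simp: X_carrier X_ops)
qed (auto simp: X_ops X_val K.a_ac intro: X_add_closed[unfolded X_ops])

lemma X_smult_module:
 assumes f: "f .: X" and g: "g .: X" and c: "c .: K" and d: "d .: K"
 shows "(c .+~K d) *.~X f = c *.~X f .+~X d *.~X f"
  "c *.~X (f .+~X g) = c *.~X f .+~X c *.~X g"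
  "(c .*~K d) *.~X f = c *.~X (d *.~X f)" "\<one>~K *.~X f = f"
 using X_val[OF f] X_val[OF g] c d by (auto simp: X_ops K.l_distr K.r_distr K.m_assoc)

lemma X_module: "module K X"
 by (rule moduleI[OF K.is_cring X_abelian_group X_smult_closed]) (auto intro: X_smult_module)

text \<open>The ring laws are not yet available at this point, so zero is written as a scalar
  multiple by zero and pulled out of the product.\<close>

lemma X_zero_mult:
 assumes f: "f .: X"
 shows "\<zero>~X .*~X f = \<zero>~X" "f .*~X \<zero>~X = \<zero>~X"
proof -
 interpret X: module K X by (rule X_module)
 have "\<zero>~X = \<zero>~K *.~X \<zero>~X" by simp
 then show "\<zero>~X .*~X f = \<zero>~X" "f .*~X \<zero>~X = \<zero>~X"
  using X_smult_mult[OF X.zero_closed f K.zero_closed] X_smult_mult[OF f X.zero_closed K.zero_closed]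
   X.smult_l_null X_mult_closed f X.zero_closed by metis+
qed

text \<open>Three nested inductions reduce the claim, which is linear in each argument, to
  associativity in the monoid.\<close>

lemma X_assoc:
 assumes f: "f .: X" and g: "g .: X" and h: "h .: X"
 shows "(f .*~X g) .*~X h = f .*~X (g .*~X h)"
 using f
proof (induction rule: X_induct)
 case zero
 then show ?case using g h by (simp add: X_zero_mult X_mult_closed)
next
 case (add f f')
 then show ?case using g h by (simp add: X_l_distr X_mult_closed)
next
 case (scaled c a)
 note c = scaled
 from g show ?case
 proof (induction rule: X_induct)
  case zero
  then show ?case using h c by (simp add: X_zero_mult X_smult_closed delta_closed)
 next
  case (add g g')
  then show ?case using c h by (simp add: X_l_distr X_r_distr X_mult_closed X_smult_closed delta_closed)
 next
  case (scaled d b)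
  note d = scaled
  from h show ?case
  proof (induction rule: X_induct)
   case zero
   then show ?case using c d by (simp add: X_zero_mult X_smult_closed delta_closed X_mult_closed)
  next
   case (add g g')
   then show ?case using c d by (simp add: X_r_distr X_mult_closed X_smult_closed delta_closed)
  next
   case (scaled e b)
   then show ?case using c d
    by (simp add: X_smult_mult X_smult_closed delta_closed X_mult_closed delta_mult M.m_assoc)
  qed
 qed
qed

lemma X_delta_one:
 assumes f: "f .: X"
 shows "\<delta> \<one>~M .*~X f = f" "f .*~X \<delta> \<one>~M = f"
 using f
 by (induction rule: X_induct)
  (simp_all add: X_zero_mult X_l_distr X_r_distr X_smult_mult delta_mult delta_closed)

lemma X_kalg: "kalg K X"
proof -
 interpret X: module K X by (rule X_module)
 have "ring X"
 proof (rule ringI)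
  show "Group.monoid X"
   by (rule monoidI) (auto simp: X_mult_closed X_assoc X_ops(4) X_delta_one delta_closed)
 qed (auto simp: X.abelian_group_axioms X_l_distr X_r_distr)
 then show ?thesis
  by (intro kalg.intro X_module kalg_axioms.intro) (auto simp: X_smult_mult)
qed

text \<open>The linear extension of \<open>g\<close> is multiplicative because both sides are
  bilinear and agree on basis elements.\<close>

lemma X_lift:
 assumes B: "kalg K B" and g: "!!m. m .: M ==> g m .: B"
  and g1: "g \<one>~M = \<one>~B"
  and gm: "!!a b. [| a .: M; b .: M |] ==> g (a .*~M b) = g a .*~B g b"
 shows "\<exists>h\<in>kalg_hom K X B. \<forall>m\<in>carrier M. h (\<delta> m) = g m"
proof -
 interpret B: kalg K B by fact
 interpret X: kalg K X by (rule X_kalg)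
 define h where "h f = finsum B (%m. f m *.~B g m) (supp f)" for f
 have h: "h f = finsum B (%m. f m *.~B g m) S" if "f .: X" "finite S" "supp f \<subseteq> S" "S \<subseteq> carrier M" for f S
  unfolding h_def
  by (rule B.add.finprod_mono_neutral_cong_left) (use that g X_val[OF that(1)] in auto)
 have cl: "(%m. f m *.~B g m) \<in> S \<rightarrow> carrier B" if "f .: X" "S \<subseteq> carrier M" for f S
  using that g X_val[OF that(1)] by auto
 have h_closed: "h f .: B" if f: "f .: X" for f
  unfolding h_def by (rule B.finsum_closed[OF cl[OF f X_supp(1)[OF f]]])
 have h_add: "h (f .+~X f') = h f .+~B h f'" if f: "f .: X" "f' .: X" for f f'
 proof -
  let ?S = "supp f \<union> supp f'"
  have S: "finite ?S" "?S \<subseteq> carrier M" using X_supp f by auto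
  have "h (f .+~X f') = finsum B (%m. f m *.~B g m .+~B f' m *.~B g m) ?S"
   unfolding h[OF X_add_closed[OF f] S(1) _ S(2), of, simplified X_ops]
   apply (subst h[OF X_add_closed[OF f] S(1) _ S(2)])
    apply (use X_val f in \<open>auto simp: X_ops\<close>)[1]
   apply (rule B.finsum_cong')
    apply (use X_val f S g in \<open>auto simp: X_ops B.smult_l_distr\<close>)
   done
  also have "\<dots> = h f .+~B h f'"
   using h[OF f(1) S(1) _ S(2)] h[OF f(2) S(1) _ S(2)] B.finsum_addf[OF cl[OF f(1) S(2)] cl[OF f(2) S(2)]] by simp
  finally show ?thesis .
 qed
 have h_smult: "h (c *.~X f) = c *.~B h f" if c: "c .: K" and f: "f .: X" for c f
 proof -
  have "h (c *.~X f) = finsum B (%m. c *.~B (f m *.~B g m)) (supp f)"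
   apply (subst h[OF X_smult_closed[OF c f] X_supp(2)[OF f] _ X_supp(1)[OF f]])
    apply (use X_val f c in \<open>auto simp: X_ops\<close>)[1]
   apply (rule B.finsum_cong')
    apply (use X_val[OF f] X_supp[OF f] f g c in \<open>auto simp: X_ops B.smult_assoc1\<close>)
   done
  then show ?thesis
   using B.finsum_smult_ldistr[OF X_supp(2)[OF f] c cl[OF f X_supp(1)[OF f]]] by (simp add: h_def)
 qed
 have h_delta: "h (\<delta> m) = g m" if m: "m .: M" for m
  apply (subst h[OF delta_closed[OF m], of "{m}"])
  using m g[OF m] by (auto simp: basis_elt_def)
 have h_zero: "h \<zero>~X = \<zero>~B" by (simp add: h_def X_ops)
 have h_mult: "h (f .*~X f') = h f .*~B h f'" if f: "f .: X" and f': "f' .: X" for f f'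
  using f
 proof (induction rule: X_induct)
  case zero
  then show ?case using f' by (simp add: X_zero_mult h_zero h_closed)
 next
  case (add f f2)
  then show ?case using f' by (simp add: X_l_distr h_add X_mult_closed B.l_distr h_closed)
 next
  case (scaled c a)
  note c = scaled
  from f' show ?case
  proof (induction rule: X_induct)
   case zero
   then show ?case using c by (simp add: X_zero_mult h_zero h_closed X_smult_closed delta_closed)
  next
   case (add f f2)
   then show ?case using c by (simp add: X_r_distr h_add X_mult_closed B.r_distr h_closed X_smult_closed delta_closed)
  next
   case (scaled d b)
   then show ?case using c
    by (simp add: X_smult_mult h_smult X_smult_closed delta_closed X_mult_closed delta_mult h_delta gm g B.smult_assoc2 B.smult_assoc3)
  qed
 qed
 have "h \<in> kalg_hom K X B"
  by (rule kalg_homI) (simp_all add: h_closed h_mult h_add h_smult X_ops(4) h_delta g1)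
 with h_delta show ?thesis by blast
qed

end

section \<open>Complex algebras and the quantum group\<close>

lemma complex_alg_simps [simp]:
 "carrier complex_alg = UNIV" "x .*~complex_alg y = x * y" "\<one>~complex_alg = 1"
 "\<zero>~complex_alg = 0" "x .+~complex_alg y = x + y" "x *.~complex_alg y = x * y"
 by (auto simp: complex_alg_def)

lemma complex_cring: "cring complex_alg"
proof (rule cringI)
 show "abelian_group complex_alg"
 proof (rule abelian_groupI)
  fix x :: complex
  show "\<exists>y\<in>carrier complex_alg. y .+~complex_alg x = \<zero>~complex_alg"
   by (rule bexI[of _ "- x"]) auto
 qed auto
 show "comm_monoid complex_alg" by (rule comm_monoidI) auto
qed (auto simp: algebra_simps)

interpretation CC: cring complex_alg by (rule complex_cring)

lemma complex_uminus [simp]: ".-~complex_alg x = - x"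
 by (rule CC.sum_zero_eq_neg[symmetric]) auto

locale calg = kalg complex_alg A for A (structure)
begin

lemma csmult_closed [simp, intro]: "x .: A ==> c *. x .: A"
 by (rule smult_closed) simp

lemma csmult:
 "x .: A ==> (a + b) *. x = a *. x .+ b *. x"
 "[| x .: A; y .: A |] ==> a *. (x .+ y) = a *. x .+ a *. y"
 "x .: A ==> a *. (b *. x) = (a * b) *. x"
 "x .: A ==> 1 *. x = x"
 "x .: A ==> 0 *. x = \<zero>"
 "a *. \<zero> = \<zero>"
 "[| x .: A; y .: A |] ==> (a *. x) .* y = a *. (x .* y)"
 "[| x .: A; y .: A |] ==> x .* (a *. y) = a *. (x .* y)"
 "x .: A ==> a *. (.- x) = (- a) *. x"
 "x .: A ==> .- (a *. x) = (- a) *. x"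
 using smult_l_distr[of a b x] smult_r_distr[of a x y] smult_assoc1[of a b x] smult_one[of x] smult_l_null[of x]
  smult_r_null[of a] smult_assoc2[of a x y] smult_assoc3[of a x y] smult_r_minus[of a x] smult_l_minus[of a x]
 by auto

lemma uminus_csmult: "x .: A ==> .- x = (- 1) *. x"
 using csmult(10)[of x 1] by (simp add: csmult(4))

lemma calg_self: "calg A" by unfold_locales

end

lemma calgI: "kalg complex_alg A ==> calg A" by (simp add: calg_def)

abbreviation "chom \<equiv> kalg_hom complex_alg"

lemma chomI:
 assumes "!!x. x .: A ==> h x .: B"
  "!!x y. [| x .: A; y .: A |] ==> h (x .*~A y) = h x .*~B h y"
  "!!x y. [| x .: A; y .: A |] ==> h (x .+~A y) = h x .+~B h y"
  "h \<one>~A = \<one>~B"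
  "!!c x. x .: A ==> h (c *.~A x) = c *.~B h x"
 shows "h \<in> chom A B"
 using assms by (intro kalg_homI) auto

lemma chomD:
 assumes "h \<in> chom A B"
 shows "!!x. x .: A ==> h x .: B"
  "!!x y. [| x .: A; y .: A |] ==> h (x .*~A y) = h x .*~B h y"
  "!!x y. [| x .: A; y .: A |] ==> h (x .+~A y) = h x .+~B h y"
  "h \<one>~A = \<one>~B"
  "!!c x. x .: A ==> h (c *.~A x) = c *.~B h x"
 using kalg_homD[OF assms] by auto

lemma calg_ring: "calg A ==> ring A"
 by (simp add: calg_def kalg_def)

lemma chomD_add:
 assumes "h \<in> chom A B" "calg A" "calg B"
 shows "h \<zero>~A = \<zero>~B" "x .: A ==> h (.-~A x) = .-~B h x"
  "x .: A ==> y .: A ==> h (x .-~A y) = h x .-~B h y"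
 using kalg_hom_zero[OF assms(1)] kalg_hom_uminus[OF assms(1)] kalg_hom_minus[OF assms(1)]
  calg_ring[OF assms(2)] calg_ring[OF assms(3)] by simp_all

lemma alg_hom_iff: "h \<in> alg_hom A B \<longleftrightarrow> h \<in> chom A B \<and> h \<in> extensional (carrier A)"
 by (auto simp: alg_hom_def lin_hom_def kalg_hom_def ring_hom_def PiE_def)

text \<open>This turns a map obtained from a universal property into the extensional witness that a
  definite description requires.\<close>

lemma chom_restrict:
 assumes "h \<in> chom A B" "calg A" shows "restrict h (carrier A) \<in> alg_hom A B"
proof -
 interpret A: calg A by fact
 have "restrict h (carrier A) \<in> chom A B"
  by (rule chomI) (simp_all add: chomD[OF assms(1)])
 then show ?thesis by (simp add: alg_hom_iff)
qed

lemma free_monoid_monoid: "Group.monoid (free_monoid X)"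
 by (rule monoidI) (auto simp: free_monoid_def)

lemma free_monoid_sel [simp]: "carrier (free_monoid X) = lists X" "(a .*~(free_monoid X) b) = a @ b" "\<one>~(free_monoid X) = []"
 by (auto simp: free_monoid_def)

lemma (in ring) word_prod_append:
 assumes "!!x. x \<in> X ==> v x .: R" "w \<in> lists X" "w' \<in> lists X"
 shows "foldr (%x y. v x .* y) w' \<one> .: R"
  "foldr (%x y. v x .* y) (w @ w') \<one> = foldr (%x y. v x .* y) w \<one> .* foldr (%x y. v x .* y) w' \<one>"
proof -
 have c: "foldr (%x y. v x .* y) u \<one> .: R" if "u \<in> lists X" for u
  using that by (induction u) (auto simp: assms(1))
 then show "foldr (%x y. v x .* y) w' \<one> .: R" using assms by blast
 show "foldr (%x y. v x .* y) (w @ w') \<one> = foldr (%x y. v x .* y) w \<one> .* foldr (%x y. v x .* y) w' \<one>"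
  using assms(2) by (induction w) (use assms c in \<open>auto simp: m_assoc\<close>)
qed

section \<open>The quantum group by generators and relations\<close>

interpretation FA: monoid_algebra complex_alg "free_monoid (UNIV :: gen set)"
 by (intro monoid_algebra.intro complex_cring free_monoid_monoid)

interpretation FA: calg free_alg
 unfolding free_alg_def by (intro calgI FA.X_kalg)

lemma FA_delta [simp]: "basis_elt complex_alg w .: free_alg"
 unfolding free_alg_def by (rule FA.delta_closed) simp

lemmas FA_induct = FA.X_induct[folded free_alg_def, consumes 1, case_names zero add scaled]

lemma FA_delta_mult: "basis_elt complex_alg v .*~free_alg basis_elt complex_alg w = basis_elt complex_alg (v @ w :: gen list)"
 unfolding free_alg_def using FA.delta_mult[of v w] by simp

lemma qrels_carrier: "qrels \<subseteq> carrier free_alg"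
 by (auto simp: qrels_def Let_def)

lemma qideal_ideal: "ideal qideal free_alg"
 unfolding qideal_def by (rule FA.genideal_ideal[OF qrels_carrier])

interpretation UQ: calg UQ
 unfolding UQ_def by (intro calgI FA.quot_alg_kalg qideal_ideal)

abbreviation "qproj x \<equiv> qideal +>~free_alg x"

lemma qproj_hom: "qproj \<in> chom free_alg UQ"
 unfolding UQ_def using FA.quot_proj_hom[OF qideal_ideal] .

lemma qgen_closed [simp]: "qgen x .: UQ"
 unfolding qgen_def using chomD(1)[OF qproj_hom] by simp

lemma qproj_rel: "x \<in> qrels ==> qproj x = \<zero>~UQ"
 unfolding UQ_def using FA.quot_proj_zero_iff[OF qideal_ideal] FA.genideal_self[OF qrels_carrier] qrels_carrier
 by (auto simp: qideal_def)

lemma qproj_delta: "qproj (basis_elt complex_alg w) = foldr (%x y. qgen x .*~UQ y) w \<one>~UQ"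
proof (induction w)
 case Nil
 have "basis_elt complex_alg [] = \<one>~free_alg"
  by (auto simp: free_alg_def FA.X_ops)
 then show ?case using chomD(4)[OF qproj_hom] by simp
next
 case (Cons x w)
 have "qproj (basis_elt complex_alg [x] .*~free_alg basis_elt complex_alg w) = qproj (basis_elt complex_alg [x]) .*~UQ qproj (basis_elt complex_alg w)"
  by (rule chomD(2)[OF qproj_hom]) auto
 then show ?case using Cons by (simp add: FA_delta_mult qgen_def)
qed

lemma UQ_rels:
 "qK .*~UQ qKinv = \<one>~UQ" "qKinv .*~UQ qK = \<one>~UQ"
 "qK .*~UQ qE .+~UQ qE .*~UQ qK = \<zero>~UQ" "qK .*~UQ qF .+~UQ qF .*~UQ qK = \<zero>~UQ"
 "qE .*~UQ qF .-~UQ qF .*~UQ qE = (2 * \<i>) *.~UQ (qK .-~UQ qKinv)"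
proof -
 note pr = chomD[OF qproj_hom] chomD_add[OF qproj_hom FA.calg_self UQ.calg_self] qproj_delta
 show "qK .*~UQ qKinv = \<one>~UQ" "qKinv .*~UQ qK = \<one>~UQ"
  using qproj_rel[of "basis_elt complex_alg [GenK, GenKinv] .-~free_alg \<one>~free_alg"]
   qproj_rel[of "basis_elt complex_alg [GenKinv, GenK] .-~free_alg \<one>~free_alg"]
  by (simp_all add: qrels_def Let_def pr)
 show "qK .*~UQ qE .+~UQ qE .*~UQ qK = \<zero>~UQ" "qK .*~UQ qF .+~UQ qF .*~UQ qK = \<zero>~UQ"
  using qproj_rel[of "basis_elt complex_alg [GenK, GenE] .+~free_alg basis_elt complex_alg [GenE, GenK]"]
   qproj_rel[of "basis_elt complex_alg [GenK, GenF] .+~free_alg basis_elt complex_alg [GenF, GenK]"]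
  by (simp_all add: qrels_def Let_def pr)
 show "qE .*~UQ qF .-~UQ qF .*~UQ qE = (2 * \<i>) *.~UQ (qK .-~UQ qKinv)"
  using qproj_rel[of "(basis_elt complex_alg [GenE, GenF] .-~free_alg basis_elt complex_alg [GenF, GenE]) .-~free_alg ((2 * \<i>) *.~free_alg (basis_elt complex_alg [GenK] .-~free_alg basis_elt complex_alg [GenKinv]))"]
  by (simp add: qrels_def Let_def pr)
qed

text \<open>Words in the generators span the free algebra and hence its quotient; no normal form is
  involved.\<close>

lemma UQ_induct [consumes 1, case_names gen one add smult mult]:
 assumes u: "u .: UQ"
  and gen: "!!x. P (qgen x)" and one: "P \<one>~UQ"
  and add: "!!x y. [| x .: UQ; y .: UQ; P x; P y |] ==> P (x .+~UQ y)"
  and smult: "!!c x. [| x .: UQ; P x |] ==> P (c *.~UQ x)"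
  and mult: "!!x y. [| x .: UQ; y .: UQ; P x; P y |] ==> P (x .*~UQ y)"
 shows "P u"
proof -
 from u obtain f where f: "f .: free_alg" "u = qproj f"
  by (auto simp: UQ_def FA.quot_alg_sel)
 have w: "foldr (%x y. qgen x .*~UQ y) w \<one>~UQ .: UQ \<and> P (foldr (%x y. qgen x .*~UQ y) w \<one>~UQ)" for w
  by (induction w) (auto intro: mult gen one)
 note pr = chomD[OF qproj_hom]
 from f(1) have "P (qproj f)"
 proof (induction rule: FA_induct)
  case zero
  \<comment> \<open>The rule has no case for zero, so zero is reached as a scalar multiple of
    one.\<close>
  have "qproj \<zero>~free_alg = 0 *.~UQ \<one>~UQ"
   using chomD_add[OF qproj_hom FA.calg_self UQ.calg_self] by (simp add: UQ.csmult)
  then show ?case using smult[OF UQ.one_closed one] by simp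
 next
  case (add f g)
  then show ?case using assms(4)[of "qproj f" "qproj g"] pr by simp
 next
  case (scaled c m)
  have "qproj (c *.~free_alg basis_elt complex_alg m) = c *.~UQ qproj (basis_elt complex_alg m)"
   by (rule pr) simp
  then show ?case using smult w[of m] by (simp add: qproj_delta)
 qed
 then show ?thesis using f by simp
qed

lemma UQ_lift:
 assumes B: "calg B" and v: "!!x. v x .: B"
  and rels: "v GenK .*~B v GenKinv = \<one>~B" "v GenKinv .*~B v GenK = \<one>~B"
   "v GenK .*~B v GenE .+~B v GenE .*~B v GenK = \<zero>~B" "v GenK .*~B v GenF .+~B v GenF .*~B v GenK = \<zero>~B"
   "v GenE .*~B v GenF .-~B v GenF .*~B v GenE = (2 * \<i>) *.~B (v GenK .-~B v GenKinv)"
 shows "\<exists>h\<in>chom UQ B. \<forall>x. h (qgen x) = v x"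
proof -
 interpret B: calg B by fact
 let ?g = "%w. foldr (%x y. v x .*~B y) w \<one>~B"
 have "\<exists>h\<in>kalg_hom complex_alg FA.X B. \<forall>m\<in>carrier (free_monoid UNIV). h (basis_elt complex_alg m) = ?g m"
 proof (rule FA.X_lift[OF B.kalg_axioms])
  show "?g m .: B" for m using B.word_prod_append(1)[of UNIV v "[]" m] v by simp
  show "?g (a .*~(free_monoid UNIV) b) = ?g a .*~B ?g b" for a b
   using B.word_prod_append(2)[of UNIV v a b] v by simp
 qed simp
 then obtain h where h: "h \<in> chom free_alg B" "!!w. h (basis_elt complex_alg w) = ?g w"
  by (auto simp: free_alg_def)
 note hs = chomD[OF h(1)] chomD_add[OF h(1) FA.calg_self B]
 have "\<exists>k\<in>chom UQ B. \<forall>x\<in>carrier free_alg. k (qproj x) = h x"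
  unfolding UQ_def qideal_def
 proof (rule FA.quot_gen_lift[OF B.ring_axioms h(1) qrels_carrier])
  fix x assume "x \<in> qrels"
  then show "h x = \<zero>~B"
   unfolding qrels_def Let_def
   by (elim insertE emptyE; hypsubst) (simp_all add: hs h(2) v rels)
 qed
 then obtain k where k: "k \<in> chom UQ B" "\<forall>x\<in>carrier free_alg. k (qproj x) = h x"
  by (rule bexE)
 have "k (qgen x) = v x" for x
  unfolding qgen_def using bspec[OF k(2) FA_delta, of "[x]"] h(2) v by simp
 then show ?thesis using k(1) by (intro bexI[of _ k]) simp_all
qed

text \<open>Tensor factors are numbered \<open>1\<close>, \<open>2\<close> and \<open>i + 1\<close>;
  rewriting \<open>1\<close> to a successor would keep such terms from matching.\<close>

declare One_nat_def [simp del]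

lemma (in abelian_group) eq_neg_of_sum_zero:
 assumes "x .: G" "y .: G" "x .+ y = \<zero>" shows "x = .- y"
 using minus_equality[OF assms(3,2,1)] by simp

text \<open>
  In terms of \<open>G = iKF\<close> the relations of the quantum group have integer coefficients, so that
  computations with generators take place in arbitrary rings.
\<close>

definition utriple :: "('b, 'm) ring_scheme => 'b => 'b => 'b => 'b => bool" where
 "utriple B e g k k' \<longleftrightarrow> e .: B \<and> g .: B \<and> k .: B \<and> k' .: B \<and>
   k .*~B k' = \<one>~B \<and> k' .*~B k = \<one>~B \<and> k .*~B e = .-~B (e .*~B k) \<and> k .*~B g = .-~B (g .*~B k) \<and>
   e .*~B g .+~B g .*~B e = (k .*~B k .-~B \<one>~B) .+~B (k .*~B k .-~B \<one>~B)"

lemma utripleD: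
 assumes "utriple B e g k k'"
 shows "e .: B" "g .: B" "k .: B" "k' .: B"
  "k .*~B k' = \<one>~B" "k' .*~B k = \<one>~B" "k .*~B e = .-~B (e .*~B k)" "k .*~B g = .-~B (g .*~B k)"
  "e .*~B g .+~B g .*~B e = (k .*~B k .-~B \<one>~B) .+~B (k .*~B k .-~B \<one>~B)"
 using assms by (auto simp: utriple_def)

lemma (in ring) anticomm_inverse:
 assumes "k .: R" "k' .: R" "x .: R" "k .* k' = \<one>" "k' .* k = \<one>" "k .* x = .- (x .* k)"
 shows "k' .* x = .- (x .* k')"
proof -
 have "k' .* x = k' .* (x .* (k .* k'))" using assms by simp
 also have "\<dots> = k' .* ((x .* k) .* k')" using assms(1-3) by (simp only: m_assoc m_closed)
 also have "x .* k = .- (k .* x)" using assms(1-3,6) by simp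
 also have "k' .* (.- (k .* x) .* k') = .- ((k' .* k) .* (x .* k'))"
  using assms(1-3) by (simp add: l_minus r_minus m_assoc)
 finally show ?thesis using assms(1-3,5) by simp
qed

lemma (in ring) comm_inverse:
 assumes "k .: R" "k' .: R" "x .: R" "k .* k' = \<one>" "k' .* k = \<one>" "k .* x = x .* k"
 shows "k' .* x = x .* k'"
proof -
 have "k' .* x = k' .* (x .* (k .* k'))" using assms by simp
 also have "\<dots> = k' .* ((x .* k) .* k')" using assms(1-3) by (simp only: m_assoc m_closed)
 also have "\<dots> = (k' .* k) .* (x .* k')"
  using assms(1-3) by (simp add: assms(6)[symmetric] m_assoc)
 finally show ?thesis using assms(1-3,5) by simp
qed

text \<open>Since \<open>k\<close> anticommutes with \<open>e\<close>, passing from \<open>f\<close>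
  to \<i> times \<open>k .* f\<close> turns the commutator with \<open>e\<close> into an
  anticommutator. The constants combine to -\<i> times 2\<i>, which is 2, and the inverse of
  \<open>k\<close> is absorbed by the new factor \<open>k\<close>.\<close>

lemma (in calg) triple_of_gens:
 assumes c: "e .: A" "f .: A" "k .: A" "k' .: A"
  and r: "k .* k' = \<one>" "k' .* k = \<one>" "k .* e .+ e .* k = \<zero>" "k .* f .+ f .* k = \<zero>"
   "e .* f .- f .* e = (2 * \<i>) *. (k .- k')"
 shows "utriple A e (\<i> *. (k .* f)) k k'"
proof -
 have ke: "k .* e = .- (e .* k)" and kf: "k .* f = .- (f .* k)"
  using r(3,4) c eq_neg_of_sum_zero[of "k .* e" "e .* k"] eq_neg_of_sum_zero[of "k .* f" "f .* k"] by simp_all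
 have ek: "e .* k = .- (k .* e)" and fk: "f .* k = .- (k .* f)" using ke kf c by simp_all
 have "e .* (\<i> *. (k .* f)) .+ (\<i> *. (k .* f)) .* e = (- \<i>) *. (k .* (e .* f .- f .* e))"
  using c by (simp add: csmult m_assoc[symmetric] ek l_minus a_minus_def r_distr r_minus)
 also have "\<dots> = (- \<i> * (2 * \<i>)) *. (k .* (k .- k'))"
  unfolding r(5) using c by (simp add: csmult)
 also have "- \<i> * (2 * \<i>) = 1 + 1" by (simp add: complex_eq_iff)
 also have "(1 + 1) *. (k .* (k .- k')) = (1 + 1) *. (k .* k .- \<one>)"
  using c by (simp add: a_minus_def r_distr r_minus r)
 also have "\<dots> = (k .* k .- \<one>) .+ (k .* k .- \<one>)"
  by (subst csmult(1)) (use c in \<open>simp_all add: csmult(4)\<close>)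
 finally show ?thesis
  using c r(1,2) ke by (simp add: utriple_def csmult m_assoc fk r_minus)
qed

text \<open>The way back. Together with \<open>triple_of_gens\<close> it shows that a homomorphism
  from \<open>UQ\<close> amounts to a triple, as used in \<open>UQ_lift_triple\<close>.\<close>

lemma (in calg) gens_of_triple:
 assumes t: "utriple A e g k k'" and f: "f = (- \<i>) *. (k' .* g)"
 shows "f .: A" "k .* e .+ e .* k = \<zero>" "k .* f .+ f .* k = \<zero>"
   "e .* f .- f .* e = (2 * \<i>) *. (k .- k')" "\<i> *. (k .* f) = g"
proof -
 note c = utripleD(1-4)[OF t] note r = utripleD(5-)[OF t]
 have gk: "g .* k = .- (k .* g)" and ek': "e .* k' = .- (k' .* e)" and gk': "g .* k' = .- (k' .* g)"
  using c r anticomm_inverse[of k k' e] anticomm_inverse[of k k' g] by simp_all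
 show "f .: A" using c by (simp add: f)
 show "k .* e .+ e .* k = \<zero>" using c r(3) by (simp add: l_neg)
 have kk: "k .* (k' .* g) = g" "k' .* (k .* g) = g" using c r(1,2) by (simp_all add: m_assoc[symmetric])
 show "k .* f .+ f .* k = \<zero>"
  using c csmult(1)[OF c(2), of "- \<i>" "\<i>", symmetric] by (simp add: f csmult m_assoc gk r_minus kk)
 show "\<i> *. (k .* f) = g" using c kk by (simp add: f csmult)
 have "e .* f .- f .* e = \<i> *. (k' .* (e .* g .+ g .* e))"
  using c by (simp add: f csmult m_assoc[symmetric] ek' l_minus a_minus_def r_distr r_minus)
 also have "\<dots> = \<i> *. ((1 + 1) *. (k .- k'))"
  unfolding r(5) csmult(1)[OF minus_closed[OF c(3,4)]]
  using c r(2) by (simp add: csmult(4) r_distr a_minus_def r_minus m_assoc[symmetric])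
 finally show "e .* f .- f .* e = (2 * \<i>) *. (k .- k')" using c by (simp add: csmult(3) mult.commute)
qed

lemma qFt_closed [simp]: "qFt .: UQ"
 by (simp add: qFt_def)

lemma UQ_triple: "utriple UQ qE qFt qK qKinv"
 unfolding qFt_def by (rule UQ.triple_of_gens[OF _ _ _ _ UQ_rels]) auto

lemma qF_eq: "qF = (- \<i>) *.~UQ (qKinv .*~UQ qFt)"
 by (simp add: qFt_def UQ.csmult UQ.m_assoc[symmetric] UQ_rels)

text \<open>Substituting F = -\<i> K^-1 (iKF) removes the imaginary unit. In this form \<Omega> has
  integer coefficients and can be represented in \<open>gring\<close>.\<close>

lemma qOmega_eq: "qOmega = qK .-~UQ qKinv .*~UQ (\<one>~UQ .+~UQ qE .*~UQ qFt)"
proof -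
 note t = utripleD[OF UQ_triple]
 have a: "qE .*~UQ qKinv = .-~UQ (qKinv .*~UQ qE)"
  using UQ.anticomm_inverse[OF t(3,4,1,5,6,7)] by simp
 have "\<i> *.~UQ (qE .*~UQ qF) = (qE .*~UQ qKinv) .*~UQ qFt"
  unfolding qF_eq by (simp add: UQ.csmult UQ.m_assoc)
 also have "\<dots> = .-~UQ (qKinv .*~UQ (qE .*~UQ qFt))"
  unfolding a by (simp add: UQ.l_minus UQ.m_assoc)
 finally show ?thesis
  by (simp add: qOmega_def a_minus_def UQ.r_distr UQ.minus_add UQ.a_ac)
qed

lemma qOmega_closed [simp]: "qOmega .: UQ"
 by (simp add: qOmega_def)

lemma utriple_hom:
 assumes t: "utriple A e g k k'" and h: "h \<in> chom A B" and A: "calg A" and B: "calg B"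
 shows "utriple B (h e) (h g) (h k) (h k')"
proof -
 interpret A: calg A by fact
 interpret B: calg B by fact
 note c = utripleD(1-4)[OF t] note r = utripleD(5-)[OF t]
 note hs = chomD[OF h] chomD_add[OF h A B]
 have "h e .*~B h g .+~B h g .*~B h e = h (e .*~A g .+~A g .*~A e)" using c by (simp add: hs)
 also have "\<dots> = (h k .*~B h k .-~B \<one>~B) .+~B (h k .*~B h k .-~B \<one>~B)"
  unfolding r(5) using c by (simp add: hs)
 finally show ?thesis
  unfolding utriple_def using c r(1-4) by (simp add: hs flip: hs(2))
qed

lemma UQ_lift_triple:
 assumes B: "calg B" and t: "utriple B e g k k'"
 shows "\<exists>h\<in>chom UQ B. h qE = e \<and> h qFt = g \<and> h qK = k \<and> h qKinv = k'"
proof -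
 interpret B: calg B by fact
 note c = utripleD(1-4)[OF t] note r = utripleD(5-)[OF t]
 define f where "f = (- \<i>) *.~B (k' .*~B g)"
 note gt = B.gens_of_triple[OF t f_def]
 define v where "v x = (case x of GenE => e | GenF => f | GenK => k | GenKinv => k')" for x
 have v: "v GenE = e" "v GenF = f" "v GenK = k" "v GenKinv = k'" by (simp_all add: v_def)
 have "\<exists>h\<in>chom UQ B. \<forall>x. h (qgen x) = v x"
 proof (rule UQ_lift[OF B])
  fix x show "v x .: B" using c gt(1) by (cases x) (simp_all add: v)
 qed (use r(1,2) gt in \<open>simp_all only: v\<close>)
 then obtain h where h: "h \<in> chom UQ B" "\<forall>x. h (qgen x) = v x" by (rule bexE)
 have "h qFt = g"
  unfolding qFt_def using chomD[OF h(1)] h(2) gt(5) c gt(1) by (simp add: v)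
 then show ?thesis using h v by (intro bexI[of _ h]) simp_all
qed

text \<open>Inverses in \<open>B\<close> are unique, so the value at the inverse of K is forced by
  the value at K. The description of \<open>coproduct\<close> by three values relies on
  this.\<close>

lemma UQ_hom_eq:
 assumes B: "calg B" and h: "h \<in> chom UQ B" "h' \<in> chom UQ B"
  and eq: "h qE = h' qE" "h qF = h' qF" "h qK = h' qK" and u: "u .: UQ"
 shows "h u = h' u"
proof -
 interpret B: calg B by fact
 note hs = chomD[OF h(1)] chomD[OF h(2)]
 have inv: "h qK .*~B h qKinv = \<one>~B" "h' qKinv .*~B h' qK = \<one>~B"
  using hs(2)[of qK qKinv] hs(7)[of qKinv qK] by (simp_all add: UQ_rels hs)
 have "h' qKinv = h' qKinv .*~B (h qK .*~B h qKinv)" using inv hs by simp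
 also have "\<dots> = (h' qKinv .*~B h' qK) .*~B h qKinv" using hs eq(3) by (simp add: B.m_assoc)
 finally have k: "h qKinv = h' qKinv" using inv hs by simp
 from u show ?thesis
 proof (induction rule: UQ_induct)
  case (gen x)
  then show ?case using eq k by (cases x) simp_all
 qed (simp_all add: hs)
qed

lemma UQ_hom_eq_triple:
 assumes B: "calg B" and h: "h \<in> chom UQ B" "h' \<in> chom UQ B"
  and eq: "h qE = h' qE" "h qFt = h' qFt" "h qK = h' qK" "h qKinv = h' qKinv" and u: "u .: UQ"
 shows "h u = h' u"
 by (rule UQ_hom_eq[OF B h eq(1) _ eq(3) u]) (use eq chomD[OF h(1)] chomD[OF h(2)] in \<open>simp add: qF_eq\<close>)

section \<open>Tensor powers\<close>

lemma fun_upd_PiE: "t \<in> I \<rightarrow>\<^sub>E C ==> j \<in> I ==> x \<in> C ==> t(j := x) \<in> I \<rightarrow>\<^sub>E C"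
 by (auto simp: PiE_def extensional_def Pi_def)

locale tensor_power = calg A for A (structure) + fixes n :: nat
begin

abbreviation "P \<equiv> product_group {1..n} (%_. A)"
abbreviation "TP \<equiv> tensor_pow n A"
abbreviation "TA \<equiv> tuples_alg n A"
abbreviation "I \<equiv> {1..n}"
abbreviation "tuples \<equiv> I \<rightarrow>\<^sub>E carrier A"
abbreviation "\<iota> \<equiv> in_factor n A"

lemma P_monoid: "Group.monoid P"
 by (rule monoidI) (auto simp: m_assoc PiE_def extensional_def fun_eq_iff Pi_def restrict_def)

sublocale T: monoid_algebra complex_alg P
 by (intro monoid_algebra.intro complex_cring P_monoid)

sublocale TA: calg TA
 unfolding tuples_alg_def by (intro calgI T.X_kalg)

lemma delta_in_TA: "t \<in> tuples ==> basis_elt complex_alg t .: TA"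
 unfolding tuples_alg_def by (rule T.delta_closed) simp

lemma multilinear_rels_carrier: "multilinear_rels n A \<subseteq> carrier TA"
 by (auto simp: multilinear_rels_def Let_def fun_upd_PiE delta_in_TA)

lemma tensor_ideal_ideal: "ideal (tensor_ideal n A) TA"
 unfolding tensor_ideal_def by (rule TA.genideal_ideal[OF multilinear_rels_carrier])

sublocale TP: calg TP
 unfolding tensor_pow_def by (intro calgI TA.quot_alg_kalg tensor_ideal_ideal)

lemma TP_calg: "calg TP" by (rule TP.calg_self)

definition proj where "proj x = tensor_ideal n A +>~TA x"

definition pure where "pure t = proj (basis_elt complex_alg t)"

lemma proj_hom: "proj \<in> chom TA TP"
 unfolding tensor_pow_def proj_def using TA.quot_proj_hom[OF tensor_ideal_ideal] .

lemma pure_closed: "t \<in> tuples ==> pure t .: TP"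
 unfolding pure_def by (rule chomD(1)[OF proj_hom delta_in_TA])

lemma proj_rel: "x \<in> multilinear_rels n A ==> proj x = \<zero>~TP"
 unfolding tensor_pow_def proj_def using TA.quot_proj_zero_iff[OF tensor_ideal_ideal] TA.genideal_self[OF multilinear_rels_carrier] multilinear_rels_carrier
 by (auto simp: tensor_ideal_def)

lemma pure_add:
 assumes t: "t \<in> tuples" and j: "j \<in> I" and x: "x .: A" "y .: A"
 shows "pure (t(j := x .+ y)) = pure (t(j := x)) .+~TP pure (t(j := y))"
proof -
 have d: "basis_elt complex_alg (t(j := z)) .: TA" if "z .: A" for z
  using t j that by (intro delta_in_TA fun_upd_PiE)
 have "proj (basis_elt complex_alg (t(j := x .+ y)) .-~TA (basis_elt complex_alg (t(j := x)) .+~TA basis_elt complex_alg (t(j := y)))) = \<zero>~TP"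
  by (rule proj_rel) (use t j x in \<open>unfold multilinear_rels_def Let_def, blast\<close>)
 then show ?thesis
  using d x chomD[OF proj_hom] chomD_add[OF proj_hom TA.calg_self TP_calg] by (simp add: pure_def)
qed

lemma pure_smult:
 assumes t: "t \<in> tuples" and j: "j \<in> I" and x: "x .: A"
 shows "pure (t(j := c *. x)) = c *.~TP pure (t(j := x))"
proof -
 have d: "basis_elt complex_alg (t(j := z)) .: TA" if "z .: A" for z
  using t j that by (intro delta_in_TA fun_upd_PiE)
 have "proj (basis_elt complex_alg (t(j := c *. x)) .-~TA (c *.~TA basis_elt complex_alg (t(j := x)))) = \<zero>~TP"
  by (rule proj_rel) (use t j x in \<open>unfold multilinear_rels_def Let_def, blast\<close>)
 then show ?thesis
  using d x chomD[OF proj_hom] chomD_add[OF proj_hom TA.calg_self TP_calg] by (simp add: pure_def)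
qed

lemma pure_mult:
 assumes t: "s \<in> tuples" "t \<in> tuples"
 shows "pure s .*~TP pure t = pure (\<lambda>k\<in>I. s k .* t k)"
proof -
 have "basis_elt complex_alg s .*~TA basis_elt complex_alg t = basis_elt complex_alg (\<lambda>k\<in>I. s k .* t k)"
  unfolding tuples_alg_def using T.delta_mult[of s t] t by simp
 then show ?thesis
  unfolding pure_def using chomD(2)[OF proj_hom delta_in_TA[OF t(1)] delta_in_TA[OF t(2)]] by simp
qed

lemma pure_one: "pure (\<lambda>k\<in>I. \<one>) = \<one>~TP"
proof -
 have "\<one>~TA = basis_elt complex_alg (\<lambda>k\<in>I. \<one>)" unfolding tuples_alg_def T.X_ops by simp
 then show ?thesis unfolding pure_def using chomD(4)[OF proj_hom] by simp
qed

lemma in_factor_pure: "j \<in> I ==> \<iota> j x = pure ((\<lambda>k\<in>I. \<one>)(j := x))"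
proof -
 assume "j \<in> I"
 then have "(\<lambda>k\<in>I. if k = j then x else \<one>) = (\<lambda>k\<in>I. \<one>)(j := x)" by auto
 then show ?thesis by (simp add: in_factor_def pure_def proj_def)
qed

lemma one_tuple: "(\<lambda>k\<in>I. \<one>) \<in> tuples" by auto

lemma in_factor_hom: assumes j: "j \<in> I" shows "\<iota> j \<in> chom A TP"
proof (rule chomI)
 fix x y assume x: "x .: A" and y: "y .: A"
 have "(\<lambda>k\<in>I. ((\<lambda>k\<in>I. \<one>)(j := x)) k .* ((\<lambda>k\<in>I. \<one>)(j := y)) k) = (\<lambda>k\<in>I. \<one>)(j := x .* y)"
  using j by (auto simp: fun_eq_iff)
 then show "\<iota> j (x .* y) = \<iota> j x .*~TP \<iota> j y"
  using pure_mult[OF fun_upd_PiE[OF one_tuple j x] fun_upd_PiE[OF one_tuple j y]] j by (simp add: in_factor_pure)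
qed (use j in \<open>simp_all add: in_factor_pure pure_add one_tuple pure_smult pure_one pure_closed fun_upd_PiE fun_upd_idem del: One_nat_def\<close>)

lemma in_factor_commute:
 assumes "i \<in> I" "j \<in> I" "i \<noteq> j" "x .: A" "y .: A"
 shows "\<iota> i x .*~TP \<iota> j y = \<iota> j y .*~TP \<iota> i x"
proof -
 have "(\<lambda>k\<in>I. ((\<lambda>k\<in>I. \<one>)(i := x)) k .* ((\<lambda>k\<in>I. \<one>)(j := y)) k) = (\<lambda>k\<in>I. ((\<lambda>k\<in>I. \<one>)(j := y)) k .* ((\<lambda>k\<in>I. \<one>)(i := x)) k)"
  using assms by (auto simp: fun_eq_iff)
 then show ?thesis
  using pure_mult[OF fun_upd_PiE[OF one_tuple assms(1,4)] fun_upd_PiE[OF one_tuple assms(2,5)]]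
   pure_mult[OF fun_upd_PiE[OF one_tuple assms(2,5)] fun_upd_PiE[OF one_tuple assms(1,4)]] assms
  by (simp add: in_factor_pure)
qed

text \<open>Induction over the positions already reached, with ones in all other positions; the full
  list then yields \<open>pure_eq_prod\<close>.\<close>

lemma pure_prod_list:
 assumes t: "t \<in> tuples" and L: "distinct L" "set L \<subseteq> I"
 shows "foldr (%j y. \<iota> j (t j) .*~TP y) L \<one>~TP = pure (\<lambda>k\<in>I. if k \<in> set L then t k else \<one>)"
proof -
 define s where "s L = (\<lambda>k\<in>I. if k \<in> set L then t k else \<one>)" for L
 have "foldr (%j y. \<iota> j (t j) .*~TP y) L \<one>~TP = pure (s L)"
  using L
 proof (induction L)
  case Nil
  have "s [] = (\<lambda>k\<in>I. \<one>)" by (simp add: s_def)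
  then have "pure (s []) = \<one>~TP" by (rule ssubst[where P = "%t. pure t = \<one>~TP"]) (rule pure_one)
  then show ?case by simp
 next
  case (Cons j L)
  then have j: "j \<in> I" "t j .: A" "j \<notin> set L" using t by auto
  have s: "s L \<in> tuples" using t by (auto simp: s_def)
  have tk: "t k .: A" if "k \<in> I" for k using t that by auto
  have "(\<lambda>k\<in>I. ((\<lambda>k\<in>I. \<one>)(j := t j)) k .* s L k) = s (j # L)"
   using j tk by (auto simp: fun_eq_iff s_def)
  then show ?case
   using Cons j pure_mult[OF fun_upd_PiE[OF one_tuple j(1,2)] s] in_factor_pure[OF j(1)] by simp
 qed
 then show ?thesis by (simp only: s_def)
qed

lemma pure_eq_prod:
 assumes t: "t \<in> tuples"
 shows "pure t = foldr (%j y. \<iota> j (t j) .*~TP y) [1..<Suc n] \<one>~TP"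
proof -
 have "(\<lambda>k\<in>I. if k \<in> set [1..<Suc n] then t k else \<one>) = t"
  using t by (auto simp: fun_eq_iff PiE_def extensional_def)
 then show ?thesis using pure_prod_list[OF t, of "[1..<Suc n]"] by force
qed

lemma TP_induct [consumes 1, case_names gen one add smult mult]:
 assumes u: "u .: TP"
  and gen: "!!j x. j \<in> I ==> x .: A ==> Q (\<iota> j x)" and one: "Q \<one>~TP"
  and add: "!!x y. [| x .: TP; y .: TP; Q x; Q y |] ==> Q (x .+~TP y)"
  and smult: "!!c x. [| x .: TP; Q x |] ==> Q (c *.~TP x)"
  and mult: "!!x y. [| x .: TP; y .: TP; Q x; Q y |] ==> Q (x .*~TP y)"
 shows "Q u"
proof -
 from u obtain f where f: "f .: TA" "u = proj f"
  by (auto simp: tensor_pow_def TA.quot_alg_sel proj_def)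
 have w: "Q (pure t)" if t: "t \<in> tuples" for t
 proof -
  have "Q (foldr (%j y. \<iota> j (t j) .*~TP y) L \<one>~TP) \<and> foldr (%j y. \<iota> j (t j) .*~TP y) L \<one>~TP .: TP"
   if "set L \<subseteq> I" for L
   using that
  proof (induction L)
   case (Cons j L)
   then have j: "j \<in> I" "t j .: A" using t by auto
   then show ?case using Cons gen[OF j] chomD(1)[OF in_factor_hom[OF j(1)] j(2)] by (auto intro: mult)
  qed (simp add: one)
  from this[of "[1..<Suc n]"] show ?thesis unfolding pure_eq_prod[OF t] by force
 qed
 note pr = chomD[OF proj_hom]
 note ind = T.X_induct[folded tuples_alg_def, consumes 1, case_names zero add scaled]
 from f(1) have "Q (proj f)"
 proof (induction rule: ind)
  case zero
  have "proj \<zero>~TA = 0 *.~TP \<one>~TP"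
   using chomD_add[OF proj_hom TA.calg_self TP_calg] by (simp add: TP.csmult)
  then show ?case using smult[OF TP.one_closed one] by simp
 next
  case (add f g)
  then show ?case using assms(4)[of "proj f" "proj g"] pr by simp
 next
  case (scaled c m)
  then have m: "m \<in> tuples" by simp
  have "proj (c *.~TA basis_elt complex_alg m) = c *.~TP pure m"
   unfolding pure_def using pr(5)[OF delta_in_TA[OF m]] .
  then show ?case using smult[OF pure_closed[OF m] w[OF m], of c] by simp
 qed
 then show ?thesis using f by simp
qed

lemma TP_hom_eq:
 assumes B: "calg B" and h: "h \<in> chom TP B" "h' \<in> chom TP B"
  and eq: "!!j x. j \<in> I ==> x .: A ==> h (\<iota> j x) = h' (\<iota> j x)" and u: "u .: TP"
 shows "h u = h' u"
proof -
 note hs = chomD[OF h(1)] chomD[OF h(2)]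
 from u show ?thesis by (induction rule: TP_induct) (simp_all add: hs eq)
qed

end

text \<open>Images of different factors have to commute for the ordered product of the
  \<open>f j\<close> to be multiplicative. This is the setting in which \<open>tensor_lift\<close>
  exists.\<close>

locale commuting_homs = tensor_power A n + B: calg B
 for A (structure) and n and B :: "(complex, 'b, 'p) module_scheme" +
 fixes f :: "nat => 'a => 'b"
 assumes f_hom: "!!j. j \<in> {1..n} ==> f j \<in> chom A B"
  and f_comm: "!!i j x y. [| i \<in> {1..n}; j \<in> {1..n}; i \<noteq> j; x .: A; y .: A |] ==>
   f i x .*~B f j y = f j y .*~B f i x"
begin

definition "pl L t = foldr (%j y. f j (t j) .*~B y) L \<one>~B"

lemma pl_simps: "pl [] t = \<one>~B" "pl (j # L) t = f j (t j) .*~B pl L t"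
 by (simp_all add: pl_def)

lemma pl_closed: "t \<in> tuples ==> set L \<subseteq> I ==> pl L t .: B"
 by (induction L) (auto simp: pl_simps intro!: B.m_closed chomD(1)[OF f_hom])

lemma pl_commute:
 assumes t: "t \<in> tuples" and i: "i \<in> I" and x: "x .: A"
 shows "set L \<subseteq> I ==> i \<notin> set L ==> pl L t .*~B f i x = f i x .*~B pl L t"
proof (induction L)
 case Nil
 then show ?case using chomD(1)[OF f_hom[OF i] x] by (simp add: pl_simps)
next
 case (Cons j L)
 then have j: "j \<in> I" "t j .: A" "set L \<subseteq> I" using t by auto
 note c = chomD(1)[OF f_hom[OF i] x] chomD(1)[OF f_hom[OF j(1)] j(2)] pl_closed[OF t j(3)]
 have "pl (j # L) t .*~B f i x = f j (t j) .*~B (f i x .*~B pl L t)"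
  using c Cons by (simp add: pl_simps B.m_assoc)
 also have "\<dots> = (f i x .*~B f j (t j)) .*~B pl L t"
  using f_comm[OF i j(1) _ x j(2)] Cons.prems(2) c by (simp add: B.m_assoc[symmetric])
 finally show ?case using c by (simp add: pl_simps B.m_assoc)
qed

text \<open>The entry of \<open>t\<close> in the head factor is moved past the product for
  \<open>s\<close> over the tail, which involves only other factors.\<close>

lemma pl_mult:
 assumes t: "s \<in> tuples" "t \<in> tuples"
 shows "set L \<subseteq> I ==> distinct L ==> pl L (\<lambda>k\<in>I. s k .* t k) = pl L s .*~B pl L t"
proof (induction L)
 case Nil
 then show ?case by (simp add: pl_simps)
next
 case (Cons j L)
 then have j: "j \<in> I" "s j .: A" "t j .: A" "set L \<subseteq> I" "j \<notin> set L" using t by auto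
 note c = chomD(1)[OF f_hom[OF j(1)] j(2)] chomD(1)[OF f_hom[OF j(1)] j(3)] pl_closed[OF t(1) j(4)] pl_closed[OF t(2) j(4)]
 have "pl (j # L) (\<lambda>k\<in>I. s k .* t k) = f j (s j) .*~B ((f j (t j) .*~B pl L s) .*~B pl L t)"
 proof -
  have d: "distinct L" using Cons.prems by simp
  have "pl (j # L) (\<lambda>k\<in>I. s k .* t k) = f j (s j .* t j) .*~B (pl L s .*~B pl L t)"
   unfolding pl_simps(2) Cons.IH[OF j(4) d] by (simp only: restrict_apply' j(1))
  then show ?thesis using c chomD(2)[OF f_hom[OF j(1)] j(2,3)] by (simp add: B.m_assoc)
 qed
 also have "f j (t j) .*~B pl L s = pl L s .*~B f j (t j)"
  using pl_commute[OF t(1) j(1,3,4,5)] by simp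
 finally show ?case using c by (simp add: pl_simps B.m_assoc)
qed

lemma pl_cong: "(!!k. k \<in> set L ==> s k = t k) ==> pl L s = pl L t"
 by (induction L) (simp_all add: pl_simps)

lemma pl_one: "set L \<subseteq> I ==> pl L (\<lambda>k\<in>I. \<one>) = \<one>~B"
 by (induction L) (simp_all add: pl_simps chomD(4)[OF f_hom])

lemma pl_upd_notin: "j \<notin> set L ==> pl L (t(j := x)) = pl L t"
 by (rule pl_cong) auto

lemma pl_upd: "i \<noteq> j ==> pl (i # L) (t(j := x)) = f i (t i) .*~B pl L (t(j := x))"
 unfolding pl_simps(2) by (subst fun_upd_other) auto

lemma pl_upd_same: "j \<notin> set L ==> pl (j # L) (t(j := x)) = f j x .*~B pl L t"
 unfolding pl_simps(2) fun_upd_same by (subst pl_upd_notin) auto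

text \<open>A position of a distinct list enters the ordered product exactly once, hence linearly.
  This is what kills \<open>multilinear_rels\<close>.\<close>

lemma pl_linear:
 assumes t: "t \<in> tuples" and j: "j \<in> I" and x: "x .: A" "y .: A"
 shows "set L \<subseteq> I ==> distinct L ==> j \<in> set L ==>
  pl L (t(j := x .+ y)) = pl L (t(j := x)) .+~B pl L (t(j := y)) \<and> pl L (t(j := c *. x)) = c *.~B pl L (t(j := x))"
proof (induction L)
 case (Cons i L)
 then have i: "i \<in> I" "t i .: A" "set L \<subseteq> I" "i \<notin> set L" using t by auto
 note fj = chomD[OF f_hom[OF j]]
 show ?case
 proof (cases "i = j")
  case True
  then show ?thesis
   using x fj(1)[OF x(1)] fj(1)[OF x(2)] pl_closed[OF t i(3)]
   unfolding True pl_upd_same[OF i(4)[unfolded True]] by (simp add: fj B.l_distr B.csmult)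
 next
  case False
  then have "j \<in> set L" using Cons.prems by simp
  then have IH: "pl L (t(j := x .+ y)) = pl L (t(j := x)) .+~B pl L (t(j := y))" "pl L (t(j := c *. x)) = c *.~B pl L (t(j := x))"
   using conjunct1[OF Cons.IH[OF i(3)]] conjunct2[OF Cons.IH[OF i(3)]] Cons.prems(2) by (simp_all only: distinct.simps)
  have c: "f i (t i) .: B" "pl L (t(j := x)) .: B" "pl L (t(j := y)) .: B"
   using chomD(1)[OF f_hom[OF i(1)] i(2)] pl_closed[OF _ i(3)] fun_upd_PiE[OF t j] x by blast+
  show ?thesis using c unfolding pl_upd[OF False] IH by (simp add: B.r_distr B.csmult)
 qed
qed simp

lemma tensor_lift_exists: "\<exists>h\<in>chom TP B. \<forall>j\<in>I. \<forall>x\<in>carrier A. h (\<iota> j x) = f j x"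
proof -
 let ?L = "[1..<Suc n]"
 have L: "set ?L \<subseteq> I" "distinct ?L" "!!j. j \<in> I ==> j \<in> set ?L" by auto
 have "\<exists>h\<in>kalg_hom complex_alg T.X B. \<forall>m\<in>carrier P. h (basis_elt complex_alg m) = pl ?L m"
 proof (rule T.X_lift[OF B.kalg_axioms])
  show "pl ?L m .: B" if "m .: P" for m using that pl_closed[OF _ L(1)] by simp
  show "pl ?L \<one>~P = \<one>~B" using pl_one[OF L(1)] by simp
  show "pl ?L (a .*~P b) = pl ?L a .*~B pl ?L b" if "a .: P" "b .: P" for a b
   using that pl_mult[OF _ _ L(1,2)] by simp
 qed
 then obtain h where h: "h \<in> chom TA B" "\<forall>m\<in>carrier P. h (basis_elt complex_alg m) = pl ?L m"
  unfolding tuples_alg_def by (rule bexE)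
 have hd: "h (basis_elt complex_alg t) = pl ?L t" if "t \<in> tuples" for t using h(2) that by simp
 note hs = chomD[OF h(1)] chomD_add[OF h(1) TA.calg_self B.calg_self]
 have "\<exists>k\<in>chom TP B. \<forall>x\<in>carrier TA. k (proj x) = h x"
  unfolding tensor_pow_def tensor_ideal_def proj_def
 proof (rule TA.quot_gen_lift[OF B.ring_axioms h(1) multilinear_rels_carrier])
  fix r assume "r \<in> multilinear_rels n A"
  then consider t j x y where "t \<in> tuples" "j \<in> I" "x .: A" "y .: A"
    "r = basis_elt complex_alg (t(j := x .+ y)) .-~TA (basis_elt complex_alg (t(j := x)) .+~TA basis_elt complex_alg (t(j := y)))"
   | t j c x where "t \<in> tuples" "j \<in> I" "x .: A"
    "r = basis_elt complex_alg (t(j := c *. x)) .-~TA (c *.~TA basis_elt complex_alg (t(j := x)))"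
   unfolding multilinear_rels_def Let_def by blast
  then show "h r = \<zero>~B"
  proof cases
   case 1
   have u: "t(j := z) \<in> tuples" if "z .: A" for z by (rule fun_upd_PiE[OF 1(1,2) that])
   show ?thesis
    unfolding 1(5) using 1(3,4) pl_linear[OF 1(1-4) L(1,2) L(3)[OF 1(2)]] pl_closed[OF u L(1)]
    by (simp add: hs hd u delta_in_TA del: upt_Suc)
  next
   case 2
   have u: "t(j := z) \<in> tuples" if "z .: A" for z by (rule fun_upd_PiE[OF 2(1,2) that])
   show ?thesis
    unfolding 2(4) using 2(3) pl_linear[OF 2(1-3) 2(3) L(1,2) L(3)[OF 2(2)]] pl_closed[OF u L(1)]
    by (simp add: hs hd u delta_in_TA del: upt_Suc)
  qed
 qed
 then obtain k where k: "k \<in> chom TP B" "\<forall>x\<in>carrier TA. k (proj x) = h x" by (rule bexE)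
 have "k (\<iota> j x) = f j x" if j: "j \<in> I" and x: "x .: A" for j x
 proof -
  let ?t = "(\<lambda>k\<in>I. \<one>)(j := x)"
  have t: "?t \<in> tuples" by (rule fun_upd_PiE[OF one_tuple j x])
  have pl: "pl L ?t = (if j \<in> set L then f j x else \<one>~B)" if "set L \<subseteq> I" "distinct L" for L
   using that
  proof (induction L)
   case (Cons i L)
   then show ?case using chomD(1)[OF f_hom[OF j] x] chomD(4)[OF f_hom[of i]] by (auto simp: pl_simps)
  qed (simp add: pl_simps)
  have "k (\<iota> j x) = pl ?L ?t"
   unfolding in_factor_pure[OF j] pure_def using bspec[OF k(2) delta_in_TA[OF t]] hd[OF t] by simp
  then show ?thesis using pl[OF L(1,2)] L(3)[OF j] by simp
 qed
 then show ?thesis using k(1) by (intro bexI[of _ k] ballI)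
qed

text \<open>The recurring pattern for definite descriptions: a homomorphism from the universal
  property is restricted to the carrier to make it extensional, and it is the only one because the
  factors generate.\<close>

lemma tensor_lift_spec:
 shows tensor_lift_hom: "tensor_lift n A B f \<in> chom TP B"
  and tensor_lift_in_factor: "[| j \<in> I; x .: A |] ==> tensor_lift n A B f (\<iota> j x) = f j x"
proof -
 obtain h where h: "h \<in> chom TP B" "\<forall>j\<in>I. \<forall>x\<in>carrier A. h (\<iota> j x) = f j x"
  using tensor_lift_exists by (rule bexE)
 let ?Q = "%h. h \<in> alg_hom TP B \<and> (\<forall>j\<in>{1..n}. \<forall>a\<in>carrier A. h (\<iota> j a) = f j a)"
 have Q: "?Q (restrict h (carrier TP))"
  using chom_restrict[OF h(1) TP_calg] h(2) chomD(1)[OF in_factor_hom] by auto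
 have uniq: "h1 = restrict h (carrier TP)" if "?Q h1" for h1
 proof (rule extensionalityI)
  show "h1 \<in> extensional (carrier TP)" using that by (auto simp: alg_hom_iff)
  show "h1 x = restrict h (carrier TP) x" if "x .: TP" for x
   using TP_hom_eq[OF B.calg_self _ _ _ that, of h1 "restrict h (carrier TP)"] \<open>?Q h1\<close> Q by (simp add: alg_hom_iff)
 qed simp
 have "?Q (tensor_lift n A B f)"
  unfolding tensor_lift_def by (rule theI[of ?Q, OF Q uniq])
 then show "tensor_lift n A B f \<in> chom TP B"
  "[| j \<in> I; x .: A |] ==> tensor_lift n A B f (\<iota> j x) = f j x"
  by (auto simp: alg_hom_iff)
qed

end

section \<open>Localization at a central element\<close>

context calg
begin

abbreviation "PA \<equiv> poly_alg A"
abbreviation "mnm \<equiv> up_ring.monom (UP A)"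

lemma UPr: "UP_ring A" by unfold_locales

lemma PA_sel: "carrier PA = up A" "\<one>~PA = (%i. if i = 0 then \<one> else \<zero>)" "\<zero>~PA = (%i. \<zero>)"
 "c *.~PA p = (%n. c *. p n)"
 by (simp_all add: poly_alg_def UP_def)

lemma PA_ops: assumes "p \<in> up A" "q \<in> up A"
 shows "p .+~PA q = (%i. p i .+ q i)" "p .*~PA q = (%n. \<Oplus>i \<in> {..n}. p i .* q (n - i))"
 using assms by (simp_all add: poly_alg_def UP_def)

lemma mon_eq: "a .: A ==> mnm a k = (%i. if i = k then a else \<zero>)"
 by (simp add: UP_def)

lemma mon_closed: "a .: A ==> mnm a k \<in> up A"
 using UP_ring.monom_closed[OF UPr, of a k] by (simp add: UP_def)

lemma mon_mult: "a .: A ==> b .: A ==> mnm a k .*~PA mnm b l = mnm (a .* b) (k + l)"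
 using UP_ring.monom_mult[OF UPr, of a b k l] by (simp add: poly_alg_def)

lemma up_csmult: "p \<in> up A ==> (%n. c *. p n) \<in> up A"
proof (rule mem_upI)
 assume p: "p \<in> up A"
 then obtain n where "bound \<zero> n p" by auto
 then have "bound \<zero> n (%n. c *. p n)" by (simp add: bound_def csmult)
 then show "\<exists>n. bound \<zero> n (%n. c *. p n)" by blast
qed auto

lemma PA_calg: "calg PA"
proof (rule calgI, rule kalgI[OF complex_cring])
 show "ring PA"
  by (rule ring_cong_record[OF UP_ring.UP_ring[OF UPr]]) (simp_all add: poly_alg_def)
next
 fix c p q assume "p .: PA" "q .: PA"
 then have p: "p \<in> up A" "q \<in> up A" by (simp_all add: PA_sel)
 have v: "p i .: A" "q i .: A" for i using p by auto
 show "c *.~PA (p .+~PA q) = c *.~PA p .+~PA c *.~PA q"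
  unfolding PA_sel PA_ops[OF p] PA_ops[OF up_csmult[OF p(1)] up_csmult[OF p(2)]]
  using v by (simp add: csmult)
 have fs: "c *. (\<Oplus>i\<in>{..n}. p i .* q (n - i)) = (\<Oplus>i\<in>{..n}. c *. (p i .* q (n - i)))" for n
  by (rule finsum_smult_ldistr) (use v in auto)
 show "c *.~PA p .*~PA q = c *.~PA (p .*~PA q)"
  unfolding PA_sel PA_ops[OF p] PA_ops[OF up_csmult[OF p(1)] p(2)] fs
  using v by (simp add: csmult)
 show "p .*~PA (c *.~PA q) = c *.~PA (p .*~PA q)"
  unfolding PA_sel PA_ops[OF p] PA_ops[OF p(1) up_csmult[OF p(2)]] fs
  using v by (simp add: csmult)
next
 fix a b p assume "p .: PA"
 then have p: "p \<in> up A" by (simp add: PA_sel)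
 have v: "p i .: A" for i using p by auto
 show "(a .+~complex_alg b) *.~PA p = a *.~PA p .+~PA b *.~PA p"
  unfolding PA_sel PA_ops[OF up_csmult[OF p] up_csmult[OF p]] using v by (simp add: csmult)
 show "a *.~PA p .: PA" "(a .*~complex_alg b) *.~PA p = a *.~PA (b *.~PA p)" "\<one>~complex_alg *.~PA p = p"
  using v up_csmult[OF p] by (simp_all add: PA_sel csmult)
qed

text \<open>Induction on a bound for the degree, splitting off the leading coefficient.\<close>

lemma PA_induct [consumes 1, case_names mnm add]:
 assumes p: "p \<in> up A" and m: "!!a k. a .: A ==> Q (mnm a k)"
  and a: "!!p q. [| p \<in> up A; q \<in> up A; Q p; Q q |] ==> Q (p .+~PA q)"
 shows "Q p"
proof -
 have "Q p" if "p \<in> up A" "!!i. i > N ==> p i = \<zero>" for N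
  using that
 proof (induction N arbitrary: p)
  case 0
  then have p0: "p 0 .: A" by auto
  have "p = mnm (p 0) 0" unfolding mon_eq[OF p0] using 0 by auto
  then show ?case using m[OF p0, of 0] by simp
 next
  case (Suc N)
  have v: "p i .: A" for i using Suc.prems by auto
  define q where "q = (%i. if i = Suc N then \<zero> else p i)"
  have qz: "q i = \<zero>" if "i > N" for i using that Suc.prems(2)[of i] by (cases "i = Suc N") (auto simp: q_def)
  have q: "q \<in> up A"
  proof (rule mem_upI)
   show "q i .: A" for i using v by (simp add: q_def)
   show "\<exists>n. bound \<zero> n q" using qz by (intro exI[of _ N] bound.intro) auto
  qed
  have mm: "mnm (p (Suc N)) (Suc N) \<in> up A" by (rule mon_closed[OF v])
  have "p = (%i. q i .+ mnm (p (Suc N)) (Suc N) i)"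
   unfolding mon_eq[OF v] using v by (auto simp: q_def)
  then have "p = q .+~PA mnm (p (Suc N)) (Suc N)"
   using PA_ops(1)[OF q mm] by simp
  then show ?case using a[OF q mon_closed[OF v] Suc.IH[OF q qz] m[OF v]] by metis
 qed
 moreover obtain n where "bound \<zero> n p" using p by auto
 ultimately show ?thesis using p by (auto simp: bound_def)
qed

end

lemma pow_commute:
 assumes "ring B" "x .: B" "u .: B" "x .*~B u = u .*~B x"
 shows "x .*~B u [^]~B (k::nat) = u [^]~B k .*~B x"
proof -
 interpret ring B by fact
 show ?thesis
  by (induction k) (use assms(2-) in \<open>simp_all add: m_assoc[symmetric]\<close>, simp add: m_assoc)
qed

text \<open>Substituting \<open>u\<close> for the variable respects products because
  \<open>u\<close> commutes with the values of \<open>f\<close>; by bilinearity only monomials have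
  to be compared.\<close>

lemma PA_lift:
 assumes A: "calg A" and B: "calg B" and f: "f \<in> chom A B" and u: "u .: B"
  and comm: "!!a. a .: A ==> f a .*~B u = u .*~B f a"
 shows "\<exists>h\<in>chom (poly_alg A) B. \<forall>a\<in>carrier A. \<forall>k. h (up_ring.monom (UP A) a k) = f a .*~B u [^]~B k"
proof -
 interpret A: calg A by fact
 interpret B: calg B by fact
 interpret P: calg "poly_alg A" by (rule A.PA_calg)
 let ?t = "%p k. f (p k) .*~B u [^]~B (k::nat)"
 note fs = chomD[OF f] chomD_add[OF f A B]
 define h where "h p = finsum B (?t p) {k. p k \<noteq> \<zero>~A}" for p
 have v: "p k .: A" if "p \<in> up A" for p k using that by auto
 have tc: "?t p \<in> S \<rightarrow> carrier B" if "p \<in> up A" for p S using fs(1)[OF v[OF that]] u by auto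
 have h: "h p = finsum B (?t p) {..N}" if "p \<in> up A" "!!i. i > N ==> p i = \<zero>~A" for p N
  unfolding h_def
 proof (rule B.add.finprod_mono_neutral_cong_left)
  show "{k. p k \<noteq> \<zero>~A} \<subseteq> {..N}" using that(2) not_le by auto
  show "?t p \<in> {..N} \<rightarrow> carrier B" using tc[OF that(1)] .
 qed (use u in \<open>simp_all add: fs\<close>)
 have bd: "\<exists>N. \<forall>i>N. p i = \<zero>~A \<and> q i = \<zero>~A" if p: "p \<in> up A" and q: "q \<in> up A" for p q
 proof -
  obtain n where "bound \<zero>~A n p" using A.bound_upD[OF p] by (rule exE)
  moreover obtain m where "bound \<zero>~A m q" using A.bound_upD[OF q] by (rule exE)
  ultimately show ?thesis by (intro exI[of _ "max n m"]) (auto simp: bound_def)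
 qed
 have h_closed: "h p .: B" if "p \<in> up A" for p
  unfolding h_def by (rule B.finsum_closed[OF tc[OF that]])
 have h_add: "h (p .+~(poly_alg A) q) = h p .+~B h q" if p: "p \<in> up A" and q: "q \<in> up A" for p q
 proof -
  obtain N where N: "!!i. i > N ==> p i = \<zero>~A" "!!i. i > N ==> q i = \<zero>~A" using bd[OF p q] by auto
  have "h (p .+~(poly_alg A) q) = finsum B (?t (%i. p i .+~A q i)) {..N}"
   unfolding A.PA_ops[OF p q] by (rule h[OF A.up_add_closed[OF p q]]) (simp add: N)
  also have "\<dots> = finsum B (%k. ?t p k .+~B ?t q k) {..N}"
   by (rule B.finsum_cong') (use v[OF p] v[OF q] u in \<open>simp_all add: fs B.l_distr\<close>)
  also have "\<dots> = h p .+~B h q"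
   using B.finsum_addf[OF tc[OF p] tc[OF q]] h[OF p N(1)] h[OF q N(2)] by simp
  finally show ?thesis .
 qed
 have h_smult: "h (c *.~(poly_alg A) p) = c *.~B h p" if p: "p \<in> up A" for p c
 proof -
  obtain N where N: "!!i. i > N ==> p i = \<zero>~A" using bd[OF p p] by auto
  have "h (c *.~(poly_alg A) p) = finsum B (?t (%i. c *.~A p i)) {..N}"
   unfolding A.PA_sel by (rule h[OF A.up_csmult[OF p]]) (simp add: N A.csmult)
  also have "\<dots> = finsum B (%k. c *.~B ?t p k) {..N}"
   by (rule B.finsum_cong') (use v[OF p] u in \<open>simp_all add: fs B.csmult\<close>)
  also have "\<dots> = c *.~B h p"
   using B.finsum_smult_ldistr[OF _ _ tc[OF p], of "{..N}" c] h[OF p N] by simp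
  finally show ?thesis .
 qed
 have h_mon: "h (A.mnm a k) = f a .*~B u [^]~B k" if a: "a .: A" for a k
 proof (cases "a = \<zero>~A")
  case True
  then have "{i. A.mnm a k i \<noteq> \<zero>~A} = {}" using A.mon_eq[OF a] by auto
  then show ?thesis using True u by (simp add: h_def fs)
 next
  case False
  then have s: "{i. A.mnm a k i \<noteq> \<zero>~A} = {k}" using A.mon_eq[OF a] by auto
  have "finsum B (?t (A.mnm a k)) {k} = ?t (A.mnm a k) k"
   using fs(1)[OF a] u A.mon_eq[OF a] by (subst B.finsum_insert) simp_all
  then show ?thesis unfolding h_def s using A.mon_eq[OF a] by simp
 qed
 have h_mult: "h (p .*~(poly_alg A) q) = h p .*~B h q" if p: "p \<in> up A" and q: "q \<in> up A" for p q
  using p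
 proof (induction rule: A.PA_induct)
  case (mnm a k)
  note a = mnm
  note ma = A.mon_closed[OF a, of k]
  from q show ?case
  proof (induction rule: A.PA_induct)
   case (mnm b l)
   have "h (A.mnm a k .*~(poly_alg A) A.mnm b l) = f a .*~B (f b .*~B u [^]~B k) .*~B u [^]~B l"
    using a mnm u by (simp add: A.mon_mult h_mon fs B.m_assoc B.nat_pow_mult)
   also have "f b .*~B u [^]~B k = u [^]~B k .*~B f b"
    using pow_commute[OF B.ring_axioms fs(1)[OF mnm] u comm[OF mnm]] .
   finally show ?case using a mnm u by (simp add: h_mon fs B.m_assoc)
  next
   case (add q q')
   then have "q .: (poly_alg A)" "q' .: (poly_alg A)" "A.mnm a k .: (poly_alg A)"
    using ma by (simp_all add: A.PA_sel)
   moreover from this have "A.mnm a k .*~(poly_alg A) q \<in> up A" "A.mnm a k .*~(poly_alg A) q' \<in> up A"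
    using P.m_closed by (simp_all add: A.PA_sel(1)[symmetric])
   ultimately show ?case using add ma by (simp add: P.r_distr h_add B.r_distr h_closed)
  qed
 next
  case (add p p')
  then have "p .: (poly_alg A)" "p' .: (poly_alg A)" "q .: (poly_alg A)"
   using q by (simp_all add: A.PA_sel)
  moreover from this have "p .*~(poly_alg A) q \<in> up A" "p' .*~(poly_alg A) q \<in> up A"
   using P.m_closed by (simp_all add: A.PA_sel(1)[symmetric])
  ultimately show ?case using add q by (simp add: P.l_distr h_add B.l_distr h_closed)
 qed
 have "\<one>~(poly_alg A) = A.mnm \<one>~A 0" by (simp add: A.PA_sel A.mon_eq)
 then have "h \<one>~(poly_alg A) = \<one>~B" by (simp add: h_mon fs)
 then have "h \<in> chom (poly_alg A) B"
  by (intro chomI) (simp_all add: A.PA_sel(1) h_closed h_mult h_add h_smult)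
 then show ?thesis using h_mon by (intro bexI[of _ h] ballI allI)
qed

locale localization = calg A for A (structure) + fixes s
 assumes s_closed: "s .: A" and s_central: "!!a. a .: A ==> s .* a = a .* s"
begin

abbreviation "LA \<equiv> localize A s"
abbreviation "\<tau> \<equiv> to_loc A s"

sublocale PA: calg PA by (rule PA_calg)

lemma mon_PA: "a .: A ==> mnm a k .: PA"
 by (simp add: PA_sel mon_closed)

lemma loc_gen_closed: "{mnm s 1 .-~PA \<one>~PA} \<subseteq> carrier PA"
 using mon_PA[OF s_closed] by simp

lemma loc_ideal_ideal: "ideal (loc_ideal A s) PA"
 unfolding loc_ideal_def by (rule PA.genideal_ideal[OF loc_gen_closed])

sublocale LA: calg LA
 unfolding localize_def by (intro calgI PA.quot_alg_kalg loc_ideal_ideal)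

lemma LA_calg: "calg LA" by (rule LA.calg_self)

definition "lproj p = loc_ideal A s +>~PA p"
text \<open>The class of the variable, which the relation makes inverse to \<open>s\<close>.\<close>

definition "ti = lproj (mnm \<one> 1)"

lemma lproj_hom: "lproj \<in> chom PA LA"
 unfolding localize_def lproj_def using PA.quot_proj_hom[OF loc_ideal_ideal] .

lemma to_loc_lproj: "\<tau> a = lproj (mnm a 0)"
 by (simp add: to_loc_def lproj_def)

lemma to_loc_hom: "\<tau> \<in> chom A LA"
proof (rule chomI)
 fix x y c assume x: "x .: A" and y: "y .: A"
 note l = chomD[OF lproj_hom]
 show "\<tau> x .: LA" unfolding to_loc_lproj using l(1) mon_PA[OF x] by blast
 show "\<tau> (x .* y) = \<tau> x .*~LA \<tau> y"
  unfolding to_loc_lproj using l(2)[OF mon_PA[OF x, of 0] mon_PA[OF y, of 0]] mon_mult[OF x y, of 0 0] by simp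
 have "mnm x 0 .+~PA mnm y 0 = mnm (x .+ y) 0"
  unfolding PA_ops[OF mon_closed[OF x] mon_closed[OF y]] using x y by (auto simp: mon_eq)
 then show "\<tau> (x .+ y) = \<tau> x .+~LA \<tau> y"
  unfolding to_loc_lproj using l(3)[OF mon_PA[OF x, of 0] mon_PA[OF y, of 0]] by simp
next
 fix c x assume x: "x .: A"
 have "c *.~PA mnm x 0 = mnm (c *. x) 0" using x by (auto simp: PA_sel mon_eq csmult)
 then show "\<tau> (c *. x) = c *.~LA \<tau> x"
  unfolding to_loc_lproj using chomD(5)[OF lproj_hom mon_PA[OF x, of 0], of c] by simp
next
 have "\<one>~PA = mnm \<one> 0" by (simp add: PA_sel mon_eq)
 then show "\<tau> \<one> = \<one>~LA" unfolding to_loc_lproj using chomD(4)[OF lproj_hom] by simp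
qed

lemma ti_closed: "ti .: LA"
 unfolding ti_def using chomD(1)[OF lproj_hom] mon_PA by simp

lemma ti_commute: "a .: A ==> \<tau> a .*~LA ti = ti .*~LA \<tau> a"
 unfolding to_loc_lproj ti_def
 using chomD(2)[OF lproj_hom mon_PA[of a 0] mon_PA[of \<one> 1]] chomD(2)[OF lproj_hom mon_PA[of \<one> 1] mon_PA[of a 0]]
 by (simp add: mon_mult)

lemma ti_inverse: "\<tau> s .*~LA ti = \<one>~LA" "ti .*~LA \<tau> s = \<one>~LA"
proof -
 have "mnm s 1 .-~PA \<one>~PA \<in> loc_ideal A s"
  unfolding loc_ideal_def using PA.genideal_self[OF loc_gen_closed] by simp
 then have "lproj (mnm s 1 .-~PA \<one>~PA) = \<zero>~LA"
  unfolding localize_def lproj_def using PA.quot_proj_zero_iff[OF loc_ideal_ideal] loc_gen_closed by simp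
 then have e: "lproj (mnm s 1) = \<one>~LA"
  using chomD_add(3)[OF lproj_hom PA_calg LA_calg mon_PA[OF s_closed]] chomD[OF lproj_hom] mon_PA[OF s_closed, of 1] by simp
 show "\<tau> s .*~LA ti = \<one>~LA"
  unfolding to_loc_lproj ti_def
  using chomD(2)[OF lproj_hom mon_PA[of s 0] mon_PA[of \<one> 1]] s_closed e by (simp add: mon_mult)
 then show "ti .*~LA \<tau> s = \<one>~LA" using ti_commute[OF s_closed] by simp
qed

lemma LA_induct [consumes 1, case_names base inverse add mult]:
 assumes x: "x .: LA" and b: "!!a. a .: A ==> Q (\<tau> a)" and i: "Q ti"
  and add: "!!x y. [| x .: LA; y .: LA; Q x; Q y |] ==> Q (x .+~LA y)"
  and mult: "!!x y. [| x .: LA; y .: LA; Q x; Q y |] ==> Q (x .*~LA y)"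
 shows "Q x"
proof -
 from x obtain p where p: "p \<in> up A" "x = lproj p"
  by (auto simp: localize_def PA.quot_alg_sel lproj_def PA_sel)
 note l = chomD[OF lproj_hom]
 have m: "Q (lproj (mnm a k))" if a: "a .: A" for a k
 proof (induction k)
  case 0
  then show ?case using b[OF a] by (simp add: to_loc_lproj)
 next
  case (Suc k)
  have "lproj (mnm a (Suc k)) = lproj (mnm a k) .*~LA ti"
   unfolding ti_def using l(2)[OF mon_PA[OF a, of k] mon_PA[of \<one> 1]] a by (simp add: mon_mult flip: Suc_eq_plus1)
  then show ?case using mult[OF l(1)[OF mon_PA[OF a]] ti_closed Suc i] by simp
 qed
 from p(1) have "Q (lproj p)"
 proof (induction rule: PA_induct)
  case (mnm a k)
  then show ?case by (rule m)
 next
  case (add p q)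
  then show ?case using assms(4)[of "lproj p" "lproj q"] l by (simp add: PA_sel)
 qed
 then show ?thesis using p by simp
qed

lemma LA_hom_eq:
 assumes B: "calg B" and h: "h \<in> chom LA B" "h' \<in> chom LA B"
  and eq: "!!a. a .: A ==> h (\<tau> a) = h' (\<tau> a)" and x: "x .: LA"
 shows "h x = h' x"
proof -
 interpret B: calg B by fact
 note hs = chomD[OF h(1)] chomD[OF h(2)]
 have c: "\<tau> s .: LA" using chomD(1)[OF to_loc_hom s_closed] .
 have "h ti .*~B h (\<tau> s) = \<one>~B" "h' (\<tau> s) .*~B h' ti = \<one>~B"
  using hs(2)[OF ti_closed c] hs(7)[OF c ti_closed] by (simp_all add: ti_inverse hs)
 then have "h ti = h' ti"
  using B.inv_unique[of "h ti" "h (\<tau> s)" "h' ti"] eq[OF s_closed] hs(1)[OF ti_closed] hs(6)[OF ti_closed] hs(1)[OF c] by simp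
 with x show ?thesis by (induction rule: LA_induct) (simp_all add: hs eq)
qed

text \<open>As \<open>s\<close> is central, \<open>f s\<close> commutes with the values of
  \<open>f\<close>, and therefore so does its inverse \<open>u\<close>. This permits the
  substitution of \<open>u\<close> in \<open>PA_lift\<close>, under which the defining relation of
  the localization vanishes.\<close>

lemma LA_lift:
 assumes B: "calg B" and f: "f \<in> chom A B" and u: "u .: B" "f s .*~B u = \<one>~B" "u .*~B f s = \<one>~B"
 shows "\<exists>h\<in>chom LA B. \<forall>a\<in>carrier A. h (\<tau> a) = f a"
proof -
 interpret B: calg B by fact
 note fs = chomD[OF f]
 have comm: "f a .*~B u = u .*~B f a" if a: "a .: A" for a
  using B.comm_inverse[OF fs(1)[OF s_closed] u(1) fs(1)[OF a] u(2,3)] s_central[OF a]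
   fs(2)[OF s_closed a] fs(2)[OF a s_closed] by simp
 obtain g where g: "g \<in> chom PA B" "\<forall>a\<in>carrier A. \<forall>k. g (mnm a k) = f a .*~B u [^]~B k"
  using PA_lift[OF calg_self B f u(1) comm] by (rule bexE)
 have "\<exists>h\<in>chom LA B. \<forall>x\<in>carrier PA. h (lproj x) = g x"
  unfolding localize_def loc_ideal_def lproj_def
 proof (rule PA.quot_gen_lift[OF B.ring_axioms g(1) loc_gen_closed])
  fix x assume "x \<in> {mnm s 1 .-~PA \<one>~PA}"
  then show "g x = \<zero>~B"
   using g(2) s_closed u chomD_add(3)[OF g(1) PA_calg B mon_PA[OF s_closed]] chomD(4)[OF g(1)] by (simp add: fs)
 qed
 then obtain h where h: "h \<in> chom LA B" "\<forall>x\<in>carrier PA. h (lproj x) = g x" by (rule bexE)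
 have "h (\<tau> a) = f a" if a: "a .: A" for a
  unfolding to_loc_lproj using bspec[OF h(2) mon_PA[OF a, of 0]] g(2) a fs(1)[OF a] by simp
 then show ?thesis using h(1) by (intro bexI[of _ h] ballI)
qed

lemma loc_lift_spec:
 assumes B: "calg B" and f: "f \<in> chom A B" and u: "u .: B" "f s .*~B u = \<one>~B" "u .*~B f s = \<one>~B"
 shows loc_lift_hom: "loc_lift A s B f \<in> chom LA B"
  and loc_lift_to_loc: "a .: A ==> loc_lift A s B f (\<tau> a) = f a"
proof -
 interpret B: calg B by fact
 obtain h where h: "h \<in> chom LA B" "\<forall>a\<in>carrier A. h (\<tau> a) = f a"
  using LA_lift[OF B f u] by (rule bexE)
 let ?Q = "%h. h \<in> alg_hom LA B \<and> (\<forall>a\<in>carrier A. h (\<tau> a) = f a)"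
 have Q: "?Q (restrict h (carrier LA))"
  using chom_restrict[OF h(1) LA_calg] h(2) chomD(1)[OF to_loc_hom] by auto
 have uniq: "h1 = restrict h (carrier LA)" if "?Q h1" for h1
 proof (rule extensionalityI)
  show "h1 \<in> extensional (carrier LA)" using that by (auto simp: alg_hom_iff)
  show "h1 x = restrict h (carrier LA) x" if "x .: LA" for x
   using LA_hom_eq[OF B _ _ _ that, of h1 "restrict h (carrier LA)"] \<open>?Q h1\<close> Q by (simp add: alg_hom_iff)
 qed simp
 have "?Q (loc_lift A s B f)"
  unfolding loc_lift_def by (rule theI[of ?Q, OF Q uniq])
 then show "loc_lift A s B f \<in> chom LA B" "a .: A ==> loc_lift A s B f (\<tau> a) = f a"
  by (auto simp: alg_hom_iff)
qed

end

section \<open>Calculus with a commuting pair of triples\<close>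

text \<open>
  The polynomial identities behind the braiding hold in every ring that contains two commuting
  triples. They are verified in the type-class ring \<open>gring\<close>, which is the product of all rings (over
  the elements of a given type) with such a pair; projection to a factor transfers them to that ring.
  The indices \<open>0, \<dots>, 3\<close> and \<open>4, \<dots>, 7\<close> stand for \<open>E, G, K, K\<^sup>-\<^sup>1\<close> of the two triples, and \<open>8\<close> for the
  inverse of \<open>(K\<^sub>2 - G\<^sub>1E\<^sub>2)\<^sup>2 = K\<^sub>2\<^sup>2 + G\<^sub>1\<^sup>2E\<^sub>2\<^sup>2\<close>.
\<close>

definition pair_rel :: "'a ring => (nat => 'a) => bool" where
 "pair_rel R v \<longleftrightarrow> ring R \<and> utriple R (v 0) (v 1) (v 2) (v 3) \<and> utriple R (v 4) (v 5) (v 6) (v 7) \<and>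
   (\<forall>i<4. \<forall>j\<in>{4..<8}. v j .*~R v i = v i .*~R v j) \<and> v 8 .: R \<and>
   v 8 .*~R (v 6 .*~R v 6 .+~R v 1 .*~R (v 1 .*~R (v 4 .*~R v 4))) = \<one>~R \<and>
   (v 6 .*~R v 6 .+~R v 1 .*~R (v 1 .*~R (v 4 .*~R v 4))) .*~R v 8 = \<one>~R"

text \<open>The product is encoded as a subtype of a function space. Fixing the values outside
  \<open>pair_rel\<close> makes equality the same as equality in every factor, as
  \<open>gring_eqI\<close> needs.\<close>

typedef 'a gring = "{f :: 'a ring \<times> (nat => 'a) => 'a.
  \<forall>R v. if pair_rel R v then f (R, v) .: R else f (R, v) = undefined}"
proof -
 have "\<zero>~R .: R" if "pair_rel R v" for R :: "'a ring" and v
  using that by (auto simp: pair_rel_def intro: ring.ring_simprules)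
 then show ?thesis
  by (intro exI[of _ "%(R, v). if pair_rel R v then \<zero>~R else undefined"]) auto
qed

definition ev :: "'a ring => (nat => 'a) => 'a gring => 'a" where
 "ev R v x = Rep_gring x (R, v)"

definition mk_gring :: "('a ring => (nat => 'a) => 'a) => 'a gring" where
 "mk_gring f = Abs_gring (%(R, v). if pair_rel R v then f R v else undefined)"

lemma ev_mk: "(!!R v. pair_rel R v ==> f R v .: R) ==> pair_rel R v ==> ev R v (mk_gring f) = f R v"
 unfolding ev_def mk_gring_def by (subst Abs_gring_inverse) auto

lemma gring_eqI:
 fixes x y :: "'a gring"
 assumes "!!R v. pair_rel R v ==> ev R v x = ev R v y"
 shows "x = y"
proof (rule Rep_gring_inject[THEN iffD1], rule ext)
 fix p :: "'a ring \<times> (nat => 'a)"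
 obtain R v where p: "p = (R, v)" by (cases p)
 show "Rep_gring x p = Rep_gring y p"
 proof (cases "pair_rel R v")
  case True
  then show ?thesis using assms[OF True] by (simp add: ev_def p)
 next
  case False
  then show ?thesis using Rep_gring[of x] Rep_gring[of y] by (simp add: p)
 qed
qed

lemma ev_closed: "pair_rel R v ==> ev R v x .: R"
 using Rep_gring[of x] by (auto simp: ev_def)

lemma pair_rel_ring: "pair_rel R v ==> ring R" by (simp add: pair_rel_def)

instantiation gring :: (type) "{ring, monoid_mult}"
begin

definition "0 = mk_gring (%R v. \<zero>~R)"
definition "1 = mk_gring (%R v. \<one>~R)"
definition "x + y = mk_gring (%R v. ev R v x .+~R ev R v y)"
definition "x * y = mk_gring (%R v. ev R v x .*~R ev R v y)"
definition "- x = mk_gring (%R v. .-~R ev R v x)"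
definition "x - y = mk_gring (%R v. ev R v x .-~R ev R v y)"

lemma ev_ops [simp]:
 assumes p: "pair_rel R v"
 shows "ev R v 0 = \<zero>~R" "ev R v 1 = \<one>~R" "ev R v (x + y) = ev R v x .+~R ev R v y"
  "ev R v (x * y) = ev R v x .*~R ev R v y" "ev R v (- x) = .-~R ev R v x" "ev R v (x - y) = ev R v x .-~R ev R v y"
proof -
 note c = ev_closed ring.ring_simprules[OF pair_rel_ring]
 show "ev R v 0 = \<zero>~R" unfolding zero_gring_def by (rule ev_mk[OF _ p]) (simp add: c)
 show "ev R v 1 = \<one>~R" unfolding one_gring_def by (rule ev_mk[OF _ p]) (simp add: c)
 show "ev R v (x + y) = ev R v x .+~R ev R v y" unfolding plus_gring_def by (rule ev_mk[OF _ p]) (simp add: c)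
 show "ev R v (x * y) = ev R v x .*~R ev R v y" unfolding times_gring_def by (rule ev_mk[OF _ p]) (simp add: c)
 show "ev R v (- x) = .-~R ev R v x" unfolding uminus_gring_def by (rule ev_mk[OF _ p]) (simp add: c)
 show "ev R v (x - y) = ev R v x .-~R ev R v y" unfolding minus_gring_def
  by (rule ev_mk[OF _ p]) (intro abelian_group.minus_closed ring.is_abelian_group pair_rel_ring ev_closed)
qed

instance
proof
 fix a b c :: "'a gring"
 show "a + b + c = a + (b + c)"
  by (rule gring_eqI) (simp add: ev_closed ring.ring_simprules(7)[OF pair_rel_ring])
 show "a + b = b + a"
  by (rule gring_eqI) (simp add: ev_closed ring.ring_simprules(10)[OF pair_rel_ring])
 show "0 + a = a"
  by (rule gring_eqI) (simp add: ev_closed ring.ring_simprules(8)[OF pair_rel_ring])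
 show "- a + a = 0"
  by (rule gring_eqI) (simp add: ev_closed ring.ring_simprules(9)[OF pair_rel_ring])
 show "a - b = a + - b"
  by (rule gring_eqI) (simp add: ev_closed a_minus_def)
 show "a * b * c = a * (b * c)"
  by (rule gring_eqI) (simp add: ev_closed ring.ring_simprules(11)[OF pair_rel_ring])
 show "1 * a = a"
  by (rule gring_eqI) (simp add: ev_closed ring.ring_simprules(12)[OF pair_rel_ring])
 show "a * 1 = a"
 proof (rule gring_eqI)
  fix R v assume p: "pair_rel R (v :: nat => 'a)"
  interpret ring R by (rule pair_rel_ring[OF p])
  show "ev R v (a * 1) = ev R v a" using p ev_closed[OF p] by simp
 qed
 show "(a + b) * c = a * c + b * c"
  by (rule gring_eqI) (simp add: ev_closed ring.ring_simprules(13)[OF pair_rel_ring])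
 show "a * (b + c) = a * b + a * c"
 proof (rule gring_eqI)
  fix R v assume p: "pair_rel R (v :: nat => 'a)"
  interpret ring R by (rule pair_rel_ring[OF p])
  show "ev R v (a * (b + c)) = ev R v (a * b + a * c)" using p ev_closed[OF p] by (simp add: r_distr)
 qed
qed

end

definition gen :: "nat => 'a gring" where
 "gen i = mk_gring (%R v. v i)"

lemma pair_rel_closed: "pair_rel R v ==> i < 9 ==> v i .: R"
proof -
 assume p: "pair_rel R v" and "i < 9"
 then have "i = 0 \<or> i = 1 \<or> i = 2 \<or> i = 3 \<or> i = 4 \<or> i = 5 \<or> i = 6 \<or> i = 7 \<or> i = 8" by auto
 then show ?thesis using p by (auto simp: pair_rel_def utriple_def)
qed

lemma ev_gen: "i < 9 ==> pair_rel R v ==> ev R v (gen i) = v i"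
 unfolding gen_def by (rule ev_mk) (auto intro: pair_rel_closed)

abbreviation "E1 \<equiv> gen 0"
abbreviation "G1 \<equiv> gen 1"
abbreviation "K1 \<equiv> gen 2"
abbreviation "L1 \<equiv> gen 3"
abbreviation "E2 \<equiv> gen 4"
abbreviation "G2 \<equiv> gen 5"
abbreviation "K2 \<equiv> gen 6"
abbreviation "L2 \<equiv> gen 7"
abbreviation "C \<equiv> gen 8"

lemma gring_triple_K:
 "K1 * L1 = 1" "L1 * K1 = 1" "K1 * E1 = - (E1 * K1)" "K1 * G1 = - (G1 * K1)"
 "K2 * L2 = 1" "L2 * K2 = 1" "K2 * E2 = - (E2 * K2)" "K2 * G2 = - (G2 * K2)"
 by (rule gring_eqI, simp add: ev_gen, simp add: pair_rel_def utriple_def)+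

lemma gring_triple_EG:
 "E1 * G1 + G1 * E1 = K1 * K1 - 1 + (K1 * K1 - 1)" "E2 * G2 + G2 * E2 = K2 * K2 - 1 + (K2 * K2 - 1)"
 by (rule gring_eqI, simp add: ev_gen, simp add: pair_rel_def utriple_def)+

lemma inverse_anticommute:
 assumes "k * l = (1 :: 'a :: {ring, monoid_mult})" "l * k = 1" "k * x = - (x * k)" shows "l * x = - (x * l)"
proof -
 have "l * x = l * (x * k) * l" using assms(1) by (simp add: mult.assoc)
 also have "x * k = - (k * x)" using assms(3) by simp
 also have "l * - (k * x) * l = - ((l * k) * (x * l))" by (simp add: mult.assoc)
 finally show ?thesis using assms(2) by simp
qed

lemma gring_triple_L:
 "L1 * E1 = - (E1 * L1)" "L1 * G1 = - (G1 * L1)" "L2 * E2 = - (E2 * L2)" "L2 * G2 = - (G2 * L2)"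
 by (rule inverse_anticommute[OF gring_triple_K(1,2,3)] inverse_anticommute[OF gring_triple_K(1,2,4)]
   inverse_anticommute[OF gring_triple_K(5,6,7)] inverse_anticommute[OF gring_triple_K(5,6,8)])+

lemma gring_triple_GE:
 "G1 * E1 = K1 * K1 - 1 + (K1 * K1 - 1) - E1 * G1" "G2 * E2 = K2 * K2 - 1 + (K2 * K2 - 1) - E2 * G2"
 by (simp_all add: gring_triple_EG[symmetric])

lemmas gring_triple = gring_triple_K gring_triple_L gring_triple_GE

lemma gring_cross: "i < 4 ==> j \<in> {4..<8} ==> gen j * gen i = gen i * gen j"
 by (rule gring_eqI) (simp add: ev_gen, simp add: pair_rel_def)

lemma assoc_rule: "a * b = t ==> a * (b * x) = t * (x :: 'a :: monoid_mult)"
 by (simp add: mult.assoc[symmetric])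

lemmas gring_cross_rules =
 gring_cross[of 0 4, simplified] gring_cross[of 0 5, simplified] gring_cross[of 0 6, simplified] gring_cross[of 0 7, simplified]
 gring_cross[of 1 4, simplified] gring_cross[of 1 5, simplified] gring_cross[of 1 6, simplified] gring_cross[of 1 7, simplified]
 gring_cross[of 2 4, simplified] gring_cross[of 2 5, simplified] gring_cross[of 2 6, simplified] gring_cross[of 2 7, simplified]
 gring_cross[of 3 4, simplified] gring_cross[of 3 5, simplified] gring_cross[of 3 6, simplified] gring_cross[of 3 7, simplified]

text \<open>A rewrite system that sorts words: letters of the first triple come before those of the
  second, and within a triple E comes before G, and G before K or L. The variants obtained from
  \<open>assoc_rule\<close> act inside products bracketed to the right. After sorting, the
  identities below are additive bookkeeping.\<close>

lemmas gring_nf = gring_triple gring_triple[THEN assoc_rule] gring_cross_rules gring_cross_rules[THEN assoc_rule]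

section \<open>Polynomial identities behind the braiding\<close>

definition "gOm1 = K1 - L1 * (1 + E1 * G1)"
definition "gOm2 = K2 - L2 * (1 + E2 * G2)"
text \<open>\<open>gD\<close>, \<open>gP\<close> and \<open>gX\<close> are the images of K, E and
  iKF of the first factor under the braiding. \<open>gW\<close>, \<open>G1\<close> and
  \<open>gT\<close> are the images of E, iKF and K of the second factor after multiplication by
  \<open>gD\<close> from the left, which clears their denominator.\<close>

definition "gD = K2 - G1 * E2"
definition "gD2 = K2 * K2 + G1 * (G1 * (E2 * E2))"
definition "gP = K1 * E2"
text \<open>Solved from compatibility with the coproduct: \<open>P18\<close> determines
  \<open>gX * gT\<close>, and \<open>gT\<close> is invertible. In the same way \<open>gW\<close> is
  read off from \<open>P17\<close>.\<close>

definition "gX = L1 * (G2 + G1 * G1 * E2 + G1 * gOm2)"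
definition "gW = K2 * K2 * E1 - E2 * E2 * G1 - K1 * gOm1 * E2 * K2"
definition "gT = K1 * K2"

lemmas g_defs = gOm1_def gOm2_def gD_def gD2_def gP_def gX_def gW_def gT_def

lemma gOm_central:
 "gOm1 * E1 = E1 * gOm1" "gOm1 * G1 = G1 * gOm1" "gOm1 * K1 = K1 * gOm1"
 "G1 * E1 = E1 * G1 + (K1 * gOm1 + K1 * gOm1)" "K1 * gOm1 = K1 * K1 - 1 - E1 * G1"
 by (simp_all add: g_defs gring_nf algebra_simps)

lemma gOm_sq: "K1 * K1 * (gOm1 * gOm1) = (K1 * K1 - 1) * (K1 * K1 - 1) - E1 * E1 * (G1 * G1)"
 by (simp add: g_defs gring_nf algebra_simps)

text \<open>\<open>P1\<close> to \<open>P4\<close> make \<open>gP\<close>, \<open>gX\<close>,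
  \<open>gD\<close> a triple once \<open>gD\<close> is inverted. \<open>P5\<close> to
  \<open>P7\<close> say that dividing \<open>gW\<close>, \<open>G1\<close> and \<open>gT\<close> by
  \<open>gD\<close> gives the same on either side.\<close>

lemma g_poly:
 shows P1: "gD * gD = gD2" and P2: "gD * gP = - (gP * gD)" and P3: "gD * gX = - (gX * gD)"
  and P4: "gP * gX + gX * gP = gD2 - 1 + (gD2 - 1)"
  and P5: "gD * gW = gW * gD" and P6: "gD * G1 = G1 * gD" and P7: "gD * gT = gT * gD"
  by (simp_all add: g_defs gring_nf algebra_simps)

text \<open>\<open>gD\<close> itself anticommutes with \<open>gP\<close> and \<open>gX\<close>. The
  signs in \<open>P8\<close> to \<open>P13\<close> are therefore cancelled by division by
  \<open>gD\<close>, and the two new triples commute. \<open>P14\<close> to \<open>P16\<close> are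
  the relations of the second triple with the denominator cleared.\<close>

lemma g_poly2:
 shows P8: "gW * gP = - (gP * gW)" and P9: "gW * gX = - (gX * gW)"
  and P10: "G1 * gP = - (gP * G1)" and P11: "G1 * gX = - (gX * G1)"
  and P12: "gT * gP = - (gP * gT)" and P13: "gT * gX = - (gX * gT)"
  and P14: "gT * gW = - (gW * gT)" and P15: "gT * G1 = - (G1 * gT)"
  and P16: "gW * G1 + G1 * gW = (gT * gT - gD2) + (gT * gT - gD2)"
  by (simp_all add: g_defs gring_nf algebra_simps)

text \<open>\<open>P17\<close> and \<open>P18\<close> express compatibility with the coproduct,
  \<open>P21\<close> and \<open>P22\<close> the exchange of the two \<Omega>. \<open>P19\<close> and
  \<open>P20\<close> will determine the two images of the \<alpha> that are not again of the form
  \<alpha>.\<close>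

lemma g_poly3:
 shows P17: "gD * (E2 + E1 * K2) = gW - gP * gT"
  and P18: "gD * (G2 + G1 * K2) = G1 - gX * gT"
  and P19: "K1 * K1 * gX * gOm1 = K1 * K1 * G1 * gOm2 - (G1 * gOm2 - K1 * G2 * gOm1) - G1 * G1 * (E1 * gOm2 - K1 * E2 * gOm1)"
  and P20: "gW * gOm2 = K1 * E2 * gOm1 + K2 * K2 * (E1 * gOm2 - K1 * E2 * gOm1) - E2 * E2 * (G1 * gOm2 - K1 * G2 * gOm1)"
  and P21: "gD * gOm2 = gD2 - 1 - gP * gX"
  and P22: "gD * gT * gOm1 = gT * gT - gD2 - gW * G1"
  by (simp_all add: g_defs gring_nf algebra_simps)

lemma gring_C0: "C * gD2 = 1" "gD2 * C = 1"
 by (rule gring_eqI, simp add: gD2_def ev_gen, simp add: pair_rel_def)+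

text \<open>Only squares of generators occur in \<open>gD2\<close>, and every generator commutes
  with these.\<close>

lemma gD2_central:
 "x \<in> {E1, G1, K1, L1, E2, G2, K2, L2} ==> gD2 * x = x * gD2"
 by (elim insertE emptyE; hypsubst) (simp_all add: g_defs gring_nf algebra_simps)

lemma inverse_commute:
 assumes "k * l = (1 :: 'a :: {ring, monoid_mult})" "l * k = 1" "k * x = x * k" shows "l * x = x * l"
proof -
 have "l * x = l * (x * k) * l" using assms(1) by (simp add: mult.assoc)
 also have "\<dots> = (l * k) * (x * l)" unfolding assms(3)[symmetric] by (simp add: mult.assoc)
 finally show ?thesis using assms(2) by simp
qed

lemma C_central0: "x \<in> {E1, G1, K1, L1, E2, G2, K2, L2} ==> x * C = C * x"
 using inverse_commute[OF gring_C0(2) gring_C0(1) gD2_central] by (rule sym)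

lemma C_central:
 "E1 * C = C * E1" "G1 * C = C * G1" "K1 * C = C * K1" "L1 * C = C * L1"
 "E2 * C = C * E2" "G2 * C = C * G2" "K2 * C = C * K2" "L2 * C = C * L2"
 by (rule C_central0; simp)+

lemma C_central2: "gD * C = C * gD" "gP * C = C * gP" "gX * C = C * gX" "gW * C = C * gW" "gT * C = C * gT" "gD2 * C = C * gD2"
 by (simp_all add: g_defs C_central C_central[THEN assoc_rule] mult.assoc distrib_left distrib_right left_diff_distrib right_diff_distrib)

text \<open>\<open>C\<close> is a central inverse of the square of \<open>gD\<close>, so
  \<open>C * gD\<close> inverts \<open>gD\<close>. Accordingly \<open>gY\<close>, \<open>gQ\<close>
  and \<open>gS\<close> are the quotients of \<open>gW\<close>, \<open>G1\<close> and
  \<open>gT\<close> by \<open>gD\<close>.\<close>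

definition "gDi = C * gD"
definition "gY = C * (gD * gW)"
definition "gQ = C * (gD * G1)"
definition "gS = C * (gD * gT)"
definition "gSi = L1 * (L2 * gD)"

lemmas gC_rules = C_central(2) C_central2 C_central(2)[THEN assoc_rule] C_central2[THEN assoc_rule]
 gring_C0 gring_C0[THEN assoc_rule]

lemma gP_swap: "gP * gD = - (gD * gP)" "gX * gD = - (gD * gX)" "gW * gD = gD * gW" "G1 * gD = gD * G1" "gT * gD = gD * gT"
 by (simp_all add: P2 P3 P5 P6 P7)

lemmas gnf2 = gP_swap gP_swap[THEN assoc_rule] P1 P1[THEN assoc_rule]
 P8 P9 P10 P11 P12 P13 P14 P15
 P8[THEN assoc_rule] P9[THEN assoc_rule] P10[THEN assoc_rule] P11[THEN assoc_rule] P12[THEN assoc_rule] P13[THEN assoc_rule] P14[THEN assoc_rule] P15[THEN assoc_rule]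

lemma C_cancel: "C * (C * gD2) = C" "C * (C * (gD2 * x)) = C * x" "C * (gD2 * x) = x"
 by (simp_all add: gring_C0 gring_C0[THEN assoc_rule])

lemma new_triple1:
 "gD * gDi = 1" "gDi * gD = 1" "gD * gP = - (gP * gD)" "gD * gX = - (gX * gD)"
 "gP * gX + gX * gP = gD * gD - 1 + (gD * gD - 1)"
 using P4 by (simp_all add: gDi_def gC_rules gnf2 mult.assoc)

lemma gTL: "gT * (L1 * (L2 * x)) = x" "L1 * (L2 * (gT * x)) = x" "L1 * (L2 * gT) = 1"
 by (simp_all add: gT_def gring_nf mult.assoc)

lemma L_C: "L1 * (C * x) = C * (L1 * x)" "L2 * (C * x) = C * (L2 * x)"
 using C_central(4,8)[THEN assoc_rule, of x] by (simp_all add: mult.assoc)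

lemma new_triple2:
 "gS * gSi = 1" "gSi * gS = 1" "gS * gY = - (gY * gS)" "gS * gQ = - (gQ * gS)"
 "gY * gQ + gQ * gY = gS * gS - 1 + (gS * gS - 1)"
proof -
 show "gS * gSi = 1" by (simp add: gS_def gSi_def gTL mult.assoc P1 gring_C0)
 show "gSi * gS = 1" by (simp add: gS_def gSi_def mult.assoc gC_rules P1[THEN assoc_rule] L_C C_cancel gTL)
 show "gS * gY = - (gY * gS)" "gS * gQ = - (gQ * gS)"
  by (simp_all add: gS_def gY_def gQ_def mult.assoc gC_rules gnf2)
 have "gY * gQ + gQ * gY = C * (C * (gD2 * (gW * G1 + G1 * gW)))"
  by (simp add: gY_def gQ_def mult.assoc gC_rules gnf2 distrib_left)
 also have "\<dots> = C * (gT * gT - gD2) + C * (gT * gT - gD2)"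
  unfolding P16 C_cancel by (simp add: distrib_left)
 also have "C * (gT * gT - gD2) = gS * gS - 1"
  by (simp add: right_diff_distrib gring_C0 gS_def mult.assoc gC_rules gnf2 C_cancel)
 finally show "gY * gQ + gQ * gY = gS * gS - 1 + (gS * gS - 1)" .
qed

lemma new_cross0:
 assumes "x \<in> {gP, gX, gD}" "y \<in> {gY, gQ, gS}" shows "y * x = x * y"
 using assms
 by (elim insertE emptyE; hypsubst) (simp_all add: gS_def gY_def gQ_def mult.assoc gC_rules gnf2)

lemma new_cross:
 assumes x: "x \<in> {gP, gX, gD, gDi}" and y: "y \<in> {gY, gQ, gS, gSi}" shows "y * x = x * y"
proof -
 have 1: "y * x = x * y" if "x \<in> {gP, gX, gD}" "y \<in> {gY, gQ, gS, gSi}" for x y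
 proof (cases "y = gSi")
  case True
  then show ?thesis using inverse_commute[OF new_triple2(1,2), of x] new_cross0[OF that(1), of gS] by simp
 next
  case False
  then show ?thesis using new_cross0[OF that(1), of y] that(2) by blast
 qed
 show ?thesis
 proof (cases "x = gDi")
  case True
  then show ?thesis using inverse_commute[OF new_triple1(1,2), of y] 1[of gD y] y by simp
 next
  case False
  then show ?thesis using 1[OF _ y] x by blast
 qed
qed

lemma new_coproduct: "gY + gP * gS = E2 + E1 * K2" "gQ + gX * gS = G2 + G1 * K2" "gD * gS = K1 * K2"
proof -
 have "gY + gP * gS = C * (gD * (gW - gP * gT))"
  by (simp add: gY_def gS_def mult.assoc gC_rules gnf2 right_diff_distrib)
 then show "gY + gP * gS = E2 + E1 * K2"
  unfolding P17[symmetric] by (simp only: P1[THEN assoc_rule] C_cancel)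
 have "gQ + gX * gS = C * (gD * (G1 - gX * gT))"
  by (simp add: gQ_def gS_def mult.assoc gC_rules gnf2 right_diff_distrib)
 then show "gQ + gX * gS = G2 + G1 * K2"
  unfolding P18[symmetric] by (simp only: P1[THEN assoc_rule] C_cancel)
 show "gD * gS = K1 * K2"
  by (simp add: gS_def mult.assoc gC_rules P1[THEN assoc_rule] C_cancel) (simp add: gT_def)
qed

text \<open>With denominators cleared these are \<open>P21\<close> and \<open>P22\<close>: the
  braiding exchanges the two copies of \<Omega>.\<close>

lemma new_Omega: "gD - gDi * (1 + gP * gX) = gOm2" "gS - gSi * (1 + gY * gQ) = gOm1"
proof -
 have "gD - gDi * (1 + gP * gX) = gDi * (gD * gD - 1 - gP * gX)"
  by (simp add: right_diff_distrib distrib_left new_triple1(2)[THEN assoc_rule])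
 also have "gD * gD - 1 - gP * gX = gD * gOm2" by (simp add: P1 P21)
 finally show "gD - gDi * (1 + gP * gX) = gOm2" by (simp add: new_triple1(2)[THEN assoc_rule])
 have "gS * gS - 1 - gY * gQ = C * (gT * gT - gD2 - gW * G1)"
  by (simp add: gS_def gY_def gQ_def right_diff_distrib gring_C0 mult.assoc gC_rules gnf2 C_cancel)
 also have "\<dots> = gS * gOm1"
  unfolding gS_def P22[symmetric] by (simp add: mult.assoc)
 finally have e: "gS * gS - 1 - gY * gQ = gS * gOm1" .
 have "gS - gSi * (1 + gY * gQ) = gSi * (gS * gS - 1 - gY * gQ)"
  by (simp add: right_diff_distrib distrib_left new_triple2(2)[THEN assoc_rule])
 then show "gS - gSi * (1 + gY * gQ) = gOm1" unfolding e by (simp add: new_triple2(2)[THEN assoc_rule])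
qed

lemma new_alpha: "gD * gY = gW" "gD * gQ = G1" "gSi * gQ = L1 * (G1 * L2)"
proof -
 show "gD * gY = gW" and q: "gD * gQ = G1"
  by (simp_all add: gY_def gQ_def mult.assoc gC_rules P1[THEN assoc_rule] C_cancel)
 have "gSi * gQ = L1 * (L2 * G1)" by (simp add: gSi_def mult.assoc q)
 then show "gSi * gQ = L1 * (G1 * L2)" by (simp add: gring_cross_rules)
qed

text \<open>\<open>gring\<close> ranges over plain ring records, so the further fields of an algebra
  are dropped before \<open>ev\<close> is applied.\<close>

definition rg :: "('a, 'm) ring_scheme => 'a ring" where
 "rg B = \<lparr>carrier = carrier B, mult = mult B, one = one B, zero = zero B, add = add B\<rparr>"

lemma rg_simps [simp]:
 "carrier (rg B) = carrier B" "x .*~(rg B) y = x .*~B y" "\<one>~(rg B) = \<one>~B" "\<zero>~(rg B) = \<zero>~B"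
 "x .+~(rg B) y = x .+~B y" ".-~(rg B) x = .-~B x" "x .-~(rg B) y = x .-~B y"
 by (simp_all add: rg_def a_minus_def a_inv_def m_inv_def)

lemma rg_ring: "ring B ==> ring (rg B)"
 by (rule ring_cong_record) (simp_all add: rg_def)

lemma rg_utriple [simp]: "utriple (rg B) = utriple B"
 by (intro ext) (simp add: utriple_def)

definition pair_val :: "(qelt => 'b) => (qelt => 'b) => 'b => nat => 'b" where
 "pair_val f1 f2 c i = (if i = 0 then f1 qE else if i = 1 then f1 qFt else if i = 2 then f1 qK else if i = 3 then f1 qKinv
   else if i = 4 then f2 qE else if i = 5 then f2 qFt else if i = 6 then f2 qK else if i = 7 then f2 qKinv else c)"

lemma pair_val_simps [simp]:
 "pair_val f1 f2 c 0 = f1 qE" "pair_val f1 f2 c 1 = f1 qFt" "pair_val f1 f2 c 2 = f1 qK" "pair_val f1 f2 c 3 = f1 qKinv"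
 "pair_val f1 f2 c 4 = f2 qE" "pair_val f1 f2 c 5 = f2 qFt" "pair_val f1 f2 c 6 = f2 qK" "pair_val f1 f2 c 7 = f2 qKinv"
 "pair_val f1 f2 c 8 = c"
 by (simp_all add: pair_val_def)

lemma UQ_induct_triple [consumes 1, case_names E Ft K Kinv one add smult mult]:
 assumes u: "u .: UQ"
  and gens: "P qE" "P qFt" "P qK" "P qKinv" and one: "P \<one>~UQ"
  and add: "!!x y. [| x .: UQ; y .: UQ; P x; P y |] ==> P (x .+~UQ y)"
  and smult: "!!c x. [| x .: UQ; P x |] ==> P (c *.~UQ x)"
  and mult: "!!x y. [| x .: UQ; y .: UQ; P x; P y |] ==> P (x .*~UQ y)"
 shows "P u"
 using u
proof (induction rule: UQ_induct)
 case (gen x)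
 have "P qF" unfolding qF_eq by (intro smult mult gens) simp_all
 then show ?case using gens by (cases x) simp_all
qed (use assms in simp_all)

lemma UQ_homs_commute_elt:
 assumes B: "calg B" and f: "f \<in> chom UQ B" and y: "y .: B"
  and c: "f qE .*~B y = y .*~B f qE" "f qFt .*~B y = y .*~B f qFt" "f qK .*~B y = y .*~B f qK"
   "f qKinv .*~B y = y .*~B f qKinv" and x: "x .: UQ"
 shows "f x .*~B y = y .*~B f x"
proof -
 interpret B: calg B by fact
 note fs = chomD[OF f]
 from x show ?thesis
 proof (induction rule: UQ_induct_triple)
  case (mult a b)
  then have ab: "f a .: B" "f b .: B" using fs by blast+
  have "f (a .*~UQ b) .*~B y = f a .*~B (y .*~B f b)" using mult ab y by (simp add: fs B.m_assoc)
  also have "\<dots> = (y .*~B f a) .*~B f b" using mult ab y by (simp add: B.m_assoc[symmetric])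
  finally show ?case using mult ab y by (simp add: fs B.m_assoc)
 qed (use y c in \<open>simp_all add: fs B.l_distr B.r_distr B.csmult\<close>)
qed

lemma UQ_homs_commute:
 assumes B: "calg B" and f: "f \<in> chom UQ B" and g: "g \<in> chom UQ B"
  and c: "!!a b. a \<in> {qE, qFt, qK, qKinv} ==> b \<in> {qE, qFt, qK, qKinv} ==> f a .*~B g b = g b .*~B f a"
  and x: "x .: UQ" and y: "y .: UQ"
 shows "f x .*~B g y = g y .*~B f x"
proof (rule UQ_homs_commute_elt[OF B f chomD(1)[OF g y] _ _ _ _ x])
 have "g y .*~B f a = f a .*~B g y" if "a \<in> {qE, qFt, qK, qKinv}" for a
 proof -
  have a: "a .: UQ" using that by auto
  show ?thesis
   by (rule UQ_homs_commute_elt[OF B g chomD(1)[OF f a] _ _ _ _ y]; rule c[OF that, symmetric]; simp)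
 qed
 then show "f qE .*~B g y = g y .*~B f qE" "f qFt .*~B g y = g y .*~B f qFt" "f qK .*~B g y = g y .*~B f qK"
   "f qKinv .*~B g y = g y .*~B f qKinv" by simp_all
qed

text \<open>\<open>c\<close> inverts the square of the braided image of K, as index 8 of
  \<open>pair_rel\<close> demands. In the localization it comes from the inverse of
  \<open>qw\<close>, and at a character it is a scalar.\<close>

locale hom_pair = B?: calg B for B :: "(complex, 'b, 'p) module_scheme" (structure) +
 fixes f1 f2 :: "qelt => 'b" and c :: 'b
 assumes f1: "f1 \<in> chom UQ B" and f2: "f2 \<in> chom UQ B"
  and comm: "!!x y. x .: UQ ==> y .: UQ ==> f2 y .* f1 x = f1 x .* f2 y"
  and c: "c .: B"
   "c .* (f2 qK .* f2 qK .+ f1 qFt .* (f1 qFt .* (f2 qE .* f2 qE))) = \<one>"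
   "(f2 qK .* f2 qK .+ f1 qFt .* (f1 qFt .* (f2 qE .* f2 qE))) .* c = \<one>"
begin

lemma pr: "pair_rel (rg B) (pair_val f1 f2 c)"
proof -
 have "pair_val f1 f2 c j .*~(rg B) pair_val f1 f2 c i = pair_val f1 f2 c i .*~(rg B) pair_val f1 f2 c j" if "i < 4" "j \<in> {4..<8}" for i j
 proof -
  have "i = 0 \<or> i = 1 \<or> i = 2 \<or> i = 3" "j = 4 \<or> j = 5 \<or> j = 6 \<or> j = 7" using that by auto
  then show ?thesis by (elim disjE) (simp_all add: comm)
 qed
 then show ?thesis
  using rg_ring[OF ring_axioms] utriple_hom[OF UQ_triple f1 UQ.calg_self calg_self] utriple_hom[OF UQ_triple f2 UQ.calg_self calg_self] c
  by (simp add: pair_rel_def)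
qed

text \<open>Identities in \<open>gring\<close> are carried to \<open>B\<close> by applying this
  evaluation to both sides.\<close>

abbreviation "vv x \<equiv> ev (rg B) (pair_val f1 f2 c) x"

lemma vv_ops [simp]: "vv 0 = \<zero>" "vv 1 = \<one>" "vv (x + y) = vv x .+ vv y" "vv (x * y) = vv x .* vv y" "vv (- x) = .- vv x" "vv (x - y) = vv x .- vv y"
 using ev_ops[OF pr] by simp_all

lemma vv_closed [simp]: "vv x .: B"
 using ev_closed[OF pr, of x] by simp

lemma vv_gen [simp]: "vv E1 = f1 qE" "vv G1 = f1 qFt" "vv K1 = f1 qK" "vv L1 = f1 qKinv"
 "vv E2 = f2 qE" "vv G2 = f2 qFt" "vv K2 = f2 qK" "vv L2 = f2 qKinv" "vv C = c"
 using ev_gen[OF _ pr] by simp_all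

lemma f_closed [simp]: "x .: UQ ==> f1 x .: B" "x .: UQ ==> f2 x .: B"
 using chomD(1)[OF f1] chomD(1)[OF f2] by auto

lemma vv_Om: "vv gOm1 = f1 qOmega" "vv gOm2 = f2 qOmega"
 unfolding gOm1_def gOm2_def qOmega_eq
 by (simp_all add: chomD[OF f1] chomD[OF f2] chomD_add[OF f1 UQ.calg_self calg_self] chomD_add[OF f2 UQ.calg_self calg_self])

lemma new_homs:
 obtains g1 g2 where "g1 \<in> chom UQ B" "g2 \<in> chom UQ B"
  "!!x y. x .: UQ ==> y .: UQ ==> g2 y .* g1 x = g1 x .* g2 y"
  "g1 qE = vv gP" "g1 qFt = vv gX" "g1 qK = vv gD" "g1 qKinv = vv gDi"
  "g2 qE = vv gY" "g2 qFt = vv gQ" "g2 qK = vv gS" "g2 qKinv = vv gSi"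
  "g1 qOmega = f2 qOmega" "g2 qOmega = f1 qOmega"
proof -
 have t1: "utriple B (vv gP) (vv gX) (vv gD) (vv gDi)"
  unfolding utriple_def
  using new_triple1[THEN arg_cong[where f = vv]] by simp
 have t2: "utriple B (vv gY) (vv gQ) (vv gS) (vv gSi)"
  unfolding utriple_def
  using new_triple2[THEN arg_cong[where f = vv]] by simp
 obtain g1 where g1: "g1 \<in> chom UQ B" "g1 qE = vv gP \<and> g1 qFt = vv gX \<and> g1 qK = vv gD \<and> g1 qKinv = vv gDi"
  using UQ_lift_triple[OF calg_self t1] by (rule bexE)
 obtain g2 where g2: "g2 \<in> chom UQ B" "g2 qE = vv gY \<and> g2 qFt = vv gQ \<and> g2 qK = vv gS \<and> g2 qKinv = vv gSi"
  using UQ_lift_triple[OF calg_self t2] by (rule bexE)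
 have cr: "vv y .* vv x = vv x .* vv y" if "x \<in> {gP, gX, gD, gDi}" "y \<in> {gY, gQ, gS, gSi}" for x y
  using new_cross[OF that, THEN arg_cong[where f = vv]] by simp
 have "g2 a .* g1 b = g1 b .* g2 a" if "a \<in> {qE, qFt, qK, qKinv}" "b \<in> {qE, qFt, qK, qKinv}" for a b
 proof -
  have "\<exists>y\<in>{gY, gQ, gS, gSi}. g2 a = vv y" using that(1) g2(2) by (elim insertE emptyE) simp_all
  then obtain y where y: "y \<in> {gY, gQ, gS, gSi}" "g2 a = vv y" by (rule bexE)
  have "\<exists>x\<in>{gP, gX, gD, gDi}. g1 b = vv x" using that(2) g1(2) by (elim insertE emptyE) simp_all
  then obtain x where x: "x \<in> {gP, gX, gD, gDi}" "g1 b = vv x" by (rule bexE)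
  show ?thesis unfolding x(2) y(2) using cr[OF x(1) y(1)] .
 qed
 then have comm: "g2 y .* g1 x = g1 x .* g2 y" if "x .: UQ" "y .: UQ" for x y
  using UQ_homs_commute[OF calg_self g2(1) g1(1) _ that(2,1)] by simp
 have "g1 qOmega = vv (gD - gDi * (1 + gP * gX))" "g2 qOmega = vv (gS - gSi * (1 + gY * gQ))"
  unfolding qOmega_eq using g1(2) g2(2)
  by (simp_all add: chomD[OF g1(1)] chomD[OF g2(1)] chomD_add[OF g1(1) UQ.calg_self calg_self] chomD_add[OF g2(1) UQ.calg_self calg_self])
 then have "g1 qOmega = f2 qOmega" "g2 qOmega = f1 qOmega" by (simp_all only: new_Omega vv_Om)
 then show ?thesis using that[OF g1(1) g2(1) comm] g1(2) g2(2) by simp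
qed

end

text \<open>A single triple is completed by the trivial one, with E and iKF zero and K equal to one;
  the denominator is then one. So identities in the letters of the first triple hold for a triple in
  any ring.\<close>

lemma triple_pair_rel:
 assumes R: "ring R" and t: "utriple R e g k l"
 shows "pair_rel (rg R) (%i. if i = 0 then e else if i = 1 then g else if i = 2 then k else if i = 3 then l
  else if i = 4 then \<zero>~R else if i = 5 then \<zero>~R else \<one>~R)" (is "pair_rel _ ?v")
proof -
 interpret ring R by fact
 note c = utripleD(1-4)[OF t]
 have "?v j .*~R ?v i = ?v i .*~R ?v j" if "i < 4" "j \<in> {4..<8}" for i j
 proof -
  have "i = 0 \<or> i = 1 \<or> i = 2 \<or> i = 3" "j = 4 \<or> j = 5 \<or> j = 6 \<or> j = 7" using that by auto
  then show ?thesis using c by (elim disjE) simp_all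
 qed
 then show ?thesis using rg_ring[OF R] t c by (simp add: pair_rel_def) (simp add: utriple_def a_minus_def r_neg)
qed

lemma triple_Omega:
 assumes R: "ring R" and t: "utriple R e g k l" and om: "om = k .-~R l .*~R (\<one>~R .+~R e .*~R g)"
 shows "om .*~R e = e .*~R om" "om .*~R g = g .*~R om" "om .*~R k = k .*~R om"
  "g .*~R e = e .*~R g .+~R (k .*~R om .+~R k .*~R om)"
  "k .*~R k .*~R (om .*~R om) = (k .*~R k .-~R \<one>~R) .*~R (k .*~R k .-~R \<one>~R) .-~R e .*~R e .*~R (g .*~R g)"
proof -
 note p = triple_pair_rel[OF R t]
 let ?v = "%i::nat. if i = 0 then e else if i = 1 then g else if i = 2 then k else if i = 3 then l
  else if i = 4 then \<zero>~R else if i = 5 then \<zero>~R else \<one>~R"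
 have g: "ev (rg R) ?v E1 = e" "ev (rg R) ?v G1 = g" "ev (rg R) ?v K1 = k" "ev (rg R) ?v L1 = l"
  using ev_gen[OF _ p] by simp_all
 note ops = ev_ops[OF p] g
 have o: "ev (rg R) ?v gOm1 = om" unfolding gOm1_def om by (simp add: ops)
 show "om .*~R e = e .*~R om" using gOm_central(1)[THEN arg_cong[where f = "ev (rg R) ?v"]] by (simp only: ops o rg_simps)
 show "om .*~R g = g .*~R om" using gOm_central(2)[THEN arg_cong[where f = "ev (rg R) ?v"]] by (simp only: ops o rg_simps)
 show "om .*~R k = k .*~R om" using gOm_central(3)[THEN arg_cong[where f = "ev (rg R) ?v"]] by (simp only: ops o rg_simps)
 show "g .*~R e = e .*~R g .+~R (k .*~R om .+~R k .*~R om)"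
  using gOm_central(4)[THEN arg_cong[where f = "ev (rg R) ?v"]] by (simp only: ops o rg_simps)
 show "k .*~R k .*~R (om .*~R om) = (k .*~R k .-~R \<one>~R) .*~R (k .*~R k .-~R \<one>~R) .-~R e .*~R e .*~R (g .*~R g)"
  using gOm_sq[THEN arg_cong[where f = "ev (rg R) ?v"]] by (simp only: ops o rg_simps)
qed

lemmas UQ_Omega = triple_Omega[OF UQ.ring_axioms UQ_triple qOmega_eq]

lemma id_chom: "calg A ==> (%x. x) \<in> chom A A"
 by (rule chomI) simp_all

lemma UQ_central:
 assumes y: "y .: UQ" and c: "qE .*~UQ y = y .*~UQ qE" "qFt .*~UQ y = y .*~UQ qFt" "qK .*~UQ y = y .*~UQ qK"
  and x: "x .: UQ"
 shows "x .*~UQ y = y .*~UQ x"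
proof (rule UQ_homs_commute_elt[OF UQ.calg_self id_chom[OF UQ.calg_self] y c _ x])
 show "qKinv .*~UQ y = y .*~UQ qKinv"
  by (rule UQ.comm_inverse[OF _ _ y UQ_rels(1,2) c(3)]) simp_all
qed

lemma qOmega_central: "x .: UQ ==> x .*~UQ qOmega = qOmega .*~UQ x"
 by (rule UQ_central) (simp_all add: UQ_Omega(1-3))

section \<open>Signs and the calculus of \<alpha>, \<beta> and \<epsilon>\<close>

context ring
begin

lemma add_sub_cancel: "[| x .: R; y .: R |] ==> (x .+ y) .- x = y"
 by (simp add: a_minus_def a_comm[of x y] a_assoc r_neg)

text \<open>\<open>True\<close> stands for the sign of anticommutation. Signs of products then
  combine by exclusive or, that is, by inequality of truth values.\<close>

definition sc :: "bool => 'a => 'a => bool" where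
 "sc s x y \<longleftrightarrow> x .* y = (if s then .- (y .* x) else y .* x)"

lemma sc_sym: "[| sc s x y; x .: R; y .: R |] ==> sc s y x"
 by (auto simp: sc_def split: if_splits)

lemma sc_mult_l:
 assumes "sc s x z" "sc t y z" and c: "x .: R" "y .: R" "z .: R"
 shows "sc (s \<noteq> t) (x .* y) z"
proof -
 have "(x .* y) .* z = x .* (y .* z)" using c by (simp add: m_assoc)
 also have "\<dots> = (if t then .- ((x .* z) .* y) else (x .* z) .* y)"
  using assms(2) c by (simp add: sc_def r_minus m_assoc)
 also have "\<dots> = (if s \<noteq> t then .- (z .* (x .* y)) else z .* (x .* y))"
  using assms(1) c by (simp add: sc_def l_minus m_assoc)
 finally show ?thesis by (simp add: sc_def)
qed

lemma sc_mult_r: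
 assumes "sc s z x" "sc t z y" and c: "x .: R" "y .: R" "z .: R"
 shows "sc (s \<noteq> t) z (x .* y)"
 by (rule sc_sym[OF sc_mult_l[OF sc_sym[OF assms(1)] sc_sym[OF assms(2)]]]) (use c in simp_all)

lemma sc_add_l:
 assumes "sc s x z" "sc s y z" and c: "x .: R" "y .: R" "z .: R"
 shows "sc s (x .+ y) z"
 using assms by (auto simp: sc_def l_distr r_distr minus_add)

lemma sc_add_r:
 assumes "sc s z x" "sc s z y" and c: "x .: R" "y .: R" "z .: R"
 shows "sc s z (x .+ y)"
 using assms by (auto simp: sc_def l_distr r_distr minus_add)

lemma sc_one: "x .: R ==> sc False \<one> x" "x .: R ==> sc False x \<one>"
 by (simp_all add: sc_def)

lemma sc_inverse:
 assumes "sc False k x" "k .: R" "l .: R" "x .: R" "k .* l = \<one>" "l .* k = \<one>"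
 shows "sc False l x"
 using comm_inverse[OF assms(2,3,4,5,6)] assms(1) by (simp add: sc_def)

end

text \<open>The common setting of the localized tensor power and of the quotient at a nonsingular
  character, so that the calculus of \<alpha> and \<beta> is developed once for both.\<close>

locale urep = calg R for R :: "(complex, 'r, 's) module_scheme" (structure) +
 fixes n :: nat and f :: "nat => qelt => 'r"
 assumes f_hom: "j \<in> {1..n} ==> f j \<in> chom UQ R"
  and f_comm: "[| i \<in> {1..n}; j \<in> {1..n}; i \<noteq> j; x .: UQ; y .: UQ |] ==> f i x .* f j y = f j y .* f i x"
  and f_unit: "j \<in> {1..n} ==> f j qOmega \<in> Units R"
begin

abbreviation "I \<equiv> {1..n}"
abbreviation "Kp \<equiv> K_prefix R f"
abbreviation "\<alpha> \<equiv> alpha R f"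
abbreviation "\<beta> \<equiv> beta R f"
abbreviation "Z \<equiv> base_ring R f n"
definition "\<omega> j = m_inv R (f j qOmega)"
definition "gx \<nu> = (if \<nu> = (1::nat) then qE else qFt)"

lemma gx_closed [simp]: "gx \<nu> .: UQ" by (simp add: gx_def)

lemma fc [simp]: "j \<in> I ==> x .: UQ ==> f j x .: R"
 using chomD(1)[OF f_hom] by blast

lemmas f_ops = chomD(2-5)[OF f_hom] chomD_add[OF f_hom UQ.calg_self calg_self]

lemma \<omega>_props: assumes j: "j \<in> I"
 shows "\<omega> j .: R" "f j qOmega .* \<omega> j = \<one>" "\<omega> j .* f j qOmega = \<one>"
 using f_unit[OF j] by (simp_all add: \<omega>_def)

lemma \<omega>c [simp]: "j \<in> I ==> \<omega> j .: R" using \<omega>_props(1) .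

lemma sc_diff: "[| i \<in> I; j \<in> I; i \<noteq> j; x .: UQ; y .: UQ |] ==> sc False (f i x) (f j y)"
 using f_comm by (simp add: sc_def)

lemma sc_same_Omega: "[| i \<in> I; x .: UQ |] ==> sc False (f i qOmega) (f i x)"
 using qOmega_central[of x] f_ops(1)[of i x qOmega] f_ops(1)[of i qOmega x] by (simp add: sc_def)

lemma sc_\<omega>: assumes "i \<in> I" "j \<in> I" "x .: UQ" shows "sc False (\<omega> i) (f j x)"
proof (rule sc_inverse[OF _ _ _ _ \<omega>_props(2,3)])
 show "sc False (f i qOmega) (f j x)" using assms sc_same_Omega[of j x] sc_diff[of i j qOmega x] by (cases "i = j") auto
qed (use assms in simp_all)

lemma sc_\<omega>\<omega>: assumes "i \<in> I" "j \<in> I" shows "sc False (\<omega> i) (\<omega> j)"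
 using sc_sym[OF sc_inverse[OF sc_sym[OF sc_\<omega>[OF assms, of qOmega]] _ _ _ \<omega>_props(2,3)[OF assms(2)]]] assms by simp

lemma sc_K_gx: "i \<in> I ==> sc True (f i qK) (f i (gx \<nu>))"
proof -
 assume i: "i \<in> I"
 have "f i (qK .*~UQ gx \<nu>) = f i (.-~UQ (gx \<nu> .*~UQ qK))"
  using utripleD(7,8)[OF UQ_triple] by (simp add: gx_def)
 then show ?thesis using i by (simp add: sc_def f_ops)
qed

lemma Kp_simps: "Kp 1 = \<one>" "1 \<le> j ==> j \<le> n ==> Kp (Suc j) = Kp j .* f j qK" "j \<le> Suc n ==> Kp j .: R"
proof -
 have a: "foldr (%k x. f k qK .* x) L y = foldr (%k x. f k qK .* x) L \<one> .* y \<and> foldr (%k x. f k qK .* x) L \<one> .: R"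
  if "set L \<subseteq> I" "y .: R" for L y
  using that by (induction L) (auto simp: m_assoc)
 show "Kp 1 = \<one>" by (simp add: K_prefix_def)
 show "j \<le> Suc n ==> Kp j .: R"
 proof -
  assume "j \<le> Suc n"
  then have "set [1..<j] \<subseteq> I" by auto
  then show "Kp j .: R" using a[OF _ one_closed] by (simp add: K_prefix_def)
 qed
 assume j: "1 \<le> j" "j \<le> n"
 have s: "set [1..<j] \<subseteq> I" using j by auto
 show "Kp (Suc j) = Kp j .* f j qK"
  unfolding K_prefix_def using a[OF s, of "f j qK"] j by simp
qed

lemma Kpc [simp]: "j \<in> I ==> Kp j .: R" "j \<in> I ==> Kp (Suc j) .: R" "Kp (Suc n) .: R"
 using Kp_simps(3) by auto

text \<open>Only K of the factor \<open>i\<close> can produce a sign against a generator of that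
  factor, and the prefix contains it exactly when \<open>i < j\<close>.\<close>

lemma Kp_sc:
 assumes i: "i \<in> I" and j: "1 \<le> j" "j \<le> Suc n"
 shows "sc (i < j) (Kp j) (f i (gx \<nu>)) \<and> sc False (Kp j) (f i qK) \<and> sc False (Kp j) (\<omega> i) \<and> sc False (Kp j) (f i qOmega)"
 using j
proof (induction j rule: dec_induct)
 case base
 then show ?case using i by (simp add: Kp_simps(1) sc_one)
next
 case (step j)
 then have jI: "j \<in> I" "Kp j .: R" "f j qK .: R" and IH: "sc (i < j) (Kp j) (f i (gx \<nu>))" "sc False (Kp j) (f i qK)" "sc False (Kp j) (\<omega> i)" "sc False (Kp j) (f i qOmega)"
  using Kp_simps(3) by auto
 have e: "Kp (Suc j) = Kp j .* f j qK" using Kp_simps(2) step by simp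
 have 1: "sc (i = j) (f j qK) (f i (gx \<nu>))"
  using sc_K_gx[OF i] sc_diff[OF jI(1) i, of qK "gx \<nu>"] by (cases "i = j") auto
 have 2: "sc False (f j qK) (f i qK)" using sc_diff[OF jI(1) i, of qK qK] by (cases "i = j") (auto simp: sc_def)
 have 3: "sc False (f j qK) (\<omega> i)" using sc_sym[OF sc_\<omega>[OF i jI(1), of qK]] i jI by simp
 have 4: "sc False (f j qK) (f i qOmega)"
  using sc_diff[OF jI(1) i, of qK qOmega] sc_sym[OF sc_same_Omega[OF i, of qK]] i by (cases "i = j") auto
 have "(i < Suc j) = ((i < j) \<noteq> (i = j))" by auto
 then show ?case
  unfolding e using sc_mult_l[OF IH(1) 1] sc_mult_l[OF IH(2) 2] sc_mult_l[OF IH(3) 3] sc_mult_l[OF IH(4) 4] i jI by simp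
qed

lemma Kp_sc': assumes "i \<in> I" "j \<in> I" shows "sc (i < j) (Kp j) (f i (gx \<nu>))" "sc False (Kp j) (f i qK)" "sc False (Kp j) (\<omega> i)" "sc False (Kp j) (f i qOmega)"
 using Kp_sc[OF assms(1)] assms(2) by auto

lemma Kp_Kp: assumes "i \<in> I" "1 \<le> j" "j \<le> Suc n" shows "sc False (Kp i) (Kp j)"
 using assms(2,3)
proof (induction j rule: dec_induct)
 case base
 then show ?case using assms by (simp add: Kp_simps(1) sc_one)
next
 case (step j)
 then have j: "j \<in> I" by auto
 show ?case using sc_mult_r[OF step.IH Kp_sc'(2)[OF j assms(1)]] j assms step by (simp add: Kp_simps(2))
qed

lemma alpha_eq: "\<alpha> j \<nu> = Kp j .* f j (gx \<nu>) .* \<omega> j"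
 by (simp add: alpha_def gx_def \<omega>_def)

lemma alpha_closed [simp]: "j \<in> I ==> \<alpha> j \<nu> .: R"
 by (simp add: alpha_eq)

lemma sc_alpha_l:
 assumes j: "j \<in> I" and z: "z .: R" and "sc s (Kp j) z" "sc t (f j (gx \<nu>)) z" "sc False (\<omega> j) z"
 shows "sc (s \<noteq> t) (\<alpha> j \<nu>) z"
proof -
 have "sc ((s \<noteq> t) \<noteq> False) (\<alpha> j \<nu>) z"
  unfolding alpha_eq by (rule sc_mult_l[OF sc_mult_l[OF assms(3,4)] assms(5)]) (use j z in simp_all)
 then show ?thesis by simp
qed

text \<open>The prefix of \<alpha> at \<open>k\<close> contains K of the factor \<open>j\<close>,
  which anticommutes with the generator in \<alpha> at \<open>j\<close>. No other sign arises, since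
  the prefix at \<open>j\<close> stops before both factors.\<close>

lemma alpha_anti:
 assumes j: "j \<in> I" and k: "k \<in> I" and jk: "j < k"
 shows "sc True (\<alpha> j \<mu>) (\<alpha> k \<nu>)"
proof -
 have K: "sc False (Kp j) (\<alpha> k \<nu>)"
 proof -
  have "sc ((False \<noteq> (k < j)) \<noteq> False) (Kp j) (Kp k .* f k (gx \<nu>) .* \<omega> k)"
   by (rule sc_mult_r[OF sc_mult_r[OF Kp_Kp[OF j] Kp_sc'(1)[OF k j]] Kp_sc'(3)[OF k j]]) (use j k in simp_all)
  then show ?thesis using jk by (simp add: alpha_eq)
 qed
 have x: "sc True (f j (gx \<mu>)) (\<alpha> k \<nu>)"
 proof -
  have "sc (((j < k) \<noteq> False) \<noteq> False) (f j (gx \<mu>)) (Kp k .* f k (gx \<nu>) .* \<omega> k)"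
   by (rule sc_mult_r[OF sc_mult_r[OF sc_sym[OF Kp_sc'(1)[OF j k]] sc_diff[OF j k]] sc_sym[OF sc_\<omega>[OF k j]]])
    (use j k jk in simp_all)
  then show ?thesis using jk by (simp add: alpha_eq)
 qed
 have o: "sc False (\<omega> j) (\<alpha> k \<nu>)"
 proof -
  have "sc ((False \<noteq> False) \<noteq> False) (\<omega> j) (Kp k .* f k (gx \<nu>) .* \<omega> k)"
   by (rule sc_mult_r[OF sc_mult_r[OF sc_sym[OF Kp_sc'(3)[OF j k]] sc_\<omega>[OF j k]] sc_\<omega>\<omega>[OF j k]])
    (use j k jk in simp_all)
  then show ?thesis by (simp add: alpha_eq)
 qed
 show ?thesis using sc_alpha_l[OF j alpha_closed[OF k] K x o] by simp
qed

definition "Ks i = foldr (%k x. f k qK .* x) [Suc i..<Suc n] \<one>"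

lemma Ks_simps: "Ks n = \<one>" "i < n ==> Ks i = f (Suc i) qK .* Ks (Suc i)"
 by (simp_all add: Ks_def upt_conv_Cons del: upt_Suc)

lemma Ks_closed [simp]: "i \<le> n ==> Ks i .: R"
 by (induction i rule: inc_induct) (auto simp: Ks_simps)

lemma Ks_sc:
 assumes j: "j \<in> I" and i: "i \<le> n"
 shows "sc (i < j) (Ks i) (f j (gx \<nu>)) \<and> sc False (Ks i) (f j qK) \<and> sc False (Ks i) (\<omega> j) \<and> sc False (Ks i) (f j qOmega)"
 using i
proof (induction i rule: inc_induct)
 case base
 then show ?case using j by (simp add: Ks_simps sc_one)
next
 case (step i)
 let ?i = "Suc i"
 have iI: "?i \<in> I" using step by auto
 have IH: "sc (?i < j) (Ks ?i) (f j (gx \<nu>))" "sc False (Ks ?i) (f j qK)" "sc False (Ks ?i) (\<omega> j)" "sc False (Ks ?i) (f j qOmega)"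
  using step.IH by auto
 have 1: "sc (j = ?i) (f ?i qK) (f j (gx \<nu>))"
  using sc_K_gx[OF j] sc_diff[OF iI j, of qK "gx \<nu>"] by (cases "j = ?i") auto
 have 2: "sc False (f ?i qK) (f j qK)" using sc_diff[OF iI j, of qK qK] by (cases "j = ?i") (auto simp: sc_def)
 have 3: "sc False (f ?i qK) (\<omega> j)" using sc_sym[OF sc_\<omega>[OF j iI, of qK]] iI j by simp
 have 4: "sc False (f ?i qK) (f j qOmega)"
  using sc_diff[OF iI j, of qK qOmega] sc_sym[OF sc_same_Omega[OF j, of qK]] j by (cases "j = ?i") auto
 have e: "(i < j) = ((j = ?i) \<noteq> (?i < j))" by auto
 have c: "Ks ?i .: R" "f ?i qK .: R" using step iI by auto
 show ?case
  unfolding e Ks_simps(2)[OF step(2)] using sc_mult_l[OF 1 IH(1)] sc_mult_l[OF 2 IH(2)] sc_mult_l[OF 3 IH(3)] sc_mult_l[OF 4 IH(4)] j c by simp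
qed

lemma Ks_sc': assumes "j \<in> I" "i \<le> n"
 shows "sc (i < j) (Ks i) (f j (gx \<nu>))" "sc False (Ks i) (f j qK)" "sc False (Ks i) (\<omega> j)"
 using Ks_sc[OF assms] by auto

lemma Kp_Ks: assumes "j \<in> I" "i \<le> n" shows "sc False (Kp j) (Ks i)"
 using assms(2)
proof (induction i rule: inc_induct)
 case base
 then show ?case using assms by (simp add: Ks_simps sc_one)
next
 case (step i)
 have iI: "Suc i \<in> I" using step by auto
 show ?case unfolding Ks_simps(2)[OF step(2)]
  using sc_mult_r[OF Kp_sc'(2)[OF iI assms(1)] step.IH] assms step iI by simp
qed

abbreviation "KK \<equiv> Kp (Suc n)"

lemma Kp_mult_Ks: assumes j: "j \<le> n" shows "Kp (Suc j) .* Ks j = KK"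
 using j
proof (induction j rule: inc_induct)
 case base
 then show ?case by (simp add: Ks_simps)
next
 case (step j)
 have "Suc j \<in> I" using step by auto
 then show ?case using step Kp_simps(2)[of "Suc j"] Kp_simps(3)[of "Suc j"] by (simp add: Ks_simps m_assoc)
qed

lemma Kp_unit: "1 \<le> j ==> j \<le> Suc n ==> Kp j \<in> Units R"
proof (induction j rule: dec_induct)
 case base
 then show ?case by (simp add: Kp_simps(1))
next
 case (step j)
 then have j: "j \<in> I" by auto
 have "f j qK .* f j qKinv = \<one>" "f j qKinv .* f j qK = \<one>"
  using f_ops(1)[OF j, of qK qKinv] f_ops(1)[OF j, of qKinv qK] f_ops(3)[OF j] by (simp_all add: UQ_rels)
 then have "f j qK \<in> Units R" using j unfolding Units_def by auto
 then show ?case using step by (simp add: Kp_simps(2))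
qed

definition "ee \<nu> i = f i (gx \<nu>) .* Ks i"

primrec eps :: "nat => nat => 'r" where
 "eps \<nu> 0 = \<zero>"
| "eps \<nu> (Suc k) = eps \<nu> k .+ ee \<nu> (Suc k)"

lemma ee_closed [simp]: "i \<in> I ==> ee \<nu> i .: R" by (simp add: ee_def)

lemma eps_closed [simp]: "k \<le> n ==> eps \<nu> k .: R" by (induction k) auto

definition "cb x y = x .* y .- y .* x"

lemma cb_sc: "[| sc False x y; x .: R; y .: R |] ==> cb x y = \<zero>"
 by (simp add: sc_def cb_def)

text \<open>For \<open>i < j\<close> two signs arise: the prefix of \<alpha> meets the generator of
  the factor \<open>i\<close>, and the suffix in \<open>ee\<close> meets the generator of the factor
  \<open>j\<close>. They cancel. For \<open>i > j\<close> there is no sign at all.\<close>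

lemma cb_alpha_diff:
 assumes j: "j \<in> I" and i: "i \<in> I" and ij: "i \<noteq> j"
 shows "sc False (\<alpha> j \<nu>) (ee \<mu> i)"
proof -
 have 1: "sc (i < j) (Kp j) (ee \<mu> i)"
  using sc_mult_r[OF Kp_sc'(1)[OF i j] Kp_Ks[OF j], of i \<mu>] i j by (simp add: ee_def)
 have 2: "sc (i < j) (f j (gx \<nu>)) (ee \<mu> i)"
 proof -
  have a: "sc False (f j (gx \<nu>)) (f i (gx \<mu>))" by (rule sc_diff[OF j i ij[symmetric]]) simp_all
  have b: "sc (i < j) (f j (gx \<nu>)) (Ks i)" by (rule sc_sym[OF Ks_sc'(1)[OF j]]) (use i j in simp_all)
  show ?thesis using sc_mult_r[OF a b] i j by (simp add: ee_def)
 qed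
 have 3: "sc False (\<omega> j) (ee \<mu> i)"
  using sc_mult_r[OF sc_\<omega>[OF j i] sc_sym[OF Ks_sc'(3)[OF j]], of "gx \<mu>" i] i j by (simp add: ee_def)
 show ?thesis using sc_alpha_l[OF j ee_closed[OF i] 1 2 3] by simp
qed

text \<open>The structure constants of \<open>gx_commutator\<close>: the commutator of iKF with E is
  2 K\<Omega>, and it changes sign with the order.\<close>

definition "cc \<nu> \<mu> = (if (\<nu> = 1) = (\<mu> = 1) then (0::complex) else if \<mu> = (1::nat) then 2 else - 2)" for \<nu> :: nat

lemma gx_commutator: "gx \<nu> .*~UQ gx \<mu> .-~UQ gx \<mu> .*~UQ gx \<nu> = cc \<nu> \<mu> *.~UQ (qK .*~UQ qOmega)"
proof -
 have two: "(2 :: complex) *.~UQ x = x .+~UQ x" if "x .: UQ" for x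
  using UQ.csmult(1)[OF that, of 1 1] that by (simp add: UQ.csmult(4))
 have m2: "(- 2 :: complex) *.~UQ x = .-~UQ (x .+~UQ x)" if "x .: UQ" for x
  using UQ.csmult(10)[OF that, of 2] two[OF that] by simp
 have a: "qFt .*~UQ qE = qE .*~UQ qFt .+~UQ (qK .*~UQ qOmega .+~UQ qK .*~UQ qOmega)" by (rule UQ_Omega(4))
 have 1: "qFt .*~UQ qE .-~UQ qE .*~UQ qFt = qK .*~UQ qOmega .+~UQ qK .*~UQ qOmega"
  unfolding a by (rule UQ.add_sub_cancel) simp_all
 have 2: "qE .*~UQ qFt .-~UQ qFt .*~UQ qE = .-~UQ (qFt .*~UQ qE .-~UQ qE .*~UQ qFt)"
  by (simp add: a_minus_def UQ.minus_add UQ.a_comm)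
 show ?thesis
  using 1 2 by (auto simp: gx_def cc_def two m2 UQ.csmult(5) a_minus_def UQ.r_neg)
qed

text \<open>The \<Omega> produced by the commutator cancels the inverse in \<alpha>, which is the
  point of that normalization. The remaining K join the prefix and the suffix to form the product
  over all factors, whatever \<open>j\<close> is.\<close>

lemma cb_alpha_same:
 assumes j: "j \<in> I"
 shows "cb (\<alpha> j \<nu>) (ee \<mu> j) = cc \<nu> \<mu> *. KK"
proof -
 have jn: "j \<le> n" using j by simp
 note c = Kpc(1)[OF j] Ks_closed[OF jn] \<omega>c[OF j] fc[OF j gx_closed[of \<nu>]] fc[OF j gx_closed[of \<mu>]]
 have xo: "f j (gx \<mu>) .* \<omega> j = \<omega> j .* f j (gx \<mu>)" "f j (gx \<nu>) .* \<omega> j = \<omega> j .* f j (gx \<nu>)"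
  using sc_\<omega>[OF j j] by (simp_all add: sc_def)
 have ko: "Ks j .* \<omega> j = \<omega> j .* Ks j" and kx: "Ks j .* f j (gx \<nu>) = f j (gx \<nu>) .* Ks j"
  using Ks_sc'(1,3)[OF j jn] by (simp_all add: sc_def)
 have kk: "Ks j .* Kp j = Kp j .* Ks j" using Kp_Ks[OF j jn] by (simp add: sc_def)
 have xk: "f j (gx \<mu>) .* Kp j = Kp j .* f j (gx \<mu>)" using Kp_sc'(1)[OF j j, of \<mu>] by (simp add: sc_def)
 have 1: "\<alpha> j \<nu> .* ee \<mu> j = Kp j .* (\<omega> j .* ((f j (gx \<nu>) .* f j (gx \<mu>)) .* Ks j))"
 proof -
  have "\<alpha> j \<nu> .* ee \<mu> j = Kp j .* ((f j (gx \<nu>) .* \<omega> j) .* (f j (gx \<mu>) .* Ks j))" using c by (simp add: alpha_eq ee_def m_assoc)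
  then show ?thesis using c by (simp add: xo m_assoc)
 qed
 have 2: "ee \<mu> j .* \<alpha> j \<nu> = Kp j .* (\<omega> j .* ((f j (gx \<mu>) .* f j (gx \<nu>)) .* Ks j))"
 proof -
  have "ee \<mu> j .* \<alpha> j \<nu> = f j (gx \<mu>) .* ((Ks j .* Kp j) .* (f j (gx \<nu>) .* \<omega> j))" using c by (simp add: alpha_eq ee_def m_assoc)
  also have "\<dots> = (f j (gx \<mu>) .* Kp j) .* ((Ks j .* \<omega> j) .* f j (gx \<nu>))" using c by (simp add: kk xo m_assoc)
  also have "\<dots> = Kp j .* ((f j (gx \<mu>) .* \<omega> j) .* (Ks j .* f j (gx \<nu>)))" using c by (simp add: xk ko m_assoc)
  finally show ?thesis using c by (simp add: xo kx m_assoc)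
 qed
 have "cb (\<alpha> j \<nu>) (ee \<mu> j) = Kp j .* (\<omega> j .* (f j (gx \<nu> .*~UQ gx \<mu> .-~UQ gx \<mu> .*~UQ gx \<nu>) .* Ks j))"
  unfolding cb_def 1 2 using c j by (simp add: f_ops a_minus_def l_distr r_distr l_minus r_minus)
 also have "\<dots> = cc \<nu> \<mu> *. (Kp j .* (\<omega> j .* (f j qOmega .* f j qK .* Ks j)))"
  unfolding gx_commutator using c j qOmega_central[of qK] by (simp add: f_ops csmult)
 also have "\<omega> j .* (f j qOmega .* f j qK .* Ks j) = (\<omega> j .* f j qOmega) .* (f j qK .* Ks j)"
  using c j by (simp add: m_assoc)
 also have "Kp j .* \<dots> = (Kp j .* f j qK) .* Ks j" using c j by (simp add: \<omega>_props m_assoc)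
 also have "\<dots> = KK" using Kp_mult_Ks[OF jn] Kp_simps(2)[of j] j by simp
 finally show ?thesis .
qed

lemma cb_add_r: "[| x .: R; y .: R; z .: R |] ==> cb x (y .+ z) = cb x y .+ cb x z"
 by (simp add: cb_def a_minus_def l_distr r_distr minus_add a_ac)

lemma cb_minus_l: "[| x .: R; y .: R; z .: R |] ==> cb (x .- y) z = cb x z .- cb y z"
 by (simp add: cb_def a_minus_def l_distr r_distr minus_add a_ac l_minus r_minus)

lemma cb_alpha:
 assumes j: "j \<in> I" and k: "k \<le> n"
 shows "cb (\<alpha> j \<nu>) (eps \<mu> k) = (if j \<le> k then cc \<nu> \<mu> *. KK else \<zero>)"
 using k
proof (induction k)
 case 0
 then show ?case using j by (simp add: cb_def a_minus_def)
next
 case (Suc k)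
 then have k: "Suc k \<in> I" "k \<le> n" by auto
 have "cb (\<alpha> j \<nu>) (eps \<mu> (Suc k)) = cb (\<alpha> j \<nu>) (eps \<mu> k) .+ cb (\<alpha> j \<nu>) (ee \<mu> (Suc k))"
  using j k by (simp add: cb_add_r)
 moreover have "cb (\<alpha> j \<nu>) (ee \<mu> (Suc k)) = (if j = Suc k then cc \<nu> \<mu> *. KK else \<zero>)"
  using cb_alpha_same[OF j] cb_sc[OF cb_alpha_diff[OF j k(1)]] j k by auto
 ultimately show ?case using Suc.IH[OF k(2)] by auto
qed

lemma beta_closed [simp]: "j \<in> {1..<n} ==> \<beta> j \<nu> .: R"
 unfolding beta_def by (intro minus_closed alpha_closed) auto

text \<open>By \<open>cb_alpha\<close> the position \<open>j\<close> matters only through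
  \<open>j \<le> k\<close>. The two terms of \<beta> therefore cancel unless \<open>k\<close>
  separates \<open>j\<close> from \<open>j + 1\<close>.\<close>

lemma cb_beta:
 assumes j: "j \<in> {1..<n}" and k: "k \<le> n"
 shows "cb (\<beta> j \<nu>) (eps \<mu> k) = (if j = k then cc \<nu> \<mu> *. KK else \<zero>)"
proof -
 have J: "j \<in> I" "j + 1 \<in> I" using j by auto
 show ?thesis
  unfolding beta_def using cb_alpha[OF J(1) k, of \<nu> \<mu>] cb_alpha[OF J(2) k, of \<nu> \<mu>] J k
  by (simp add: cb_minus_l) (auto simp: a_minus_def r_neg)
qed

end

section \<open>Clifford algebras inside a ring\<close>

text \<open>
  \<open>H\<close> is a module over the central subring \<open>Zs\<close>, spanned by \<open>b 0, \<dots>, b (m - 1)\<close> with anticommutators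
  in \<open>Zs\<close>. The commutator with \<open>e k\<close> contracts a product of the \<open>b l\<close> with \<open>b k\<close>. This shows that the
  ordered products of the \<open>b k\<close> are independent, whatever the form is.
\<close>

locale clifford_setup = R?: ring R for R :: "('r, 's) ring_scheme" (structure) +
 fixes Zs H :: "'r set" and m :: nat and b e u :: "nat => 'r" and hf :: 'r
 assumes Zs: "Zs \<subseteq> carrier R" "\<one> \<in> Zs" "!!x y. [| x \<in> Zs; y \<in> Zs |] ==> x .+ y \<in> Zs"
   "!!x y. [| x \<in> Zs; y \<in> Zs |] ==> x .* y \<in> Zs" "!!x. x \<in> Zs ==> .- x \<in> Zs"
  and Zs_central: "!!z x. [| z \<in> Zs; x .: R |] ==> z .* x = x .* z"
  and half: "hf \<in> Zs" "hf .+ hf = \<one>"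
  and H: "H \<subseteq> carrier R" "!!x y. [| x \<in> H; y \<in> H |] ==> x .+ y \<in> H" "!!z x. [| z \<in> Zs; x \<in> H |] ==> z .* x \<in> H"
  and bH: "!!k. k < m ==> b k \<in> H"
  and H_span: "!!Q. [| \<zero> \<in> Q; !!k. k < m ==> b k \<in> Q; !!x y. [| x \<in> H; y \<in> H; x \<in> Q; y \<in> Q |] ==> x .+ y \<in> Q;
   !!z x. [| z \<in> Zs; x \<in> H; x \<in> Q |] ==> z .* x \<in> Q |] ==> H \<subseteq> Q"
  and H0: "\<zero> \<in> H"
  and acomm: "!!v w. [| v \<in> H; w \<in> H |] ==> v .* w .+ w .* v \<in> Zs"
  and e: "!!k. k < m ==> e k .: R"
  and be: "!!k l. [| k < m; l < m; l \<noteq> k |] ==> b l .* e k = e k .* b l"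
  and bb: "!!k. k < m ==> b k .* e k .- e k .* b k = u k" "!!k. k < m ==> u k \<in> Units R"
begin

abbreviation "ZR \<equiv> R\<lparr>carrier := Zs\<rparr>"
abbreviation "V \<equiv> submodule_of R H"
text \<open>The whole ring as an algebra over \<open>Zs\<close>, the target of the maps out of the
  Clifford algebra.\<close>

abbreviation "RA \<equiv> submodule_of R (carrier R)"
text \<open>The form is forced by the Clifford relation; its values lie in \<open>Zs\<close> by
  \<open>acomm\<close>.\<close>

definition "\<eta> v w = v .* w .+ w .* v"

lemma Zc [simp]: "z \<in> Zs ==> z .: R" using Zs(1) by blast
lemma Hc [simp]: "v \<in> H ==> v .: R" using H(1) by blast
lemma Z0': "\<zero> \<in> Zs" using Zs(3)[OF Zs(2) Zs(5)[OF Zs(2)]] by (simp add: r_neg)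

lemma ZR_cring: "cring ZR"
proof (rule cringI)
 show "abelian_group ZR"
 proof (rule abelian_groupI)
  fix x assume "x .: ZR"
  then show "\<exists>y\<in>carrier ZR. y .+~ZR x = \<zero>~ZR"
   using Zs(5) by (intro bexI[of _ ".- x"]) (simp_all add: l_neg)
 qed (simp_all add: Zs Z0' a_ac)
 show "comm_monoid ZR"
  by (rule comm_monoidI) (auto simp: Zs m_assoc intro: Zs_central)
qed (simp_all add: l_distr)

sublocale ZR: cring ZR by (rule ZR_cring)

sublocale W: monoid_algebra ZR "free_monoid H"
 by (intro monoid_algebra.intro ZR_cring free_monoid_monoid)

lemma RA_sel [simp]: "carrier RA = carrier R" "x .*~RA y = x .* y" "\<one>~RA = \<one>" "\<zero>~RA = \<zero>" "x .+~RA y = x .+ y" "x *.~RA y = x .* y"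
 by (simp_all add: submodule_of_def)

lemma V_sel [simp]: "carrier V = H" "x .+~V y = x .+ y" "x *.~V y = x .* y"
 by (simp_all add: submodule_of_def)

lemma RA_kalg: "kalg ZR RA"
proof (rule kalgI[OF ZR_cring])
 show "ring RA"
  by (rule ring_cong_record[OF R.ring_axioms]) (simp_all add: submodule_of_def)
next
 fix a x y assume "a .: ZR" "x .: RA" "y .: RA"
 then have axy: "a \<in> Zs" "x .: R" "y .: R" by simp_all
 have "x .* (a .* y) = (x .* a) .* y"
  using axy by (simp add: m_assoc)
 also have "x .* a = a .* x" using Zs_central[OF axy(1,2)] by simp
 finally have "x .* (a .* y) = (a .* x) .* y" .
 then show "x .*~RA (a *.~RA y) = a *.~RA (x .*~RA y)" using axy by (simp add: m_assoc)
qed (simp_all add: l_distr r_distr m_assoc)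

sublocale RA: kalg ZR RA by (rule RA_kalg)

lemma RA_neg: "x .: R ==> .-~RA x = .- x"
 by (rule RA.minus_equality) (simp_all add: l_neg)

abbreviation "WA \<equiv> words_alg ZR V"
abbreviation "TA \<equiv> tensor_algebra ZR V"
abbreviation "Cl \<equiv> clifford_algebra ZR V \<eta>"

sublocale WA: kalg ZR WA unfolding words_alg_def V_sel by (rule W.X_kalg)

lemma W_delta: "w \<in> lists H ==> basis_elt ZR w .: WA"
 unfolding words_alg_def V_sel by (rule W.delta_closed) simp

definition "trels = {basis_elt ZR [v .+~V w] .-~WA (basis_elt ZR [v] .+~WA basis_elt ZR [w]) | v w. v .: V \<and> w .: V} \<union>
      {basis_elt ZR [z *.~V v] .-~WA (z *.~WA basis_elt ZR [v]) | z v. z .: ZR \<and> v .: V}"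

lemma tideal_eq: "tensor_algebra_ideal ZR V = Idl~WA trels"
 by (simp add: tensor_algebra_ideal_def trels_def Let_def)

lemma trels_carrier: "trels \<subseteq> carrier WA"
 unfolding trels_def by (auto intro!: WA.minus_closed WA.add.m_closed WA.smult_closed W_delta simp: H)

lemma tideal: "ideal (tensor_algebra_ideal ZR V) WA"
 unfolding tideal_eq by (rule WA.genideal_ideal[OF trels_carrier])

sublocale TA: kalg ZR TA unfolding tensor_algebra_def by (rule WA.quot_alg_kalg[OF tideal])

definition "tproj x = tensor_algebra_ideal ZR V +>~WA x"

lemma tproj_hom: "tproj \<in> kalg_hom ZR WA TA"
 unfolding tensor_algebra_def tproj_def using WA.quot_proj_hom[OF tideal] .

abbreviation "\<tau> \<equiv> to_tensor_algebra ZR V"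

lemma tau_eq: "\<tau> v = tproj (basis_elt ZR [v])"
 by (simp add: to_tensor_algebra_def tproj_def)

lemma tau_closed: "v \<in> H ==> \<tau> v .: TA"
 unfolding tau_eq using kalg_homD(1)[OF tproj_hom W_delta[of "[v]"]] by simp

lemma tproj_rel: "x \<in> trels ==> tproj x = \<zero>~TA"
 unfolding tensor_algebra_def tproj_def
 using WA.quot_proj_zero_iff[OF tideal] WA.genideal_self[OF trels_carrier] trels_carrier
 by (auto simp: tideal_eq)

lemma tau_add: assumes "v \<in> H" "w \<in> H" shows "\<tau> (v .+ w) = \<tau> v .+~TA \<tau> w"
proof -
 have c: "basis_elt ZR [x] .: WA" if "x \<in> H" for x using W_delta[of "[x]"] that by simp
 have "tproj (basis_elt ZR [v .+ w] .-~WA (basis_elt ZR [v] .+~WA basis_elt ZR [w])) = \<zero>~TA"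
  by (rule tproj_rel) (use assms in \<open>unfold trels_def V_sel, blast\<close>)
 then have "tproj (basis_elt ZR [v .+ w]) .-~TA tproj (basis_elt ZR [v] .+~WA basis_elt ZR [w]) = \<zero>~TA"
  using kalg_hom_minus[OF tproj_hom WA.ring_axioms TA.ring_axioms] c assms H by simp
 then show ?thesis
  using kalg_homD[OF tproj_hom] c assms H unfolding tau_eq by simp
qed

lemma tau_smult: assumes "z \<in> Zs" "v \<in> H" shows "\<tau> (z .* v) = z *.~TA \<tau> v"
proof -
 have c: "basis_elt ZR [x] .: WA" if "x \<in> H" for x using W_delta[of "[x]"] that by simp
 have "tproj (basis_elt ZR [z .* v] .-~WA (z *.~WA basis_elt ZR [v])) = \<zero>~TA"
 proof (rule tproj_rel)
  have "basis_elt ZR [z *.~V v] .-~WA (z *.~WA basis_elt ZR [v]) \<in> trels"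
   using assms unfolding trels_def by force
  then show "basis_elt ZR [z .* v] .-~WA (z *.~WA basis_elt ZR [v]) \<in> trels" by simp
 qed
 then have "tproj (basis_elt ZR [z .* v]) .-~TA tproj (z *.~WA basis_elt ZR [v]) = \<zero>~TA"
  using kalg_hom_minus[OF tproj_hom WA.ring_axioms TA.ring_axioms] c assms H by simp
 then show ?thesis
  using kalg_homD[OF tproj_hom] c assms H unfolding tau_eq by simp
qed

definition "crels = {((\<tau> v .*~TA \<tau> w) .+~TA (\<tau> w .*~TA \<tau> v)) .-~TA (\<eta> v w *.~TA \<one>~TA) | v w.
      v .: V \<and> w .: V}"

lemma cideal_eq: "clifford_ideal ZR V \<eta> = Idl~TA crels"
 by (simp add: clifford_ideal_def crels_def Let_def)

lemma eta_Zs: "v \<in> H ==> w \<in> H ==> \<eta> v w \<in> Zs"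
 unfolding \<eta>_def by (rule acomm)

lemma crels_carrier: "crels \<subseteq> carrier TA"
 unfolding crels_def by (auto intro!: TA.minus_closed TA.add.m_closed TA.m_closed TA.smult_closed tau_closed simp: eta_Zs)

lemma cideal: "ideal (clifford_ideal ZR V \<eta>) TA"
 unfolding cideal_eq by (rule TA.genideal_ideal[OF crels_carrier])

sublocale Cl: kalg ZR Cl unfolding clifford_algebra_def by (rule TA.quot_alg_kalg[OF cideal])

definition "cproj x = clifford_ideal ZR V \<eta> +>~TA x"

lemma cproj_hom: "cproj \<in> kalg_hom ZR TA Cl"
 unfolding clifford_algebra_def cproj_def using TA.quot_proj_hom[OF cideal] .

abbreviation "\<kappa> \<equiv> to_clifford ZR V \<eta>"

lemma kappa_eq: "\<kappa> v = cproj (\<tau> v)"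
 by (simp add: to_clifford_def cproj_def)

lemma kappa_closed [simp]: "v \<in> H ==> \<kappa> v .: Cl"
 unfolding kappa_eq by (rule kalg_homD(1)[OF cproj_hom tau_closed])

lemma kappa_add: "v \<in> H ==> w \<in> H ==> \<kappa> (v .+ w) = \<kappa> v .+~Cl \<kappa> w"
 unfolding kappa_eq by (simp add: tau_add kalg_homD[OF cproj_hom] tau_closed)

lemma kappa_smult: "z \<in> Zs ==> v \<in> H ==> \<kappa> (z .* v) = z *.~Cl \<kappa> v"
 unfolding kappa_eq by (simp add: tau_smult kalg_homD[OF cproj_hom] tau_closed)

lemma kappa_acomm: assumes "v \<in> H" "w \<in> H"
 shows "\<kappa> v .*~Cl \<kappa> w .+~Cl \<kappa> w .*~Cl \<kappa> v = \<eta> v w *.~Cl \<one>~Cl"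
proof -
 note t = tau_closed[OF assms(1)] tau_closed[OF assms(2)]
 let ?l = "(\<tau> v .*~TA \<tau> w) .+~TA (\<tau> w .*~TA \<tau> v)" and ?r = "\<eta> v w *.~TA \<one>~TA"
 have rc: "?r .: TA" using eta_Zs[OF assms] by simp
 have "?l .-~TA ?r \<in> crels" using assms unfolding crels_def V_sel by blast
 then have "cproj (?l .-~TA ?r) = \<zero>~Cl"
  unfolding clifford_algebra_def cproj_def
  using TA.quot_proj_zero_iff[OF cideal] TA.genideal_self[OF crels_carrier] crels_carrier by (auto simp: cideal_eq)
 then have "cproj ?l .-~Cl cproj ?r = \<zero>~Cl"
  using kalg_hom_minus[OF cproj_hom TA.ring_axioms Cl.ring_axioms] t rc by simp
 then have "cproj ?l = cproj ?r"
  using kalg_homD(1)[OF cproj_hom] t rc by simp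
 then show ?thesis
  unfolding kappa_eq using kalg_homD[OF cproj_hom] t eta_Zs[OF assms] by simp
qed

lemma Cl_induct [consumes 1, case_names one gen add smult]:
 assumes x: "x .: Cl"
  and one: "Q \<one>~Cl" and gen: "!!v x. [| v \<in> H; x .: Cl; Q x |] ==> Q (\<kappa> v .*~Cl x)"
  and add: "!!x y. [| x .: Cl; y .: Cl; Q x; Q y |] ==> Q (x .+~Cl y)"
  and smult: "!!z x. [| z \<in> Zs; x .: Cl; Q x |] ==> Q (z *.~Cl x)"
 shows "Q x"
proof -
 define pp where "pp y = cproj (tproj y)" for y
 have pp: "pp \<in> kalg_hom ZR WA Cl"
  using kalg_hom_comp[OF tproj_hom cproj_hom] by (simp add: comp_def pp_def[abs_def])
 note ps = kalg_homD[OF pp]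
 obtain t where t: "t .: TA" "x = cproj t"
  using x by (auto simp: clifford_algebra_def TA.quot_alg_sel cproj_def)
 obtain y where y: "y .: WA" "t = tproj y"
  using t(1) by (auto simp: tensor_algebra_def WA.quot_alg_sel tproj_def)
 have w: "Q (pp (basis_elt ZR w))" if "w \<in> lists H" for w
  using that
 proof (induction w)
  case Nil
  have "basis_elt ZR [] = \<one>~WA" unfolding words_alg_def V_sel W.X_ops by simp
  then show ?case using one ps(4) by simp
 next
  case (Cons v w)
  then have v: "v \<in> H" "w \<in> lists H" by auto
  have "basis_elt ZR [v] .*~WA basis_elt ZR w = basis_elt ZR (v # w)"
   unfolding words_alg_def V_sel using W.delta_mult[of "[v]" w] v by simp
  then have "pp (basis_elt ZR (v # w)) = \<kappa> v .*~Cl pp (basis_elt ZR w)"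
   using ps(2)[OF W_delta[of "[v]"] W_delta[OF v(2)]] v by (simp add: kappa_eq tau_eq pp_def)
  then show ?case using gen[OF v(1) ps(1)[OF W_delta[OF v(2)]]] Cons v by simp
 qed
 have ind: "(P \<zero>~WA) ==> (!!f g. f .: WA ==> g .: WA ==> P f ==> P g ==> P (f .+~WA g)) ==>
   (!!c m. c \<in> Zs ==> m \<in> lists H ==> P (c *.~WA basis_elt ZR m)) ==> P y" for P
  using W.X_induct[of y P] y(1) unfolding words_alg_def V_sel by simp
 have "Q (pp y)"
 proof (rule ind)
  have "pp \<zero>~WA = \<zero> *.~Cl \<one>~Cl"
   using kalg_hom_zero[OF pp WA.ring_axioms Cl.ring_axioms] Cl.smult_l_null[of "\<one>~Cl"] by simp
  then show "Q (pp \<zero>~WA)" using smult[OF Z0' _ one] by simp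
 next
  fix f g assume "f .: WA" "g .: WA" "Q (pp f)" "Q (pp g)"
  then show "Q (pp (f .+~WA g))" using add ps by simp
 next
  fix c m assume c: "c \<in> Zs" and m: "m \<in> lists H"
  then show "Q (pp (c *.~WA basis_elt ZR m))" using smult[OF c ps(1)[OF W_delta[OF m]] w[OF m]] ps(5) W_delta[OF m] by simp
 qed
 then show ?thesis using t y by (simp add: pp_def)
qed

lemma Cl_lift: "\<exists>h\<in>kalg_hom ZR Cl RA. \<forall>v\<in>H. h (\<kappa> v) = v"
proof -
 let ?g = "%w. foldr (%x y. x .* y) w \<one>"
 have g: "?g w .: R" "w' \<in> lists H ==> ?g (w @ w') = ?g w .* ?g w'" if "w \<in> lists H" for w w'
  using word_prod_append[of H "%x. x"] that by auto
 have "\<exists>h\<in>kalg_hom ZR W.X RA. \<forall>w\<in>carrier (free_monoid H). h (basis_elt ZR w) = ?g w"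
 proof (rule W.X_lift[OF RA_kalg])
  show "?g (a .*~(free_monoid H) c) = ?g a .*~RA ?g c"
   if "a .: (free_monoid H)" "c .: (free_monoid H)" for a c
   using g(2)[of a c] that unfolding free_monoid_sel RA_sel by blast
 qed (simp_all add: g)
 then obtain h where h: "h \<in> kalg_hom ZR WA RA" "\<forall>w\<in>lists H. h (basis_elt ZR w) = ?g w"
  unfolding words_alg_def V_sel free_monoid_sel by (rule bexE)
 have h1: "h (basis_elt ZR [v]) = v" if "v \<in> H" for v using h(2) that by simp
 have d1: "basis_elt ZR [v] .: WA" if "v \<in> H" for v using W_delta[of "[v]"] that by simp
 note hs = kalg_homD[OF h(1)] kalg_hom_minus[OF h(1) WA.ring_axioms RA.ring_axioms]
 have "\<exists>k\<in>kalg_hom ZR TA RA. \<forall>x\<in>carrier WA. k (tproj x) = h x"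
  unfolding tensor_algebra_def tproj_def tideal_eq
 proof (rule WA.quot_gen_lift[OF RA.ring_axioms h(1) trels_carrier])
  fix x assume "x \<in> trels"
  then consider v w where "v \<in> H" "w \<in> H" "x = basis_elt ZR [v .+ w] .-~WA (basis_elt ZR [v] .+~WA basis_elt ZR [w])"
   | z v where "z \<in> Zs" "v \<in> H" "x = basis_elt ZR [z .* v] .-~WA (z *.~WA basis_elt ZR [v])"
   unfolding trels_def by auto
  then show "h x = \<zero>~RA"
  proof cases
   case 1
   have "h x = (v .+ w) .-~RA (v .+ w)" unfolding 1(3) using 1(1,2) by (simp add: hs d1 h1 H)
   then show ?thesis using 1 by (simp add: a_minus_def RA_neg r_neg)
  next
   case 2
   have "h x = (z .* v) .-~RA (z .* v)" unfolding 2(3) using 2(1,2) by (simp add: hs d1 h1 H)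
   then show ?thesis using 2 by (simp add: a_minus_def RA_neg r_neg)
  qed
 qed
 then obtain k where k: "k \<in> kalg_hom ZR TA RA" "\<forall>x\<in>carrier WA. k (tproj x) = h x" by (rule bexE)
 have k1: "k (\<tau> v) = v" if "v \<in> H" for v using k(2) d1[OF that] h1[OF that] by (simp add: tau_eq)
 note ks = kalg_homD[OF k(1)] kalg_hom_minus[OF k(1) TA.ring_axioms RA.ring_axioms]
 have "\<exists>l\<in>kalg_hom ZR Cl RA. \<forall>x\<in>carrier TA. l (cproj x) = k x"
  unfolding clifford_algebra_def cproj_def cideal_eq
 proof (rule TA.quot_gen_lift[OF RA.ring_axioms k(1) crels_carrier])
  fix x assume "x \<in> crels"
  then obtain v w where vw: "v \<in> H" "w \<in> H" "x = ((\<tau> v .*~TA \<tau> w) .+~TA (\<tau> w .*~TA \<tau> v)) .-~TA (\<eta> v w *.~TA \<one>~TA)"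
   unfolding crels_def V_sel by auto
  have "k x = \<eta> v w .-~RA \<eta> v w" unfolding vw(3) using vw(1,2) eta_Zs[OF vw(1,2)]
   by (simp add: ks tau_closed k1) (simp add: \<eta>_def)
  then show "k x = \<zero>~RA" using eta_Zs[OF vw(1,2)] by (simp add: a_minus_def RA_neg r_neg)
 qed
 then obtain l where l: "l \<in> kalg_hom ZR Cl RA" "\<forall>x\<in>carrier TA. l (cproj x) = k x" by (rule bexE)
 have "l (\<kappa> v) = v" if "v \<in> H" for v using l(2) tau_closed[OF that] k1[OF that] by (simp add: kappa_eq)
 then show ?thesis using l(1) by (intro bexI[of _ l]) simp_all
qed

text \<open>Combinations of ordered products of the first \<open>k\<close> generators, each used at
  most once. Splitting off the generator of highest index replaces sums over subsets by a single
  recursion step, on which both spanning and independence are based.\<close>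

primrec Sp :: "nat => ('r list => 'r) set set set" where
 "Sp 0 = {z *.~Cl \<one>~Cl | z. z \<in> Zs}"
| "Sp (Suc k) = {x .+~Cl \<kappa> (b k) .*~Cl y | x y. x \<in> Sp k \<and> y \<in> Sp k}"

lemma Sp_props:
 "k \<le> m ==> Sp k \<subseteq> carrier Cl \<and> \<zero>~Cl \<in> Sp k \<and> \<one>~Cl \<in> Sp k \<and> (\<forall>x\<in>Sp k. \<forall>y\<in>Sp k. x .+~Cl y \<in> Sp k) \<and>
  (\<forall>z\<in>Zs. \<forall>x\<in>Sp k. z *.~Cl x \<in> Sp k)"
proof (induction k)
 case 0
 have "\<zero>~Cl = \<zero> *.~Cl \<one>~Cl" "\<one>~Cl = \<one> *.~Cl \<one>~Cl"
  using Cl.smult_l_null[of "\<one>~Cl"] Cl.smult_one[of "\<one>~Cl"] by simp_all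
 moreover have "z *.~Cl \<one>~Cl .+~Cl z' *.~Cl \<one>~Cl = (z .+ z') *.~Cl \<one>~Cl" if "z \<in> Zs" "z' \<in> Zs" for z z'
  using Cl.smult_l_distr[of z z' "\<one>~Cl"] that by simp
 moreover have "z *.~Cl (z' *.~Cl \<one>~Cl) = (z .* z') *.~Cl \<one>~Cl" if "z \<in> Zs" "z' \<in> Zs" for z z'
  using Cl.smult_assoc1[of z z' "\<one>~Cl"] that by simp
 ultimately have *: "\<zero>~Cl \<in> Sp 0" "\<one>~Cl \<in> Sp 0"
  "x \<in> Sp 0 ==> y \<in> Sp 0 ==> x .+~Cl y \<in> Sp 0" "z \<in> Zs ==> x \<in> Sp 0 ==> z *.~Cl x \<in> Sp 0" for x y z
  using Zs(2,3,4) Z0' by (auto simp del: W.X_ops)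
 show ?case using * by auto
next
 case (Suc k)
 then have IH: "!!x. x \<in> Sp k ==> x .: Cl" "\<zero>~Cl \<in> Sp k" "\<one>~Cl \<in> Sp k" "!!x y. x \<in> Sp k ==> y \<in> Sp k ==> x .+~Cl y \<in> Sp k"
  "!!z x. z \<in> Zs ==> x \<in> Sp k ==> z *.~Cl x \<in> Sp k" by auto
 have bk: "\<kappa> (b k) .: Cl" using bH[of k] Suc.prems by simp
 have mem: "x .+~Cl \<kappa> (b k) .*~Cl y \<in> Sp (Suc k)" if "x \<in> Sp k" "y \<in> Sp k" for x y using that by auto
 have sub: "x \<in> Sp (Suc k)" if "x \<in> Sp k" for x using mem[OF that IH(2)] bk IH(1)[OF that] by simp
 show ?case
 proof (intro conjI ballI subsetI)
  show "\<zero>~Cl \<in> Sp (Suc k)" "\<one>~Cl \<in> Sp (Suc k)" using sub IH by auto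
  show "x .: Cl" if "x \<in> Sp (Suc k)" for x using that IH(1) bk by auto
  show "x .+~Cl x' \<in> Sp (Suc k)" if x: "x \<in> Sp (Suc k)" "x' \<in> Sp (Suc k)" for x x'
  proof -
   obtain a c where a: "a \<in> Sp k" "c \<in> Sp k" "x = a .+~Cl \<kappa> (b k) .*~Cl c" using x(1) by auto
   obtain a' c' where a': "a' \<in> Sp k" "c' \<in> Sp k" "x' = a' .+~Cl \<kappa> (b k) .*~Cl c'" using x(2) by auto
   have "x .+~Cl x' = (a .+~Cl a') .+~Cl \<kappa> (b k) .*~Cl (c .+~Cl c')"
    unfolding a(3) a'(3) using IH(1)[OF a(1)] IH(1)[OF a(2)] IH(1)[OF a'(1)] IH(1)[OF a'(2)] bk by (simp add: Cl.r_distr Cl.a_ac)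
   then show ?thesis using mem[OF IH(4)[OF a(1) a'(1)] IH(4)[OF a(2) a'(2)]] by simp
  qed
  show "z *.~Cl x \<in> Sp (Suc k)" if z: "z \<in> Zs" and x: "x \<in> Sp (Suc k)" for x z
  proof -
   obtain a c where a: "a \<in> Sp k" "c \<in> Sp k" "x = a .+~Cl \<kappa> (b k) .*~Cl c" using x by auto
   have "z *.~Cl x = (z *.~Cl a) .+~Cl \<kappa> (b k) .*~Cl (z *.~Cl c)"
    unfolding a(3) using IH(1)[OF a(1)] IH(1)[OF a(2)] bk z by (simp add: Cl.smult_r_distr Cl.smult_assoc3)
   then show ?thesis using mem[OF IH(5)[OF z a(1)] IH(5)[OF z a(2)]] by simp
  qed
 qed
qed

lemma SpD: assumes "k \<le> m"
 shows "!!x. x \<in> Sp k ==> x .: Cl" "\<zero>~Cl \<in> Sp k" "\<one>~Cl \<in> Sp k" "!!x y. x \<in> Sp k ==> y \<in> Sp k ==> x .+~Cl y \<in> Sp k"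
  "!!z x. z \<in> Zs ==> x \<in> Sp k ==> z *.~Cl x \<in> Sp k"
 using Sp_props[OF assms] by auto

lemma Sp_uminus: assumes k: "k \<le> m" and x: "x \<in> Sp k" shows ".-~Cl x \<in> Sp k"
proof -
 have xc: "x .: Cl" by (rule SpD(1)[OF k x])
 have "(.-~ZR \<one>~ZR) *.~Cl x = .-~Cl x"
  using Cl.smult_l_minus[OF ZR.one_closed xc] Cl.smult_one[OF xc] by simp
 moreover have ".-~ZR \<one>~ZR \<in> Zs" using ZR.a_inv_closed[OF ZR.one_closed] by simp
 ultimately show ?thesis using SpD(5)[OF k _ x] by metis
qed

text \<open>Straightening: a repeated generator is replaced by its square, which is a scalar, and a
  smaller index is moved past \<open>b k\<close> at the cost of a term in \<eta>.\<close>

lemma Sp_left_mult: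
 assumes "k \<le> m" "l < k" "x \<in> Sp k"
 shows "\<kappa> (b l) .*~Cl x \<in> Sp k"
 using assms
proof (induction k arbitrary: l x)
 case (Suc k)
 then have km: "k \<le> m" "k < m" "l < m" by auto
 obtain a c where a: "a \<in> Sp k" "c \<in> Sp k" "x = a .+~Cl \<kappa> (b k) .*~Cl c" using Suc.prems(3) by auto
 have ac: "a .: Cl" "c .: Cl" using SpD(1)[OF km(1)] a by auto
 have mem: "x .+~Cl \<kappa> (b k) .*~Cl y \<in> Sp (Suc k)" if "x \<in> Sp k" "y \<in> Sp k" for x y using that by auto
 have bl: "b l \<in> H" "b k \<in> H" using bH km by auto
 note kc = kappa_closed[OF bl(1)] kappa_closed[OF bl(2)]
 note ez = eta_Zs[OF bl]
 show ?case
 proof (cases "l = k")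
  case True
  have ez': "\<eta> (b k) (b k) \<in> Zs" using eta_Zs bl by simp
  have hz: "hf .* \<eta> (b k) (b k) \<in> Zs" using Zs(4)[OF half(1) ez'] .
  let ?q = "\<kappa> (b k) .*~Cl \<kappa> (b k)"
  have qc: "?q .: Cl" using kc by simp
  have hfc: "hf .: ZR" using half(1) by simp
  \<comment> \<open>With equal arguments the Clifford relation only gives twice the square;
    \<open>hf\<close> supplies the missing half.\<close>
  have "?q = (hf .+ hf) *.~Cl ?q" using half(2) Cl.smult_one[OF qc] by simp
  also have "\<dots> = hf *.~Cl (?q .+~Cl ?q)"
   using Cl.smult_l_distr[OF hfc hfc qc] Cl.smult_r_distr[OF hfc qc qc] by simp
  also have "\<dots> = (hf .* \<eta> (b k) (b k)) *.~Cl \<one>~Cl"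
   unfolding kappa_acomm[OF bl(2) bl(2)] using Cl.smult_assoc1[of hf "\<eta> (b k) (b k)" "\<one>~Cl"] half(1) ez' by simp
  finally have q: "?q = (hf .* \<eta> (b k) (b k)) *.~Cl \<one>~Cl" .
  have "\<kappa> (b l) .*~Cl x = ?q .*~Cl c .+~Cl \<kappa> (b k) .*~Cl a"
   unfolding a(3) True using ac kc by (simp add: Cl.r_distr Cl.m_assoc Cl.a_comm)
  also have "?q .*~Cl c = (hf .* \<eta> (b k) (b k)) *.~Cl c"
   unfolding q using hz ac by (simp add: Cl.smult_assoc2)
  finally show ?thesis using mem[OF SpD(5)[OF km(1) hz a(2)] a(1)] by simp
 next
  case False
  then have lk: "l < k" using Suc.prems by simp
  have la: "\<kappa> (b l) .*~Cl a \<in> Sp k" "\<kappa> (b l) .*~Cl c \<in> Sp k" using Suc.IH[OF km(1) lk] a by auto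
  have e1: "\<kappa> (b l) .*~Cl \<kappa> (b k) = \<eta> (b l) (b k) *.~Cl \<one>~Cl .-~Cl \<kappa> (b k) .*~Cl \<kappa> (b l)"
   unfolding kappa_acomm[OF bl, symmetric] using kc by (simp add: a_minus_def Cl.a_assoc Cl.r_neg)
  have "\<kappa> (b l) .*~Cl x = \<kappa> (b l) .*~Cl a .+~Cl (\<kappa> (b l) .*~Cl \<kappa> (b k)) .*~Cl c"
   unfolding a(3) using ac kc by (simp add: Cl.r_distr Cl.m_assoc)
  also have "\<dots> = (\<kappa> (b l) .*~Cl a .+~Cl \<eta> (b l) (b k) *.~Cl c) .+~Cl \<kappa> (b k) .*~Cl (.-~Cl (\<kappa> (b l) .*~Cl c))"
   unfolding e1 using ac kc ez by (simp add: a_minus_def Cl.l_distr Cl.l_minus Cl.r_minus Cl.smult_assoc2 Cl.m_assoc Cl.a_assoc)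
  finally show ?thesis
   using mem[OF SpD(4)[OF km(1) la(1) SpD(5)[OF km(1) ez a(2)]] Sp_uminus[OF km(1) la(2)]] by simp
 qed
qed simp

lemma kappa_zero: "\<kappa> \<zero> = \<zero>~Cl"
proof -
 have "\<kappa> (\<zero> .* \<zero>) = \<zero> *.~Cl \<kappa> \<zero>" by (rule kappa_smult[OF Z0' H0])
 then show ?thesis using Cl.smult_l_null[OF kappa_closed[OF H0]] by simp
qed

text \<open>Left multiplication by \<open>v\<close> is linear over \<open>Zs\<close> in
  \<open>v\<close>, so by \<open>H_span\<close> stability under \<open>H\<close> reduces to the
  generators treated in \<open>Sp_left_mult\<close>.\<close>

lemma Sp_all: assumes "x .: Cl" shows "x \<in> Sp m"
 using assms
proof (induction rule: Cl_induct)
 case one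
 then show ?case using SpD(3)[of m] by simp
next
 case (gen v x)
 have "H \<subseteq> {v. v \<in> H \<and> \<kappa> v .*~Cl x \<in> Sp m}"
 proof (rule H_span)
  show "\<zero> \<in> {v. v \<in> H \<and> \<kappa> v .*~Cl x \<in> Sp m}" using H0 gen SpD(2)[of m] by (simp add: kappa_zero)
  show "b k \<in> {v. v \<in> H \<and> \<kappa> v .*~Cl x \<in> Sp m}" if "k < m" for k
   using Sp_left_mult[of m k x] that bH gen by simp
  show "v .+ w \<in> {v. v \<in> H \<and> \<kappa> v .*~Cl x \<in> Sp m}"
   if "v \<in> H" "w \<in> H" "v \<in> {v. v \<in> H \<and> \<kappa> v .*~Cl x \<in> Sp m}" "w \<in> {v. v \<in> H \<and> \<kappa> v .*~Cl x \<in> Sp m}" for v w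
   using that H(2) gen SpD(4)[of m] by (simp add: kappa_add Cl.l_distr)
  show "z .* v \<in> {v. v \<in> H \<and> \<kappa> v .*~Cl x \<in> Sp m}"
   if "z \<in> Zs" "v \<in> H" "v \<in> {v. v \<in> H \<and> \<kappa> v .*~Cl x \<in> Sp m}" for z v
   using that H(3) gen SpD(5)[of m z] by (simp add: kappa_smult Cl.smult_assoc2)
 qed
 then show ?case using gen by blast
next
 case (add x y)
 then show ?case using SpD(4)[of m] by simp
next
 case (smult z x)
 then show ?case using SpD(5)[of m] by simp
qed

text \<open>Split \<open>x\<close> into \<open>a\<close> and \<open>b k\<close> times
  \<open>c\<close>. The commutator with \<open>e k\<close> annihilates \<open>h a\<close> and
  replaces \<open>b k\<close> by the unit \<open>u k\<close>. Hence \<open>c\<close> vanishes by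
  induction, and then \<open>a\<close> does.\<close>

lemma Cl_hom_inj:
 assumes h: "h \<in> kalg_hom ZR Cl RA" and hk: "!!v. v \<in> H ==> h (\<kappa> v) = v"
  and k: "k \<le> m" and x: "x \<in> Sp k" and z: "h x = \<zero>"
 shows "x = \<zero>~Cl"
proof -
 note hs = kalg_homD[OF h]
 have hc: "h x .: R" if "x .: Cl" for x using hs(1)[OF that] by simp
 \<comment> \<open>Only generators of index below \<open>j \<le> l\<close> occur in
   \<open>y\<close>, and \<open>e l\<close> commutes with all of these.\<close>
 have comm: "h y .* e l = e l .* h y" if "j \<le> l" "l < m" "y \<in> Sp j" for j l y
  using that
 proof (induction j arbitrary: y)
  case 0
  then obtain z where z: "z \<in> Zs" "y = z *.~Cl \<one>~Cl" by auto
  have "h y = z" using z hs(4,5) by simp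
  then show ?case using Zs_central[OF z(1) e[OF 0(2)]] by simp
 next
  case (Suc j)
  then have j: "j \<le> m" "j < m" "j \<noteq> l" "j \<le> l" by auto
  obtain a c where a: "a \<in> Sp j" "c \<in> Sp j" "y = a .+~Cl \<kappa> (b j) .*~Cl c" using Suc.prems(3) by auto
  have ac: "a .: Cl" "c .: Cl" using SpD(1)[OF j(1)] a by auto
  note IH = Suc.IH[OF j(4) Suc.prems(2)]
  have hy: "h y = h a .+ b j .* h c" unfolding a(3) using ac bH[OF j(2)] by (simp add: hs hk)
  have "b j .* h c .* e l = b j .* (e l .* h c)"
   using ac bH[OF j(2)] e[OF Suc.prems(2)] by (simp add: hc m_assoc IH[OF a(2)])
  also have "\<dots> = e l .* (b j .* h c)"
   using ac bH[OF j(2)] e[OF Suc.prems(2)] be[OF Suc.prems(2) j(2) j(3)] by (simp add: hc m_assoc[symmetric])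
  finally show ?case
   unfolding hy using ac bH[OF j(2)] e[OF Suc.prems(2)] by (simp add: hc l_distr r_distr IH[OF a(1)])
 qed
 show ?thesis using k x z
 proof (induction k arbitrary: x)
  case 0
  then obtain z where z: "z \<in> Zs" "x = z *.~Cl \<one>~Cl" by auto
  have "h x = z" using z hs(4,5) by simp
  then show ?case using 0 z Cl.smult_l_null[of "\<one>~Cl"] by simp
 next
  case (Suc k)
  then have k: "k \<le> m" "k < m" by auto
  obtain a c where a: "a \<in> Sp k" "c \<in> Sp k" "x = a .+~Cl \<kappa> (b k) .*~Cl c" using Suc.prems(2) by auto
  have ac: "a .: Cl" "c .: Cl" using SpD(1)[OF k(1)] a by auto
  have hx: "h a .+ b k .* h c = \<zero>" using Suc.prems(3) unfolding a(3) using ac bH[OF k(2)] by (simp add: hs hk)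
  note cm = comm[OF order_refl k(2)]
  have bk: "b k .: R" "e k .: R" using bH[OF k(2)] e[OF k(2)] by auto
  have uc: "u k .: R" using bb(2)[OF k(2)] by (rule Units_closed)
  have "u k .* h c = b k .* (e k .* h c) .- e k .* (b k .* h c)"
   unfolding bb(1)[OF k(2), symmetric] using bk ac by (simp add: hc a_minus_def l_distr l_minus m_assoc)
  also have "\<dots> = (h a .+ b k .* h c) .* e k .- e k .* (h a .+ b k .* h c)"
  proof -
   have "(h a .+ b k .* h c) .* e k = e k .* h a .+ b k .* (e k .* h c)"
    using bk ac cm[OF a(1)] cm[OF a(2)] by (simp add: hc l_distr m_assoc)
   then show ?thesis
    using bk ac by (simp add: hc r_distr a_minus_def minus_add a_ac r_neg1 r_neg2)
  qed
  also have "\<dots> = \<zero>" unfolding hx using bk by simp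
  finally have "h c = \<zero>"
   using bb(2)[OF k(2)] hc[OF ac(2)] Units_l_cancel[of "u k" "h c" "\<zero>"] uc by simp
  then have c0: "c = \<zero>~Cl" using Suc.IH[OF k(1) a(2)] by simp
  then have "h a = \<zero>" using hx \<open>h c = \<zero>\<close> bk hc[OF ac(1)] by simp
  then have "a = \<zero>~Cl" using Suc.IH[OF k(1) a(1)] by simp
  then show ?case using c0 a(3) bH[OF k(2)] by simp
 qed
qed

text \<open>\<open>C1\<close> and \<open>C2\<close> characterize \<open>CC\<close> as generated by
  \<open>Zs\<close> and \<open>H\<close> under sums and products. \<open>C1\<close> is an induction
  principle, applied here to the image of the Clifford algebra.\<close>

lemma clifford_iso:
 assumes C1: "!!Q. [| !!x. x \<in> Zs ==> x \<in> Q; !!x. x \<in> H ==> x \<in> Q; !!x y. [| x \<in> Q; y \<in> Q |] ==> x .+ y \<in> Q; !!x y. [| x \<in> Q; y \<in> Q |] ==> x .* y \<in> Q;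
   Q \<subseteq> carrier R |] ==> CC \<subseteq> Q"
  and C2: "Zs \<subseteq> CC" "H \<subseteq> CC" "!!x y. [| x \<in> CC; y \<in> CC |] ==> x .+ y \<in> CC" "!!x y. [| x \<in> CC; y \<in> CC |] ==> x .* y \<in> CC"
 shows "is_clifford_algebra_on R Zs H CC"
proof -
 obtain h where h: "h \<in> kalg_hom ZR Cl RA" "\<forall>v\<in>H. h (\<kappa> v) = v" using Cl_lift by (rule bexE)
 note hs = kalg_homD[OF h(1)]
 have hk: "h (\<kappa> v) = v" if "v \<in> H" for v using h(2) that by blast
 have hz: "h (z *.~Cl \<one>~Cl) = z" if "z \<in> Zs" for z using that by (simp add: hs)
 have inj: "inj_on h (carrier Cl)"
 proof (rule inj_onI)
  fix x y assume xy: "x .: Cl" "y .: Cl" "h x = h y"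
  have "h (x .-~Cl y) = \<zero>"
   using kalg_hom_minus[OF h(1) Cl.ring_axioms RA.ring_axioms xy(1,2)] xy(3) hs(1)[OF xy(2)] by (simp add: a_minus_def RA_neg r_neg)
  then have "x .-~Cl y = \<zero>~Cl"
   using Cl_hom_inj[OF h(1) hk order_refl Sp_all[OF Cl.minus_closed[OF xy(1,2)]]] by blast
  then show "x = y" using xy by simp
 qed
 have into: "h x \<in> CC" if "x .: Cl" for x
  using that
 proof (induction rule: Cl_induct)
  case one
  then show ?case using C2(1) Zs(2) hs(4) by auto
 next
  case (gen v x)
  then show ?case using C2(2,4) by (auto simp: hs hk)
 next
  case (add x y)
  then show ?case using C2(3) by (simp add: hs)
 next
  case (smult z x)
  then show ?case using C2(1,4) by (auto simp: hs)
 qed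
 have onto: "CC \<subseteq> h ` carrier Cl"
 proof (rule C1)
  show "x \<in> h ` carrier Cl" if "x \<in> Zs" for x using hz[OF that] that by (intro image_eqI[of _ _ "x *.~Cl \<one>~Cl"]) simp_all
  show "x \<in> h ` carrier Cl" if "x \<in> H" for x using hk[OF that] that by (intro image_eqI[of _ _ "\<kappa> x"]) simp_all
  show "x .+ y \<in> h ` carrier Cl" if x: "x \<in> h ` carrier Cl" and y: "y \<in> h ` carrier Cl" for x y
  proof -
   obtain a where a: "x = h a" "a .: Cl" using x by (rule imageE)
   obtain c where c: "y = h c" "c .: Cl" using y by (rule imageE)
   show ?thesis using a c by (intro image_eqI[of _ _ "a .+~Cl c"]) (simp_all add: hs)
  qed
  show "x .* y \<in> h ` carrier Cl" if x: "x \<in> h ` carrier Cl" and y: "y \<in> h ` carrier Cl" for x y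
  proof -
   obtain a where a: "x = h a" "a .: Cl" using x by (rule imageE)
   obtain c where c: "y = h c" "c .: Cl" using y by (rule imageE)
   show ?thesis using a c by (intro image_eqI[of _ _ "a .*~Cl c"]) (simp_all add: hs)
  qed
  show "h ` carrier Cl \<subseteq> carrier R" using hs(1) by auto
 qed
 have "h \<in> ring_iso Cl (R\<lparr>carrier := CC\<rparr>)"
  unfolding ring_iso_def ring_hom_def bij_betw_def using into onto inj hs by auto
 moreover have "symmetric_bilinear_form ZR V \<eta>"
  unfolding symmetric_bilinear_form_def
 proof (intro conjI ballI)
  fix v w z assume vw: "v .: V" "w .: V"
  show "\<eta> v w .: ZR" "\<eta> v w = \<eta> w v" using vw eta_Zs by (simp_all add: \<eta>_def a_comm)
  show "\<eta> (z *.~V v) w = z .*~ZR \<eta> v w" if "z .: ZR"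
   using vw that Zs_central[of z w] by (simp add: \<eta>_def r_distr m_assoc) (simp add: m_assoc[symmetric])
 next
  fix u v w assume "u .: V" "v .: V" "w .: V"
  then show "\<eta> (u .+~V v) w = \<eta> u w .+~ZR \<eta> v w" by (simp add: \<eta>_def l_distr r_distr a_ac)
 qed
 ultimately show ?thesis
  unfolding is_clifford_algebra_on_def Let_def using hz hk by (intro exI[of _ \<eta>] conjI bexI[of _ h] ballI) auto
qed

end

section \<open>The Clifford algebra in the localized tensor power\<close>

lemma (in Group.monoid) pow_two: "x .: G ==> x [^] (2::nat) = x .* x"
 by (simp add: numeral_2_eq_2)

context calg
begin

lemma subalg_closed: assumes "S \<subseteq> carrier A" "x \<in> subalg_gen A S" shows "x .: A"
 using assms(2,1) by (induction rule: subalg_gen.induct) auto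

lemma subalg_uminus: assumes S: "S \<subseteq> carrier A" and x: "x \<in> subalg_gen A S" shows ".- x \<in> subalg_gen A S"
 using subalg_gen.smult[OF x, of "- 1"] uminus_csmult[OF subalg_closed[OF assms]] by simp

lemma subalg_minus: assumes S: "S \<subseteq> carrier A" and x: "x \<in> subalg_gen A S" "y \<in> subalg_gen A S" shows "x .- y \<in> subalg_gen A S"
 unfolding a_minus_def by (intro subalg_gen.add x(1) subalg_uminus[OF S x(2)])

lemma subalg_commute:
 assumes S: "S \<subseteq> carrier A" and y: "y .: A" and c: "!!s. s \<in> S ==> s .* y = y .* s" and x: "x \<in> subalg_gen A S"
 shows "x .* y = y .* x"
 using x
proof (induction rule: subalg_gen.induct)
 case (mult a b)
 then have ab: "a .: A" "b .: A" using subalg_closed[OF S] by auto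
 have "a .* b .* y = a .* (y .* b)" using mult ab y by (simp add: m_assoc)
 also have "\<dots> = (y .* a) .* b" using mult ab y by (simp add: m_assoc[symmetric])
 finally show ?case using ab y by (simp add: m_assoc)
qed (use y c subalg_closed[OF S] in \<open>auto simp: l_distr r_distr csmult\<close>)

end

abbreviation "Z0gens \<equiv> {qK [^]~UQ (2::nat), qKinv [^]~UQ (2::nat), qE [^]~UQ (2::nat), qF [^]~UQ (2::nat)}"

lemma Z0gens_carrier: "Z0gens \<subseteq> carrier UQ" by simp

lemma Z0_carrier: "z \<in> Z0 ==> z .: UQ"
 unfolding Z0_def by (rule UQ.subalg_closed[OF Z0gens_carrier])

lemma Z0_closed:
 "\<one>~UQ \<in> Z0" "x \<in> Z0 ==> y \<in> Z0 ==> x .+~UQ y \<in> Z0" "x \<in> Z0 ==> y \<in> Z0 ==> x .*~UQ y \<in> Z0"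
 "x \<in> Z0 ==> c *.~UQ x \<in> Z0" "x \<in> Z0 ==> y \<in> Z0 ==> x .-~UQ y \<in> Z0"
 using UQ.subalg_minus[OF Z0gens_carrier] unfolding Z0_def by (auto intro: subalg_gen.intros)

text \<open>Two anticommutations cancel, so squares commute with the generators. The last identity
  provides the sign needed to compare the squares of F and of iKF.\<close>

lemma triple_squares:
 assumes R: "ring R" and t: "utriple R e g k l"
 shows "(e .*~R e) .*~R g = g .*~R (e .*~R e)" "(g .*~R g) .*~R e = e .*~R (g .*~R g)"
  "(e .*~R e) .*~R k = k .*~R (e .*~R e)" "(g .*~R g) .*~R k = k .*~R (g .*~R g)"
  "(k .*~R k) .*~R e = e .*~R (k .*~R k)" "(k .*~R k) .*~R g = g .*~R (k .*~R k)"
  "(l .*~R l) .*~R e = e .*~R (l .*~R l)" "(l .*~R l) .*~R g = g .*~R (l .*~R l)"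
  "(l .*~R g) .*~R (l .*~R g) = .-~R ((l .*~R l) .*~R (g .*~R g))"
proof -
 note p = triple_pair_rel[OF R t]
 let ?v = "%i::nat. if i = 0 then e else if i = 1 then g else if i = 2 then k else if i = 3 then l
  else if i = 4 then \<zero>~R else if i = 5 then \<zero>~R else \<one>~R"
 have ge: "ev (rg R) ?v E1 = e" "ev (rg R) ?v G1 = g" "ev (rg R) ?v K1 = k" "ev (rg R) ?v L1 = l"
  using ev_gen[OF _ p] by simp_all
 have m: "ev (rg R) ?v (x * y) = ev (rg R) ?v x .*~R ev (rg R) ?v y" "ev (rg R) ?v (- x) = .-~R ev (rg R) ?v x" for x y
  using ev_ops[OF p] by simp_all
 have g: "(E1 * E1) * G1 = G1 * (E1 * E1)" "(G1 * G1) * E1 = E1 * (G1 * G1)"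
  "(E1 * E1) * K1 = K1 * (E1 * E1)" "(G1 * G1) * K1 = K1 * (G1 * G1)"
  "(K1 * K1) * E1 = E1 * (K1 * K1)" "(K1 * K1) * G1 = G1 * (K1 * K1)"
  "(L1 * L1) * E1 = E1 * (L1 * L1)" "(L1 * L1) * G1 = G1 * (L1 * L1)"
  "(L1 * G1) * (L1 * G1) = - ((L1 * L1) * (G1 * G1))"
  by (simp_all add: gring_nf algebra_simps)
 show "(e .*~R e) .*~R g = g .*~R (e .*~R e)" "(g .*~R g) .*~R e = e .*~R (g .*~R g)"
  "(e .*~R e) .*~R k = k .*~R (e .*~R e)" "(g .*~R g) .*~R k = k .*~R (g .*~R g)"
  "(k .*~R k) .*~R e = e .*~R (k .*~R k)" "(k .*~R k) .*~R g = g .*~R (k .*~R k)"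
  "(l .*~R l) .*~R e = e .*~R (l .*~R l)" "(l .*~R l) .*~R g = g .*~R (l .*~R l)"
  "(l .*~R g) .*~R (l .*~R g) = .-~R ((l .*~R l) .*~R (g .*~R g))"
  using g[THEN arg_cong[where f = "ev (rg R) ?v"]] unfolding m ge by simp_all
qed

lemmas UQ_squares = triple_squares[OF UQ.ring_axioms UQ_triple]

text \<open>The sign from moving iKF past the inverse of K cancels the square of -\<i>.\<close>

lemma qF_sq: "qF .*~UQ qF = (qKinv .*~UQ qKinv) .*~UQ (qFt .*~UQ qFt)"
proof -
 have "qF .*~UQ qF = (- 1) *.~UQ ((qKinv .*~UQ qFt) .*~UQ (qKinv .*~UQ qFt))"
  unfolding qF_eq by (simp add: UQ.csmult)
 then show ?thesis unfolding UQ_squares(9) by (simp add: UQ.csmult)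
qed

lemma qFt_sq: "qFt .*~UQ qFt = (qK .*~UQ qK) .*~UQ (qF .*~UQ qF)"
proof -
 have "(qK .*~UQ qK) .*~UQ (qKinv .*~UQ qKinv) = qK .*~UQ ((qK .*~UQ qKinv) .*~UQ qKinv)"
  by (simp add: UQ.m_assoc)
 then have "(qK .*~UQ qK) .*~UQ (qKinv .*~UQ qKinv) = \<one>~UQ" by (simp add: UQ_rels)
 then show ?thesis unfolding qF_sq by (simp add: UQ.m_assoc[symmetric])
qed

lemma Z0_sq: "qK .*~UQ qK \<in> Z0" "qKinv .*~UQ qKinv \<in> Z0" "qE .*~UQ qE \<in> Z0" "qF .*~UQ qF \<in> Z0" "qFt .*~UQ qFt \<in> Z0"
proof -
 show a: "qK .*~UQ qK \<in> Z0" "qKinv .*~UQ qKinv \<in> Z0" "qE .*~UQ qE \<in> Z0" "qF .*~UQ qF \<in> Z0"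
  unfolding Z0_def by (rule subalg_gen.incl; simp add: UQ.pow_two)+
 show "qFt .*~UQ qFt \<in> Z0" unfolding qFt_sq by (intro Z0_closed a)
qed

lemma qOmega_sq: "qOmega .*~UQ qOmega = (qKinv .*~UQ qKinv) .*~UQ ((qK .*~UQ qK .-~UQ \<one>~UQ) .*~UQ (qK .*~UQ qK .-~UQ \<one>~UQ) .-~UQ (qE .*~UQ qE) .*~UQ (qFt .*~UQ qFt))"
proof -
 have "(qKinv .*~UQ qKinv) .*~UQ (qK .*~UQ qK) = qKinv .*~UQ ((qKinv .*~UQ qK) .*~UQ qK)"
  by (simp add: UQ.m_assoc)
 then have "(qKinv .*~UQ qKinv) .*~UQ (qK .*~UQ qK) = \<one>~UQ" by (simp add: UQ_rels)
 then show ?thesis unfolding UQ_Omega(5)[symmetric] by (simp add: UQ.m_assoc[symmetric])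
qed

lemma Z0_Omega: "qOmega .*~UQ qOmega \<in> Z0"
 unfolding qOmega_sq by (intro Z0_closed Z0_sq)

lemma Z0_central: assumes z: "z \<in> Z0" and x: "x .: UQ" shows "z .*~UQ x = x .*~UQ z"
proof (rule UQ.subalg_commute[OF Z0gens_carrier x _ z[unfolded Z0_def]])
 have k: "qE .*~UQ (qKinv .*~UQ qKinv) = (qKinv .*~UQ qKinv) .*~UQ qE" using UQ_squares(7) by simp
 have 1: "qK .*~UQ qK .*~UQ x = x .*~UQ (qK .*~UQ qK)"
  by (rule UQ_central[OF _ _ _ _ x, symmetric]) (simp_all add: UQ_squares UQ.m_assoc)
 have lk: "qKinv .*~UQ qK = qK .*~UQ qKinv" by (simp add: UQ_rels)
 have 2: "qKinv .*~UQ qKinv .*~UQ x = x .*~UQ (qKinv .*~UQ qKinv)"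
 proof (rule UQ_central[OF _ _ _ _ x, symmetric])
  show "qK .*~UQ (qKinv .*~UQ qKinv) = qKinv .*~UQ qKinv .*~UQ qK"
   by (simp add: UQ.m_assoc UQ_rels) (simp add: UQ.m_assoc[symmetric] UQ_rels)
 qed (simp_all add: UQ_squares)
 have 3: "qE .*~UQ qE .*~UQ x = x .*~UQ (qE .*~UQ qE)"
  by (rule UQ_central[OF _ _ _ _ x, symmetric]) (simp_all add: UQ_squares(1-4) UQ.m_assoc)
 have 4: "qFt .*~UQ qFt .*~UQ x = x .*~UQ (qFt .*~UQ qFt)"
  by (rule UQ_central[OF _ _ _ _ x, symmetric]) (simp_all add: UQ_squares(1-4) UQ.m_assoc)
 have "qF .*~UQ qF .*~UQ x = (qKinv .*~UQ qKinv) .*~UQ (x .*~UQ (qFt .*~UQ qFt))"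
  unfolding qF_sq using x 4 by (simp add: UQ.m_assoc)
 also have "\<dots> = (x .*~UQ (qKinv .*~UQ qKinv)) .*~UQ (qFt .*~UQ qFt)"
  using x by (simp add: 2[symmetric] UQ.m_assoc)
 finally have 5: "qF .*~UQ qF .*~UQ x = x .*~UQ (qF .*~UQ qF)"
  unfolding qF_sq using x by (simp add: UQ.m_assoc)
 fix s assume "s \<in> Z0gens"
 then show "s .*~UQ x = x .*~UQ s" using 1 2 3 5 by (auto simp: UQ.pow_two)
qed

context urep
begin

definition "Zgens = (\<Union>j\<in>I. f j ` Z0 \<union> {\<omega> j [^] (2::nat)})"

lemma Z_eq: "Z = subalg_gen R Zgens"
 by (simp add: base_ring_def Zgens_def \<omega>_def)

lemma Zgens_carrier: "Zgens \<subseteq> carrier R"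
 by (auto simp: Zgens_def dest: Z0_carrier)

lemma Z_carrier: "z \<in> Z ==> z .: R"
 unfolding Z_eq by (rule subalg_closed[OF Zgens_carrier])

lemma Z_closed:
 "\<one> \<in> Z" "x \<in> Z ==> y \<in> Z ==> x .+ y \<in> Z" "x \<in> Z ==> y \<in> Z ==> x .* y \<in> Z"
 "x \<in> Z ==> c *. x \<in> Z" "x \<in> Z ==> y \<in> Z ==> x .- y \<in> Z" "x \<in> Z ==> .- x \<in> Z" "\<zero> \<in> Z"
proof -
 have "0 *. \<one> \<in> subalg_gen R Zgens" by (intro subalg_gen.smult subalg_gen.one)
 moreover have "0 *. \<one> = \<zero>" by (simp add: csmult)
 ultimately show "\<zero> \<in> Z" unfolding Z_eq by simp
qed (use subalg_minus[OF Zgens_carrier] subalg_uminus[OF Zgens_carrier] in \<open>unfold Z_eq, auto intro: subalg_gen.intros\<close>)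

lemma Z_f: "j \<in> I ==> z \<in> Z0 ==> f j z \<in> Z"
 unfolding Z_eq by (rule subalg_gen.incl) (auto simp: Zgens_def)

lemma Z_\<omega>: "j \<in> I ==> \<omega> j .* \<omega> j \<in> Z"
 unfolding Z_eq by (rule subalg_gen.incl) (auto simp: Zgens_def pow_two)

lemma Zgens_comm_f:
 assumes s: "s \<in> Zgens" and i: "i \<in> I" and x: "x .: UQ" shows "s .* f i x = f i x .* s"
proof -
 from s obtain j where j: "j \<in> I" "s \<in> f j ` Z0 \<union> {\<omega> j [^] (2::nat)}" by (auto simp: Zgens_def)
 then consider z where "z \<in> Z0" "s = f j z" | "s = \<omega> j .* \<omega> j" by (auto simp: pow_two)
 then show ?thesis
 proof cases
  case 1
  then show ?thesis
   using Z0_central[OF 1(1) x] f_ops(1)[OF i, of z x] f_ops(1)[OF i, of x z] f_comm[OF j(1) i _ Z0_carrier x] Z0_carrier[OF 1(1)] x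
   by (cases "i = j") auto
 next
  case 2
  have "sc (False \<noteq> False) (\<omega> j .* \<omega> j) (f i x)"
   by (rule sc_mult_l[OF sc_\<omega>[OF j(1) i x] sc_\<omega>[OF j(1) i x]]) (use i j x in simp_all)
  then show ?thesis using 2 by (simp add: sc_def)
 qed
qed

lemma Z_comm_f: assumes "z \<in> Z" "i \<in> I" "x .: UQ" shows "sc False z (f i x)"
 using subalg_commute[OF Zgens_carrier _ Zgens_comm_f[OF _ assms(2,3)] assms(1)[unfolded Z_eq]] assms by (simp add: sc_def)

lemma Z_comm_\<omega>: assumes "z \<in> Z" "i \<in> I" shows "sc False z (\<omega> i)"
 using sc_sym[OF sc_inverse[OF sc_sym[OF Z_comm_f[OF assms, of qOmega]] _ _ _ \<omega>_props(2,3)[OF assms(2)]]] assms Z_carrier by simp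

lemma Z_comm_Kp: assumes z: "z \<in> Z" and j: "1 \<le> j" "j \<le> Suc n" shows "sc False z (Kp j)"
 using j
proof (induction j rule: dec_induct)
 case base
 then show ?case using Z_carrier[OF z] by (simp add: Kp_simps(1) sc_one)
next
 case (step j)
 then have j: "j \<in> I" by auto
 show ?case using sc_mult_r[OF step.IH Z_comm_f[OF z j, of qK]] Z_carrier[OF z] j step by (simp add: Kp_simps(2))
qed

lemma Z_comm_alpha: assumes z: "z \<in> Z" and j: "j \<in> I" shows "sc False z (\<alpha> j \<nu>)"
proof -
 have "sc ((False \<noteq> False) \<noteq> False) z (\<alpha> j \<nu>)"
  unfolding alpha_eq by (rule sc_mult_r[OF sc_mult_r[OF Z_comm_Kp[OF z] Z_comm_f[OF z j]] Z_comm_\<omega>[OF z j]])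
   (use Z_carrier[OF z] j in simp_all)
 then show ?thesis by simp
qed

lemma Z_comm_Ks: assumes z: "z \<in> Z" and i: "i \<le> n" shows "sc False z (Ks i)"
 using i
proof (induction i rule: inc_induct)
 case base
 then show ?case using Z_carrier[OF z] by (simp add: Ks_simps sc_one)
next
 case (step i)
 have iI: "Suc i \<in> I" using step by auto
 show ?case unfolding Ks_simps(2)[OF step(2)]
  using sc_mult_r[OF Z_comm_f[OF z iI, of qK] step.IH] Z_carrier[OF z] step iI by simp
qed

lemma Z_comm_eps: assumes z: "z \<in> Z" and k: "k \<le> n" shows "sc False z (eps \<nu> k)"
 using k
proof (induction k)
 case 0
 then show ?case using Z_carrier[OF z] by (simp add: sc_def)
next
 case (Suc k)
 then have k: "Suc k \<in> I" by auto
 have "sc False z (ee \<nu> (Suc k))"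
  unfolding ee_def using sc_mult_r[OF Z_comm_f[OF z k, of "gx \<nu>"] Z_comm_Ks[OF z, of "Suc k"]] Z_carrier[OF z] k by simp
 then show ?case using sc_add_r[of False z "eps \<nu> k" "ee \<nu> (Suc k)"] Suc Z_carrier[OF z] k by simp
qed

lemma Kp_sq_Z: assumes j: "1 \<le> j" "j \<le> Suc n" shows "Kp j .* Kp j \<in> Z"
 using j
proof (induction j rule: dec_induct)
 case base
 then show ?case using Z_closed(1) by (simp add: Kp_simps(1))
next
 case (step j)
 then have j: "j \<in> I" by auto
 have k: "f j qK .* Kp j = Kp j .* f j qK" using Kp_sc'(2)[OF j j] by (simp add: sc_def)
 have "Kp (Suc j) .* Kp (Suc j) = Kp j .* ((f j qK .* Kp j) .* f j qK)"
  using step j by (simp add: Kp_simps(2) m_assoc)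
 also have "\<dots> = (Kp j .* Kp j) .* f j (qK .*~UQ qK)"
  unfolding k using j by (simp add: m_assoc f_ops)
 finally show ?case using Z_closed(3)[OF step.IH Z_f[OF j Z0_sq(1)]] step by simp
qed

lemma gx_acomm_Z0: "gx \<mu> .*~UQ gx \<nu> .+~UQ gx \<nu> .*~UQ gx \<mu> \<in> Z0"
proof -
 have 1: "qE .*~UQ qFt .+~UQ qFt .*~UQ qE \<in> Z0"
  unfolding utripleD(9)[OF UQ_triple] by (intro Z0_closed Z0_sq)
 then have 2: "qFt .*~UQ qE .+~UQ qE .*~UQ qFt \<in> Z0" by (simp add: UQ.a_comm)
 show ?thesis using 1 2 Z0_closed(2)[OF Z0_sq(3) Z0_sq(3)] Z0_closed(2)[OF Z0_sq(5) Z0_sq(5)] by (simp add: gx_def)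
qed

lemma alpha_mult_same:
 assumes j: "j \<in> I"
 shows "\<alpha> j \<mu> .* \<alpha> j \<nu> = (Kp j .* Kp j) .* (\<omega> j .* \<omega> j) .* f j (gx \<mu> .*~UQ gx \<nu>)"
proof -
 note c = Kpc(1)[OF j] \<omega>c[OF j] fc[OF j gx_closed[of \<nu>]] fc[OF j gx_closed[of \<mu>]]
 have r: "f j (gx \<mu>) .* Kp j = Kp j .* f j (gx \<mu>)" "f j (gx \<mu>) .* \<omega> j = \<omega> j .* f j (gx \<mu>)" "\<omega> j .* Kp j = Kp j .* \<omega> j"
   "f j (gx \<nu>) .* \<omega> j = \<omega> j .* f j (gx \<nu>)"
  using Kp_sc'(1)[OF j j, of \<mu>] Kp_sc'(3)[OF j j] sc_\<omega>[OF j j] by (simp_all add: sc_def)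
 have r2: "f j (gx \<mu>) .* (Kp j .* x) = Kp j .* (f j (gx \<mu>) .* x)" "f j (gx \<mu>) .* (\<omega> j .* x) = \<omega> j .* (f j (gx \<mu>) .* x)"
  "\<omega> j .* (Kp j .* x) = Kp j .* (\<omega> j .* x)" if "x .: R" for x
  using c that by (simp_all add: m_assoc[symmetric] r)
 show ?thesis
  unfolding alpha_eq f_ops(1)[OF j gx_closed gx_closed] using c by (simp add: m_assoc r r2)
qed

text \<open>For different factors the anticommutator is zero by \<open>alpha_anti\<close>. Within
  one factor it is a product of the squared prefix, the squared inverse of \<Omega> and an
  anticommutator of generators from \<open>Z0\<close>.\<close>

lemma alpha_acomm_Z:
 assumes j: "j \<in> I" and k: "k \<in> I"
 shows "\<alpha> j \<mu> .* \<alpha> k \<nu> .+ \<alpha> k \<nu> .* \<alpha> j \<mu> \<in> Z"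
proof (cases "j = k")
 case True
 have "\<alpha> j \<mu> .* \<alpha> j \<nu> .+ \<alpha> j \<nu> .* \<alpha> j \<mu> = (Kp j .* Kp j) .* (\<omega> j .* \<omega> j) .* f j (gx \<mu> .*~UQ gx \<nu> .+~UQ gx \<nu> .*~UQ gx \<mu>)"
  unfolding alpha_mult_same[OF j] using j by (simp add: f_ops r_distr)
 then show ?thesis using True j Z_closed(3)[OF Z_closed(3)[OF Kp_sq_Z Z_\<omega>[OF j]] Z_f[OF j gx_acomm_Z0]] by simp
next
 case False
 then have "sc True (\<alpha> j \<mu>) (\<alpha> k \<nu>)"
  using alpha_anti[OF j k] sc_sym[OF alpha_anti[OF k j]] j k by (cases "j < k") auto
 then show ?thesis using j k Z_closed(7) by (simp add: sc_def l_neg)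
qed

lemma beta_acomm_Z:
 assumes j: "j \<in> {1..<n}" and k: "k \<in> {1..<n}"
 shows "\<beta> j \<mu> .* \<beta> k \<nu> .+ \<beta> k \<nu> .* \<beta> j \<mu> \<in> Z"
proof -
 have J: "j \<in> I" "j + 1 \<in> I" "k \<in> I" "k + 1 \<in> I" using j k by auto
 let ?A = "%i l. \<alpha> i \<mu> .* \<alpha> l \<nu> .+ \<alpha> l \<nu> .* \<alpha> i \<mu>"
 have e: "(a .- a') .* (c .- c') .+ (c .- c') .* (a .- a') =
  ((a .* c .+ c .* a) .- (a .* c' .+ c' .* a)) .- ((a' .* c .+ c .* a') .- (a' .* c' .+ c' .* a'))"
  if "a .: R" "a' .: R" "c .: R" "c' .: R" for a a' c c'
  using that by (simp add: a_minus_def l_distr r_distr l_minus r_minus minus_add a_ac)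
 have "\<beta> j \<mu> .* \<beta> k \<nu> .+ \<beta> k \<nu> .* \<beta> j \<mu> = (?A j k .- ?A j (k + 1)) .- (?A (j + 1) k .- ?A (j + 1) (k + 1))"
  unfolding beta_def by (rule e) (use J in simp_all)
 then show ?thesis using Z_closed(5) alpha_acomm_Z J by simp
qed

lemma Z_comm_beta: assumes z: "z \<in> Z" and j: "j \<in> {1..<n}" shows "sc False z (\<beta> j \<nu>)"
proof -
 have J: "j \<in> I" "j + 1 \<in> I" using j by auto
 show ?thesis
  using Z_comm_alpha[OF z J(1), of \<nu>] Z_comm_alpha[OF z J(2), of \<nu>] alpha_closed[OF J(1), of \<nu>] alpha_closed[OF J(2), of \<nu>] Z_carrier[OF z]
  by (simp add: sc_def beta_def a_minus_def l_distr r_distr l_minus r_minus)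
qed

abbreviation "Hs \<equiv> span_beta R f n"
abbreviation "idx \<equiv> {1..<n} \<times> {1, 2 :: nat}"

definition "lc z = finsum R (%(j, \<nu>). z j \<nu> .* \<beta> j \<nu>) idx"

lemma Hs_iff: "v \<in> Hs \<longleftrightarrow> (\<exists>z. v = lc z \<and> (\<forall>j \<nu>. z j \<nu> \<in> Z))"
 by (auto simp: span_beta_def lc_def)

lemma lc_fun: "(!!j \<nu>. z j \<nu> \<in> Z) ==> (%(j, \<nu>). z j \<nu> .* \<beta> j \<nu>) \<in> idx \<rightarrow> carrier R"
 using Z_carrier by auto

lemma lc_closed: "(!!j \<nu>. z j \<nu> \<in> Z) ==> lc z .: R"
 unfolding lc_def by (rule finsum_closed[OF lc_fun])

lemma Hs_carrier: "Hs \<subseteq> carrier R"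
proof
 fix v assume "v \<in> Hs"
 then obtain z where z: "v = lc z" "\<forall>j \<nu>. z j \<nu> \<in> Z" unfolding Hs_iff by (elim exE conjE)
 then show "v .: R" using lc_closed[of z] by simp
qed

lemma Hs_add: assumes "v \<in> Hs" "w \<in> Hs" shows "v .+ w \<in> Hs"
proof -
 obtain z z' where z: "v = lc z" "w = lc z'" "!!j \<nu>. z j \<nu> \<in> Z" "!!j \<nu>. z' j \<nu> \<in> Z" using assms by (auto simp: Hs_iff)
 have "lc z .+ lc z' = finsum R (%p. (case p of (j, \<nu>) => z j \<nu> .* \<beta> j \<nu>) .+ (case p of (j, \<nu>) => z' j \<nu> .* \<beta> j \<nu>)) idx"
  unfolding lc_def by (rule finsum_addf[OF lc_fun[OF z(3)] lc_fun[OF z(4)], symmetric])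
 also have "\<dots> = lc (%j \<nu>. z j \<nu> .+ z' j \<nu>)"
  unfolding lc_def by (rule finsum_cong') (use Z_carrier z in \<open>auto simp: l_distr\<close>)
 finally show ?thesis unfolding z Hs_iff using Z_closed(2) z by blast
qed

lemma Hs_mult: assumes "c \<in> Z" "v \<in> Hs" shows "c .* v \<in> Hs"
proof -
 obtain z where z: "v = lc z" "!!j \<nu>. z j \<nu> \<in> Z" using assms by (auto simp: Hs_iff)
 have "c .* lc z = finsum R (%p. c .* (case p of (j, \<nu>) => z j \<nu> .* \<beta> j \<nu>)) idx"
  unfolding lc_def by (rule finsum_rdistr[OF _ Z_carrier[OF assms(1)] lc_fun[OF z(2)]]) simp
 also have "\<dots> = lc (%j \<nu>. c .* z j \<nu>)"
  unfolding lc_def by (rule finsum_cong') (use Z_carrier z assms in \<open>auto simp: m_assoc\<close>)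
 finally show ?thesis unfolding z Hs_iff using Z_closed(3)[OF assms(1)] z by blast
qed

lemma Hs_zero: "\<zero> \<in> Hs"
proof -
 have "lc (%j \<nu>. \<zero>) = finsum R (%p. \<zero>) idx" unfolding lc_def by (rule finsum_cong') auto
 then show ?thesis unfolding Hs_iff using Z_closed(7) by (intro exI[of _ "%j \<nu>. \<zero>"]) simp
qed

lemma Hs_beta: assumes j: "j \<in> {1..<n}" and \<nu>: "\<nu> \<in> {1, 2}" shows "\<beta> j \<nu> \<in> Hs"
proof -
 let ?z = "%i \<mu>. if i = j \<and> \<mu> = \<nu> then \<one> else \<zero>"
 have zZ: "?z i \<mu> \<in> Z" for i \<mu> using Z_closed by simp
 have "lc ?z = finsum R (%p. if (j, \<nu>) = p then (case p of (j, \<nu>) => \<beta> j \<nu>) else \<zero>) idx"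
  unfolding lc_def by (rule finsum_cong') (use j \<nu> in \<open>auto split: if_splits\<close>)
 also have "\<dots> = \<beta> j \<nu>"
 proof -
  have f: "(%(j, \<nu>). \<beta> j \<nu>) \<in> idx \<rightarrow> carrier R" by auto
  show ?thesis using add.finprod_singleton[OF _ _ f, of "(j, \<nu>)"] j \<nu> by simp
 qed
 finally show ?thesis unfolding Hs_iff using zZ by (intro exI[of _ ?z]) auto
qed

lemma Hs_induct:
 assumes v: "v \<in> Hs" and z: "\<zero> \<in> Q" and b: "!!j \<nu>. j \<in> {1..<n} ==> \<nu> \<in> {1, 2} ==> \<beta> j \<nu> \<in> Q"
  and a: "!!x y. [| x \<in> Hs; y \<in> Hs; x \<in> Q; y \<in> Q |] ==> x .+ y \<in> Q"
  and m: "!!c x. [| c \<in> Z; x \<in> Hs; x \<in> Q |] ==> c .* x \<in> Q"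
 shows "v \<in> Q"
proof -
 obtain zz where zz: "v = lc zz" "!!j \<nu>. zz j \<nu> \<in> Z" using v by (auto simp: Hs_iff)
 have "finsum R (%(j, \<nu>). zz j \<nu> .* \<beta> j \<nu>) S \<in> Hs \<inter> Q" if "finite S" "S \<subseteq> idx" for S
  using that
 proof (induction S rule: finite_induct)
  case empty
  then show ?case using Hs_zero z by simp
 next
  case (insert p S)
  obtain j \<nu> where p: "p = (j, \<nu>)" by (cases p)
  have jn: "j \<in> {1..<n}" "\<nu> \<in> {1, 2}" using insert.prems p by auto
  have f: "(%(j, \<nu>). zz j \<nu> .* \<beta> j \<nu>) \<in> S \<rightarrow> carrier R" using insert.prems Z_carrier[OF zz(2)] by fastforce
  have s: "finsum R (%(j, \<nu>). zz j \<nu> .* \<beta> j \<nu>) (insert p S) = zz j \<nu> .* \<beta> j \<nu> .+ finsum R (%(j, \<nu>). zz j \<nu> .* \<beta> j \<nu>) S"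
   using insert.hyps f Z_carrier[OF zz(2)] jn by (subst finsum_insert) (auto simp: p)
  have t: "zz j \<nu> .* \<beta> j \<nu> \<in> Hs" "zz j \<nu> .* \<beta> j \<nu> \<in> Q"
   using Hs_mult[OF zz(2) Hs_beta[OF jn]] m[OF zz(2) Hs_beta[OF jn] b[OF jn]] by auto
  show ?case unfolding s using insert.IH insert.prems Hs_add[OF t(1)] a[OF t(1) _ t(2)] by auto
 qed
 from this[of idx] show ?thesis unfolding zz(1) lc_def by simp
qed

lemma Hs_acomm: assumes v: "v \<in> Hs" and w: "w \<in> Hs" shows "v .* w .+ w .* v \<in> Z"
proof -
 have Zb: "c .* x = x .* c" if "c \<in> Z" "x \<in> Hs" for c x
 proof -
  have "x \<in> {x \<in> carrier R. c .* x = x .* c}"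
  proof (rule Hs_induct[OF that(2)])
   fix j \<nu> assume "j \<in> {1..<n}" "\<nu> \<in> {1, 2 :: nat}"
   then show "\<beta> j \<nu> \<in> {x \<in> carrier R. c .* x = x .* c}" using Z_comm_beta[OF that(1), of j \<nu>] by (simp add: sc_def)
  next
   fix d x assume d: "d \<in> Z" "x \<in> {x \<in> carrier R. c .* x = x .* c}"
   \<comment> \<open>Commutativity of the base ring: its generators are images of \<open>Z0\<close>
     and squares of the \<open>\<omega> j\<close>, and both kinds commute with
     \<open>c\<close>.\<close>
   have cd: "c .* d = d .* c"
    using subalg_commute[OF Zgens_carrier Z_carrier[OF that(1)] _ d(1)[unfolded Z_eq]]
     subalg_commute[OF Zgens_carrier _ _ that(1)[unfolded Z_eq]]
   proof -
    have "d .* c = c .* d"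
    proof (rule subalg_commute[OF Zgens_carrier Z_carrier[OF that(1)] _ d(1)[unfolded Z_eq]])
     fix s assume s: "s \<in> Zgens"
     then obtain j where j: "j \<in> I" "s \<in> f j ` Z0 \<union> {\<omega> j [^] (2::nat)}" by (auto simp: Zgens_def)
     then consider z where "z \<in> Z0" "s = f j z" | "s = \<omega> j .* \<omega> j" by (auto simp: pow_two)
     then have "sc False c s"
     proof cases
      case 1
      then show ?thesis using Z_comm_f[OF that(1) j(1)] Z0_carrier by simp
     next
      case 2
      then show ?thesis using sc_mult_r[OF Z_comm_\<omega>[OF that(1) j(1)] Z_comm_\<omega>[OF that(1) j(1)]] Z_carrier[OF that(1)] j by simp
     qed
     then show "s .* c = c .* s" by (simp add: sc_def)
    qed
    then show ?thesis by simp
   qed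
   have "c .* (d .* x) = (c .* d) .* x" using d Z_carrier[OF that(1)] Z_carrier[OF d(1)] by (simp add: m_assoc)
   also have "\<dots> = (d .* x) .* c" unfolding cd using d Z_carrier[OF that(1)] Z_carrier[OF d(1)] by (simp add: m_assoc)
   finally show "d .* x \<in> {x \<in> carrier R. c .* x = x .* c}" using d Z_carrier[OF d(1)] by simp
  qed (use Z_carrier[OF that(1)] in \<open>auto simp: l_distr r_distr\<close>)
  then show ?thesis by simp
 qed
 \<comment> \<open>Extension of the claim from the \<beta> to the span in one argument. It is
   applied once with a \<beta> as \<open>w\<close> and once with a general element of the
   span.\<close>
 have ind: "v \<in> {v \<in> carrier R. v .* w .+ w .* v \<in> Z}" if w: "w .: R" "!!c. c \<in> Z ==> c .* w = w .* c"
   and b: "!!j \<nu>. j \<in> {1..<n} ==> \<nu> \<in> {1, 2} ==> \<beta> j \<nu> .* w .+ w .* \<beta> j \<nu> \<in> Z" and v: "v \<in> Hs" for v w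
 proof (rule Hs_induct[OF v])
  fix x y assume "x \<in> {v \<in> carrier R. v .* w .+ w .* v \<in> Z}" "y \<in> {v \<in> carrier R. v .* w .+ w .* v \<in> Z}"
  then have xy: "x .: R" "y .: R" "(x .* w .+ w .* x) .+ (y .* w .+ w .* y) \<in> Z" using Z_closed(2) by auto
  have "(x .+ y) .* w .+ w .* (x .+ y) = (x .* w .+ w .* x) .+ (y .* w .+ w .* y)" using xy w by (simp add: l_distr r_distr a_ac)
  then show "x .+ y \<in> {v \<in> carrier R. v .* w .+ w .* v \<in> Z}" using xy by simp
 next
  fix c x assume c: "c \<in> Z" and "x \<in> {v \<in> carrier R. v .* w .+ w .* v \<in> Z}"
  then have x: "x .: R" "c .* (x .* w .+ w .* x) \<in> Z" using Z_closed(3) by auto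
  have "w .* (c .* x) = (c .* w) .* x" using x w Z_carrier[OF c] by (simp add: w(2)[OF c] m_assoc)
  then have "(c .* x) .* w .+ w .* (c .* x) = c .* (x .* w .+ w .* x)" using x w Z_carrier[OF c] by (simp add: r_distr m_assoc)
  then show "c .* x \<in> {v \<in> carrier R. v .* w .+ w .* v \<in> Z}" using x Z_carrier[OF c] by simp
 qed (use w b Z_closed(7) in auto)
 have wc: "w .: R" using w Hs_carrier by auto
 have "v \<in> {v \<in> carrier R. v .* w .+ w .* v \<in> Z}"
 proof (rule ind[OF wc Zb[OF _ w] _ v])
  fix j \<nu> assume j: "j \<in> {1..<n}" "\<nu> \<in> {1, 2 :: nat}"
  have "w \<in> {v \<in> carrier R. v .* \<beta> j \<nu> .+ \<beta> j \<nu> .* v \<in> Z}"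
   by (rule ind[OF beta_closed[OF j(1)] Zb[OF _ Hs_beta[OF j]] beta_acomm_Z[OF _ j(1)] w])
  then show "\<beta> j \<nu> .* w .+ w .* \<beta> j \<nu> \<in> Z" using wc j by (simp add: a_comm)
 qed
 then show ?thesis by simp
qed

end

section \<open>The coproduct\<close>

declare add_2_eq_Suc [simp del] add_2_eq_Suc' [simp del]

interpretation TU: tensor_power UQ n for n :: nat
 by (intro tensor_power.intro UQ.calg_self)

lemma commuting_homsI:
 assumes A: "calg A" and B: "calg B" and h: "!!j. j \<in> {1..n} ==> f j \<in> chom A B"
  and c: "!!i j x y. [| i \<in> {1..n}; j \<in> {1..n}; i < j; x .: A; y .: A |] ==> f i x .*~B f j y = f j y .*~B f i x"
 shows "commuting_homs A n B f"
proof (intro commuting_homs.intro tensor_power.intro commuting_homs_axioms.intro A B h)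
 fix i j x y assume a: "i \<in> {1..n}" "j \<in> {1..n}" "i \<noteq> j" "x .: A" "y .: A"
 show "f i x .*~B f j y = f j y .*~B f i x"
 proof (cases "i < j")
  case True
  then show ?thesis using c a by simp
 next
  case False
  then show ?thesis using c[of j i y x] a by simp
 qed
qed

lemma commuting_homs_fac: "commuting_homs UQ n (UQn n) (fac n)"
 by (rule commuting_homsI[OF UQ.calg_self TU.TP_calg TU.in_factor_hom TU.in_factor_commute]) auto

text \<open>In the mixed terms \<open>k2\<close> passes \<open>e2\<close> or \<open>g2\<close> with
  a sign, so they cancel in the anticommutator. What remains is 2 (k2^2 - 1) + 2 (k1^2 - 1) k2^2 = 2
  (k1^2 k2^2 - 1).\<close>

lemma (in ring) coproduct_triple:
 assumes 1: "utriple R e1 g1 k1 l1" and 2: "utriple R e2 g2 k2 l2"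
  and c: "!!x y. x \<in> {e1, g1, k1, l1} ==> y \<in> {e2, g2, k2, l2} ==> x .* y = y .* x"
 shows "utriple R (e2 .+ e1 .* k2) (g2 .+ g1 .* k2) (k1 .* k2) (l1 .* l2)"
proof -
 note t1 = utripleD[OF 1] and t2 = utripleD[OF 2]
 note cl = t1(1-4) t2(1-4)
 have s: "sc False x y" "sc False y x" if "x \<in> {e1, g1, k1, l1}" "y \<in> {e2, g2, k2, l2}" for x y
  using c[OF that] by (simp_all add: sc_def)
 have anti: "sc True (k1 .* k2) (x2 .+ x1 .* k2)"
  if x: "x1 \<in> {e1, g1}" "x2 \<in> {e2, g2}" "sc True k1 x1" "sc True k2 x2" for x1 x2
 proof -
  have xc: "x1 .: R" "x2 .: R" using x cl by auto
  have a: "sc (False \<noteq> True) (k1 .* k2) x2" by (rule sc_mult_l[OF s(1) x(4)]) (use x cl xc in auto)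
  have b: "sc (True \<noteq> False) (k1 .* k2) x1" by (rule sc_mult_l[OF x(3) s(2)]) (use x cl xc in auto)
  have d: "sc (False \<noteq> False) (k1 .* k2) k2" by (rule sc_mult_l[OF s(1)]) (use cl in \<open>auto simp: sc_def\<close>)
  have "sc ((True \<noteq> False) \<noteq> (False \<noteq> False)) (k1 .* k2) (x1 .* k2)" by (rule sc_mult_r[OF b d]) (use cl xc in auto)
  then show ?thesis using sc_add_r[of True "k1 .* k2" x2 "x1 .* k2"] a cl xc by simp
 qed
 have e: "(k1 .* k2) .* (e2 .+ e1 .* k2) = .- ((e2 .+ e1 .* k2) .* (k1 .* k2))"
  using anti[of e1 e2] t1(7) t2(7) by (simp add: sc_def)
 have g: "(k1 .* k2) .* (g2 .+ g1 .* k2) = .- ((g2 .+ g1 .* k2) .* (k1 .* k2))"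
  using anti[of g1 g2] t1(8) t2(8) by (simp add: sc_def)
 have q: "a .* b .* (a' .* b') = (a .* a') .* (b .* b')" if "a' \<in> {e1, g1, k1, l1}" "b \<in> {e2, g2, k2, l2}" "a .: R" "b' .: R" for a b a' b'
 proof -
  have cc: "a' .: R" "b .: R" using that cl by auto
  have "b .* (a' .* b') = a' .* (b .* b')" using that(4) cc c[OF that(1,2)] by (simp add: m_assoc[symmetric])
  then show ?thesis using that(3,4) cc by (simp add: m_assoc)
 qed
 have kl: "k1 .* k2 .* (l1 .* l2) = \<one>" "l1 .* l2 .* (k1 .* k2) = \<one>"
  using q[of l1 k2 k1 l2] q[of k1 l2 l1 k2] cl t1 t2 by simp_all
 have kk: "k1 .* k2 .* (k1 .* k2) = (k1 .* k1) .* (k2 .* k2)" using q[of k1 k2 k1 k2] cl by simp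
 have m: "e1 .* k2 .* (g1 .* k2) = (e1 .* g1) .* (k2 .* k2)" "g1 .* k2 .* (e1 .* k2) = (g1 .* e1) .* (k2 .* k2)"
  using q[of g1 k2 e1 k2] q[of e1 k2 g1 k2] cl by simp_all
 have x1: "e2 .* (g1 .* k2) .+ g1 .* k2 .* e2 = \<zero>" "e1 .* k2 .* g2 .+ g2 .* (e1 .* k2) = \<zero>"
 proof -
  have "e2 .* (g1 .* k2) = g1 .* (e2 .* k2)" using c[of g1 e2] cl by (simp add: m_assoc[symmetric])
  then show "e2 .* (g1 .* k2) .+ g1 .* k2 .* e2 = \<zero>" using cl t2(7) by (simp add: m_assoc r_distr[symmetric] r_neg)
  have "g2 .* (e1 .* k2) = e1 .* (g2 .* k2)" using c[of e1 g2] cl by (simp add: m_assoc[symmetric])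
  then show "e1 .* k2 .* g2 .+ g2 .* (e1 .* k2) = \<zero>" using cl t2(8) by (simp add: m_assoc r_distr[symmetric] l_neg)
 qed
 let ?K = "k2 .* k2" and ?L = "k1 .* k1"
 have Kc: "?K .: R" "?L .: R" using cl by auto
 have "(e2 .+ e1 .* k2) .* (g2 .+ g1 .* k2) .+ (g2 .+ g1 .* k2) .* (e2 .+ e1 .* k2)
  = (e2 .* g2 .+ g2 .* e2) .+ (e1 .* g1 .+ g1 .* e1) .* ?K
   .+ ((e2 .* (g1 .* k2) .+ g1 .* k2 .* e2) .+ (e1 .* k2 .* g2 .+ g2 .* (e1 .* k2)))"
  using cl m by (simp add: l_distr r_distr a_ac)
 also have "\<dots> = ((?K .- \<one>) .+ (?K .- \<one>)) .+ ((?L .- \<one>) .+ (?L .- \<one>)) .* ?K"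
  unfolding x1 t2(9) t1(9) using cl by simp
 also have "\<dots> = (?L .* ?K .- \<one>) .+ (?L .* ?K .- \<one>)"
 proof -
  have "(?K .- \<one>) .+ (?L .- \<one>) .* ?K = ?L .* ?K .- \<one>"
  proof -
   have "x .+ (y .+ (.- x .+ z)) = y .+ z" if "x .: R" "y .: R" "z .: R" for x y z
    using a_lcomm[of x y ".- x .+ z"] that by (simp add: r_neg2)
   from this[of ?K ".- \<one>" "?L .* ?K"] show ?thesis using Kc by (simp add: a_minus_def l_distr l_minus a_ac)
  qed
  moreover have "((?K .- \<one>) .+ (?K .- \<one>)) .+ ((?L .- \<one>) .+ (?L .- \<one>)) .* ?K = ((?K .- \<one>) .+ (?L .- \<one>) .* ?K) .+ ((?K .- \<one>) .+ (?L .- \<one>) .* ?K)"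
   using Kc by (simp add: l_distr a_ac)
  ultimately show ?thesis by simp
 qed
 finally show ?thesis unfolding utriple_def kk using cl kl e g by simp
qed

text \<open>On iKF the coproduct has the same shape as on E, so both generators can be treated alike
  from here on. The value that the definition prescribes on F is recovered from it.\<close>

lemma coproduct_spec:
 shows coproduct_hom: "coproduct \<in> chom UQ (UQn 2)"
  and coproduct_gens: "coproduct qE = fac 2 2 qE .+~(UQn 2) (fac 2 1 qE .*~(UQn 2) fac 2 2 qK)"
   "coproduct qFt = fac 2 2 qFt .+~(UQn 2) (fac 2 1 qFt .*~(UQn 2) fac 2 2 qK)"
   "coproduct qK = fac 2 1 qK .*~(UQn 2) fac 2 2 qK"
proof -
 have I: "(1::nat) \<in> {1..2}" "(2::nat) \<in> {1..2}" by auto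
 note f1 = TU.in_factor_hom[OF I(1)] and f2 = TU.in_factor_hom[OF I(2)]
 note h1 = chomD[OF f1] and h2 = chomD[OF f2]
 have c: "fac 2 1 x .*~(UQn 2) fac 2 2 y = fac 2 2 y .*~(UQn 2) fac 2 1 x" if "x .: UQ" "y .: UQ" for x y
  by (rule TU.in_factor_commute[OF I _ that]) simp
 note t = TU.TP.coproduct_triple[OF utriple_hom[OF UQ_triple f1 UQ.calg_self TU.TP.calg_self] utriple_hom[OF UQ_triple f2 UQ.calg_self TU.TP.calg_self]]
 have "\<exists>h\<in>chom UQ (UQn 2). h qE = fac 2 2 qE .+~(UQn 2) (fac 2 1 qE .*~(UQn 2) fac 2 2 qK)
  \<and> h qFt = fac 2 2 qFt .+~(UQn 2) (fac 2 1 qFt .*~(UQn 2) fac 2 2 qK) \<and> h qK = fac 2 1 qK .*~(UQn 2) fac 2 2 qK \<and> h qKinv = fac 2 1 qKinv .*~(UQn 2) fac 2 2 qKinv"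
  by (rule UQ_lift_triple[OF TU.TP.calg_self t]) (auto simp: c)
 then obtain h where h: "h \<in> chom UQ (UQn 2)" and hE: "h qE = fac 2 2 qE .+~(UQn 2) (fac 2 1 qE .*~(UQn 2) fac 2 2 qK)"
  and hG: "h qFt = fac 2 2 qFt .+~(UQn 2) (fac 2 1 qFt .*~(UQn 2) fac 2 2 qK)" and hK: "h qK = fac 2 1 qK .*~(UQn 2) fac 2 2 qK" and hL: "h qKinv = fac 2 1 qKinv .*~(UQn 2) fac 2 2 qKinv"
  by (elim bexE conjE)
 have hF: "h qF = (fac 2 1 qKinv .*~(UQn 2) fac 2 2 qF) .+~(UQn 2) fac 2 1 qF"
 proof -
  have cl: "fac 2 j x .: (UQn 2)" if "j \<in> {1, 2}" "x .: UQ" for j x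
   using that h1(1) h2(1) by auto
  have kk: "fac 2 2 qKinv .*~(UQn 2) fac 2 2 qK = \<one>~(UQn 2)" using h2(2)[of qKinv qK] h2(4) by (simp add: UQ_rels)
  have "fac 2 1 qKinv .*~(UQn 2) fac 2 2 qKinv .*~(UQn 2) (fac 2 1 qFt .*~(UQn 2) fac 2 2 qK)
   = fac 2 1 qKinv .*~(UQn 2) (fac 2 2 qKinv .*~(UQn 2) fac 2 1 qFt) .*~(UQn 2) fac 2 2 qK" using cl by (simp add: TU.TP.m_assoc)
  also have "\<dots> = fac 2 1 qKinv .*~(UQn 2) fac 2 1 qFt"
   using cl kk by (simp add: c[symmetric] TU.TP.m_assoc)
  finally have m: "fac 2 1 qKinv .*~(UQn 2) fac 2 2 qKinv .*~(UQn 2) (fac 2 1 qFt .*~(UQn 2) fac 2 2 qK) = fac 2 1 qKinv .*~(UQn 2) fac 2 1 qFt" .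
  have "h qF = (- \<i>) *.~(UQn 2) (fac 2 1 qKinv .*~(UQn 2) fac 2 2 qKinv .*~(UQn 2) (fac 2 2 qFt .+~(UQn 2) (fac 2 1 qFt .*~(UQn 2) fac 2 2 qK)))"
   by (simp add: qF_eq chomD[OF h] hL hG)
  also have "\<dots> = (- \<i>) *.~(UQn 2) (fac 2 1 qKinv .*~(UQn 2) (fac 2 2 qKinv .*~(UQn 2) fac 2 2 qFt)) .+~(UQn 2) (- \<i>) *.~(UQn 2) (fac 2 1 qKinv .*~(UQn 2) fac 2 1 qFt)"
   using cl m by (simp add: TU.TP.r_distr TU.TP.csmult TU.TP.m_assoc)
  finally show ?thesis using cl by (simp add: qF_eq h1 h2 TU.TP.csmult)
 qed
 let ?Q = "%h. h \<in> alg_hom UQ (UQn 2) \<and>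
   h qE = fac 2 2 qE .+~(UQn 2) (fac 2 1 qE .*~(UQn 2) fac 2 2 qK) \<and>
   h qF = (fac 2 1 qKinv .*~(UQn 2) fac 2 2 qF) .+~(UQn 2) fac 2 1 qF \<and>
   h qK = fac 2 1 qK .*~(UQn 2) fac 2 2 qK"
 have Q: "?Q (restrict h (carrier UQ))" using chom_restrict[OF h UQ.calg_self] hE hF hK by simp
 have uniq: "h' = restrict h (carrier UQ)" if q: "?Q h'" for h'
 proof (rule extensionalityI)
  show "h' \<in> extensional (carrier UQ)" using q by (auto simp: alg_hom_iff)
  show "h' x = restrict h (carrier UQ) x" if "x .: UQ" for x
   using UQ_hom_eq[OF TU.TP.calg_self _ h _ _ _ that, of h'] q hE hF hK that by (simp add: alg_hom_iff)
 qed simp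
 have cp: "coproduct = restrict h (carrier UQ)" unfolding coproduct_def by (rule the_equality[of ?Q, OF Q uniq])
 then show "coproduct \<in> chom UQ (UQn 2)" using Q by (simp add: alg_hom_iff)
 have "coproduct u = h u" if "u .: UQ" for u using that by (simp add: cp)
 then show "coproduct qE = fac 2 2 qE .+~(UQn 2) (fac 2 1 qE .*~(UQn 2) fac 2 2 qK)"
   "coproduct qFt = fac 2 2 qFt .+~(UQn 2) (fac 2 1 qFt .*~(UQn 2) fac 2 2 qK)"
   "coproduct qK = fac 2 1 qK .*~(UQn 2) fac 2 2 qK"
  using hE hG hK by simp_all
qed

lemma tensor_lift_commute:
 assumes h: "commuting_homs UQ n B f" and y: "y .: B"
  and c: "!!j x. [| j \<in> {1..n}; x .: UQ |] ==> f j x .*~B y = y .*~B f j x" and u: "u .: (UQn n)"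
 shows "tensor_lift n UQ B f u .*~B y = y .*~B tensor_lift n UQ B f u"
proof -
 interpret F: commuting_homs UQ n B f by (rule h)
 note hs = chomD[OF F.tensor_lift_hom]
 note cl = hs(1)
 from u show ?thesis
 proof (induction rule: TU.TP_induct)
  case (gen j x)
  then show ?case using c by (simp add: F.tensor_lift_in_factor)
 next
  case (mult a b)
  let ?a = "tensor_lift n UQ B f a" and ?b = "tensor_lift n UQ B f b"
  have ab: "?a .: B" "?b .: B" using mult cl by blast+
  have "?a .*~B ?b .*~B y = ?a .*~B (y .*~B ?b)" using mult ab y by (simp add: F.B.m_assoc)
  also have "\<dots> = (y .*~B ?a) .*~B ?b" using mult ab y by (simp add: F.B.m_assoc[symmetric])
  finally show ?case using mult ab y by (simp add: hs F.B.m_assoc)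
 qed (use y hs in \<open>simp_all add: F.B.l_distr F.B.r_distr F.B.csmult\<close>)
qed

lemma commuting_homs_mono:
 assumes "commuting_homs UQ n B f" "m \<le> n" shows "commuting_homs UQ m B f"
proof -
 interpret F: commuting_homs UQ n B f by fact
 show ?thesis using assms(2) by (intro commuting_homsI UQ.calg_self F.B.calg_self F.f_hom F.f_comm) auto
qed

text \<open>That the two maps in the recursion commute needs the homomorphism property at
  \<open>m\<close>, and the homomorphism property at \<open>m + 1\<close> needs that commutation.
  The local fact \<open>step\<close> breaks the circle and is used again at the end.\<close>

lemma coproduct_upto_hom: "coproduct_upto m \<in> chom UQ (UQn (m + 1))"
 and coproduct_upto_comm: "commuting_homs UQ 2 (UQn (m + 2))
   (%k. if k = 1 then tensor_lift (m + 1) UQ (UQn (m + 2)) (fac (m + 2)) \<circ> coproduct_upto m else fac (m + 2) (m + 2))"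
proof -
 have step: "commuting_homs UQ 2 (UQn (m + 2))
   (%k. if k = 1 then tensor_lift (m + 1) UQ (UQn (m + 2)) (fac (m + 2)) \<circ> coproduct_upto m else fac (m + 2) (m + 2))"
  if h: "coproduct_upto m \<in> chom UQ (UQn (m + 1))" for m
 proof (rule commuting_homsI[OF UQ.calg_self TU.TP_calg])
  let ?n = "m + 2"
  have c: "commuting_homs UQ (m + 1) (UQn ?n) (fac ?n)" by (rule commuting_homs_mono[OF commuting_homs_fac]) simp
  interpret F: commuting_homs UQ "m + 1" "UQn ?n" "fac ?n" by (rule c)
  have hh: "tensor_lift (m + 1) UQ (UQn ?n) (fac ?n) \<circ> coproduct_upto m \<in> chom UQ (UQn ?n)" by (rule kalg_hom_comp[OF h F.tensor_lift_hom])
  have fh: "fac ?n ?n \<in> chom UQ (UQn ?n)" by (rule TU.in_factor_hom) simp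
  show "(if k = 1 then tensor_lift (m + 1) UQ (UQn ?n) (fac ?n) \<circ> coproduct_upto m else fac ?n ?n) \<in> chom UQ (UQn ?n)" for k
   using hh fh by simp
  fix i j x y assume a: "i \<in> {1..2::nat}" "j \<in> {1..2}" "i < j" "x .: UQ" "y .: UQ"
  then have ij: "i = 1" "j \<noteq> 1" by auto
  have "tensor_lift (m + 1) UQ (UQn ?n) (fac ?n) (coproduct_upto m x) .*~(UQn ?n) fac ?n ?n y = fac ?n ?n y .*~(UQn ?n) tensor_lift (m + 1) UQ (UQn ?n) (fac ?n) (coproduct_upto m x)"
   by (rule tensor_lift_commute[OF c chomD(1)[OF fh a(5)] TU.in_factor_commute chomD(1)[OF h a(4)]]) (use a in auto)
  then show "(if i = 1 then tensor_lift (m + 1) UQ (UQn ?n) (fac ?n) \<circ> coproduct_upto m else fac ?n ?n) x .*~(UQn ?n) (if j = 1 then tensor_lift (m + 1) UQ (UQn ?n) (fac ?n) \<circ> coproduct_upto m else fac ?n ?n) y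
   = (if j = 1 then tensor_lift (m + 1) UQ (UQn ?n) (fac ?n) \<circ> coproduct_upto m else fac ?n ?n) y .*~(UQn ?n) (if i = 1 then tensor_lift (m + 1) UQ (UQn ?n) (fac ?n) \<circ> coproduct_upto m else fac ?n ?n) x"
   using ij by simp
 qed
 show h: "coproduct_upto m \<in> chom UQ (UQn (m + 1))" for m
 proof (induction m)
  case 0
  then show ?case using TU.in_factor_hom[of 1 1] by simp
 next
  case (Suc m)
  interpret F: commuting_homs UQ 2 "UQn (m + 2)" "%k. if k = 1 then tensor_lift (m + 1) UQ (UQn (m + 2)) (fac (m + 2)) \<circ> coproduct_upto m else fac (m + 2) (m + 2)"
   by (rule step[OF Suc])
  have "Suc m + 1 = m + 2" by simp
  then show ?case using kalg_hom_comp[OF coproduct_hom F.tensor_lift_hom] by (simp only: o_def coproduct_upto.simps)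
 qed
 show "commuting_homs UQ 2 (UQn (m + 2))
   (%k. if k = 1 then tensor_lift (m + 1) UQ (UQn (m + 2)) (fac (m + 2)) \<circ> coproduct_upto m else fac (m + 2) (m + 2))" by (rule step[OF h])
qed

text \<open>\<open>g\<close> restricts to the partial coproduct on the first factor and to the last
  \<open>f\<close> on the second. The recursion for \<open>coproduct_upto\<close> thus becomes a
  recursion inside \<open>B\<close>, with no computation in tensor powers.\<close>

lemma tensor_lift_coproduct_upto:
 assumes h: "commuting_homs UQ (m + 2) B f" and u: "u .: UQ"
 defines "d \<equiv> %m u. tensor_lift (m + 1) UQ B f (coproduct_upto m u)"
 shows "\<exists>g\<in>chom (UQn 2) B. (\<forall>x\<in>carrier UQ. g (fac 2 1 x) = d m x \<and> g (fac 2 2 x) = f (m + 2) x) \<and> (\<forall>u\<in>carrier UQ. d (Suc m) u = g (coproduct u))"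
proof -
 interpret F: commuting_homs UQ "m + 2" B f by (rule h)
 have h1: "commuting_homs UQ (m + 1) B f" by (rule commuting_homs_mono[OF h]) simp
 interpret F1: commuting_homs UQ "m + 1" B f by (rule h1)
 let ?G = "%k::nat. if k = 1 then tensor_lift (m + 1) UQ (UQn (m + 2)) (fac (m + 2)) \<circ> coproduct_upto m else fac (m + 2) (m + 2)"
 interpret G: commuting_homs UQ 2 "UQn (m + 2)" ?G by (rule coproduct_upto_comm)
 have c: "commuting_homs UQ (m + 1) (UQn (m + 2)) (fac (m + 2))" by (rule commuting_homs_mono[OF commuting_homs_fac]) simp
 interpret C: commuting_homs UQ "m + 1" "UQn (m + 2)" "fac (m + 2)" by (rule c)
 let ?g = "tensor_lift (m + 2) UQ B f \<circ> tensor_lift 2 UQ (UQn (m + 2)) ?G"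
 have g: "?g \<in> chom (UQn 2) B" by (rule kalg_hom_comp[OF G.tensor_lift_hom F.tensor_lift_hom])
 \<comment> \<open>Embedding into \<open>m + 2\<close> factors before lifting changes nothing, since
   both maps agree on each of the first \<open>m + 1\<close> factors.\<close>
 have e: "tensor_lift (m + 2) UQ B f (tensor_lift (m + 1) UQ (UQn (m + 2)) (fac (m + 2)) w) = tensor_lift (m + 1) UQ B f w" if w: "w .: (UQn (m + 1))" for w
 proof -
  have "(tensor_lift (m + 2) UQ B f \<circ> tensor_lift (m + 1) UQ (UQn (m + 2)) (fac (m + 2))) w = tensor_lift (m + 1) UQ B f w"
   by (rule TU.TP_hom_eq[OF F.B.calg_self kalg_hom_comp[OF C.tensor_lift_hom F.tensor_lift_hom] F1.tensor_lift_hom _ w])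
    (simp add: C.tensor_lift_in_factor F.tensor_lift_in_factor F1.tensor_lift_in_factor)
  then show ?thesis by simp
 qed
 have 1: "?g (fac 2 1 x) = d m x" "?g (fac 2 2 x) = f (m + 2) x" if "x .: UQ" for x
 proof -
  have "tensor_lift 2 UQ (UQn (m + 2)) ?G (fac 2 1 x) = ?G 1 x" by (rule G.tensor_lift_in_factor[OF _ that]) simp
  then show "?g (fac 2 1 x) = d m x" using e[OF chomD(1)[OF coproduct_upto_hom that]] by (simp add: d_def)
  have "tensor_lift 2 UQ (UQn (m + 2)) ?G (fac 2 2 x) = ?G 2 x" by (rule G.tensor_lift_in_factor[OF _ that]) simp
  then show "?g (fac 2 2 x) = f (m + 2) x" using F.tensor_lift_in_factor[of "m + 2" x] that by simp
 qed
 show ?thesis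
 proof (intro bexI[of _ ?g] conjI ballI)
  have "Suc m + 1 = m + 2" by simp
  then show "d (Suc m) u = ?g (coproduct u)" for u by (simp only: d_def o_def coproduct_upto.simps)
 qed (use 1 g in auto)
qed

section \<open>The iterated coproduct and supercommutation\<close>

context urep
begin

lemma f_commuting: "commuting_homs UQ n R f"
 by (rule commuting_homsI[OF UQ.calg_self calg_self f_hom f_comm]) auto

definition "\<Delta> m u = tensor_lift (m + 1) UQ R f (coproduct_upto m u)"

lemma \<Delta>_hom: assumes "m < n" shows "\<Delta> m \<in> chom UQ R"
proof -
 interpret F: commuting_homs UQ "m + 1" R f by (rule commuting_homs_mono[OF f_commuting]) (use assms in simp)
 show ?thesis using kalg_hom_comp[OF coproduct_upto_hom[of m] F.tensor_lift_hom] by (simp add: o_def \<Delta>_def[abs_def])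
qed

text \<open>\<open>\<Delta> m\<close> involves the first \<open>m + 1\<close> factors;
  multiplication by the K of the remaining ones completes each summand to the form it has in
  \<open>eps\<close>. The prefix index is \<open>m + 2\<close> because \<open>Kp j\<close> stops
  before \<open>j\<close>.\<close>

lemma \<Delta>_gens: "m < n ==> \<Delta> m (gx \<nu>) .* Ks (Suc m) = eps \<nu> (Suc m) \<and> \<Delta> m qK = Kp (Suc (Suc m))"
proof (induction m)
 case 0
 interpret F: commuting_homs UQ "1" R f by (rule commuting_homs_mono[OF f_commuting]) (use 0 in simp)
 have e: "\<Delta> 0 u = f 1 u" if "u .: UQ" for u using F.tensor_lift_in_factor[of 1 u] that by (simp add: \<Delta>_def)
 have I: "1 \<in> I" using 0 by simp
 have "Kp (Suc 1) = f 1 qK" using Kp_simps(2)[of 1] Kp_simps(1) I by simp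
 moreover have "eps \<nu> (Suc 0) = ee \<nu> (Suc 0)" using ee_closed[OF I, of \<nu>] by (simp add: One_nat_def)
 ultimately show ?case using e[of "gx \<nu>"] e[of qK] by (simp add: ee_def One_nat_def)
next
 case (Suc m)
 have c: "commuting_homs UQ (m + 2) R f" by (rule commuting_homs_mono[OF f_commuting]) (use Suc in simp)
 obtain g where g: "g \<in> chom (UQn 2) R" and g1: "\<forall>x\<in>carrier UQ. g (fac 2 1 x) = \<Delta> m x \<and> g (fac 2 2 x) = f (m + 2) x" and g2: "\<forall>u\<in>carrier UQ. \<Delta> (Suc m) u = g (coproduct u)"
  using tensor_lift_coproduct_upto[OF c UQ.one_closed, folded \<Delta>_def] by (elim bexE conjE)
 have mI: "Suc (Suc m) \<in> I" using Suc by simp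
 have IH: "\<Delta> m (gx \<nu>) .* Ks (Suc m) = eps \<nu> (Suc m)" "\<Delta> m qK = Kp (Suc (Suc m))" using Suc by auto
 note gs = chomD[OF g]
 have I: "(1::nat) \<in> {1..2}" "(2::nat) \<in> {1..2}" by auto
 note fcl = chomD(1)[OF TU.in_factor_hom[OF I(1)]] chomD(1)[OF TU.in_factor_hom[OF I(2)]]
 have gg: "g (fac 2 1 x) = \<Delta> m x" "g (fac 2 2 x) = f (Suc (Suc m)) x" if "x .: UQ" for x using g1 that by (auto simp: add_2_eq_Suc')
 have dc: "\<Delta> m (gx \<nu>) .: R" using chomD(1)[OF \<Delta>_hom] Suc by simp
 have Kc: "Ks (Suc (Suc m)) .: R" using Suc by simp
 have cg: "coproduct (gx \<nu>) = fac 2 2 (gx \<nu>) .+~(UQn 2) (fac 2 1 (gx \<nu>) .*~(UQn 2) fac 2 2 qK)"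
  by (simp add: gx_def coproduct_gens)
 have "\<Delta> (Suc m) (gx \<nu>) = f (Suc (Suc m)) (gx \<nu>) .+ \<Delta> m (gx \<nu>) .* f (Suc (Suc m)) qK"
  using g2 by (simp add: cg gs fcl gg)
 then have "\<Delta> (Suc m) (gx \<nu>) .* Ks (Suc (Suc m)) = ee \<nu> (Suc (Suc m)) .+ \<Delta> m (gx \<nu>) .* Ks (Suc m)"
  using mI dc Kc Ks_simps(2)[of "Suc m"] Suc.prems by (simp add: l_distr m_assoc ee_def)
 moreover have "\<Delta> (Suc m) qK = Kp (Suc (Suc (Suc m)))"
  using g2 mI Kp_simps(2)[of "Suc (Suc m)"] by (simp add: coproduct_gens gs fcl gg IH(2))
 ultimately show ?case using Suc.prems mI ee_closed[of "Suc (Suc m)" \<nu>] eps_closed[of "Suc m" \<nu>] by (simp add: IH(1) a_comm)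
qed

lemma \<Delta>_total: assumes "n \<ge> 1" shows "\<Delta> (n - 1) qE = eps 1 n" "\<Delta> (n - 1) qFt = eps 2 n" "\<Delta> (n - 1) qK = KK"
proof -
 have m: "n - 1 < n" "Suc (n - 1) = n" using assms by auto
 note d = \<Delta>_gens[OF m(1), unfolded m(2) Ks_simps(1)]
 have "\<Delta> (n - 1) (gx \<nu>) = eps \<nu> n" for \<nu> using d[of \<nu>] chomD(1)[OF \<Delta>_hom[OF m(1)], of "gx \<nu>"] by simp
 from this[of 1] this[of 2] show "\<Delta> (n - 1) qE = eps 1 n" "\<Delta> (n - 1) qFt = eps 2 n" by (simp_all add: gx_def)
 show "\<Delta> (n - 1) qK = KK" using d by simp
qed

text \<open>At \<open>k = n\<close> no contraction takes place, because \<open>j < n\<close>. The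
  full product of the K contains exactly one K that anticommutes with the generator in a given
  \<alpha>.\<close>

lemma beta_supercommute_gens:
 assumes j: "j \<in> {1..<n}"
 shows "sc False (\<beta> j \<nu>) (eps \<mu> n)" "sc True (\<beta> j \<nu>) KK"
proof -
 have "cb (\<beta> j \<nu>) (eps \<mu> n) = \<zero>" using cb_beta[OF j order_refl] j by simp
 then show "sc False (\<beta> j \<nu>) (eps \<mu> n)" using j by (simp add: cb_def sc_def)
 have a: "sc True KK (\<alpha> i \<nu>)" if i: "i \<in> I" for i
 proof -
  have 1: "sc (i < Suc n) KK (f i (gx \<nu>))" "sc False KK (\<omega> i)" using Kp_sc[OF i, of "Suc n" \<nu>] by auto
  have 2: "sc False KK (Kp i)" by (rule sc_sym[OF Kp_Kp[OF i]]) (use i in auto)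
  have "sc ((False \<noteq> True) \<noteq> False) KK (\<alpha> i \<nu>)" unfolding alpha_eq
   by (rule sc_mult_r[OF sc_mult_r[OF 2]]) (use 1 i in auto)
  then show ?thesis by simp
 qed
 have "KK .* \<beta> j \<nu> = .- (\<beta> j \<nu> .* KK)"
  using a[of j] a[of "j + 1"] j by (simp add: sc_def beta_def a_minus_def l_distr r_distr l_minus r_minus minus_add)
 then show "sc True (\<beta> j \<nu>) KK" using j by (simp add: sc_def)
qed

lemma q_homog_closed: "q_homog e u ==> u .: UQ"
 by (induction rule: q_homog.induct) auto

lemma sc_anti_inverse:
 assumes "sc True k x" "k .: R" "l .: R" "x .: R" "k .* l = \<one>" "l .* k = \<one>"
 shows "sc True l x"
 using anticomm_inverse[of k l x] assms by (simp add: sc_def)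

text \<open>\<open>d\<close> is the parity of \<open>y\<close>. Since E and iKF are even and K is
  odd, the hypotheses are the claim on generators, and the rest follows the inductive definition of
  \<open>q_homog\<close>.\<close>

lemma supercommute_coproduct:
 assumes n: "n \<ge> 1" and y: "y .: R" and g: "sc False y (eps 1 n)" "sc False y (eps 2 n)" "sc d y KK"
  and u: "q_homog e u"
 shows "sc (d \<and> e) y (\<Delta> (n - 1) u)"
proof -
 note D = chomD[OF \<Delta>_hom[of "n - 1"]] note Dc = D(1)[OF _ q_homog_closed]
 have m: "n - 1 < n" using n by simp
 note D = chomD[OF \<Delta>_hom[OF m]]
 note G = \<Delta>_total[OF n]
 have kl: "KK .* \<Delta> (n - 1) qKinv = \<one>" "\<Delta> (n - 1) qKinv .* KK = \<one>"
  using D(2)[of qK qKinv] D(2)[of qKinv qK] by (simp_all add: UQ_rels G D(4))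
 have lc: "\<Delta> (n - 1) qKinv .: R" using D(1) by simp
 from u show ?thesis
 proof (induction rule: q_homog.induct)
  case 4
  show ?case
  proof (cases d)
   case True
   then show ?thesis using sc_sym[OF sc_anti_inverse[OF sc_sym[OF _ y] _ lc y kl]] g(3) lc y by simp
  next
   case False
   then show ?thesis using sc_sym[OF sc_inverse[OF sc_sym[OF _ y] _ lc y kl]] g(3) lc y by simp
  qed
 next
  case (6 e u v)
  then have "sc (d \<and> e) y (\<Delta> (n - 1) u .+ \<Delta> (n - 1) v)" using q_homog_closed y D(1) by (intro sc_add_r) auto
  then show ?case using 6 q_homog_closed by (simp add: D)
 next
  case (7 e u c)
  then show ?case using q_homog_closed[OF 7(1)] D(1)[OF q_homog_closed[OF 7(1)]] y by (auto simp: D sc_def csmult)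
 next
  case (8 e u e' v)
  then have "sc ((d \<and> e) \<noteq> (d \<and> e')) y (\<Delta> (n - 1) u .* \<Delta> (n - 1) v)" using q_homog_closed y D(1) by (intro sc_mult_r) auto
  moreover have "((d \<and> e) \<noteq> (d \<and> e')) = (d \<and> (e \<noteq> e'))" by auto
  ultimately show ?case using 8 q_homog_closed by (simp add: D)
 qed (use g y in \<open>auto simp: G D(4) sc_def\<close>)
qed

lemma supercommute_Z: "n \<ge> 1 ==> z \<in> Z ==> q_homog e u ==> sc False z (\<Delta> (n - 1) u)"
 using supercommute_coproduct[of z False e u] Z_comm_eps[of z n] Z_comm_Kp[of z "Suc n"] Z_carrier by simp

lemma supercommute_Hs:
 assumes n: "n \<ge> 1" and v: "v \<in> Hs" and u: "q_homog e u"
 shows "sc e v (\<Delta> (n - 1) u)"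
proof -
 have m: "n - 1 < n" using n by simp
 have d: "\<Delta> (n - 1) u .: R" using chomD(1)[OF \<Delta>_hom[OF m] q_homog_closed[OF u]] .
 have "v \<in> {v. sc e v (\<Delta> (n - 1) u)}"
 proof (rule Hs_induct[OF v])
  show "\<beta> j \<nu> \<in> {v. sc e v (\<Delta> (n - 1) u)}" if j: "j \<in> {1..<n}" "\<nu> \<in> {1, 2 :: nat}" for j \<nu>
   using supercommute_coproduct[OF n beta_closed[OF j(1)] beta_supercommute_gens(1)[OF j(1)] beta_supercommute_gens(1)[OF j(1)] beta_supercommute_gens(2)[OF j(1)] u] by simp
  show "\<zero> \<in> {v. sc e v (\<Delta> (n - 1) u)}" using d by (simp add: sc_def)
  show "x .+ y \<in> {v. sc e v (\<Delta> (n - 1) u)}" if "x \<in> Hs" "y \<in> Hs" "x \<in> {v. sc e v (\<Delta> (n - 1) u)}" "y \<in> {v. sc e v (\<Delta> (n - 1) u)}" for x y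
   using sc_add_l[of e x _ y] that Hs_carrier d by auto
  show "c .* x \<in> {v. sc e v (\<Delta> (n - 1) u)}" if "c \<in> Z" "x \<in> Hs" "x \<in> {v. sc e v (\<Delta> (n - 1) u)}" for c x
   using sc_mult_l[OF supercommute_Z[OF n that(1) u], of e x] that Hs_carrier Z_carrier[OF that(1)] d by auto
 qed
 then show ?thesis by simp
qed

end

section \<open>The Clifford algebra in the localized tensor power\<close>

interpretation LQ: localization UQ qOmega
 by (intro localization.intro localization_axioms.intro UQ.calg_self qOmega_closed) (simp add: qOmega_central)

interpretation TL: tensor_power UQloc n for n :: nat
 by (intro tensor_power.intro LQ.LA_calg)

lemma atloc_hom: "j \<in> {1..n} ==> atloc n j \<in> chom UQ (UQlocn n)"
 using kalg_hom_comp[OF LQ.to_loc_hom TL.in_factor_hom, of j n] by (simp add: o_def atloc_def[abs_def])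

lemma atloc_Omega:
 assumes j: "j \<in> {1..n}"
 shows "atloc n j qOmega .*~(UQlocn n) in_factor n UQloc j LQ.ti = \<one>~(UQlocn n)"
  "in_factor n UQloc j LQ.ti .*~(UQlocn n) atloc n j qOmega = \<one>~(UQlocn n)"
  "in_factor n UQloc j LQ.ti .: (UQlocn n)"
proof -
 note h = chomD[OF TL.in_factor_hom[OF j]] and c = chomD(1)[OF LQ.to_loc_hom qOmega_closed]
 show "atloc n j qOmega .*~(UQlocn n) in_factor n UQloc j LQ.ti = \<one>~(UQlocn n)" "in_factor n UQloc j LQ.ti .*~(UQlocn n) atloc n j qOmega = \<one>~(UQlocn n)" 
  unfolding atloc_def h(2)[OF c LQ.ti_closed, symmetric] h(2)[OF LQ.ti_closed c, symmetric] LQ.ti_inverse h(4) by (rule refl)+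
 show "in_factor n UQloc j LQ.ti .: (UQlocn n)" by (rule h(1)[OF LQ.ti_closed])
qed

interpretation U: urep "UQlocn n" n "atloc n" for n :: nat
proof (intro urep.intro urep_axioms.intro TL.TP_calg atloc_hom)
 fix i j x y assume "i \<in> {1..n}" "j \<in> {1..n}" "i \<noteq> j" "x .: UQ" "y .: UQ"
 then show "atloc n i x .*~(UQlocn n) atloc n j y = atloc n j y .*~(UQlocn n) atloc n i x"
  unfolding atloc_def by (intro TL.in_factor_commute chomD(1)[OF LQ.to_loc_hom])
next
 fix j assume j: "j \<in> {1..n}"
 show "atloc n j qOmega \<in> Units (UQlocn n)"
  unfolding Units_def using atloc_Omega[OF j] chomD(1)[OF atloc_hom[OF j] qOmega_closed] by auto
qed

lemma atloc_inverse: assumes j: "j \<in> {1..n}" shows "U.\<omega> n j = in_factor n UQloc j LQ.ti"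
 unfolding U.\<omega>_def using atloc_Omega[OF j] chomD(1)[OF atloc_hom[OF j] qOmega_closed] by (intro TL.TP.inv_unique'[symmetric]) auto

text \<open>The locale \<open>urep\<close> gives commutation with the images of \<open>UQ\<close>
  and with the inverses of \<Omega>. In the localized tensor power these generate
  everything.\<close>

lemma Zn_central:
 assumes z: "z \<in> Zn n" and x: "x .: (UQlocn n)"
 shows "z .*~(UQlocn n) x = x .*~(UQlocn n) z"
proof -
 have z': "z \<in> base_ring (UQlocn n) (atloc n) n" using z by (simp add: Zn_def)
 have zc: "z .: (UQlocn n)" by (rule U.Z_carrier[OF z'])
 have "ring.sc (UQlocn n) False z x"
  using x
 proof (induction rule: TL.TP_induct)
  case (gen j a)
  note h = chomD[OF TL.in_factor_hom[OF gen(1)]]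
  from gen(2) show ?case
  proof (induction rule: LQ.LA_induct)
   case (base a)
   then show ?case using U.Z_comm_f[OF z' gen(1), of a] by (simp add: atloc_def)
  next
   case inverse
   then show ?case using U.Z_comm_\<omega>[OF z' gen(1)] by (simp add: atloc_inverse[OF gen(1)])
  next
   case (add x y)
   then show ?case using h(1)[OF add(1)] h(1)[OF add(2)] zc by (simp add: h(3)) (rule TL.TP.sc_add_r)
  next
   case (mult x y)
   then show ?case using h(1)[OF mult(1)] h(1)[OF mult(2)] zc TL.TP.sc_mult_r[of n False z _ False] by (simp add: h(2)) 
  qed
 next
  case (mult x y)
  then show ?case using zc TL.TP.sc_mult_r[of n False z x False y] by simp
 qed (use zc in \<open>simp_all add: TL.TP.sc_def TL.TP.l_distr TL.TP.r_distr TL.TP.csmult\<close>)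
 then show ?thesis by (simp add: TL.TP.sc_def)
qed

lemma (in calg) csmult_Units: assumes "c \<noteq> 0" "x \<in> Units A" shows "c *. x \<in> Units A"
proof -
 have x: "x .: A" "inv x .: A" "x .* inv x = \<one>" "inv x .* x = \<one>" using assms by auto
 then have "(c *. x) .* ((1 / c) *. inv x) = \<one>" "((1 / c) *. inv x) .* (c *. x) = \<one>" using assms(1) by (simp_all add: csmult)
 moreover have "(1 / c) *. inv x .: A" "c *. x .: A" using x by auto
 ultimately show ?thesis unfolding Units_def by blast
qed

lemma clifford_Cn: "is_clifford_algebra_on (UQlocn n) (Zn n) (Hn n) (Cn n)"
proof -
 let ?R = "UQlocn n"
 \<comment> \<open>\<open>k\<close> enumerates pairs of a block \<open>k div 2 + 1\<close> and a
   type, with even \<open>k\<close> for type 1. The contracting element has the opposite type, as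
   only opposite types have a nonzero commutator.\<close>
 let ?b = "%k. beta ?R (atloc n) (k div 2 + 1) (if even k then 1 else 2)"
 let ?e = "%k. U.eps n (if even k then 2 else 1) (k div 2 + 1)"
 let ?u = "%k. U.cc (if even k then 1 else 2) (if even k then 2 else 1) *.~?R K_prefix ?R (atloc n) (Suc n)"
 have idx: "k div 2 + 1 \<in> {1..<n}" "k div 2 + 1 \<le> n" if "k < 2 * (n - 1)" for k using that by auto
 interpret S: clifford_setup ?R "Zn n" "Hn n" "2 * (n - 1)" ?b ?e ?u "(1 / 2) *.~?R \<one>~?R"
 proof (intro clifford_setup.intro TL.TP.ring_axioms clifford_setup_axioms.intro)
  show "Zn n \<subseteq> carrier ?R" using U.Z_carrier by (auto simp: Zn_def)
  show "\<one>~?R \<in> Zn n" "!!x y. x \<in> Zn n ==> y \<in> Zn n ==> x .+~?R y \<in> Zn n"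
   "!!x y. x \<in> Zn n ==> y \<in> Zn n ==> x .*~?R y \<in> Zn n" "!!x. x \<in> Zn n ==> .-~?R x \<in> Zn n"
   unfolding Zn_def by (rule U.Z_closed; assumption?)+
  show "!!z x. z \<in> Zn n ==> x \<in> carrier ?R ==> z .*~?R x = x .*~?R z" by (rule Zn_central)
  show "(1 / 2) *.~?R \<one>~?R \<in> Zn n" unfolding Zn_def by (intro U.Z_closed)
  show "(1 / 2) *.~?R \<one>~?R .+~?R (1 / 2) *.~?R \<one>~?R = \<one>~?R"
   using TL.TP.csmult(1)[of "\<one>~?R" n "1/2" "1/2"] TL.TP.csmult(4)[of "\<one>~?R" n] by simp
  show "Hn n \<subseteq> carrier ?R" unfolding Hn_def by (rule U.Hs_carrier)
  show "!!x y. x \<in> Hn n ==> y \<in> Hn n ==> x .+~?R y \<in> Hn n" unfolding Hn_def by (rule U.Hs_add)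
  show "!!z x. z \<in> Zn n ==> x \<in> Hn n ==> z .*~?R x \<in> Hn n" unfolding Hn_def Zn_def by (rule U.Hs_mult)
  show "?b k \<in> Hn n" if "k < 2 * (n - 1)" for k unfolding Hn_def by (rule U.Hs_beta[OF idx(1)[OF that]]) simp
  show "\<zero>~?R \<in> Hn n" unfolding Hn_def by (rule U.Hs_zero)
  show "v .*~?R w .+~?R w .*~?R v \<in> Zn n" if "v \<in> Hn n" "w \<in> Hn n" for v w using that unfolding Hn_def Zn_def by (rule U.Hs_acomm)
  show "?e k \<in> carrier ?R" if "k < 2 * (n - 1)" for k by (rule U.eps_closed[OF idx(2)[OF that]])
  show "?b l .*~?R ?e k = ?e k .*~?R ?b l" if k: "k < 2 * (n - 1)" and l: "l < 2 * (n - 1)" and lk: "l \<noteq> k" for k l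
  proof -
   have "U.cb n (?b l) (?e k) = \<zero>~?R"
   proof (cases "l div 2 = k div 2")
    case True
    \<comment> \<open>Distinct indices in one block have distinct parity, so this \<beta> and the
      contracting element are of the same type and commute.\<close>
    then have "even l \<noteq> even k" using lk by (metis div_mult_mod_eq parity_cases)
    then have "U.cc (if even l then 1 else 2) (if even k then 2 else 1) = 0" by (auto simp: U.cc_def)
    then show ?thesis unfolding U.cb_beta[OF idx(1)[OF l] idx(2)[OF k]] using U.Kpc(3)[of n] by (simp add: TL.TP.csmult)
   next
    case False
    then show ?thesis unfolding U.cb_beta[OF idx(1)[OF l] idx(2)[OF k]] by simp
   qed
   then show ?thesis using U.beta_closed[OF idx(1)[OF l]] U.eps_closed[OF idx(2)[OF k]] by (simp add: U.cb_def)
  qed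
  show "?b k .*~?R ?e k .-~?R ?e k .*~?R ?b k = ?u k" if "k < 2 * (n - 1)" for k
   using U.cb_beta[OF idx(1)[OF that] idx(2)[OF that]] by (simp add: U.cb_def)
  show "?u k \<in> Units ?R" if "k < 2 * (n - 1)" for k
   by (rule TL.TP.csmult_Units[OF _ U.Kp_unit]) (auto simp: U.cc_def)
  show "Hn n \<subseteq> Q" if q: "\<zero>~?R \<in> Q" "!!k. k < 2 * (n - 1) ==> ?b k \<in> Q"
   "!!x y. [| x \<in> Hn n; y \<in> Hn n; x \<in> Q; y \<in> Q |] ==> x .+~?R y \<in> Q" "!!z x. [| z \<in> Zn n; x \<in> Hn n; x \<in> Q |] ==> z .*~?R x \<in> Q" for Q
  proof
   fix v assume "v \<in> Hn n"
   then have v: "v \<in> span_beta ?R (atloc n) n" by (simp add: Hn_def)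
   show "v \<in> Q"
   proof (rule U.Hs_induct[OF v q(1)])
    fix j \<nu> assume j: "j \<in> {1..<n}" "\<nu> \<in> {1, 2 :: nat}"
    \<comment> \<open>The inverse of the enumeration: the remainder \<open>\<nu> - 1\<close> is 0
      for type 1 and 1 for type 2.\<close>
    define k where "k = 2 * (j - 1) + (\<nu> - 1)"
    have jk: "k < 2 * (n - 1)" "k div 2 + 1 = j" "(if even k then 1 else 2) = \<nu>" using j by (auto simp: k_def)
    show "beta ?R (atloc n) j \<nu> \<in> Q" using q(2)[OF jk(1)] unfolding jk(2,3) .
   qed (use q(3,4) in \<open>unfold Hn_def Zn_def, blast+\<close>)
  qed
 qed
 have Cs: "Zn n \<union> Hn n \<subseteq> carrier ?R" using S.Zs(1) S.H(1) by auto
 show ?thesis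
 proof (rule S.clifford_iso)
  fix Q assume q: "!!x. x \<in> Zn n ==> x \<in> Q" "!!x. x \<in> Hn n ==> x \<in> Q" "!!x y. [| x \<in> Q; y \<in> Q |] ==> x .+~?R y \<in> Q"
   "!!x y. [| x \<in> Q; y \<in> Q |] ==> x .*~?R y \<in> Q" "Q \<subseteq> carrier ?R"
  show "Cn n \<subseteq> Q"
  proof
   fix x assume "x \<in> Cn n"
   then have "x \<in> subalg_gen ?R (Zn n \<union> Hn n)" by (simp add: Cn_def)
   then show "x \<in> Q"
   proof (induction rule: subalg_gen.induct)
    case (smult x c)
    have "c *.~?R \<one>~?R \<in> Q" by (rule q(1)) (unfold Zn_def, intro U.Z_closed)
    then have "(c *.~?R \<one>~?R) .*~?R x \<in> Q" using smult q(4) by simp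
    moreover have "x \<in> carrier ?R" using smult q(5) by auto
    ultimately show ?case by (simp add: TL.TP.csmult)
   qed (use q S.Zs(2) in auto)
  qed
 qed (unfold Cn_def, auto intro: subalg_gen.intros)
qed

lemma supercommute_Cn:
 assumes n: "n \<ge> 1" and c: "Cn_homog n d c" and u: "q_homog e u"
 shows "supercommute (UQlocn n) d e c (coproduct_loc n u)"
proof -
 have D: "coproduct_loc n u = U.\<Delta> n (n - 1) u" using n by (simp add: coproduct_loc_def U.\<Delta>_def)
 have m: "n - 1 < n" using n by simp
 have Dc: "coproduct_loc n u .: (UQlocn n)" unfolding D by (rule chomD(1)[OF U.\<Delta>_hom[OF m] U.q_homog_closed[OF u]])
 have "c .: (UQlocn n) \<and> ring.sc (UQlocn n) (d \<and> e) c (coproduct_loc n u)"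
  using c
 proof (induction rule: Cn_homog.induct)
  case (1 z)
  then have z: "z \<in> base_ring (UQlocn n) (atloc n) n" by (simp add: Zn_def)
  show ?case using U.supercommute_Z[OF n z u] U.Z_carrier[OF z] by (simp add: D)
 next
  case (2 v)
  then have v: "v \<in> span_beta (UQlocn n) (atloc n) n" by (simp add: Hn_def)
  show ?case using U.supercommute_Hs[OF n v u] U.Hs_carrier v by (auto simp: D)
 next
  case (3 d x y)
  then show ?case using TL.TP.sc_add_l[of n "d \<and> e" x "coproduct_loc n u" y] Dc by simp
 next
  case (4 d x d' y)
  have "((d \<and> e) \<noteq> (d' \<and> e)) = ((d \<noteq> d') \<and> e)" by auto
  then show ?case using 4 TL.TP.sc_mult_l[of n "d \<and> e" x "coproduct_loc n u" "d' \<and> e" y] Dc by simp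
 qed
 then show ?thesis by (simp add: supercommute_def TL.TP.sc_def)
qed

section \<open>Characters\<close>

lemma charD:
 assumes "ch \<in> characters"
 shows "ch \<one>~UQ = 1" "!!x y. [| x \<in> Z0; y \<in> Z0 |] ==> ch (x .+~UQ y) = ch x + ch y"
  "!!x y. [| x \<in> Z0; y \<in> Z0 |] ==> ch (x .*~UQ y) = ch x * ch y" "!!c x. x \<in> Z0 ==> ch (c *.~UQ x) = c * ch x"
  "!!x y. [| x \<in> Z0; y \<in> Z0 |] ==> ch (x .-~UQ y) = ch x - ch y"
proof -
 have h: "ch \<in> ring_hom (UQ\<lparr>carrier := Z0\<rparr>) complex_alg" "ch \<in> lin_hom (UQ\<lparr>carrier := Z0\<rparr>) complex_alg"
  using assms by (auto simp: characters_def alg_hom_def)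
 show 1: "ch \<one>~UQ = 1" "!!x y. [| x \<in> Z0; y \<in> Z0 |] ==> ch (x .+~UQ y) = ch x + ch y"
  "!!x y. [| x \<in> Z0; y \<in> Z0 |] ==> ch (x .*~UQ y) = ch x * ch y" "!!c x. x \<in> Z0 ==> ch (c *.~UQ x) = c * ch x"
  using h by (auto simp: ring_hom_def lin_hom_def)
 fix x y assume xy: "x \<in> Z0" "y \<in> Z0"
 have "x .-~UQ y = x .+~UQ (- 1) *.~UQ y" using xy Z0_carrier by (simp add: a_minus_def UQ.uminus_csmult)
 then show "ch (x .-~UQ y) = ch x - ch y" using xy 1 Z0_closed(4) by simp
qed

lemma char_values:
 assumes "ch \<in> characters"
 shows "ch (qK .*~UQ qK) = chi_kappa ch" "ch (qE .*~UQ qE) = chi_epsilon ch" "ch (qFt .*~UQ qFt) = chi_phi ch"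
  "chi_kappa ch \<noteq> 0" "ch (qKinv .*~UQ qKinv) = 1 / chi_kappa ch" "ch (qF .*~UQ qF) = chi_phi ch / chi_kappa ch"
  "chi_kappa ch * ch (qOmega .*~UQ qOmega) = (chi_kappa ch - 1)\<^sup>2 - chi_epsilon ch * chi_phi ch"
proof -
 note c = charD[OF assms]
 show K: "ch (qK .*~UQ qK) = chi_kappa ch" and E: "ch (qE .*~UQ qE) = chi_epsilon ch"
  by (simp_all add: chi_kappa_def chi_epsilon_def UQ.pow_two)
 show G: "ch (qFt .*~UQ qFt) = chi_phi ch" by (simp add: qFt_sq chi_phi_def UQ.pow_two c(3) Z0_sq K)
 have "qK .*~UQ qK .*~UQ (qKinv .*~UQ qKinv) = qK .*~UQ (qK .*~UQ qKinv) .*~UQ qKinv" by (simp add: UQ.m_assoc)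
 then have "qK .*~UQ qK .*~UQ (qKinv .*~UQ qKinv) = \<one>~UQ" by (simp add: UQ_rels)
 from arg_cong[OF this, of ch] have l: "chi_kappa ch * ch (qKinv .*~UQ qKinv) = 1"
  by (simp only: c(3)[OF Z0_sq(1,2)] c(1) K)
 then show k: "chi_kappa ch \<noteq> 0" by auto
 then show "ch (qKinv .*~UQ qKinv) = 1 / chi_kappa ch" using l by (simp add: field_simps)
 then show "ch (qF .*~UQ qF) = chi_phi ch / chi_kappa ch" unfolding qF_sq by (simp add: c(3) Z0_sq G)
 show "chi_kappa ch * ch (qOmega .*~UQ qOmega) = (chi_kappa ch - 1)\<^sup>2 - chi_epsilon ch * chi_phi ch"
  unfolding qOmega_sq using l by (simp add: c Z0_sq Z0_closed K E G power2_eq_square mult.assoc[symmetric])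
qed

text \<open>The three squares determine the other two: that of \<open>qKinv\<close> by inversion and
  that of \<open>qF\<close> by \<open>qF_sq\<close>. So finitely many equations decide whether a
  homomorphism is compatible with a character.\<close>

lemma Z0_scalar:
 assumes x: "ch \<in> characters" and B: "calg B" and g: "g \<in> chom UQ B"
  and s: "g qE .*~B g qE = chi_epsilon ch *.~B \<one>~B" "g qFt .*~B g qFt = chi_phi ch *.~B \<one>~B"
   "g qK .*~B g qK = chi_kappa ch *.~B \<one>~B"
  and z: "z \<in> Z0"
 shows "g z = ch z *.~B \<one>~B"
proof -
 interpret B: calg B by fact
 note gs = chomD[OF g] note c = charD[OF x] note v = char_values[OF x]
 have L: "g (qKinv .*~UQ qKinv) = (1 / chi_kappa ch) *.~B \<one>~B"
 proof -
  have a: "g (qKinv .*~UQ qKinv) .: B" by (rule gs(1)) simp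
  have "qK .*~UQ qK .*~UQ (qKinv .*~UQ qKinv) = qK .*~UQ (qK .*~UQ qKinv) .*~UQ qKinv" by (simp add: UQ.m_assoc)
  then have "qK .*~UQ qK .*~UQ (qKinv .*~UQ qKinv) = \<one>~UQ" by (simp add: UQ_rels)
  then have "g (qK .*~UQ qK) .*~B g (qKinv .*~UQ qKinv) = \<one>~B"
   using gs(2)[of "qK .*~UQ qK" "qKinv .*~UQ qKinv"] gs(4) by simp
  then have "chi_kappa ch *.~B g (qKinv .*~UQ qKinv) = \<one>~B" using a s(3) by (simp add: gs(2)[of qK qK] B.csmult)
  then have "(1 / chi_kappa ch) *.~B (chi_kappa ch *.~B g (qKinv .*~UQ qKinv)) = (1 / chi_kappa ch) *.~B \<one>~B" by simp
  then show ?thesis using a v(4) by (simp add: B.csmult)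
 qed
 have G: "g (qFt .*~UQ qFt) = chi_phi ch *.~B \<one>~B" using s(2) by (simp add: gs)
 have F: "g (qF .*~UQ qF) = (chi_phi ch / chi_kappa ch) *.~B \<one>~B"
  unfolding qF_sq using gs(2)[of "qKinv .*~UQ qKinv" "qFt .*~UQ qFt"] by (simp add: L G B.csmult)
 have "z \<in> subalg_gen UQ Z0gens" using z by (simp add: Z0_def)
 then have "z \<in> Z0 \<and> g z = ch z *.~B \<one>~B"
 proof (induction rule: subalg_gen.induct)
  case (incl x)
  then have "x = qK .*~UQ qK \<or> x = qKinv .*~UQ qKinv \<or> x = qE .*~UQ qE \<or> x = qF .*~UQ qF" by (auto simp: UQ.pow_two)
  then show ?case
  proof (elim disjE)
   assume "x = qK .*~UQ qK" then show ?thesis using s(3) Z0_sq by (simp add: gs v)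
  next
   assume "x = qKinv .*~UQ qKinv" then show ?thesis using L Z0_sq by (simp add: v)
  next
   assume "x = qE .*~UQ qE" then show ?thesis using s(1) Z0_sq by (simp add: gs v)
  next
   assume "x = qF .*~UQ qF" then show ?thesis using F Z0_sq by (simp add: v)
  qed
 next
  case one
  then show ?case using Z0_closed(1) by (simp add: gs(4) c(1) B.csmult)
 next
  case (add x y)
  then show ?case using Z0_closed(2)[of x y] Z0_carrier by (simp add: gs(3) c(2) B.csmult(1))
 next
  case (mult x y)
  then show ?case using Z0_closed(3)[of x y] Z0_carrier by (simp add: gs(2) c(3) B.csmult mult.commute)
 next
  case (smult x a)
  then show ?case using Z0_closed(4)[of x a] Z0_carrier by (simp add: gs(5) c(4) B.csmult)
 qed
 then show ?thesis by simp
qed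

locale char_quot =
 fixes n :: nat and \<rho> :: obj
 assumes obj: "\<rho> \<in> objects n"
begin

abbreviation "Q \<equiv> UQchar n \<rho>"
abbreviation "atq \<equiv> atchar n \<rho>"

lemma char: "j \<in> {1..n} ==> \<rho> j \<in> characters" using obj by (auto simp: objects_def)

lemma char_gens_carrier: "(\<Union>j\<in>{1..n}. fac n j ` {z \<in> Z0. \<rho> j z = 0}) \<subseteq> carrier (UQn n)"
proof -
 have "fac n j z .: (UQn n)" if "j \<in> {1..n}" "z \<in> Z0" for j z
  by (rule chomD(1)[OF TU.in_factor_hom[OF that(1)] Z0_carrier[OF that(2)]])
 then show ?thesis by auto
qed

lemma char_ideal_ideal: "ideal (char_ideal n \<rho>) (UQn n)"
 unfolding char_ideal_def by (rule TU.TP.genideal_ideal[OF char_gens_carrier])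

lemma Q_calg: "calg Q"
 unfolding UQchar_def by (intro calgI TU.TP.quot_alg_kalg char_ideal_ideal)

sublocale Q: calg Q by (rule Q_calg)

definition "qp x = char_ideal n \<rho> +>~(UQn n) x"

lemma qp_hom: "qp \<in> chom (UQn n) Q"
 unfolding UQchar_def qp_def using TU.TP.quot_proj_hom[OF char_ideal_ideal] .

lemma at_qp: "atq j u = qp (fac n j u)" by (simp add: atchar_def qp_def)

lemma at_hom: "j \<in> {1..n} ==> atq j \<in> chom UQ Q"
 using kalg_hom_comp[OF TU.in_factor_hom qp_hom, of j] by (simp add: o_def at_qp[abs_def])

lemma at_comm: "[| i \<in> {1..n}; j \<in> {1..n}; i \<noteq> j; x .: UQ; y .: UQ |] ==> atq i x .*~Q atq j y = atq j y .*~Q atq i x"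
 unfolding at_qp using chomD(2)[OF qp_hom] chomD(1)[OF TU.in_factor_hom] TU.in_factor_commute[of i n j x y] by metis

lemma at_zero: assumes j: "j \<in> {1..n}" and z: "z \<in> Z0" "\<rho> j z = 0" shows "atq j z = \<zero>~Q"
proof -
 have "fac n j z \<in> char_ideal n \<rho>" unfolding char_ideal_def by (rule subsetD[OF TU.TP.genideal_self[OF char_gens_carrier]]) (use j z in auto)
 then show ?thesis unfolding at_qp qp_def UQchar_def
  using TU.TP.quot_proj_zero_iff[OF char_ideal_ideal] chomD(1)[OF TU.in_factor_hom[OF j] Z0_carrier[OF z(1)]] by simp
qed

text \<open>Subtracting the value of the character from \<open>z\<close> gives an element of its
  kernel.\<close>

lemma at_scalar: assumes j: "j \<in> {1..n}" and z: "z \<in> Z0" shows "atq j z = \<rho> j z *.~Q \<one>~Q"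
proof -
 note c = charD[OF char[OF j]] note h = chomD[OF at_hom[OF j]]
 let ?w = "z .+~UQ (- \<rho> j z) *.~UQ \<one>~UQ"
 have w: "?w \<in> Z0" "\<rho> j ?w = 0" using z by (simp_all add: Z0_closed c)
 have zc: "atq j z .: Q" using h(1) Z0_carrier[OF z] by blast
 have "atq j z .+~Q (- \<rho> j z) *.~Q \<one>~Q = \<zero>~Q"
  using at_zero[OF j w] Z0_carrier[OF z] by (simp add: h)
 then have "atq j z = .-~Q ((- \<rho> j z) *.~Q \<one>~Q)" using zc by (intro Q.eq_neg_of_sum_zero) simp_all
 then show ?thesis by (simp add: Q.csmult)
qed

lemma at_squares: assumes j: "j \<in> {1..n}"
 shows "atq j qE .*~Q atq j qE = chi_epsilon (\<rho> j) *.~Q \<one>~Q" "atq j qFt .*~Q atq j qFt = chi_phi (\<rho> j) *.~Q \<one>~Q"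
  "atq j qK .*~Q atq j qK = chi_kappa (\<rho> j) *.~Q \<one>~Q" "atq j qKinv .*~Q atq j qKinv = (1 / chi_kappa (\<rho> j)) *.~Q \<one>~Q"
 using at_scalar[OF j Z0_sq(1)] at_scalar[OF j Z0_sq(2)] at_scalar[OF j Z0_sq(3)] at_scalar[OF j Z0_sq(5)]
 by (simp_all add: chomD(2)[OF at_hom[OF j]] char_values[OF char[OF j]])

lemma Q_carrier: "x .: Q ==> \<exists>y\<in>carrier (UQn n). x = qp y"
 by (auto simp: UQchar_def TU.TP.quot_alg_sel qp_def)

lemma Q_induct [consumes 1, case_names gen one add smult mult]:
 assumes u: "u .: Q"
  and gen: "!!j x. j \<in> {1..n} ==> x .: UQ ==> P (atq j x)" and one: "P \<one>~Q"
  and add: "!!x y. [| x .: Q; y .: Q; P x; P y |] ==> P (x .+~Q y)"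
  and smult: "!!c x. [| x .: Q; P x |] ==> P (c *.~Q x)"
  and mult: "!!x y. [| x .: Q; y .: Q; P x; P y |] ==> P (x .*~Q y)"
 shows "P u"
proof -
 obtain y where y: "y .: (UQn n)" "u = qp y" using Q_carrier[OF u] by (rule bexE)
 note h = chomD[OF qp_hom]
 have "P (qp y)" using y(1)
 proof (induction rule: TU.TP_induct)
  case (gen j x)
  then show ?case using assms(2)[OF gen] by (simp add: at_qp)
 qed (use one add smult mult h in simp_all)
 then show ?thesis using y by simp
qed

lemma Q_hom_eq:
 assumes B: "calg B" and h: "h \<in> chom Q B" "h' \<in> chom Q B"
  and eq: "!!j x. j \<in> {1..n} ==> x .: UQ ==> h (atq j x) = h' (atq j x)" and u: "u .: Q"
 shows "h u = h' u"
proof -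
 interpret B: calg B by fact
 from u show ?thesis
  by (induction rule: Q_induct) (use eq chomD[OF h(1)] chomD[OF h(2)] in simp_all)
qed

text \<open>By \<open>Z0_scalar\<close> the three squares in each factor suffice to kill the
  generators of \<open>char_ideal\<close>.\<close>

lemma Q_lift:
 assumes g: "commuting_homs UQ n B g"
  and s: "!!j. j \<in> {1..n} ==> g j qE .*~B g j qE = chi_epsilon (\<rho> j) *.~B \<one>~B" "!!j. j \<in> {1..n} ==> g j qFt .*~B g j qFt = chi_phi (\<rho> j) *.~B \<one>~B"
   "!!j. j \<in> {1..n} ==> g j qK .*~B g j qK = chi_kappa (\<rho> j) *.~B \<one>~B"
 shows "\<exists>h\<in>chom Q B. \<forall>j\<in>{1..n}. \<forall>x\<in>carrier UQ. h (atq j x) = g j x"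
proof -
 interpret G: commuting_homs UQ n B g by (rule g)
 have "\<exists>h\<in>chom (quot_alg (UQn n) (char_ideal n \<rho>)) B. \<forall>x\<in>carrier (UQn n). h (char_ideal n \<rho> +>~(UQn n) x) = tensor_lift n UQ B g x"
  unfolding char_ideal_def
 proof (rule TU.TP.quot_gen_lift[OF G.B.ring_axioms G.tensor_lift_hom char_gens_carrier])
  fix x assume "x \<in> (\<Union>j\<in>{1..n}. fac n j ` {z \<in> Z0. \<rho> j z = 0})"
  then obtain j z where j: "j \<in> {1..n}" "z \<in> Z0" "\<rho> j z = 0" "x = fac n j z" by auto
  have "g j z = \<rho> j z *.~B \<one>~B" by (rule Z0_scalar[OF char[OF j(1)] G.B.calg_self G.f_hom[OF j(1)] s[OF j(1)] j(2)])
  then show "tensor_lift n UQ B g x = \<zero>~B"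
   unfolding j(4) G.tensor_lift_in_factor[OF j(1) Z0_carrier[OF j(2)]] by (simp add: j(3) G.B.csmult)
 qed
 then obtain h where h: "h \<in> chom (quot_alg (UQn n) (char_ideal n \<rho>)) B" "\<forall>x\<in>carrier (UQn n). h (char_ideal n \<rho> +>~(UQn n) x) = tensor_lift n UQ B g x"
  by (rule bexE)
 have "h (atq j x) = g j x" if "j \<in> {1..n}" "x .: UQ" for j x
  using h(2) chomD(1)[OF TU.in_factor_hom that(2)] that G.tensor_lift_in_factor[OF that] by (simp add: atchar_def)
 then show ?thesis using h(1) unfolding UQchar_def by (intro bexI[of _ h]) simp_all
qed

end

section \<open>A representation with a given character\<close>

text \<open>There are infinitely many positions, of which the factor \<open>j\<close> uses position
  \<open>j\<close>; one type then serves every \<open>n\<close>.\<close>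

type_synonym states = "(nat => bool) => complex"

definition op_alg :: "(complex, states => states) module" where
 "op_alg = \<lparr>carrier = {T. (\<forall>f g. T (%s. f s + g s) = (%s. T f s + T g s)) \<and> (\<forall>c f. T (%s. c * f s) = (%s. c * T f s))},
   mult = (\<circ>), one = id, zero = (%f s. 0), add = (%T U f s. T f s + U f s), smult = (%c T f s. c * T f s)\<rparr>"

lemma op_calg: "calg op_alg"
proof (rule calgI, rule kalgI[OF complex_cring])
 show "ring op_alg"
 proof (rule ringI)
  show "abelian_group op_alg"
  proof (rule abelian_groupI)
   fix T assume T: "T .: op_alg"
   have "(%f s. - T f s) .: op_alg" using T by (simp add: op_alg_def)
   moreover have "(%f s. - T f s) .+~op_alg T = \<zero>~op_alg" by (simp add: op_alg_def)
   ultimately show "\<exists>U\<in>carrier op_alg. U .+~op_alg T = \<zero>~op_alg" by blast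
  qed (auto simp: op_alg_def algebra_simps fun_eq_iff)
  show "Group.monoid op_alg" by (rule monoidI) (auto simp: op_alg_def)
 qed (auto simp: op_alg_def algebra_simps fun_eq_iff)
qed (auto simp: op_alg_def algebra_simps fun_eq_iff)

text \<open>Matrices of size two are indexed by truth values; a state is a tensor of two-dimensional vectors, one for each factor.\<close>

definition op_at :: "nat => (bool => bool => complex) => states => states" where
 "op_at j M f s = M (s j) False * f (s(j := False)) + M (s j) True * f (s(j := True))"

lemma op_at_closed: "op_at j M .: op_alg"
 by (auto simp: op_alg_def op_at_def algebra_simps fun_eq_iff)

lemma op_at_mult: "op_at j M .*~op_alg op_at j N = op_at j (%a b. M a False * N False b + M a True * N True b)"
 by (auto simp: op_alg_def op_at_def algebra_simps fun_eq_iff)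

lemma op_at_comm: "i \<noteq> j ==> op_at i M .*~op_alg op_at j N = op_at j N .*~op_alg op_at i M"
 by (simp add: op_alg_def op_at_def algebra_simps fun_eq_iff fun_upd_twist)

lemma op_at_scalar: "op_at j (%a b. if a = b then c else 0) = c *.~op_alg \<one>~op_alg"
proof -
 have "(if s j = False then c else 0) * f (s(j := False)) + (if s j = True then c else 0) * f (s(j := True)) = c * f s" for f :: states and s
  by (cases "s j") (simp_all add: fun_upd_idem)
 then show ?thesis by (auto simp: op_alg_def op_at_def fun_eq_iff)
qed

lemma complex_quadratic: "\<exists>p q :: complex. p + q = 2 * b \<and> p * q = c"
proof -
 define d where "d = csqrt (b\<^sup>2 - c)"
 have "d\<^sup>2 = b\<^sup>2 - c" by (simp add: d_def)
 then show ?thesis by (intro exI[of _ "b + d"] exI[of _ "b - d"]) (simp add: algebra_simps power2_eq_square)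
qed

text \<open>E and iKF act by antidiagonal matrices with entries a, b and c, d; K acts by a diagonal
  matrix with both square roots of \<open>k\<close>. The conditions become a b = e, c d = p and a d
  + b c = 2 (k - 1).\<close>

lemma op_rep:
 assumes k: "k \<noteq> 0" and ns: "(k - 1)\<^sup>2 \<noteq> e * p"
 shows "\<exists>x y z w. utriple op_alg (op_at j x) (op_at j y) (op_at j z) (op_at j w) \<and>
  op_at j x .*~op_alg op_at j x = e *.~op_alg \<one>~op_alg \<and> op_at j y .*~op_alg op_at j y = p *.~op_alg \<one>~op_alg \<and>
  op_at j z .*~op_alg op_at j z = k *.~op_alg \<one>~op_alg"
proof -
 interpret O: calg op_alg by (rule op_calg)
 \<comment> \<open>If \<open>e\<close> is nonzero, put a = 1 and b = e; then d and c e are the roots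
   of a quadratic polynomial. If \<open>e\<close> is zero, nonsingularity makes \<open>k\<close>
   different from 1, so that d = 2 (k - 1) can be divided by.\<close>
 have "\<exists>a b c d. a * b = e \<and> c * d = p \<and> a * d + b * c = 2 * (k - 1)"
 proof (cases "e = 0")
  case True
  then have "k \<noteq> 1" using ns by auto
  then show ?thesis using True
   by (intro exI[of _ 1] exI[of _ 0] exI[of _ "p / (2 * (k - 1))"] exI[of _ "2 * (k - 1)"]) simp
 next
  case False
  obtain r s where "r + s = 2 * (k - 1)" "r * s = e * p" using complex_quadratic by blast
  then show ?thesis using False by (intro exI[of _ 1] exI[of _ e] exI[of _ "s / e"] exI[of _ r]) (simp add: field_simps)
 qed
 then obtain a b c d where abcd: "a * b = e" "c * d = p" "a * d + b * c = 2 * (k - 1)" by blast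
 define l where "l = csqrt k"
 have l: "l * l = k" "l \<noteq> 0" using k by (auto simp: l_def power2_eq_square[symmetric])
 define x where "x u v = (if u = v then 0 else if v then a else b)" for u v
 define y where "y u v = (if u = v then 0 else if v then c else d)" for u v
 define z where "z u v = (if u = v then if u then - l else l else 0)" for u v
 define w where "w u v = (if u = v then if u then - (1 / l) else 1 / l else 0)" for u v
 note defs = x_def y_def z_def w_def
 have sq: "op_at j x .*~op_alg op_at j x = e *.~op_alg \<one>~op_alg" "op_at j y .*~op_alg op_at j y = p *.~op_alg \<one>~op_alg"
   "op_at j z .*~op_alg op_at j z = k *.~op_alg \<one>~op_alg"
  unfolding op_at_mult op_at_scalar[symmetric, of _ j] by (rule arg_cong[of _ _ "op_at j"]; intro ext; auto simp: defs abcd[symmetric] l(1)[symmetric] mult.commute)+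
 have zw: "op_at j z .*~op_alg op_at j w = 1 *.~op_alg \<one>~op_alg" "op_at j w .*~op_alg op_at j z = 1 *.~op_alg \<one>~op_alg"
  unfolding op_at_mult op_at_scalar[symmetric, of _ j] by (rule arg_cong[of _ _ "op_at j"]; intro ext; use l(2) in \<open>auto simp: defs\<close>)+
 have m: "op_at j z .*~op_alg op_at j x = (- 1) *.~op_alg (op_at j x .*~op_alg op_at j z)" 
  "op_at j z .*~op_alg op_at j y = (- 1) *.~op_alg (op_at j y .*~op_alg op_at j z)"
  unfolding op_at_mult by (auto simp: op_alg_def op_at_def defs fun_eq_iff)
 have a: "op_at j x .*~op_alg op_at j y .+~op_alg op_at j y .*~op_alg op_at j x = (2 * (k - 1)) *.~op_alg \<one>~op_alg"
  unfolding op_at_mult op_at_scalar[symmetric, of _ j] abcd(3)[symmetric] by (auto simp: op_alg_def op_at_def defs fun_eq_iff algebra_simps)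
 have "(2 * (k - 1)) *.~op_alg \<one>~op_alg = (k *.~op_alg \<one>~op_alg .-~op_alg \<one>~op_alg) .+~op_alg (k *.~op_alg \<one>~op_alg .-~op_alg \<one>~op_alg)"
 proof -
  have "k *.~op_alg \<one>~op_alg .-~op_alg \<one>~op_alg = (k + - 1) *.~op_alg \<one>~op_alg"
   unfolding O.csmult(1)[OF O.one_closed] by (simp add: a_minus_def O.uminus_csmult[symmetric])
  then show ?thesis using O.csmult(1)[of "\<one>~op_alg" "k - 1" "k - 1"] by simp
 qed
 then have "utriple op_alg (op_at j x) (op_at j y) (op_at j z) (op_at j w)"
  unfolding utriple_def using op_at_closed a zw m sq(3) by (simp add: O.csmult(4) O.uminus_csmult[symmetric])
 then show ?thesis using sq by blast
qed

locale nonsing_quot = char_quot +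
 assumes ns: "nonsingular n \<rho>"
begin

lemma Omega_ne: "j \<in> {1..n} ==> \<rho> j (qOmega .*~UQ qOmega) \<noteq> 0"
 using ns by (simp add: nonsingular_def UQ.pow_two)

lemma at_Omega_sq: "j \<in> {1..n} ==> atq j qOmega .*~Q atq j qOmega = \<rho> j (qOmega .*~UQ qOmega) *.~Q \<one>~Q"
 using at_scalar[OF _ Z0_Omega] chomD(2)[OF at_hom] by simp

lemma at_Omega_unit: assumes j: "j \<in> {1..n}" shows "atq j qOmega \<in> Units Q"
proof -
 let ?c = "\<rho> j (qOmega .*~UQ qOmega)"
 have c: "atq j qOmega .: Q" using chomD(1)[OF at_hom[OF j]] by simp
 then have "atq j qOmega .*~Q ((1 / ?c) *.~Q atq j qOmega) = \<one>~Q" "((1 / ?c) *.~Q atq j qOmega) .*~Q atq j qOmega = \<one>~Q"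
  using at_Omega_sq[OF j] Omega_ne[OF j] by (simp_all add: Q.csmult)
 then show ?thesis unfolding Units_def using c by auto
qed

sublocale urep Q n atq
 by (intro urep.intro urep_axioms.intro Q_calg at_hom at_comm at_Omega_unit)

lemma omega_sq: assumes j: "j \<in> {1..n}" shows "\<omega> j .*~Q \<omega> j = (1 / \<rho> j (qOmega .*~UQ qOmega)) *.~Q \<one>~Q"
proof -
 note w = \<omega>_props[OF j]
 let ?c = "\<rho> j (qOmega .*~UQ qOmega)"
 have o: "atq j qOmega .: Q" using j by simp
 have "(\<omega> j .*~Q \<omega> j) .*~Q (atq j qOmega .*~Q atq j qOmega) = \<omega> j .*~Q (\<omega> j .*~Q atq j qOmega) .*~Q atq j qOmega"
  using w(1) o by (simp add: Q.m_assoc)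
 then have "?c *.~Q (\<omega> j .*~Q \<omega> j) = \<one>~Q" using w o by (simp add: at_Omega_sq[OF j] Q.csmult)
 then have "(1 / ?c) *.~Q (?c *.~Q (\<omega> j .*~Q \<omega> j)) = (1 / ?c) *.~Q \<one>~Q" by simp
 then show ?thesis using w Omega_ne[OF j] by (simp add: Q.csmult)
qed

text \<open>At a nonsingular character the generators of the base ring become numbers, including the
  inverse square of \<Omega>. The span of the \<beta> is thus a complex span.\<close>

lemma Z_scalars: assumes "z \<in> Z" shows "\<exists>c. z = c *.~Q \<one>~Q"
 using assms[unfolded Z_eq]
proof (induction rule: subalg_gen.induct)
 case (incl x)
 then obtain j where j: "j \<in> {1..n}" "x \<in> atq j ` Z0 \<union> {\<omega> j [^]~Q (2::nat)}" by (auto simp: Zgens_def)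
 then consider z where "z \<in> Z0" "x = atq j z" | "x = \<omega> j .*~Q \<omega> j" by (auto simp: Q.pow_two)
 then show ?case using at_scalar[OF j(1)] omega_sq[OF j(1)] by cases auto
next
 case one
 then show ?case by (intro exI[of _ 1]) (simp add: Q.csmult)
next
 case (add x y)
 then show ?case using Q.csmult(1)[of "\<one>~Q"] by (metis Q.one_closed)
next
 case (mult x y)
 then obtain c d where "x = c *.~Q \<one>~Q" "y = d *.~Q \<one>~Q" by blast
 then show ?case by (intro exI[of _ "c * d"]) (simp add: Q.csmult mult.commute)
next
 case (smult x a)
 then obtain c where "x = c *.~Q \<one>~Q" by blast
 then show ?case by (intro exI[of _ "a * c"]) (simp add: Q.csmult)
qed

text \<open>The factors act at different positions of \<open>states\<close>, so their operators
  commute and define a homomorphism to \<open>op_alg\<close>. There one and zero differ.\<close>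

lemma nontrivial: "\<one>~Q \<noteq> \<zero>~Q"
proof -
 interpret O: calg op_alg by (rule op_calg)
 let ?P = "%j g. g \<in> chom UQ op_alg \<and> (\<forall>a\<in>{qE, qFt, qK, qKinv}. \<exists>M. g a = op_at j M) \<and> g qE .*~op_alg g qE = chi_epsilon (\<rho> j) *.~op_alg \<one>~op_alg \<and>
  g qFt .*~op_alg g qFt = chi_phi (\<rho> j) *.~op_alg \<one>~op_alg \<and> g qK .*~op_alg g qK = chi_kappa (\<rho> j) *.~op_alg \<one>~op_alg"
 have ex: "\<exists>g. ?P j g" if j: "j \<in> {1..n}" for j
 proof -
  note v = char_values[OF char[OF j]]
  have ne: "(chi_kappa (\<rho> j) - 1)\<^sup>2 \<noteq> chi_epsilon (\<rho> j) * chi_phi (\<rho> j)" using v(4,7) Omega_ne[OF j] by (metis mult_eq_0_iff right_minus_eq)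
  obtain x y z w where t: "utriple op_alg (op_at j x) (op_at j y) (op_at j z) (op_at j w)" and s: "op_at j x .*~op_alg op_at j x = chi_epsilon (\<rho> j) *.~op_alg \<one>~op_alg"
   "op_at j y .*~op_alg op_at j y = chi_phi (\<rho> j) *.~op_alg \<one>~op_alg" "op_at j z .*~op_alg op_at j z = chi_kappa (\<rho> j) *.~op_alg \<one>~op_alg"
   using op_rep[OF v(4) ne, of j] by (elim exE conjE)
  obtain g where g: "g \<in> chom UQ op_alg" "g qE = op_at j x" "g qFt = op_at j y" "g qK = op_at j z" "g qKinv = op_at j w"
   using UQ_lift_triple[OF op_calg t] by (elim bexE conjE)
  show ?thesis by (rule exI[of _ g]) (use g s in auto)
 qed
 from ex have "\<forall>j\<in>{1..n}. \<exists>g. ?P j g" by (intro ballI)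
 from bchoice[OF this] obtain g where "\<forall>j\<in>{1..n}. ?P j (g j)" by (rule exE)
 then have g: "?P j (g j)" if "j \<in> {1..n}" for j using that by (rule bspec)
 have gh: "g j \<in> chom UQ op_alg" if "j \<in> {1..n}" for j using g[OF that] by (elim conjE)
 have gm: "\<exists>M. g j a = op_at j M" if "j \<in> {1..n}" "a \<in> {qE, qFt, qK, qKinv}" for j a using g[OF that(1)] that(2) by (elim conjE) (erule (1) bspec)
 have "commuting_homs UQ n op_alg g"
 proof (rule commuting_homsI[OF UQ.calg_self op_calg gh])
  fix i j x y assume a: "i \<in> {1..n}" "j \<in> {1..n}" "i < j" "x .: UQ" "y .: UQ"
  show "g i x .*~op_alg g j y = g j y .*~op_alg g i x"
  proof (rule UQ_homs_commute[OF op_calg gh[OF a(1)] gh[OF a(2)] _ a(4,5)])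
   fix b c assume "b \<in> {qE, qFt, qK, qKinv}" "c \<in> {qE, qFt, qK, qKinv}"
   then obtain M N where "g i b = op_at i M" "g j c = op_at j N" using gm a(1,2) by meson
   then show "g i b .*~op_alg g j c = g j c .*~op_alg g i b" using op_at_comm[of i j] a(3) by simp
  qed
 qed
 from Q_lift[OF this] obtain h where h: "h \<in> chom Q op_alg" using g by blast
 show ?thesis
 proof
  assume "\<one>~Q = \<zero>~Q"
  then have "\<one>~op_alg = \<zero>~op_alg" using chomD(4)[OF h] chomD_add(1)[OF h Q_calg op_calg] by simp
  then have "(%s. 1) = (%s::nat => bool. 0 :: complex)" by (simp add: op_alg_def) (metis id_apply)
  then show False by (metis zero_neq_one)
 qed
qed

lemma KK_scalar: assumes "c *.~Q KK = \<zero>~Q" shows "c = 0"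
proof (rule ccontr)
 assume "c \<noteq> 0"
 have u: "KK \<in> Units Q" by (rule Kp_unit) auto
 then have "c *.~Q KK \<in> Units Q" using \<open>c \<noteq> 0\<close> by (rule Q.csmult_Units[rotated])
 then have "\<zero>~Q \<in> Units Q" using assms by simp
 then obtain y where "y .: Q" "y .*~Q \<zero>~Q = \<one>~Q" unfolding Units_def by blast
 then show False using nontrivial by simp
qed

end

section \<open>The braiding\<close>

lemma chom_inverse_eq:
 assumes B: "calg B" and h: "h \<in> chom UQ B" "h' \<in> chom UQ B" and eq: "h qK = h' qK"
 shows "h qKinv = h' qKinv"
proof -
 interpret B: calg B by fact
 note hs = chomD[OF h(1)] chomD[OF h(2)]
 have i: "h qK .*~B h qKinv = \<one>~B" "h' qKinv .*~B h' qK = \<one>~B"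
  using hs(2)[of qK qKinv] hs(7)[of qKinv qK] by (simp_all add: UQ_rels hs)
 have "h' qKinv = h' qKinv .*~B (h qK .*~B h qKinv)" using i hs by simp
 also have "\<dots> = (h' qKinv .*~B h' qK) .*~B h qKinv" unfolding eq using hs by (simp add: B.m_assoc)
 finally show ?thesis using i hs by simp
qed

lemma UQ_hom_eq_Ft:
 assumes B: "calg B" and h: "h \<in> chom UQ B" "h' \<in> chom UQ B" and eq: "h qE = h' qE" "h qFt = h' qFt" "h qK = h' qK"
  and u: "u .: UQ"
 shows "h u = h' u"
 by (rule UQ_hom_eq_triple[OF B h eq chom_inverse_eq[OF B h eq(3)] u])

lemma chom_K_inverse:
 assumes h: "h \<in> chom UQ B" shows "h qK .*~B h qKinv = \<one>~B" "h qKinv .*~B h qK = \<one>~B"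
 using chomD(2)[OF h, of qK qKinv] chomD(2)[OF h, of qKinv qK] chomD(4)[OF h] by (simp_all add: UQ_rels)

text \<open>A homomorphism from the tensor square to \<open>B\<close> in disguise, by
  \<open>tensor_lift\<close>. Pairs can be composed and compared without mention of the tensor
  product.\<close>

definition commuting_pair :: "(complex, 'b, 'p) module_scheme => (qelt => 'b) => (qelt => 'b) => bool" where
 "commuting_pair B g1 g2 \<longleftrightarrow> g1 \<in> chom UQ B \<and> g2 \<in> chom UQ B \<and>
   (\<forall>x\<in>carrier UQ. \<forall>y\<in>carrier UQ. g2 y .*~B g1 x = g1 x .*~B g2 y)"

lemma commuting_pairD:
 assumes "commuting_pair B g1 g2"
 shows "g1 \<in> chom UQ B" "g2 \<in> chom UQ B" "!!x y. [| x .: UQ; y .: UQ |] ==> g2 y .*~B g1 x = g1 x .*~B g2 y"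
 using assms by (auto simp: commuting_pair_def)

text \<open>
  The pair \<open>(g1, g2)\<close> arises from \<open>(f1, f2)\<close> by the braiding: if \<open>f1\<close> and \<open>f2\<close> are the two tensor
  factors then \<open>g1 u\<close> and \<open>g2 u\<close> are the images of \<open>u \<otimes> 1\<close> and \<open>1 \<otimes> u\<close>.
\<close>

definition braided :: "(complex, 'b, 'p) module_scheme => (qelt => 'b) => (qelt => 'b) => (qelt => 'b) => (qelt => 'b) => bool" where
 "braided B f1 f2 g1 g2 \<longleftrightarrow> commuting_pair B f1 f2 \<and> commuting_pair B g1 g2 \<and>
   g1 qE = f1 qK .*~B f2 qE \<and> g1 qK .*~B g2 qFt = f1 qFt \<and> g1 qK = f2 qK .-~B f1 qFt .*~B f2 qE \<and>
   g2 qE .+~B g1 qE .*~B g2 qK = f2 qE .+~B f1 qE .*~B f2 qK \<and>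
   g2 qFt .+~B g1 qFt .*~B g2 qK = f2 qFt .+~B f1 qFt .*~B f2 qK \<and> g1 qK .*~B g2 qK = f1 qK .*~B f2 qK"

lemma braidedD:
 assumes "braided B f1 f2 g1 g2"
 shows "commuting_pair B f1 f2" "commuting_pair B g1 g2"
  "g1 qE = f1 qK .*~B f2 qE" "g1 qK .*~B g2 qFt = f1 qFt" "g1 qK = f2 qK .-~B f1 qFt .*~B f2 qE"
  "g2 qE .+~B g1 qE .*~B g2 qK = f2 qE .+~B f1 qE .*~B f2 qK"
  "g2 qFt .+~B g1 qFt .*~B g2 qK = f2 qFt .+~B f1 qFt .*~B f2 qK" "g1 qK .*~B g2 qK = f1 qK .*~B f2 qK"
 using assms by (auto simp: braided_def)

text \<open>The unknowns are found one at a time. E and K of the first component are given, so the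
  product of the two K yields K of the second; then iKF and E of the second follow, and finally iKF
  of the first, by cancelling the invertible \<open>g2 qK\<close>.\<close>

lemma pair_unique:
 assumes B: "calg B" and g: "commuting_pair B g1 g2" and h: "commuting_pair B h1 h2"
  and e: "g1 qE = h1 qE" "g1 qK .*~B g2 qFt = h1 qK .*~B h2 qFt" "g1 qK = h1 qK"
   "g2 qE .+~B g1 qE .*~B g2 qK = h2 qE .+~B h1 qE .*~B h2 qK"
   "g2 qFt .+~B g1 qFt .*~B g2 qK = h2 qFt .+~B h1 qFt .*~B h2 qK" "g1 qK .*~B g2 qK = h1 qK .*~B h2 qK"
  and u: "u .: UQ"
 shows "g1 u = h1 u" "g2 u = h2 u"
proof -
 interpret B: calg B by fact
 note G = commuting_pairD[OF g] and H = commuting_pairD[OF h]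
 note gc [simp] = chomD(1)[OF G(1)] chomD(1)[OF G(2)] chomD(1)[OF H(1)] chomD(1)[OF H(2)]
 have l: "g1 qKinv = h1 qKinv" by (rule chom_inverse_eq[OF B G(1) H(1) e(3)])
 note i = chom_K_inverse[OF G(1)] chom_K_inverse[OF H(1)] chom_K_inverse[OF G(2)] chom_K_inverse[OF H(2)]
 have can: "x = y" if "g1 qK .*~B x = h1 qK .*~B y" "x .: B" "y .: B" for x y
 proof -
  have "g1 qKinv .*~B (g1 qK .*~B x) = h1 qKinv .*~B (h1 qK .*~B y)" by (simp only: l that(1))
  moreover have "g1 qKinv .*~B (g1 qK .*~B x) = x" "h1 qKinv .*~B (h1 qK .*~B y) = y"
   using that(2,3) by (simp_all add: B.m_assoc[symmetric] i)
  ultimately show ?thesis by simp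
 qed
 have K: "g2 qK = h2 qK" by (rule can[OF e(6)]) simp_all
 have F: "g2 qFt = h2 qFt" by (rule can[OF e(2)]) simp_all
 have E: "g2 qE = h2 qE" using e(4) by (simp add: e(1) K)
 have "g1 qFt .*~B g2 qK = h1 qFt .*~B g2 qK" using e(5) by (simp add: F K)
 then have "g1 qFt .*~B g2 qK .*~B g2 qKinv = h1 qFt .*~B g2 qK .*~B g2 qKinv" by simp
 then have F1: "g1 qFt = h1 qFt" by (simp add: B.m_assoc i)
 show "g1 u = h1 u" by (rule UQ_hom_eq_Ft[OF B G(1) H(1) e(1) F1 e(3) u])
 show "g2 u = h2 u" by (rule UQ_hom_eq_Ft[OF B G(2) H(2) E F K u])
qed

lemma braided_unique:
 assumes B: "calg B" and g: "braided B f1 f2 g1 g2" "braided B f1 f2 h1 h2" and u: "u .: UQ"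
 shows "g1 u = h1 u" "g2 u = h2 u"
 using pair_unique[OF B braidedD(2)[OF g(1)] braidedD(2)[OF g(2)] _ _ _ _ _ _ u] braidedD(3-8)[OF g(1)] braidedD(3-8)[OF g(2)] by simp_all

lemma commuting_pair_comp:
 assumes "commuting_pair B f1 f2" "h \<in> chom B D"
 shows "commuting_pair D (h \<circ> f1) (h \<circ> f2)"
proof -
 note f = commuting_pairD[OF assms(1)] and h = chomD[OF assms(2)]
 have "h (f2 y) .*~D h (f1 x) = h (f1 x) .*~D h (f2 y)" if "x .: UQ" "y .: UQ" for x y
  using f(3)[OF that] h(2)[OF chomD(1)[OF f(1) that(1)] chomD(1)[OF f(2) that(2)]] h(2)[OF chomD(1)[OF f(2) that(2)] chomD(1)[OF f(1) that(1)]] by simp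
 then show ?thesis using kalg_hom_comp[OF f(1) assms(2)] kalg_hom_comp[OF f(2) assms(2)] by (simp add: commuting_pair_def)
qed

lemma braided_comp:
 assumes g: "braided B f1 f2 g1 g2" and h: "h \<in> chom B D" and B: "calg B" and D: "calg D"
 shows "braided D (h \<circ> f1) (h \<circ> f2) (h \<circ> g1) (h \<circ> g2)"
proof -
 interpret B: calg B by fact
 note b = braidedD[OF g]
 note c = commuting_pairD[OF b(1)] commuting_pairD[OF b(2)]
 note cl [simp] = chomD(1)[OF c(1)] chomD(1)[OF c(2)] chomD(1)[OF c(4)] chomD(1)[OF c(5)]
 note hs = chomD[OF h] chomD_add[OF h B D]
 have m: "h x .*~D h y = h (x .*~B y)" if "x .: B" "y .: B" for x y using hs that by simp
 have a: "h x .+~D h y = h (x .+~B y)" if "x .: B" "y .: B" for x y using hs that by simp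
 have n: "h x .-~D h y = h (x .-~B y)" if "x .: B" "y .: B" for x y using hs that by simp
 show ?thesis
  unfolding braided_def using commuting_pair_comp[OF b(1) h] commuting_pair_comp[OF b(2) h]
  by (simp add: m a n b(3,5)[symmetric] b(4,6,7,8))
qed

text \<open>With E and iKF exchanged the braiding would send K to \<open>K2 - E1 * G2\<close> in
  place of \<open>gD\<close>. Evaluated at the braided elements this is the left side, and the
  original \<open>K1\<close> comes back. It is the one equation of the inversion that is not
  immediate.\<close>

lemma new_inverse: "gS - gP * gQ = (K1 :: 'a gring)"
proof -
 have "gD * (gS - gP * gQ) = K1 * K2 - gD * (gP * (gQ :: 'a gring))" by (simp add: right_diff_distrib new_coproduct(3)[symmetric])
 also have "gD * (gP * gQ) = - (gP * (G1 :: 'a gring))" using new_alpha(2) gP_swap(1) by (metis minus_mult_left mult.assoc minus_equation_iff)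
 also have "K1 * K2 - - (gP * G1) = gD * (K1 :: 'a gring)" by (simp add: g_defs gring_nf algebra_simps)
 finally have "gDi * (gD * (gS - gP * gQ)) = gDi * (gD * (K1 :: 'a gring))" by simp
 then show ?thesis by (simp add: mult.assoc[symmetric] new_triple1(2))
qed

context hom_pair begin

lemma f_pair: "commuting_pair B f1 f2" using f1 f2 comm by (simp add: commuting_pair_def)

lemma braided_exists:
 obtains g1 g2 where "braided B f1 f2 g1 g2" "g1 qOmega = f2 qOmega" "g2 qOmega = f1 qOmega"
  "g1 qE = vv gP" "g1 qFt = vv gX" "g1 qK = vv gD" "g1 qKinv = vv gDi"
  "g2 qE = vv gY" "g2 qFt = vv gQ" "g2 qK = vv gS" "g2 qKinv = vv gSi"
proof -
 obtain g1 g2 where g: "g1 \<in> chom UQ B" "g2 \<in> chom UQ B"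
  and c: "!!x y. x .: UQ ==> y .: UQ ==> g2 y .* g1 x = g1 x .* g2 y"
  and v: "g1 qE = vv gP" "g1 qFt = vv gX" "g1 qK = vv gD" "g1 qKinv = vv gDi"
  "g2 qE = vv gY" "g2 qFt = vv gQ" "g2 qK = vv gS" "g2 qKinv = vv gSi"
  "g1 qOmega = f2 qOmega" "g2 qOmega = f1 qOmega"
  by (rule new_homs, rule that)
 have cg: "commuting_pair B g1 g2" using g c by (simp add: commuting_pair_def)
 have "vv gP = f1 qK .* f2 qE" "vv gD = f2 qK .- f1 qFt .* f2 qE" by (simp_all add: gP_def gD_def)
 then have "braided B f1 f2 g1 g2" unfolding braided_def v
  using f_pair cg new_coproduct[THEN arg_cong[where f = vv]] new_alpha(2)[THEN arg_cong[where f = vv]] by simp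
 then show ?thesis using that v by blast
qed

end

text \<open>The two summands anticommute, so the mixed terms of the square cancel.\<close>

lemma (in ring) coproduct_square:
 assumes "x1 .: R" "x2 .: R" "k2 .: R" "x2 .* x1 = x1 .* x2" "k2 .* x1 = x1 .* k2" "k2 .* x2 = .- (x2 .* k2)"
 shows "(x2 .+ x1 .* k2) .* (x2 .+ x1 .* k2) = x2 .* x2 .+ (x1 .* x1) .* (k2 .* k2)"
proof -
 have a: "x1 .* k2 .* x2 = .- (x1 .* x2 .* k2)" using assms by (simp add: m_assoc r_minus)
 have b: "x2 .* (x1 .* k2) = x1 .* x2 .* k2" using assms by (simp add: m_assoc[symmetric])
 have "x1 .* k2 .* (x1 .* k2) = x1 .* (k2 .* x1) .* k2" using assms(1-3) by (simp add: m_assoc)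
 also have "\<dots> = (x1 .* x1) .* (k2 .* k2)" using assms(1-3) by (simp add: assms(5) m_assoc)
 finally have d: "x1 .* k2 .* (x1 .* k2) = (x1 .* x1) .* (k2 .* k2)" .
 have "(x2 .+ x1 .* k2) .* (x2 .+ x1 .* k2) = (x2 .* x2 .+ x1 .* k2 .* (x1 .* k2)) .+ (x2 .* (x1 .* k2) .+ x1 .* k2 .* x2)"
  using assms(1-3) by (simp add: l_distr r_distr a_ac)
 then show ?thesis unfolding a b d using assms(1-3) by (simp add: r_neg)
qed

text \<open>Computed from the relations in \<open>braided\<close> and not from the explicit images.
  The squares of \<open>g2 qK\<close> and \<open>g2 qFt\<close> come from division by
  \<open>k1\<close>, the square of \<open>g1 qK\<close>; those of \<open>g1 qFt\<close> and
  \<open>g2 qE\<close> come from \<open>coproduct_square\<close>.\<close>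

lemma braided_squares:
 assumes B: "calg B" and b: "braided B f1 f2 g1 g2"
  and s: "f1 qE .*~B f1 qE = ea *.~B \<one>~B" "f1 qFt .*~B f1 qFt = pa *.~B \<one>~B" "f1 qK .*~B f1 qK = ka *.~B \<one>~B"
   "f2 qE .*~B f2 qE = eb *.~B \<one>~B" "f2 qFt .*~B f2 qFt = pb *.~B \<one>~B" "f2 qK .*~B f2 qK = kb *.~B \<one>~B"
  and nz: "k1 = kb + pa * eb" "k1 \<noteq> 0" "k2 = ka * kb / k1" "k2 \<noteq> 0"
 shows "g1 qE .*~B g1 qE = (ka * eb) *.~B \<one>~B" "g1 qK .*~B g1 qK = k1 *.~B \<one>~B" "g2 qK .*~B g2 qK = k2 *.~B \<one>~B"
  "g2 qFt .*~B g2 qFt = (pa / k1) *.~B \<one>~B" "g1 qFt .*~B g1 qFt = ((pb + pa * kb - pa / k1) / k2) *.~B \<one>~B"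
  "g2 qE .*~B g2 qE = (eb + ea * kb - ka * eb * k2) *.~B \<one>~B"
proof -
 interpret B: calg B by fact
 note d = braidedD[OF b]
 note F = commuting_pairD[OF d(1)] and G = commuting_pairD[OF d(2)]
 note cl [simp] = chomD(1)[OF F(1)] chomD(1)[OF F(2)] chomD(1)[OF G(1)] chomD(1)[OF G(2)]
 have sq: "(x .*~B y) .*~B (x .*~B y) = (a * c) *.~B \<one>~B"
  if "x .: B" "y .: B" "y .*~B x = x .*~B y" "x .*~B x = a *.~B \<one>~B" "y .*~B y = c *.~B \<one>~B" for x y a c
 proof -
  have "(x .*~B y) .*~B (x .*~B y) = x .*~B (y .*~B x) .*~B y" using that(1,2) by (simp add: B.m_assoc)
  also have "\<dots> = (x .*~B x) .*~B (y .*~B y)" unfolding that(3) using that(1,2) by (simp add: B.m_assoc)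
  finally show ?thesis unfolding that(4,5) by (simp add: B.csmult mult.commute)
 qed
 show e1: "g1 qE .*~B g1 qE = (ka * eb) *.~B \<one>~B" unfolding d(3) by (rule sq) (use F(3) s in simp_all)
 have anti: "h qK .*~B h x = .-~B (h x .*~B h qK)" if "h \<in> chom UQ B" "x \<in> {qE, qFt}" for h x
  using utripleD(7,8)[OF utriple_hom[OF UQ_triple that(1) UQ.calg_self B]] that(2) by auto
 show k1: "g1 qK .*~B g1 qK = k1 *.~B \<one>~B"
 proof -
  let ?y = "f1 qFt" and ?x = "f2 qE" and ?k = "f2 qK"
  have yx: "(?y .*~B ?x) .*~B (?y .*~B ?x) = (pa * eb) *.~B \<one>~B" by (rule sq) (use F(3) s in simp_all)
  have "?k .*~B (?y .*~B ?x) = ?y .*~B (?k .*~B ?x)" using F(3)[of qFt qK] by (simp add: B.m_assoc[symmetric])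
  also have "\<dots> = .-~B (?y .*~B ?x .*~B ?k)" using anti[OF F(2), of qE] by (simp add: B.r_minus B.m_assoc)
  finally have k: "?k .*~B (?y .*~B ?x) = .-~B (?y .*~B ?x .*~B ?k)" .
  let ?w = "?y .*~B ?x"
  have "(?k .-~B ?w) .*~B (?k .-~B ?w) = (?k .*~B ?k .+~B ?w .*~B ?w) .-~B (?k .*~B ?w .+~B ?w .*~B ?k)"
  proof -
   have "(p .-~B q) .*~B (p .-~B q) = (p .*~B p .+~B q .*~B q) .-~B (p .*~B q .+~B q .*~B p)" if "p .: B" "q .: B" for p q
    using that by (simp add: a_minus_def B.l_distr B.r_distr B.l_minus B.r_minus B.minus_add B.a_ac)
   then show ?thesis by simp
  qed
  also have "\<dots> = (kb + pa * eb) *.~B \<one>~B" unfolding k yx s(6) by (simp add: B.l_neg B.csmult(1) a_minus_def)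
  finally show ?thesis unfolding d(5) nz(1) .
 qed
 have pk: "(g1 qK .*~B g1 qK) .*~B (y .*~B y) = (g1 qK .*~B y) .*~B (g1 qK .*~B y)" if "y .: B" "y .*~B g1 qK = g1 qK .*~B y" for y
 proof -
  have "(g1 qK .*~B y) .*~B (g1 qK .*~B y) = g1 qK .*~B (y .*~B g1 qK) .*~B y" using that(1) by (simp add: B.m_assoc)
  then show ?thesis unfolding that(2) using that(1) by (simp add: B.m_assoc)
 qed
 have sc: "y .*~B y = (a / k1) *.~B \<one>~B"
  if "y .: B" "y .*~B g1 qK = g1 qK .*~B y" "(g1 qK .*~B y) .*~B (g1 qK .*~B y) = a *.~B \<one>~B" for y a
 proof -
  have "k1 *.~B (y .*~B y) = a *.~B \<one>~B" using pk[OF that(1,2)] that(1) unfolding that(3) k1 by (simp add: B.csmult)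
  then have "(1 / k1) *.~B (k1 *.~B (y .*~B y)) = (1 / k1) *.~B (a *.~B \<one>~B)" by simp
  then show ?thesis using that(1) nz(2) by (simp add: B.csmult)
 qed
 show k2: "g2 qK .*~B g2 qK = k2 *.~B \<one>~B" unfolding nz(3)
  by (rule sc) (use G(3) in \<open>simp_all add: d(8) sq[OF _ _ _ s(3,6)] F(3)\<close>)
 show p2: "g2 qFt .*~B g2 qFt = (pa / k1) *.~B \<one>~B"
  by (rule sc) (use G(3) in \<open>simp_all add: d(4) s(2)\<close>)
 have co: "g2 x .*~B g2 x .+~B (g1 x .*~B g1 x) .*~B (g2 qK .*~B g2 qK) = f2 x .*~B f2 x .+~B (f1 x .*~B f1 x) .*~B (f2 qK .*~B f2 qK)" if x: "x \<in> {qE, qFt}" for x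
 proof -
  have xc: "x .: UQ" using x by auto
  have "g2 x .+~B g1 x .*~B g2 qK = f2 x .+~B f1 x .*~B f2 qK" using x d(6,7) by auto
  then show ?thesis
   using B.coproduct_square[of "g1 x" "g2 x" "g2 qK"] B.coproduct_square[of "f1 x" "f2 x" "f2 qK"] F(3)[OF xc] G(3)[OF xc] xc anti[OF F(2) x] anti[OF G(2) x] by simp
 qed
 have sub: "x = (b - a) *.~B \<one>~B" if "a *.~B \<one>~B .+~B x = b *.~B \<one>~B" "x .: B" for x a b
 proof -
  have "(- a) *.~B \<one>~B .+~B (a *.~B \<one>~B .+~B x) = ((- a + a) *.~B \<one>~B) .+~B x"
   unfolding B.csmult(1)[OF B.one_closed] using that(2) by (simp add: B.a_assoc)
  then have "x = (- a) *.~B \<one>~B .+~B b *.~B \<one>~B" using that by (simp add: B.csmult(5))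
  then show ?thesis by (simp add: B.csmult(1)[symmetric])
 qed
 have dv: "y = (b / k2) *.~B \<one>~B" if "k2 *.~B y = b *.~B \<one>~B" "y .: B" for y b
 proof -
  have "(1 / k2) *.~B (k2 *.~B y) = (1 / k2) *.~B (b *.~B \<one>~B)" using that by simp
  then show ?thesis using that(2) nz(4) by (simp add: B.csmult)
 qed
 have "(pa / k1) *.~B \<one>~B .+~B k2 *.~B (g1 qFt .*~B g1 qFt) = (pb + pa * kb) *.~B \<one>~B"
  using co[of qFt] by (simp add: p2 k2 s B.csmult mult.commute)
 then show "g1 qFt .*~B g1 qFt = ((pb + pa * kb - pa / k1) / k2) *.~B \<one>~B" by (intro dv sub) simp_all
 have "(ka * eb * k2) *.~B \<one>~B .+~B g2 qE .*~B g2 qE = (eb + ea * kb) *.~B \<one>~B"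
  using co[of qE] by (simp add: e1 k2 s B.csmult B.a_comm mult.commute mult.left_commute)
 then show "g2 qE .*~B g2 qE = (eb + ea * kb - ka * eb * k2) *.~B \<one>~B" by (intro sub) simp_all
qed

text \<open>This automorphism conjugates the braiding to its inverse.\<close>

definition swap :: "qelt => qelt" where
 "swap = (SOME h. h \<in> chom UQ UQ \<and> h qE = qFt \<and> h qFt = qE \<and> h qK = qK \<and> h qKinv = qKinv)"

lemma swap: "swap \<in> chom UQ UQ" "swap qE = qFt" "swap qFt = qE" "swap qK = qK" "swap qKinv = qKinv"
proof -
 have "utriple UQ qFt qE qK qKinv" using UQ_triple UQ.a_comm[of "qE .*~UQ qFt" "qFt .*~UQ qE"] by (simp add: utriple_def)
 from UQ_lift_triple[OF UQ.calg_self this] have "\<exists>h. h \<in> chom UQ UQ \<and> h qE = qFt \<and> h qFt = qE \<and> h qK = qK \<and> h qKinv = qKinv"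
  by (simp only: Bex_def)
 then have "swap \<in> chom UQ UQ \<and> swap qE = qFt \<and> swap qFt = qE \<and> swap qK = qK \<and> swap qKinv = qKinv"
  unfolding swap_def by (rule someI_ex)
 then show "swap \<in> chom UQ UQ" "swap qE = qFt" "swap qFt = qE" "swap qK = qK" "swap qKinv = qKinv" by auto
qed

lemma commuting_pair_swap:
 assumes "commuting_pair B f1 f2" shows "commuting_pair B (f1 \<circ> swap) (f2 \<circ> swap)"
 using commuting_pairD[OF assms] chomD(1)[OF swap(1)] kalg_hom_comp[OF swap(1), of _ B] by (simp add: commuting_pair_def)

text \<open>Under \<open>swap\<close> the equation for E and the one for iKF trade places, and the
  coproduct relations are permuted. Hence \<open>h\<close> satisfies the equations that determine
  \<open>f\<close>; the value of K is supplied by \<open>k\<close>.\<close>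

lemma braided_inverse:
 assumes B: "calg B" and b: "braided B (f1 \<circ> swap) (f2 \<circ> swap) g1 g2" and c: "braided B (g1 \<circ> swap) (g2 \<circ> swap) h1 h2"
  and f: "commuting_pair B f1 f2" and u: "u .: UQ"
  and k: "g2 qK .-~B g1 qE .*~B g2 qFt = f1 qK"
 shows "h1 u = f1 u" "h2 u = f2 u"
 using pair_unique[OF B braidedD(2)[OF c] f _ _ _ _ _ _ u] braidedD(3-8)[OF b] braidedD(3-8)[OF c] k by (simp_all add: swap)

lemma (in hom_pair) braided_key: "braided B f1 f2 g1 g2 ==> g2 qK .- g1 qE .* g2 qFt = f1 qK"
proof -
 assume b: "braided B f1 f2 g1 g2"
 obtain h1 h2 where h: "braided B f1 f2 h1 h2" "h1 qE = vv gP" "h2 qFt = vv gQ" "h2 qK = vv gS" by (rule braided_exists, rule that)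
 note e = braided_unique[OF calg_self b h(1)]
 show ?thesis using e(1)[of qE] e(2)[of qFt] e(2)[of qK] h new_inverse[THEN arg_cong[where f = vv]] by simp
qed

lemma commuting_pair_cong:
 assumes "commuting_pair B f1 f2" "!!u. u .: UQ ==> f1 u = h1 u" "!!u. u .: UQ ==> f2 u = h2 u"
 shows "commuting_pair B h1 h2"
proof -
 note f = commuting_pairD[OF assms(1)]
 have "h1 \<in> chom UQ B" "h2 \<in> chom UQ B"
  by (rule kalg_hom_cong[OF f(1) assms(2) UQ.kalg_axioms], assumption) (rule kalg_hom_cong[OF f(2) assms(3) UQ.kalg_axioms], assumption)
 then show ?thesis using f(3) assms(2,3) by (simp add: commuting_pair_def)
qed

lemma braided_cong:
 assumes b: "braided B f1 f2 g1 g2" and f: "!!u. u .: UQ ==> f1 u = f1' u" "!!u. u .: UQ ==> f2 u = f2' u"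
  and g: "!!u. u .: UQ ==> g1 u = g1' u" "!!u. u .: UQ ==> g2 u = g2' u"
 shows "braided B f1' f2' g1' g2'"
 using braidedD[OF b] commuting_pair_cong[OF braidedD(1)[OF b] f] commuting_pair_cong[OF braidedD(2)[OF b] g] by (simp add: braided_def f g)

section \<open>The localized tensor square and \<open>Rcheck\<close>\<close>

lemma fac_pair: "commuting_pair (UQn 2) (fac 2 1) (fac 2 2)"
 using TU.in_factor_hom[of 1 2] TU.in_factor_hom[of 2 2] TU.in_factor_commute[of 2 2 1] by (simp add: commuting_pair_def)

lemma fac_closed [simp]: "x .: UQ ==> fac 2 1 x .: (UQn 2)" "x .: UQ ==> fac 2 2 x .: (UQn 2)"
 using chomD(1)[OF commuting_pairD(1)[OF fac_pair]] chomD(1)[OF commuting_pairD(2)[OF fac_pair]] by auto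

lemma qw_eq: "qw = \<one>~(UQn 2) .+~(UQn 2) (fac 2 1 (qFt .*~UQ qFt) .*~(UQn 2) fac 2 2 ((qKinv .*~UQ qKinv) .*~UQ (qE .*~UQ qE)))"
 by (simp add: qw_def qFt_sq UQ.pow_two)

lemma qw_closed: "qw .: (UQn 2)" by (simp add: qw_eq)

lemma qw_central: assumes a: "a .: (UQn 2)" shows "qw .*~(UQn 2) a = a .*~(UQn 2) qw"
proof -
 note f = commuting_pairD[OF fac_pair]
 have z: "ring.sc (UQn 2) False (fac 2 k z) (fac 2 j x)" if "k \<in> {1, 2}" "j \<in> {1..2}" "z \<in> Z0" "x .: UQ" for k j z x
 proof -
  have zc: "z .: UQ" using Z0_carrier that by blast
  have "k = 1 \<or> k = 2" "j = 1 \<or> j = 2" using that by auto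
  then show ?thesis
   using f(3)[OF that(4) zc] f(3)[OF zc that(4)] Z0_central[OF that(3,4)] chomD(2)[OF f(1) zc that(4)] chomD(2)[OF f(1) that(4) zc]
    chomD(2)[OF f(2) zc that(4)] chomD(2)[OF f(2) that(4) zc] by (elim disjE) (simp_all add: TU.TP.sc_def)
 qed
 have Z: "(qKinv .*~UQ qKinv) .*~UQ (qE .*~UQ qE) \<in> Z0" by (intro Z0_closed Z0_sq)
 have q: "ring.sc (UQn 2) False qw (fac 2 j x)" if j: "j \<in> {1..2}" and x: "x .: UQ" for j x
 proof -
  have "j = 1 \<or> j = 2" using j by auto
  then have c: "fac 2 j x .: (UQn 2)" using x by auto
  have "ring.sc (UQn 2) (False \<noteq> False) (fac 2 1 (qFt .*~UQ qFt) .*~(UQn 2) fac 2 2 ((qKinv .*~UQ qKinv) .*~UQ (qE .*~UQ qE))) (fac 2 j x)"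
   by (rule TU.TP.sc_mult_l[OF z[OF _ j Z0_sq(5) x] z[OF _ j Z x]]) (use c in simp_all)
  then show ?thesis unfolding qw_eq using c by (intro TU.TP.sc_add_l TU.TP.sc_one) simp_all
 qed
 from a have "ring.sc (UQn 2) False qw a"
 proof (induction rule: TU.TP_induct)
  case (gen j x)
  then show ?case by (rule q)
 next
  case (mult x y)
  then show ?case using TU.TP.sc_mult_r[of 2 False qw x False y] qw_closed by simp
 qed (use qw_closed in \<open>simp_all add: TU.TP.sc_def TU.TP.l_distr TU.TP.r_distr TU.TP.csmult\<close>)
 then show ?thesis by (simp add: TU.TP.sc_def)
qed

interpretation LW: localization "UQn 2" qw
 by (intro localization.intro localization_axioms.intro TU.TP_calg qw_closed qw_central)

abbreviation "UQ2w \<equiv> localize (UQn 2) qw"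
abbreviation "toW \<equiv> to_loc (UQn 2) qw"

text \<open>\<open>Rcheck\<close> is prescribed on F of the second factor, whereas
  \<open>braided\<close> speaks of iKF. Once the product of the two K is preserved, multiplying by
  it translates one condition into the other.\<close>

lemma pair_Ft_F_iff:
 assumes B: "calg B" and f: "commuting_pair B f1 f2" and g: "commuting_pair B g1 g2"
  and k: "g1 qK .*~B g2 qK = f1 qK .*~B f2 qK"
 shows "g1 qK .*~B g2 qFt = f1 qFt \<longleftrightarrow> g2 qF = f1 qF .*~B f2 qKinv"
proof -
 interpret B: calg B by fact
 note F = commuting_pairD[OF f] and G = commuting_pairD[OF g]
 note cl [simp] = chomD(1)[OF F(1)] chomD(1)[OF F(2)] chomD(1)[OF G(1)] chomD(1)[OF G(2)]
 have KF: "h qK .*~B h qF = (- \<i>) *.~B h qFt" if "h \<in> chom UQ B" for h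
 proof -
  have "qK .*~UQ qF = (- \<i>) *.~UQ qFt" by (simp add: qFt_def UQ.csmult)
  then show ?thesis using chomD(2)[OF that, of qK qF] chomD(5)[OF that, of qFt] by simp
 qed
 have a: "f1 qK .*~B f2 qK .*~B g2 qF = (- \<i>) *.~B (g1 qK .*~B g2 qFt)"
  unfolding k[symmetric] using KF[OF G(2)] by (simp add: B.m_assoc B.csmult)
 have b: "f1 qK .*~B f2 qK .*~B (f1 qF .*~B f2 qKinv) = (- \<i>) *.~B f1 qFt"
 proof -
  have "f1 qK .*~B f2 qK .*~B (f1 qF .*~B f2 qKinv) = f1 qK .*~B (f2 qK .*~B f1 qF) .*~B f2 qKinv" by (simp add: B.m_assoc)
  also have "\<dots> = f1 qK .*~B f1 qF .*~B (f2 qK .*~B f2 qKinv)" unfolding F(3)[OF qgen_closed qgen_closed] by (simp add: B.m_assoc)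
  finally show ?thesis by (simp add: KF[OF F(1)] chom_K_inverse[OF F(2)])
 qed
 have can: "x = y" if "f1 qK .*~B f2 qK .*~B x = f1 qK .*~B f2 qK .*~B y" "x .: B" "y .: B" for x y
 proof -
  have i: "f2 qKinv .*~B f1 qKinv .*~B (f1 qK .*~B f2 qK .*~B z) = z" if "z .: B" for z
  proof -
   have "f2 qKinv .*~B f1 qKinv .*~B (f1 qK .*~B f2 qK .*~B z) = f2 qKinv .*~B (f1 qKinv .*~B f1 qK) .*~B f2 qK .*~B z"
    using that by (simp add: B.m_assoc)
   then show ?thesis using that by (simp add: chom_K_inverse[OF F(1)] chom_K_inverse[OF F(2)])
  qed
  have "f2 qKinv .*~B f1 qKinv .*~B (f1 qK .*~B f2 qK .*~B x) = f2 qKinv .*~B f1 qKinv .*~B (f1 qK .*~B f2 qK .*~B y)" by (simp only: that(1))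
  then show ?thesis by (simp only: i[OF that(2)] i[OF that(3)])
 qed
 have neg: "x = y" if "(- \<i>) *.~B x = (- \<i>) *.~B y" "x .: B" "y .: B" for x y
 proof -
  have "\<i> *.~B ((- \<i>) *.~B x) = \<i> *.~B ((- \<i>) *.~B y)" using that(1) by simp
  then show ?thesis using that(2,3) by (simp add: B.csmult)
 qed
 show ?thesis
 proof
  assume "g1 qK .*~B g2 qFt = f1 qFt"
  then show "g2 qF = f1 qF .*~B f2 qKinv" using a b can[of "g2 qF" "f1 qF .*~B f2 qKinv"] by simp
 next
  assume "g2 qF = f1 qF .*~B f2 qKinv"
  then show "g1 qK .*~B g2 qFt = f1 qFt" using a b neg[of "g1 qK .*~B g2 qFt" "f1 qFt"] by simp
 qed
qed

text \<open>The square of the image of K is \<open>qw\<close> times the square of K in the second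
  factor, so it is inverted by the inverse of \<open>qw\<close> together with the inverse square of
  that K.\<close>

lemma hom_pair_UQ2w:
 "hom_pair UQ2w (toW \<circ> fac 2 1) (toW \<circ> fac 2 2) (LW.ti .*~UQ2w toW (fac 2 2 (qKinv .*~UQ qKinv)))"
proof -
 note l = chomD[OF LW.to_loc_hom]
 note F = commuting_pairD[OF fac_pair] note F1 = chomD[OF F(1)] and F2 = chomD[OF F(2)]
 note P = commuting_pairD[OF commuting_pair_comp[OF fac_pair LW.to_loc_hom]]
 let ?D = "fac 2 2 (qK .*~UQ qK) .+~(UQn 2) fac 2 1 (qFt .*~UQ qFt) .*~(UQn 2) fac 2 2 (qE .*~UQ qE)"
 let ?L = "fac 2 2 (qKinv .*~UQ qKinv)"
 have KL: "(qKinv .*~UQ qKinv) .*~UQ (qK .*~UQ qK) = \<one>~UQ"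
 proof -
  have "(qKinv .*~UQ qKinv) .*~UQ (qK .*~UQ qK) = qKinv .*~UQ (qKinv .*~UQ qK) .*~UQ qK" by (simp add: UQ.m_assoc)
  then show ?thesis by (simp add: UQ_rels)
 qed
 have LD: "?L .*~(UQn 2) ?D = qw"
 proof -
  have "?L .*~(UQn 2) (fac 2 1 (qFt .*~UQ qFt) .*~(UQn 2) fac 2 2 (qE .*~UQ qE)) = fac 2 1 (qFt .*~UQ qFt) .*~(UQn 2) (?L .*~(UQn 2) fac 2 2 (qE .*~UQ qE))"
   using F(3)[of "qFt .*~UQ qFt" "qKinv .*~UQ qKinv"] by (simp add: TU.TP.m_assoc[symmetric])
  moreover have "?L .*~(UQn 2) fac 2 2 (qK .*~UQ qK) = \<one>~(UQn 2)" using F2(2)[of "qKinv .*~UQ qKinv" "qK .*~UQ qK"] KL F2(4) by simp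
  ultimately show ?thesis unfolding qw_eq by (simp add: TU.TP.r_distr F2(2)[of "qKinv .*~UQ qKinv" "qE .*~UQ qE"])
 qed
 have "ring.sc (UQn 2) False ?L (fac 2 1 (qFt .*~UQ qFt) .*~(UQn 2) fac 2 2 (qE .*~UQ qE))"
 proof -
  have "ring.sc (UQn 2) False ?L (fac 2 1 (qFt .*~UQ qFt))" using F(3)[of "qFt .*~UQ qFt" "qKinv .*~UQ qKinv"] by (simp add: TU.TP.sc_def)
  moreover have "ring.sc (UQn 2) False ?L (fac 2 2 (qE .*~UQ qE))"
   using Z0_central[OF Z0_sq(2), of "qE .*~UQ qE"] F2(2)[of "qKinv .*~UQ qKinv" "qE .*~UQ qE"] F2(2)[of "qE .*~UQ qE" "qKinv .*~UQ qKinv"] by (simp add: TU.TP.sc_def)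
  ultimately show ?thesis using TU.TP.sc_mult_r[of 2 False ?L "fac 2 1 (qFt .*~UQ qFt)" False "fac 2 2 (qE .*~UQ qE)"] by simp
 qed
 then have Lc: "?D .*~(UQn 2) ?L = ?L .*~(UQn 2) ?D"
  using Z0_central[OF Z0_sq(2), of "qK .*~UQ qK"] F2(2)[of "qKinv .*~UQ qKinv" "qK .*~UQ qK"] F2(2)[of "qK .*~UQ qK" "qKinv .*~UQ qKinv"]
  by (simp add: TU.TP.sc_def TU.TP.l_distr TU.TP.r_distr)
 have D: "(toW \<circ> fac 2 2) qK .*~UQ2w (toW \<circ> fac 2 2) qK .+~UQ2w (toW \<circ> fac 2 1) qFt .*~UQ2w ((toW \<circ> fac 2 1) qFt .*~UQ2w ((toW \<circ> fac 2 2) qE .*~UQ2w (toW \<circ> fac 2 2) qE)) = toW ?D"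
  by (simp add: l F1(2) F2(2) LW.LA.m_assoc TU.TP.m_assoc)
 have c: "LW.ti .*~UQ2w toW ?L .: UQ2w" using LW.ti_closed l(1) by simp
 have "LW.ti .*~UQ2w toW ?L .*~UQ2w toW ?D = LW.ti .*~UQ2w toW qw"
  using LW.ti_closed l(1) l(2)[of ?L ?D] by (simp add: LW.LA.m_assoc LD)
 then have 1: "LW.ti .*~UQ2w toW ?L .*~UQ2w toW ?D = \<one>~UQ2w" by (simp add: LW.ti_inverse)
 have "toW ?D .*~UQ2w (LW.ti .*~UQ2w toW ?L) = (toW ?D .*~UQ2w LW.ti) .*~UQ2w toW ?L" using LW.ti_closed l(1) by (simp add: LW.LA.m_assoc)
 also have "\<dots> = LW.ti .*~UQ2w toW (?D .*~(UQn 2) ?L)" using LW.ti_commute[of ?D] LW.ti_closed l(1) l(2)[of ?D ?L] by (simp add: LW.LA.m_assoc)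
 finally have 2: "toW ?D .*~UQ2w (LW.ti .*~UQ2w toW ?L) = \<one>~UQ2w" unfolding Lc LD by (simp add: LW.ti_inverse)
 show ?thesis
  by (intro hom_pair.intro hom_pair_axioms.intro LW.LA_calg P c) (simp_all only: D 1 2)
qed

lemma coproduct_agree:
 assumes B: "calg B" and h: "h \<in> chom (UQn 2) B" "l \<in> chom (UQn 2) B"
 shows "(\<forall>u\<in>carrier UQ. h (coproduct u) = l (coproduct u)) \<longleftrightarrow>
   h (fac 2 2 qE) .+~B h (fac 2 1 qE) .*~B h (fac 2 2 qK) = l (fac 2 2 qE) .+~B l (fac 2 1 qE) .*~B l (fac 2 2 qK) \<and>
   h (fac 2 2 qFt) .+~B h (fac 2 1 qFt) .*~B h (fac 2 2 qK) = l (fac 2 2 qFt) .+~B l (fac 2 1 qFt) .*~B l (fac 2 2 qK) \<and>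
   h (fac 2 1 qK) .*~B h (fac 2 2 qK) = l (fac 2 1 qK) .*~B l (fac 2 2 qK)" (is "?A \<longleftrightarrow> ?E \<and> ?F \<and> ?K")
proof -
 have v: "(r (coproduct qE) = r (fac 2 2 qE) .+~B r (fac 2 1 qE) .*~B r (fac 2 2 qK))"
  "r (coproduct qFt) = r (fac 2 2 qFt) .+~B r (fac 2 1 qFt) .*~B r (fac 2 2 qK)" "r (coproduct qK) = r (fac 2 1 qK) .*~B r (fac 2 2 qK)"
  if "r \<in> chom (UQn 2) B" for r using chomD[OF that] by (simp_all add: coproduct_gens)
 have "?A \<longleftrightarrow> h (coproduct qE) = l (coproduct qE) \<and> h (coproduct qFt) = l (coproduct qFt) \<and> h (coproduct qK) = l (coproduct qK)"
 proof
  assume e: "h (coproduct qE) = l (coproduct qE) \<and> h (coproduct qFt) = l (coproduct qFt) \<and> h (coproduct qK) = l (coproduct qK)"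
  show ?A
  proof
   fix u assume u: "u .: UQ"
   show "h (coproduct u) = l (coproduct u)"
    using UQ_hom_eq_Ft[OF B kalg_hom_comp[OF coproduct_hom h(1)] kalg_hom_comp[OF coproduct_hom h(2)] _ _ _ u] e by simp
  qed
 qed simp
 then show ?thesis unfolding v[OF h(1)] v[OF h(2)] .
qed

text \<open>For a homomorphism, the conditions in the definition of \<open>Rcheck\<close> are
  equivalent to \<open>braided\<close> for its restrictions to the two factors. Existence then comes
  from the explicit formulas and uniqueness from \<open>braided_unique\<close>.\<close>

lemma Rcheck_spec:
 shows Rcheck_hom: "Rcheck \<in> chom (UQn 2) UQ2w"
  and Rcheck_braided: "braided UQ2w (toW \<circ> fac 2 1) (toW \<circ> fac 2 2) (Rcheck \<circ> fac 2 1) (Rcheck \<circ> fac 2 2)"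
proof -
 interpret H: hom_pair UQ2w "toW \<circ> fac 2 1" "toW \<circ> fac 2 2" "LW.ti .*~UQ2w toW (fac 2 2 (qKinv .*~UQ qKinv))"
  by (rule hom_pair_UQ2w)
 note l = chomD[OF LW.to_loc_hom] chomD_add[OF LW.to_loc_hom TU.TP_calg LW.LA_calg]
 have iff: "h (fac 2 1 qE) = toW (fac 2 1 qK .*~(UQn 2) fac 2 2 qE) \<and>
    h (fac 2 2 qF) = toW (fac 2 1 qF .*~(UQn 2) fac 2 2 qKinv) \<and>
    h (fac 2 1 qK) = toW (fac 2 2 qK .-~(UQn 2) (\<i> *.~(UQn 2) (fac 2 1 (qK .*~UQ qF) .*~(UQn 2) fac 2 2 qE))) \<and>
    (\<forall>u\<in>carrier UQ. h (coproduct u) = toW (coproduct u)) \<longleftrightarrow> braided UQ2w (toW \<circ> fac 2 1) (toW \<circ> fac 2 2) (h \<circ> fac 2 1) (h \<circ> fac 2 2)"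
  if h: "h \<in> chom (UQn 2) UQ2w" for h
 proof -
  note cp = commuting_pair_comp[OF fac_pair h] and lp = commuting_pair_comp[OF fac_pair LW.to_loc_hom]
  have k: "\<i> *.~(UQn 2) (fac 2 1 (qK .*~UQ qF) .*~(UQn 2) fac 2 2 qE) = fac 2 1 qFt .*~(UQn 2) fac 2 2 qE"
   unfolding qFt_def using chomD(5)[OF commuting_pairD(1)[OF fac_pair], of "qK .*~UQ qF" \<i>] by (simp add: TU.TP.csmult)
  have i: "g1K \<and> g2F \<and> e3 \<and> (E \<and> F \<and> K) \<longleftrightarrow> g1K \<and> g2F' \<and> e3 \<and> E \<and> F \<and> K" if "K ==> g2F = g2F'" for g1K g2F g2F' e3 E F K
   using that by auto
  show ?thesis
   unfolding braided_def coproduct_agree[OF LW.LA_calg h LW.to_loc_hom] k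
   using cp lp pair_Ft_F_iff[OF LW.LA_calg lp cp] by (simp add: l) blast
 qed
 let ?Q = "%h. h \<in> alg_hom (UQn 2) UQ2w \<and> h (fac 2 1 qE) = toW (fac 2 1 qK .*~(UQn 2) fac 2 2 qE) \<and>
    h (fac 2 2 qF) = toW (fac 2 1 qF .*~(UQn 2) fac 2 2 qKinv) \<and>
    h (fac 2 1 qK) = toW (fac 2 2 qK .-~(UQn 2) (\<i> *.~(UQn 2) (fac 2 1 (qK .*~UQ qF) .*~(UQn 2) fac 2 2 qE))) \<and>
    (\<forall>u\<in>carrier UQ. h (coproduct u) = toW (coproduct u))"
 have Q: "?Q h \<longleftrightarrow> h \<in> chom (UQn 2) UQ2w \<and> h \<in> extensional (carrier (UQn 2)) \<and> braided UQ2w (toW \<circ> fac 2 1) (toW \<circ> fac 2 2) (h \<circ> fac 2 1) (h \<circ> fac 2 2)" for h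
 proof (cases "h \<in> chom (UQn 2) UQ2w")
  case True
  show ?thesis unfolding alg_hom_iff iff[OF True] by (simp only: conj_assoc)
 next
  case False
  then show ?thesis unfolding alg_hom_iff by simp
 qed
 obtain g1 g2 where g: "braided UQ2w (toW \<circ> fac 2 1) (toW \<circ> fac 2 2) g1 g2" by (rule H.braided_exists, rule that)
 note G = commuting_pairD[OF braidedD(2)[OF g]]
 let ?G = "%k::nat. if k = 1 then g1 else g2"
 interpret G: commuting_homs UQ 2 UQ2w ?G
 proof (rule commuting_homsI[OF UQ.calg_self LW.LA_calg])
  show "?G j \<in> chom UQ UQ2w" for j using G by simp
  fix i j x y assume a: "i \<in> {1..2::nat}" "j \<in> {1..2}" "i < j" "x .: UQ" "y .: UQ"
  then have "i = 1" "j \<noteq> 1" by auto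
  then show "?G i x .*~UQ2w ?G j y = ?G j y .*~UQ2w ?G i x" using G(3)[OF a(4,5)] by simp
 qed
 let ?t = "tensor_lift 2 UQ UQ2w ?G"
 have t: "?t (fac 2 1 u) = g1 u" "?t (fac 2 2 u) = g2 u" if "u .: UQ" for u
  using G.tensor_lift_in_factor[of 1 u] G.tensor_lift_in_factor[of 2 u] that by simp_all
 let ?h = "restrict ?t (carrier (UQn 2))"
 have h: "?h \<in> chom (UQn 2) UQ2w" using chom_restrict[OF G.tensor_lift_hom TU.TP_calg] by (simp add: alg_hom_iff)
 have ht: "?h (fac 2 1 u) = g1 u" "?h (fac 2 2 u) = g2 u" if "u .: UQ" for u
  using t that by simp_all
 have hb: "braided UQ2w (toW \<circ> fac 2 1) (toW \<circ> fac 2 2) (?h \<circ> fac 2 1) (?h \<circ> fac 2 2)"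
  by (rule braided_cong[OF g]) (simp_all only: ht o_apply)
 have Qh: "?Q ?h" unfolding Q using h hb by simp
 have uniq: "h' = ?h" if q: "?Q h'" for h'
 proof -
  have q': "h' \<in> chom (UQn 2) UQ2w" "h' \<in> extensional (carrier (UQn 2))" "braided UQ2w (toW \<circ> fac 2 1) (toW \<circ> fac 2 2) (h' \<circ> fac 2 1) (h' \<circ> fac 2 2)"
   using q unfolding Q by auto
  show ?thesis
  proof (rule extensionalityI[OF q'(2)])
   show "h' x = ?h x" if x: "x .: (UQn 2)" for x
   proof (rule TU.TP_hom_eq[OF LW.LA_calg q'(1) h _ x])
    fix j u assume j: "j \<in> {1..2::nat}" and u: "u .: UQ"
    have "j = 1 \<or> j = 2" using j by auto
    then show "h' (fac 2 j u) = ?h (fac 2 j u)" using braided_unique[OF LW.LA_calg q'(3) hb u] by auto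
   qed
  qed simp
 qed
 have "?Q Rcheck" unfolding Rcheck_def Let_def by (rule theI[of ?Q, OF Qh uniq])
 then show "Rcheck \<in> chom (UQn 2) UQ2w" "braided UQ2w (toW \<circ> fac 2 1) (toW \<circ> fac 2 2) (Rcheck \<circ> fac 2 1) (Rcheck \<circ> fac 2 2)"
  unfolding Q by auto
qed

lemma hom_pair_scalar:
 assumes B: "calg B" and f: "commuting_pair B f1 f2"
  and s: "f1 qFt .*~B f1 qFt = pa *.~B \<one>~B" "f2 qE .*~B f2 qE = eb *.~B \<one>~B" "f2 qK .*~B f2 qK = kb *.~B \<one>~B"
  and k: "k1 = kb + pa * eb" "k1 \<noteq> 0"
 shows "hom_pair B f1 f2 ((1 / k1) *.~B \<one>~B)"
proof -
 interpret B: calg B by fact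
 note F = commuting_pairD[OF f]
 have c: "f1 qFt .: B" using chomD(1)[OF F(1)] by simp
 have e: "f2 qK .*~B f2 qK .+~B f1 qFt .*~B (f1 qFt .*~B (f2 qE .*~B f2 qE)) = k1 *.~B \<one>~B"
  unfolding s k(1) B.csmult(1)[OF B.one_closed] using c by (simp add: B.csmult s mult.commute)
 show ?thesis
  by (intro hom_pair.intro hom_pair_axioms.intro B F) (simp_all add: e B.csmult k(2))
qed

text \<open>The generators are treated in the order in which \<open>pair_unique\<close> solves for
  them, with \<open>comm_inverse\<close> for the inverses. This keeps a braided pair commuting with
  the other tensor factors.\<close>

lemma braided_commute:
 assumes B: "calg B" and b: "braided B f1 f2 g1 g2" and y: "y .: B"
  and c: "!!x. x .: UQ ==> f1 x .*~B y = y .*~B f1 x" "!!x. x .: UQ ==> f2 x .*~B y = y .*~B f2 x"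
  and u: "u .: UQ"
 shows "g1 u .*~B y = y .*~B g1 u" "g2 u .*~B y = y .*~B g2 u"
proof -
 interpret B: calg B by fact
 note d = braidedD[OF b]
 note F = commuting_pairD[OF d(1)] and G = commuting_pairD[OF d(2)]
 note cl [simp] = chomD(1)[OF F(1)] chomD(1)[OF F(2)] chomD(1)[OF G(1)] chomD(1)[OF G(2)]
 have m: "(x .*~B z) .*~B y = y .*~B (x .*~B z)" if "x .: B" "z .: B" "x .*~B y = y .*~B x" "z .*~B y = y .*~B z" for x z
  using B.sc_mult_l[of False x y False z] that y by (simp add: B.sc_def)
 have a: "(x .+~B z) .*~B y = y .*~B (x .+~B z)" "(x .-~B z) .*~B y = y .*~B (x .-~B z)"
  if "x .: B" "z .: B" "x .*~B y = y .*~B x" "z .*~B y = y .*~B z" for x z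
  using that y by (simp_all add: a_minus_def B.l_distr B.r_distr B.l_minus B.r_minus)
 note i = chom_K_inverse[OF G(1)] chom_K_inverse[OF G(2)]
 have 1: "g1 qE .*~B y = y .*~B g1 qE" unfolding d(3) by (rule m) (simp_all add: c)
 have 2: "g1 qK .*~B y = y .*~B g1 qK" unfolding d(5) by (intro a m) (simp_all add: c)
 have 3: "g1 qKinv .*~B y = y .*~B g1 qKinv" by (rule B.comm_inverse[OF _ _ y i(1,2) 2]) simp_all
 have l: "g1 qKinv .*~B (g1 qK .*~B x) = x" if "x .: B" for x using that by (simp add: B.m_assoc[symmetric] i)
 have fk: "f1 qK .*~B f2 qK .*~B y = y .*~B (f1 qK .*~B f2 qK)" by (rule m) (simp_all add: c)
 have "g2 qK = g1 qKinv .*~B (f1 qK .*~B f2 qK)" using l[of "g2 qK"] by (simp add: d(8))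
 then have 4: "g2 qK .*~B y = y .*~B g2 qK" using m[OF _ _ 3 fk] by simp
 have 5: "g2 qKinv .*~B y = y .*~B g2 qKinv" by (rule B.comm_inverse[OF _ _ y i(3,4) 4]) simp_all
 have "g2 qFt = g1 qKinv .*~B f1 qFt" using l[of "g2 qFt"] by (simp add: d(4))
 then have 6: "g2 qFt .*~B y = y .*~B g2 qFt" using m[OF _ _ 3 c(1)[OF qFt_closed]] by simp
 have co: "x = z .-~B w" if "x .+~B w = z" "x .: B" "w .: B" for x z w
 proof -
  have "(x .+~B w) .-~B w = x" using that(2,3) by (simp add: a_minus_def B.a_assoc B.r_neg)
  then show ?thesis using that(1) by simp
 qed
 have fe: "(f2 x .+~B f1 x .*~B f2 qK) .*~B y = y .*~B (f2 x .+~B f1 x .*~B f2 qK)" if "x .: UQ" for x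
  by (intro a m) (use that in \<open>simp_all add: c\<close>)
 have "g2 qE = (f2 qE .+~B f1 qE .*~B f2 qK) .-~B g1 qE .*~B g2 qK" by (rule co[OF d(6)]) simp_all
 then have 7: "g2 qE .*~B y = y .*~B g2 qE" using a(2)[OF _ _ fe m[OF _ _ 1 4]] by simp
 have "g1 qFt .*~B g2 qK = (f2 qFt .+~B f1 qFt .*~B f2 qK) .-~B g2 qFt"
  by (rule co) (simp_all add: d(7)[symmetric] B.a_comm)
 then have 8: "(g1 qFt .*~B g2 qK) .*~B y = y .*~B (g1 qFt .*~B g2 qK)" using a(2)[OF _ _ fe 6] by simp
 have "g1 qFt = (g1 qFt .*~B g2 qK) .*~B g2 qKinv" by (simp add: B.m_assoc i)
 then have 9: "g1 qFt .*~B y = y .*~B g1 qFt" using m[OF _ _ 8 5] by simp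
 show "g1 u .*~B y = y .*~B g1 u" by (rule UQ_homs_commute_elt[OF B G(1) y 1 9 2 3 u])
 show "g2 u .*~B y = y .*~B g2 u" by (rule UQ_homs_commute_elt[OF B G(2) y 7 6 4 5 u])
qed

text \<open>Condition \<open>c\<close> says that whatever commutes with the factors \<open>i\<close>
  and \<open>i + 1\<close> commutes with \<open>g1\<close> and \<open>g2\<close>. Elements of the
  other factors are of this kind.\<close>

lemma commuting_homs_replace:
 assumes f: "commuting_homs UQ n B f" and B: "calg B" and i: "i \<in> {1..n}" "i + 1 \<in> {1..n}" and g: "commuting_pair B g1 g2"
  and c: "!!y u. [| u .: UQ; y .: B; !!x. x .: UQ ==> f i x .*~B y = y .*~B f i x;
    !!x. x .: UQ ==> f (i + 1) x .*~B y = y .*~B f (i + 1) x |] ==> g1 u .*~B y = y .*~B g1 u \<and> g2 u .*~B y = y .*~B g2 u"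
 shows "commuting_homs UQ n B (%j. if j = i then g1 else if j = i + 1 then g2 else f j)"
proof -
 interpret F: commuting_homs UQ n B f by (rule f)
 note G = commuting_pairD[OF g]
 have r: "g1 u .*~B f j x = f j x .*~B g1 u \<and> g2 u .*~B f j x = f j x .*~B g2 u" if "u .: UQ" "x .: UQ" "j \<in> {1..n}" "j \<noteq> i" "j \<noteq> i + 1" for u x j
  by (rule c[OF that(1)]) (use that i chomD(1)[OF F.f_hom[OF that(3)] that(2)] F.f_comm[OF i(1) that(3)] F.f_comm[OF i(2) that(3)] in auto)
 show ?thesis
 proof (rule commuting_homsI[OF UQ.calg_self B])
  show "(if j = i then g1 else if j = i + 1 then g2 else f j) \<in> chom UQ B" if "j \<in> {1..n}" for j using that G(1,2) F.f_hom by simp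
  fix a b x y assume ab: "a \<in> {1..n}" "b \<in> {1..n}" "a < b" "x .: UQ" "y .: UQ"
  consider "a = i" "b = i + 1" | "a \<in> {i, i + 1}" "b \<notin> {i, i + 1}" | "b \<in> {i, i + 1}" "a \<notin> {i, i + 1}" | "a \<notin> {i, i + 1}" "b \<notin> {i, i + 1}"
   using ab(3) by fastforce
  then show "(if a = i then g1 else if a = i + 1 then g2 else f a) x .*~B (if b = i then g1 else if b = i + 1 then g2 else f b) y
   = (if b = i then g1 else if b = i + 1 then g2 else f b) y .*~B (if a = i then g1 else if a = i + 1 then g2 else f a) x"
  proof cases
   case 1
   then show ?thesis using G(3)[OF ab(4,5)] by simp
  next
   case 2
   then show ?thesis using r[OF ab(4,5,2)] by auto
  next
   case 3
   then show ?thesis using r[OF ab(5,4,1)] by auto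
  next
   case 4
   then show ?thesis using F.f_comm[OF ab(1,2) _ ab(4,5)] ab(3) by simp
  qed
 qed
qed

section \<open>A crossing acting between quotients at characters\<close>

locale colored_crossing =
 fixes n i :: nat and \<rho> \<rho>' :: obj
 assumes sig: "sigma_colored n i \<rho> \<rho>'"
begin

lemma idx: "1 \<le> i" "i < n" "i \<in> {1..n}" "i + 1 \<in> {1..n}" and objs: "\<rho> \<in> objects n" "\<rho>' \<in> objects n"
 using sig by (auto simp: sigma_colored_def)

sublocale A: char_quot n \<rho> by (rule char_quot.intro) (rule objs)
sublocale B: char_quot n \<rho>' by (rule char_quot.intro) (rule objs)

text \<open>The numbering is that of \<sigma>: the source colors are 1 and 2, and the target colors
  are 4 at \<open>i\<close> and 3 at \<open>i + 1\<close>.\<close>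

abbreviation "\<kappa>1 \<equiv> chi_kappa (\<rho> i)"
abbreviation "\<kappa>2 \<equiv> chi_kappa (\<rho> (i + 1))"
abbreviation "\<kappa>3 \<equiv> chi_kappa (\<rho>' (i + 1))"
abbreviation "\<kappa>4 \<equiv> chi_kappa (\<rho>' i)"
abbreviation "\<epsilon>1 \<equiv> chi_epsilon (\<rho> i)"
abbreviation "\<epsilon>2 \<equiv> chi_epsilon (\<rho> (i + 1))"
abbreviation "\<epsilon>3 \<equiv> chi_epsilon (\<rho>' (i + 1))"
abbreviation "\<epsilon>4 \<equiv> chi_epsilon (\<rho>' i)"
abbreviation "\<phi>1 \<equiv> chi_phi (\<rho> i)"
abbreviation "\<phi>2 \<equiv> chi_phi (\<rho> (i + 1))"
abbreviation "\<phi>3 \<equiv> chi_phi (\<rho>' (i + 1))"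
abbreviation "\<phi>4 \<equiv> chi_phi (\<rho>' i)"

lemma other: "j \<noteq> i ==> j \<noteq> i + 1 ==> \<rho>' j = \<rho> j" using sig by (simp add: sigma_colored_def)

lemma sigma_matrices:
 "chi_plus (\<rho> i) ** chi_plus (\<rho> (i + 1)) = chi_plus (\<rho>' i) ** chi_plus (\<rho>' (i + 1))"
 "chi_minus (\<rho> i) ** chi_minus (\<rho> (i + 1)) = chi_minus (\<rho>' i) ** chi_minus (\<rho>' (i + 1))"
 "chi_minus (\<rho> i) ** chi_plus (\<rho> (i + 1)) = chi_plus (\<rho>' i) ** chi_minus (\<rho>' (i + 1))"
 using sig by (simp_all add: sigma_colored_def Let_def)

lemma coords:
 "\<kappa>1 * \<kappa>2 = \<kappa>4 * \<kappa>3" "\<phi>1 * \<kappa>2 + \<phi>2 = \<phi>4 * \<kappa>3 + \<phi>3" "\<epsilon>2 + \<epsilon>1 * \<kappa>2 = \<epsilon>3 + \<epsilon>4 * \<kappa>3"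
 "\<kappa>2 + \<epsilon>1 * \<phi>2 = \<kappa>4" "\<epsilon>1 = \<kappa>4 * \<epsilon>3" "\<kappa>1 * \<phi>2 = \<phi>4" "\<kappa>1 = \<phi>4 * \<epsilon>3 + \<kappa>3"
proof -
 note d = chi_plus_def chi_minus_def matrix_matrix_mult_def sum_2
 show "\<kappa>1 * \<kappa>2 = \<kappa>4 * \<kappa>3" using sigma_matrices(1)[THEN arg_cong[where f = "%M. M $ 1 $ 1"]] by (simp add: d)
 show "\<phi>1 * \<kappa>2 + \<phi>2 = \<phi>4 * \<kappa>3 + \<phi>3" using sigma_matrices(1)[THEN arg_cong[where f = "%M. M $ 2 $ 1"]] by (simp add: d)
 show "\<epsilon>2 + \<epsilon>1 * \<kappa>2 = \<epsilon>3 + \<epsilon>4 * \<kappa>3" using sigma_matrices(2)[THEN arg_cong[where f = "%M. M $ 1 $ 2"]] by (simp add: d)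
 show "\<kappa>2 + \<epsilon>1 * \<phi>2 = \<kappa>4" using sigma_matrices(3)[THEN arg_cong[where f = "%M. M $ 1 $ 1"]] by (simp add: d)
 show "\<epsilon>1 = \<kappa>4 * \<epsilon>3" using sigma_matrices(3)[THEN arg_cong[where f = "%M. M $ 1 $ 2"]] by (simp add: d)
 show "\<kappa>1 * \<phi>2 = \<phi>4" using sigma_matrices(3)[THEN arg_cong[where f = "%M. M $ 2 $ 1"]] by (simp add: d)
 show "\<kappa>1 = \<phi>4 * \<epsilon>3 + \<kappa>3" using sigma_matrices(3)[THEN arg_cong[where f = "%M. M $ 2 $ 2"]] by (simp add: d)
qed

lemma kappa_ne: "\<kappa>1 \<noteq> 0" "\<kappa>2 \<noteq> 0" "\<kappa>3 \<noteq> 0" "\<kappa>4 \<noteq> 0"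
 using char_values(4)[OF A.char] char_values(4)[OF B.char] idx by auto

text \<open>The shadow on characters of the exchange of the two \<Omega>. It is derived from
  \<open>coords\<close> after clearing the denominators \<kappa>, and it carries nonsingularity
  across a crossing.\<close>

lemma Omega_swap:
 "\<rho> i (qOmega .*~UQ qOmega) = \<rho>' (i + 1) (qOmega .*~UQ qOmega)" "\<rho> (i + 1) (qOmega .*~UQ qOmega) = \<rho>' i (qOmega .*~UQ qOmega)"
proof -
 note k = kappa_ne and c = coords
 note o = char_values(7)[OF A.char[OF idx(3)]] char_values(7)[OF A.char[OF idx(4)]] char_values(7)[OF B.char[OF idx(3)]] char_values(7)[OF B.char[OF idx(4)]]
 have p2: "\<phi>2 = \<phi>4 / \<kappa>1" using c(6) k by (simp add: field_simps)
 have k2: "\<kappa>2 = \<kappa>4 * \<kappa>3 / \<kappa>1" using c(1) k by (simp add: field_simps)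
 have "\<kappa>3 * ((\<kappa>1 - 1)\<^sup>2 - \<epsilon>1 * \<phi>1) = \<kappa>1 * ((\<kappa>3 - 1)\<^sup>2 - \<epsilon>3 * \<phi>3)"
 proof -
  have "\<kappa>4 * (\<kappa>3 * (\<epsilon>1 * \<phi>1)) = \<epsilon>1 * \<kappa>1 * (\<phi>1 * \<kappa>2)" using c(1) by (metis mult.assoc mult.commute)
  also have "\<phi>1 * \<kappa>2 = \<phi>4 * \<kappa>3 + \<phi>3 - \<phi>2" using c(2) by (simp add: algebra_simps)
  also have "\<epsilon>1 * \<kappa>1 * \<dots> = \<kappa>4 * (\<epsilon>3 * (\<kappa>1 * (\<phi>4 * \<kappa>3 + \<phi>3) - \<phi>4))" using c(5,6) by (simp add: algebra_simps)
  finally have "\<kappa>3 * (\<epsilon>1 * \<phi>1) = \<epsilon>3 * (\<kappa>1 * (\<phi>4 * \<kappa>3 + \<phi>3) - \<phi>4)" using k(4) by simp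
  moreover have "\<kappa>3 * (\<kappa>1 - 1)\<^sup>2 - \<epsilon>3 * (\<kappa>1 * (\<phi>4 * \<kappa>3 + \<phi>3) - \<phi>4) = \<kappa>1 * ((\<kappa>3 - 1)\<^sup>2 - \<epsilon>3 * \<phi>3)"
   unfolding c(7) by (simp add: power2_eq_square algebra_simps)
  ultimately show ?thesis by (simp add: right_diff_distrib)
 qed
 then have "\<kappa>3 * (\<kappa>1 * \<rho> i (qOmega .*~UQ qOmega)) = \<kappa>1 * (\<kappa>3 * \<rho>' (i + 1) (qOmega .*~UQ qOmega))" unfolding o .
 then show "\<rho> i (qOmega .*~UQ qOmega) = \<rho>' (i + 1) (qOmega .*~UQ qOmega)" using k by simp
 have "\<kappa>4 * ((\<kappa>2 - 1)\<^sup>2 - \<epsilon>2 * \<phi>2) = \<kappa>2 * ((\<kappa>4 - 1)\<^sup>2 - \<epsilon>4 * \<phi>4)"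
 proof -
  have e2: "\<epsilon>2 = \<epsilon>3 + \<epsilon>4 * \<kappa>3 - \<epsilon>1 * \<kappa>2" using c(3) by (simp add: algebra_simps)
  have a: "\<kappa>4 * (\<epsilon>3 * \<phi>2) = \<kappa>4 - \<kappa>2" using c(4,5) by (simp add: algebra_simps)
  have b: "\<kappa>4 * (\<epsilon>4 * \<kappa>3 * \<phi>2) = \<kappa>2 * (\<epsilon>4 * \<phi>4)" using c(1,6) by (metis mult.assoc mult.commute)
  have "\<epsilon>1 * \<phi>2 = \<kappa>4 - \<kappa>2" using c(4) by (simp add: algebra_simps)
  then have d: "\<kappa>4 * (\<epsilon>1 * \<kappa>2 * \<phi>2) = \<kappa>4 * \<kappa>2 * (\<kappa>4 - \<kappa>2)" by (metis mult.assoc mult.commute)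
  have "\<kappa>4 * (\<epsilon>2 * \<phi>2) = (\<kappa>4 - \<kappa>2) + \<kappa>2 * (\<epsilon>4 * \<phi>4) - \<kappa>4 * \<kappa>2 * (\<kappa>4 - \<kappa>2)"
   unfolding e2 using a b d by (simp add: distrib_right distrib_left left_diff_distrib right_diff_distrib)
  then show ?thesis by (simp add: power2_eq_square algebra_simps)
 qed
 then have "\<kappa>4 * (\<kappa>2 * \<rho> (i + 1) (qOmega .*~UQ qOmega)) = \<kappa>2 * (\<kappa>4 * \<rho>' i (qOmega .*~UQ qOmega))" unfolding o .
 then show "\<rho> (i + 1) (qOmega .*~UQ qOmega) = \<rho>' i (qOmega .*~UQ qOmega)" using k by simp
qed

lemma nonsingular_iff: "nonsingular n \<rho> \<longleftrightarrow> nonsingular n \<rho>'"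
proof -
 let ?z = "%j. \<rho> j (qOmega .*~UQ qOmega) \<noteq> 0" and ?z' = "%j. \<rho>' j (qOmega .*~UQ qOmega) \<noteq> 0"
 have I: "{1..n} = insert i (insert (i + 1) ({1..n} - {i, i + 1}))" using idx by auto
 have "(\<forall>j\<in>{1..n}. ?z j) \<longleftrightarrow> ?z i \<and> ?z (i + 1) \<and> (\<forall>j\<in>{1..n} - {i, i + 1}. ?z j)" by (subst I) blast
 moreover have "(\<forall>j\<in>{1..n}. ?z' j) \<longleftrightarrow> ?z' i \<and> ?z' (i + 1) \<and> (\<forall>j\<in>{1..n} - {i, i + 1}. ?z' j)" by (subst I) blast
 moreover have "(\<forall>j\<in>{1..n} - {i, i + 1}. ?z j) \<longleftrightarrow> (\<forall>j\<in>{1..n} - {i, i + 1}. ?z' j)" using other by auto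
 ultimately show ?thesis unfolding nonsingular_def UQ.pow_two[OF qOmega_closed] Omega_swap by auto
qed

lemma pairB: "commuting_pair B.Q (B.atq i) (B.atq (i + 1))"
 using B.at_hom[OF idx(3)] B.at_hom[OF idx(4)] B.at_comm[OF idx(4) idx(3)] by (simp add: commuting_pair_def)

lemma pairA: "commuting_pair A.Q (A.atq i) (A.atq (i + 1))"
 using A.at_hom[OF idx(3)] A.at_hom[OF idx(4)] A.at_comm[OF idx(4) idx(3)] by (simp add: commuting_pair_def)

text \<open>The denominator of the braiding takes the value
  \<open>\<kappa>3 + \<phi>4 * \<epsilon>3\<close> at the target. By the coloring equations this is
  \<open>\<kappa>1\<close>, hence nonzero.\<close>

lemma hom_pairB: "hom_pair B.Q (B.atq i) (B.atq (i + 1)) ((1 / \<kappa>1) *.~B.Q \<one>~B.Q)"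
 by (rule hom_pair_scalar[OF B.Q_calg pairB B.at_squares(2)[OF idx(3)] B.at_squares(1,3)[OF idx(4)]]) (use coords(7) kappa_ne in simp_all)

lemma eval_at_spec:
 shows eval_at_hom: "eval_at n i \<rho>' \<in> chom UQ2w B.Q"
  and eval_at_fac: "u .: UQ ==> eval_at n i \<rho>' (toW (fac 2 1 u)) = B.atq i u" "u .: UQ ==> eval_at n i \<rho>' (toW (fac 2 2 u)) = B.atq (i + 1) u"
proof -
 let ?f = "%k::nat. B.atq (if k = 1 then i else i + 1)"
 have "commuting_homs UQ 2 B.Q ?f"
 proof (rule commuting_homsI[OF UQ.calg_self B.Q_calg])
  show "?f j \<in> chom UQ B.Q" for j using B.at_hom idx by simp
  fix a b x y assume a: "a \<in> {1..2::nat}" "b \<in> {1..2}" "a < b" "x .: UQ" "y .: UQ"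
  then have "a = 1" "b \<noteq> 1" by auto
  then show "?f a x .*~B.Q ?f b y = ?f b y .*~B.Q ?f a x" using B.at_comm[OF idx(3,4) _ a(4,5)] by simp
 qed
 then interpret F: commuting_homs UQ 2 B.Q ?f .
 let ?t = "tensor_lift 2 UQ B.Q ?f"
 note t = chomD[OF F.tensor_lift_hom]
 have v: "?t (fac 2 1 u) = B.atq i u" "?t (fac 2 2 u) = B.atq (i + 1) u" if "u .: UQ" for u
  using F.tensor_lift_in_factor[of 1 u] F.tensor_lift_in_factor[of 2 u] that by simp_all
 \<comment> \<open>On the quotient \<open>qw\<close> becomes the scalar
   \<open>1 + \<phi>4 * \<epsilon>3 / \<kappa>3\<close>, that is
   \<open>\<kappa>1 / \<kappa>3\<close>, and so the map extends to the localization.\<close>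
 have "?t qw = \<one>~B.Q .+~B.Q (\<phi>4 * (1 / \<kappa>3 * \<epsilon>3)) *.~B.Q \<one>~B.Q"
  unfolding qw_eq using chomD(2)[OF B.at_hom[OF idx(3)]] chomD(2)[OF B.at_hom[OF idx(4)]]
  by (simp add: t v B.at_squares[OF idx(3)] B.at_squares[OF idx(4)] B.Q.csmult mult.commute mult.left_commute)
 then have w: "?t qw = (\<kappa>1 / \<kappa>3) *.~B.Q \<one>~B.Q"
  using B.Q.csmult(1)[of "\<one>~B.Q" 1 "\<phi>4 * (1 / \<kappa>3 * \<epsilon>3)"] kappa_ne coords(7) by (simp add: B.Q.csmult(4) field_simps)
 have u: "(\<kappa>3 / \<kappa>1) *.~B.Q \<one>~B.Q .: B.Q" "?t qw .*~B.Q ((\<kappa>3 / \<kappa>1) *.~B.Q \<one>~B.Q) = \<one>~B.Q" "((\<kappa>3 / \<kappa>1) *.~B.Q \<one>~B.Q) .*~B.Q ?t qw = \<one>~B.Q"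
  using kappa_ne by (simp_all add: w B.Q.csmult)
 show "eval_at n i \<rho>' \<in> chom UQ2w B.Q" unfolding eval_at_def by (rule LW.loc_lift_hom[OF B.Q_calg F.tensor_lift_hom u])
 show "u .: UQ ==> eval_at n i \<rho>' (toW (fac 2 1 u)) = B.atq i u" "u .: UQ ==> eval_at n i \<rho>' (toW (fac 2 2 u)) = B.atq (i + 1) u"
  unfolding eval_at_def using LW.loc_lift_to_loc[OF B.Q_calg F.tensor_lift_hom u] v by simp_all
qed

definition "g1 u = eval_at n i \<rho>' (Rcheck (fac 2 1 u))"
definition "g2 u = eval_at n i \<rho>' (Rcheck (fac 2 2 u))"

lemma braidedB: "braided B.Q (B.atq i) (B.atq (i + 1)) g1 g2"
 by (rule braided_cong[OF braided_comp[OF Rcheck_braided eval_at_hom LW.LA_calg B.Q_calg]]) (simp_all add: eval_at_fac g1_def g2_def)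

text \<open>The conditions of \<open>Q_lift\<close> at the positions \<open>i\<close> and
  \<open>i + 1\<close>. After \<open>braided_squares\<close> they are the coloring equations in
  coordinates, which is why the crossing acts between the quotients.\<close>

lemma squaresB:
 "g1 qE .*~B.Q g1 qE = \<epsilon>1 *.~B.Q \<one>~B.Q" "g1 qFt .*~B.Q g1 qFt = \<phi>1 *.~B.Q \<one>~B.Q" "g1 qK .*~B.Q g1 qK = \<kappa>1 *.~B.Q \<one>~B.Q"
 "g2 qE .*~B.Q g2 qE = \<epsilon>2 *.~B.Q \<one>~B.Q" "g2 qFt .*~B.Q g2 qFt = \<phi>2 *.~B.Q \<one>~B.Q" "g2 qK .*~B.Q g2 qK = \<kappa>2 *.~B.Q \<one>~B.Q"
proof -
 have k: "\<kappa>1 = \<kappa>3 + \<phi>4 * \<epsilon>3" "\<kappa>2 = \<kappa>4 * \<kappa>3 / \<kappa>1" using coords(1,7) kappa_ne by (simp_all add: field_simps)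
 note s = braided_squares[OF B.Q_calg braidedB B.at_squares(1-3)[OF idx(3)] B.at_squares(1-3)[OF idx(4)] k(1) kappa_ne(1) k(2) kappa_ne(2)]
 have e: "\<phi>4 / \<kappa>1 = \<phi>2" "\<epsilon>3 + \<epsilon>4 * \<kappa>3 - \<kappa>4 * \<epsilon>3 * \<kappa>2 = \<epsilon>2"
  using coords(3,5,6) kappa_ne by (simp_all add: field_simps)
 moreover have "(\<phi>3 + \<phi>4 * \<kappa>3 - \<phi>4 / \<kappa>1) / \<kappa>2 = \<phi>1" unfolding e(1) using coords(2) kappa_ne by (simp add: field_simps)
 ultimately have "\<phi>4 / \<kappa>1 = \<phi>2" "(\<phi>3 + \<phi>4 * \<kappa>3 - \<phi>4 / \<kappa>1) / \<kappa>2 = \<phi>1" "\<epsilon>3 + \<epsilon>4 * \<kappa>3 - \<kappa>4 * \<epsilon>3 * \<kappa>2 = \<epsilon>2" by auto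
 then show "g1 qE .*~B.Q g1 qE = \<epsilon>1 *.~B.Q \<one>~B.Q" "g1 qFt .*~B.Q g1 qFt = \<phi>1 *.~B.Q \<one>~B.Q" "g1 qK .*~B.Q g1 qK = \<kappa>1 *.~B.Q \<one>~B.Q"
  "g2 qE .*~B.Q g2 qE = \<epsilon>2 *.~B.Q \<one>~B.Q" "g2 qFt .*~B.Q g2 qFt = \<phi>2 *.~B.Q \<one>~B.Q" "g2 qK .*~B.Q g2 qK = \<kappa>2 *.~B.Q \<one>~B.Q"
  using s coords(5) by simp_all
qed

lemma commuting_at: "commuting_homs UQ n B.Q B.atq" "commuting_homs UQ n A.Q A.atq"
 by (rule commuting_homsI[OF UQ.calg_self B.Q_calg B.at_hom B.at_comm]; simp) (rule commuting_homsI[OF UQ.calg_self A.Q_calg A.at_hom A.at_comm]; simp)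

abbreviation "As \<equiv> A_sigma n i \<rho> \<rho>'"

lemma A_sigma_spec:
 shows A_sigma_hom: "As \<in> chom A.Q B.Q"
  and A_sigma_at: "u .: UQ ==> As (A.atq i u) = g1 u" "u .: UQ ==> As (A.atq (i + 1) u) = g2 u"
   "[| u .: UQ; j \<in> {1..n}; j \<noteq> i; j \<noteq> i + 1 |] ==> As (A.atq j u) = B.atq j u"
proof -
 let ?g = "%j. if j = i then g1 else if j = i + 1 then g2 else B.atq j"
 have c: "commuting_homs UQ n B.Q ?g"
 proof (rule commuting_homs_replace[OF commuting_at(1) B.Q_calg idx(3,4) braidedD(2)[OF braidedB]])
  fix y u assume u: "u .: UQ" and y: "y .: B.Q" "!!x. x .: UQ ==> B.atq i x .*~B.Q y = y .*~B.Q B.atq i x"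
    "!!x. x .: UQ ==> B.atq (i + 1) x .*~B.Q y = y .*~B.Q B.atq (i + 1) x"
  show "g1 u .*~B.Q y = y .*~B.Q g1 u \<and> g2 u .*~B.Q y = y .*~B.Q g2 u"
   using braided_commute[OF B.Q_calg braidedB y u] by simp
 qed
 have "\<exists>h\<in>chom A.Q B.Q. \<forall>j\<in>{1..n}. \<forall>x\<in>carrier UQ. h (A.atq j x) = ?g j x"
  by (rule A.Q_lift[OF c]) (use squaresB B.at_squares other in auto)
 then obtain h where h: "h \<in> chom A.Q B.Q" and hv: "\<forall>j\<in>{1..n}. \<forall>x\<in>carrier UQ. h (A.atq j x) = ?g j x" by (rule bexE)
 let ?h = "restrict h (carrier A.Q)"
 have hh: "?h \<in> alg_hom A.Q B.Q" by (rule chom_restrict[OF h A.Q_calg])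
 have v: "?h (A.atq j u) = ?g j u" if "j \<in> {1..n}" "u .: UQ" for j u
  using hv that chomD(1)[OF A.at_hom[OF that(1)] that(2)] by simp
 let ?P = "%h. h \<in> alg_hom A.Q B.Q \<and> (\<forall>u\<in>carrier UQ. h (A.atq i u) = eval_at n i \<rho>' (Rcheck (fac 2 1 u)) \<and>
    h (A.atq (i + 1) u) = eval_at n i \<rho>' (Rcheck (fac 2 2 u)) \<and> (\<forall>j\<in>{1..n} - {i, i + 1}. h (A.atq j u) = B.atq j u))"
 have P: "?P ?h" using hh v[OF idx(3)] v[OF idx(4)] v by (simp add: g1_def g2_def)
 have uniq: "h' = ?h" if p: "?P h'" for h'
 proof (rule extensionalityI[of _ "carrier A.Q"])
  show "h' \<in> extensional (carrier A.Q)" using p by (simp add: alg_hom_iff)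
  show "h' x = ?h x" if x: "x .: A.Q" for x
  proof (rule A.Q_hom_eq[OF B.Q_calg _ _ _ x])
   show "h' \<in> chom A.Q B.Q" "?h \<in> chom A.Q B.Q" using p hh by (simp_all add: alg_hom_iff)
   show "h' (A.atq j u) = ?h (A.atq j u)" if "j \<in> {1..n}" "u .: UQ" for j u
    unfolding v[OF that] using p that by (simp add: g1_def g2_def)
  qed
 qed simp
 have "?P As" unfolding A_sigma_def by (rule theI[of ?P, OF P uniq])
 then show "As \<in> chom A.Q B.Q" "u .: UQ ==> As (A.atq i u) = g1 u" "u .: UQ ==> As (A.atq (i + 1) u) = g2 u"
   "[| u .: UQ; j \<in> {1..n}; j \<noteq> i; j \<noteq> i + 1 |] ==> As (A.atq j u) = B.atq j u"
  by (auto simp: alg_hom_iff g1_def g2_def)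
qed

text \<open>A left inverse is the same braiding with E and iKF exchanged; its denominator at the
  source is \<open>\<kappa>2 + \<epsilon>1 * \<phi>2\<close>, which equals \<open>\<kappa>4\<close>.
  Injectivity gives meaning to the \<open>inv_into\<close> in the action of an inverse
  crossing.\<close>

lemma A_sigma_inj: "inj_on As (carrier A.Q)"
proof -
 let ?f1 = "A.atq i \<circ> swap" and ?f2 = "A.atq (i + 1) \<circ> swap"
 have fp: "commuting_pair A.Q ?f1 ?f2" by (rule commuting_pair_swap[OF pairA])
 have k: "\<kappa>4 = \<kappa>2 + \<epsilon>1 * \<phi>2" "\<kappa>3 = \<kappa>1 * \<kappa>2 / \<kappa>4" using coords(1,4) kappa_ne by (simp_all add: field_simps)
 have s: "?f1 qE .*~A.Q ?f1 qE = \<phi>1 *.~A.Q \<one>~A.Q" "?f1 qFt .*~A.Q ?f1 qFt = \<epsilon>1 *.~A.Q \<one>~A.Q" "?f1 qK .*~A.Q ?f1 qK = \<kappa>1 *.~A.Q \<one>~A.Q"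
  "?f2 qE .*~A.Q ?f2 qE = \<phi>2 *.~A.Q \<one>~A.Q" "?f2 qFt .*~A.Q ?f2 qFt = \<epsilon>2 *.~A.Q \<one>~A.Q" "?f2 qK .*~A.Q ?f2 qK = \<kappa>2 *.~A.Q \<one>~A.Q"
  using A.at_squares[OF idx(3)] A.at_squares[OF idx(4)] by (simp_all add: swap)
 interpret H: hom_pair A.Q ?f1 ?f2 "(1 / \<kappa>4) *.~A.Q \<one>~A.Q"
  by (rule hom_pair_scalar[OF A.Q_calg fp s(2,4,6) k(1) kappa_ne(4)])
 obtain s1 s2 where b: "braided A.Q ?f1 ?f2 s1 s2" by (rule H.braided_exists, rule that)
 note sq = braided_squares[OF A.Q_calg b s k(1) kappa_ne(4) k(2) kappa_ne(3)]
 have e: "\<epsilon>1 / \<kappa>4 = \<epsilon>3" "(\<epsilon>2 + \<epsilon>1 * \<kappa>2 - \<epsilon>1 / \<kappa>4) / \<kappa>3 = \<epsilon>4" "\<phi>2 + \<phi>1 * \<kappa>2 - \<kappa>1 * \<phi>2 * \<kappa>3 = \<phi>3"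
  using coords(2,3,5,6) kappa_ne by (simp_all add: field_simps)
 let ?g = "%j. if j = i then s1 \<circ> swap else if j = i + 1 then s2 \<circ> swap else A.atq j"
 have sw: "swap (swap u) = u" if "u .: UQ" for u
  using UQ_hom_eq_Ft[OF UQ.calg_self kalg_hom_comp[OF swap(1) swap(1)] id_chom[OF UQ.calg_self] _ _ _ that] by (simp add: swap)
 note swc = chomD(1)[OF swap(1)]
 have c: "commuting_homs UQ n A.Q ?g"
 proof (rule commuting_homs_replace[OF commuting_at(2) A.Q_calg idx(3,4) commuting_pair_swap[OF braidedD(2)[OF b]]])
  fix y u assume u: "u .: UQ" and y: "y .: A.Q" "!!x. x .: UQ ==> A.atq i x .*~A.Q y = y .*~A.Q A.atq i x"
    "!!x. x .: UQ ==> A.atq (i + 1) x .*~A.Q y = y .*~A.Q A.atq (i + 1) x"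
  show "(s1 \<circ> swap) u .*~A.Q y = y .*~A.Q (s1 \<circ> swap) u \<and> (s2 \<circ> swap) u .*~A.Q y = y .*~A.Q (s2 \<circ> swap) u"
   using braided_commute[OF A.Q_calg b y(1) _ _ swc[OF u]] y(2,3) swc by simp
 qed
 have "\<exists>h\<in>chom B.Q A.Q. \<forall>j\<in>{1..n}. \<forall>x\<in>carrier UQ. h (B.atq j x) = ?g j x"
  by (rule B.Q_lift[OF c]) (use sq e coords(6) A.at_squares other in \<open>auto simp: swap\<close>)
 then obtain h where h: "h \<in> chom B.Q A.Q" and hv: "\<forall>j\<in>{1..n}. \<forall>x\<in>carrier UQ. h (B.atq j x) = ?g j x" by (rule bexE)
 have v: "h (B.atq j u) = ?g j u" if "j \<in> {1..n}" "u .: UQ" for j u using hv that by simp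
 have br: "braided A.Q (s1 \<circ> swap) (s2 \<circ> swap) (h \<circ> g1) (h \<circ> g2)"
  by (rule braided_cong[OF braided_comp[OF braidedB h B.Q_calg A.Q_calg]]) (simp_all add: v[OF idx(3)] v[OF idx(4)])
 have key: "s2 qK .-~A.Q s1 qE .*~A.Q s2 qFt = A.atq i qK" using H.braided_key[OF b] by (simp add: swap)
 note inv = braided_inverse[OF A.Q_calg b br pairA _ key]
 have "h (As x) = x" if x: "x .: A.Q" for x
 proof -
  have "(h \<circ> As) x = (%x. x) x"
  proof (rule A.Q_hom_eq[OF A.Q_calg kalg_hom_comp[OF A_sigma_hom h] id_chom[OF A.Q_calg] _ x])
   fix j u assume j: "j \<in> {1..n}" and u: "u .: UQ"
   consider "j = i" | "j = i + 1" | "j \<noteq> i" "j \<noteq> i + 1" by blast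
   then show "(h \<circ> As) (A.atq j u) = A.atq j u"
   proof cases
    case 3
    then show ?thesis using A_sigma_at(3)[OF u j 3] v[OF j u] by simp
   qed (use inv[OF u] A_sigma_at(1,2)[OF u] in auto)
  qed
  then show ?thesis by simp
 qed
 then show ?thesis by (rule inj_on_inverseI)
qed

end

lemma chom_finsum:
 assumes h: "h \<in> chom A B" and A: "calg A" and B: "calg B" and I: "finite I" and f: "f \<in> I \<rightarrow> carrier A"
 shows "h (finsum A f I) = finsum B (%i. h (f i)) I"
proof -
 interpret A: calg A by fact
 interpret B: calg B by fact
 show ?thesis using I f
 proof (induction I rule: finite_induct)
  case empty
  then show ?case using chomD_add(1)[OF h A B] by simp
 next
  case (insert i I)
  then have "(%i. h (f i)) \<in> I \<rightarrow> carrier B" "h (f i) .: B" using chomD(1)[OF h] by auto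
  then show ?case using insert chomD(3)[OF h] by simp
 qed
qed

section \<open>Coordinates on the span of the \<beta> at a character\<close>

context nonsing_quot
begin

text \<open>The image of the vector with dual coordinates \<open>a\<close> in the \<open>j\<close>th block.\<close>

definition "sv j a = (a $ 2) *.~Q \<beta> j 1 .-~Q (a $ 1) *.~Q \<beta> j 2" for a :: "complex ^ 2"

definition "svs a = finsum Q (%j. sv j (a j)) {1..<n}"

lemma sv_closed [simp]: "j \<in> {1..<n} ==> sv j a .: Q"
 using beta_closed[of j] by (simp add: sv_def del: beta_closed)

lemma sv_add: "j \<in> {1..<n} ==> sv j (a + b) = sv j a .+~Q sv j b"
 using beta_closed[of j 1] beta_closed[of j 2]
 by (simp add: sv_def Q.csmult(1) a_minus_def Q.minus_add Q.a_ac del: beta_closed)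

lemma sv_zero: "j \<in> {1..<n} ==> sv j 0 = \<zero>~Q"
 using beta_closed[of j 1] beta_closed[of j 2] by (simp add: sv_def Q.csmult a_minus_def del: beta_closed)

lemma sv_smult: "j \<in> {1..<n} ==> sv j (c *s a) = c *.~Q sv j a"
 using beta_closed[of j 1] beta_closed[of j 2] by (simp add: sv_def Q.csmult a_minus_def del: beta_closed)

lemma sv_sum: "finite J ==> j \<in> {1..<n} ==> sv j (sum r J) = finsum Q (%k. sv j (r k)) J"
proof (induction J rule: finite_induct)
 case (insert k J)
 then have "(%k. sv j (r k)) \<in> J \<rightarrow> carrier Q" using sv_closed by blast
 then show ?case using insert sv_closed[of j] by (simp add: sv_add del: sv_closed)
qed (simp add: sv_zero)

lemma sv_fun: "(%j. sv j (a j)) \<in> {1..<n} \<rightarrow> carrier Q" using sv_closed by blast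

lemma svs_closed: "svs a .: Q" unfolding svs_def by (rule Q.finsum_closed[OF sv_fun])

lemma svs_add: "svs (%j. a j + b j) = svs a .+~Q svs b"
proof -
 have "svs (%j. a j + b j) = finsum Q (%j. sv j (a j) .+~Q sv j (b j)) {1..<n}"
  unfolding svs_def by (rule Q.finsum_cong') (simp_all add: sv_add)
 then show ?thesis using Q.finsum_addf[OF sv_fun sv_fun] by (simp add: svs_def)
qed

lemma svs_smult: "svs (%j. c *s a j) = c *.~Q svs a"
proof -
 have "svs (%j. c *s a j) = finsum Q (%j. c *.~Q sv j (a j)) {1..<n}"
  unfolding svs_def by (rule Q.finsum_cong') (simp_all add: sv_smult)
 also have "\<dots> = c *.~Q svs a" unfolding svs_def by (rule Q.finsum_smult_ldistr[symmetric]) (use sv_fun in simp_all)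
 finally show ?thesis .
qed

lemma svs_single: assumes j: "j \<in> {1..<n}" shows "svs (%k. if k = j then b else 0) = sv j b"
proof -
 have "svs (%k. if k = j then b else 0) = finsum Q (%k. if j = k then sv k b else \<zero>~Q) {1..<n}"
  unfolding svs_def by (rule Q.finsum_cong') (auto simp: sv_zero)
 also have "\<dots> = sv j b"
 proof -
  have f: "(%k. sv k b) \<in> {1..<n} \<rightarrow> carrier Q" by (rule sv_fun)
  show ?thesis using Q.add.finprod_singleton[OF j _ f] by simp
 qed
 finally show ?thesis .
qed

lemma svs_cong: "(!!j. j \<in> {1..<n} ==> a j = b j) ==> svs a = svs b"
 unfolding svs_def by (rule Q.finsum_cong') auto

lemma scalar_Z: "c *.~Q \<one>~Q \<in> Z" by (intro Z_closed)

lemma Hs_smult: assumes "v \<in> Hs" shows "c *.~Q v \<in> Hs"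
proof -
 have "v .: Q" using Hs_carrier assms by auto
 then show ?thesis using Hs_mult[OF scalar_Z[of c] assms] by (simp add: Q.csmult)
qed

lemma sv_Hs: "j \<in> {1..<n} ==> sv j a \<in> Hs"
proof -
 assume j: "j \<in> {1..<n}"
 have "sv j a = (a $ 2) *.~Q \<beta> j 1 .+~Q (- (a $ 1)) *.~Q \<beta> j 2"
  using beta_closed[OF j] by (simp add: sv_def a_minus_def Q.csmult del: beta_closed)
 then show ?thesis using Hs_add[OF Hs_smult[OF Hs_beta[OF j]] Hs_smult[OF Hs_beta[OF j]]] by simp
qed

lemma svs_Hs: "svs a \<in> Hs"
proof -
 have "finsum Q (%j. sv j (a j)) J \<in> Hs" if "finite J" "J \<subseteq> {1..<n}" for J
  using that
 proof (induction J rule: finite_induct)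
  case empty
  then show ?case using Hs_zero by simp
 next
  case (insert j J)
  then have "(%j. sv j (a j)) \<in> J \<rightarrow> carrier Q" using sv_fun by blast
  then show ?case using insert Hs_add sv_Hs by simp
 qed
 then show ?thesis unfolding svs_def by simp
qed

lemma Hs_svs: assumes v: "v \<in> Hs" shows "\<exists>a. v = svs a"
proof -
 have "v \<in> {v. \<exists>a. v = svs a}"
 proof (rule Hs_induct[OF v])
  have "svs (%j. 0 *s 0) = \<zero>~Q" unfolding svs_smult using svs_closed by (simp add: Q.csmult)
  then show "\<zero>~Q \<in> {v. \<exists>a. v = svs a}" by (intro CollectI exI) (rule sym)
  show "\<beta> j \<nu> \<in> {v. \<exists>a. v = svs a}" if j: "j \<in> {1..<n}" "\<nu> \<in> {1, 2}" for j \<nu>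
  proof -
   have "sv j (vector [0, 1]) = \<beta> j 1" "sv j (vector [- 1, 0]) = \<beta> j 2"
    using beta_closed[OF j(1)] by (simp_all add: sv_def Q.csmult a_minus_def Q.uminus_csmult del: beta_closed)
   then have "\<exists>b. sv j b = \<beta> j \<nu>" using j(2) by auto
   then obtain b where b: "sv j b = \<beta> j \<nu>" by (rule exE)
   show ?thesis using svs_single[OF j(1), of b] unfolding b by (intro CollectI exI[of _ "%k. if k = j then b else 0"]) simp
  qed
  show "x .+~Q y \<in> {v. \<exists>a. v = svs a}" if xy: "x \<in> {v. \<exists>a. v = svs a}" "y \<in> {v. \<exists>a. v = svs a}" for x y
  proof -
   obtain a where a: "x = svs a" using xy(1) by (elim CollectE exE)
   obtain b where b: "y = svs b" using xy(2) by (elim CollectE exE)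
   show ?thesis unfolding a b by (intro CollectI exI) (rule svs_add[symmetric])
  qed
  show "c .*~Q x \<in> {v. \<exists>a. v = svs a}" if cx: "c \<in> Z" "x \<in> {v. \<exists>a. v = svs a}" for c x
  proof -
   obtain a where a: "x = svs a" using cx(2) by (elim CollectE exE)
   obtain d where d: "c = d *.~Q \<one>~Q" using Z_scalars[OF cx(1)] by (rule exE)
   have "c .*~Q x = svs (%j. d *s a j)" unfolding a d svs_smult using svs_closed by (simp add: Q.csmult)
   then show ?thesis by (intro CollectI exI)
  qed
 qed
 then show ?thesis by simp
qed

lemma cb_sv:
 assumes j: "j \<in> {1..<n}" and k: "k \<le> n"
 shows "cb (sv j a) (eps \<mu> k) = (if j = k then (a $ 2 * cc 1 \<mu> - a $ 1 * cc 2 \<mu>) *.~Q KK else \<zero>~Q)"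
proof -
 have s: "cb (c *.~Q x) y = c *.~Q cb x y" if "x .: Q" "y .: Q" for c x y
  using that by (simp add: cb_def Q.csmult a_minus_def)
 note b = beta_closed[OF j] note e = eps_closed[OF k]
 have "cb (sv j a) (eps \<mu> k) = (a $ 2) *.~Q cb (\<beta> j 1) (eps \<mu> k) .-~Q (a $ 1) *.~Q cb (\<beta> j 2) (eps \<mu> k)"
  unfolding sv_def using b e by (simp add: cb_minus_l s del: beta_closed)
 also have "\<dots> = (if j = k then (a $ 2 * cc 1 \<mu> + - (a $ 1 * cc 2 \<mu>)) *.~Q KK else \<zero>~Q)"
  unfolding cb_beta[OF j k] using Kpc(3) Q.csmult(1)[OF Kpc(3), of "a $ 2 * cc 1 \<mu>" "- (a $ 1 * cc 2 \<mu>)"] by (simp add: Q.csmult a_minus_def)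
 finally show ?thesis by simp
qed

text \<open>The commutator with \<open>eps \<mu> k\<close> isolates the block \<open>k\<close>, and
  the two values of \<mu> read off its two entries up to the factor -2. \<open>KK_scalar\<close>
  then turns a vanishing multiple of \<open>KK\<close> into a vanishing number.\<close>

lemma svs_zero_iff: assumes z: "svs a = \<zero>~Q" and k: "k \<in> {1..<n}" shows "a k = 0"
proof -
 have kn: "k \<le> n" using k by simp
 have c: "cb (svs a) (eps \<mu> k) = cb (sv k (a k)) (eps \<mu> k)" for \<mu>
 proof -
  have "cb (finsum Q (%j. sv j (a j)) J) (eps \<mu> k) = (if k \<in> J then cb (sv k (a k)) (eps \<mu> k) else \<zero>~Q)" if "finite J" "J \<subseteq> {1..<n}" for J
   using that
  proof (induction J rule: finite_induct)
   case empty
   then show ?case using eps_closed[OF kn] by (simp add: cb_def a_minus_def)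
  next
   case (insert j J)
   then have f: "(%j. sv j (a j)) \<in> J \<rightarrow> carrier Q" and j: "j \<in> {1..<n}" "J \<subseteq> {1..<n}" using sv_fun by blast+
   have add: "cb (x .+~Q y) (eps \<mu> k) = cb x (eps \<mu> k) .+~Q cb y (eps \<mu> k)" if "x .: Q" "y .: Q" for x y
    using that eps_closed[OF kn, of \<mu>] by (simp add: cb_def Q.l_distr Q.r_distr a_minus_def Q.minus_add Q.a_ac)
   have "cb (finsum Q (%j. sv j (a j)) (insert j J)) (eps \<mu> k) = cb (sv j (a j)) (eps \<mu> k) .+~Q (if k \<in> J then cb (sv k (a k)) (eps \<mu> k) else \<zero>~Q)"
    using insert.hyps f sv_closed[OF j(1)] Q.finsum_closed[OF f] insert.IH[OF j(2)] by (simp add: add del: sv_closed)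
   moreover have "cb (sv k (a k)) (eps \<mu> k) .: Q" using sv_closed[OF k] eps_closed[OF kn] by (simp add: cb_def del: sv_closed)
   moreover have "j \<noteq> k ==> cb (sv j (a j)) (eps \<mu> k) = \<zero>~Q" using cb_sv[OF j(1) kn] by simp
   ultimately show ?case using insert.hyps by (cases "j = k") simp_all
  qed
  from this[of "{1..<n}"] show ?thesis using k unfolding svs_def by simp
 qed
 have "cb (svs a) (eps \<mu> k) = \<zero>~Q" for \<mu> unfolding z using eps_closed[OF kn] by (simp add: cb_def a_minus_def)
 then have "(a k $ 2 * cc 1 \<mu> - a k $ 1 * cc 2 \<mu>) *.~Q KK = \<zero>~Q" for \<mu> using c[of \<mu>] cb_sv[OF k kn, of "a k" \<mu>] by simp
 then have "a k $ 2 * cc 1 \<mu> - a k $ 1 * cc 2 \<mu> = 0" for \<mu> by (rule KK_scalar)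
 from this[of 1] this[of 2] have "a k $ 1 = 0" "a k $ 2 = 0" by (simp_all add: cc_def)
 then show ?thesis by (simp add: vec_eq_iff forall_2)
qed

end

section \<open>The action of a crossing on \<alpha> and \<beta>\<close>

locale nonsingular_crossing = colored_crossing +
 assumes nsA: "nonsingular n \<rho>"
begin

sublocale NA: nonsing_quot n \<rho> by (intro nonsing_quot.intro A.char_quot_axioms nonsing_quot_axioms.intro nsA)
sublocale NB: nonsing_quot n \<rho>' by (intro nonsing_quot.intro B.char_quot_axioms nonsing_quot_axioms.intro) (use nsA nonsingular_iff in simp)

abbreviation "f1 \<equiv> B.atq i"
abbreviation "f2 \<equiv> B.atq (i + 1)"
abbreviation mB (infixl "\<cdot>" 70) where "x \<cdot> y \<equiv> x .*~B.Q y"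
abbreviation aB (infixl ".+.+" 65) where "x .+.+ y \<equiv> x .+~B.Q y"
abbreviation dB (infixl ".-.-" 65) where "x .-.- y \<equiv> x .-~B.Q y"
abbreviation sB (infixr "*.*" 75) where "c *.* y \<equiv> c *.~B.Q y"

text \<open>The last two equations are \<open>P19\<close> and \<open>P20\<close>, written with
  \<Omega> in place of its inverse so as to stay polynomial. Multiplying by both inverses turns
  their brackets into \<open>bb\<close>.\<close>

lemma gB:
 "g1 qOmega = f2 qOmega" "g2 qOmega = f1 qOmega"
 "f1 qK \<cdot> f1 qK \<cdot> g1 qFt \<cdot> f1 qOmega = f1 qK \<cdot> f1 qK \<cdot> f1 qFt \<cdot> f2 qOmega .-.- (f1 qFt \<cdot> f2 qOmega .-.- f1 qK \<cdot> f2 qFt \<cdot> f1 qOmega)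
  .-.- f1 qFt \<cdot> f1 qFt \<cdot> (f1 qE \<cdot> f2 qOmega .-.- f1 qK \<cdot> f2 qE \<cdot> f1 qOmega)"
 "(g1 qK \<cdot> g2 qE) \<cdot> f2 qOmega = f1 qK \<cdot> f2 qE \<cdot> f1 qOmega .+.+ f2 qK \<cdot> f2 qK \<cdot> (f1 qE \<cdot> f2 qOmega .-.- f1 qK \<cdot> f2 qE \<cdot> f1 qOmega)
  .-.- f2 qE \<cdot> f2 qE \<cdot> (f1 qFt \<cdot> f2 qOmega .-.- f1 qK \<cdot> f2 qFt \<cdot> f1 qOmega)"
proof -
 interpret H: hom_pair B.Q f1 f2 "(1 / \<kappa>1) *.* \<one>~B.Q" by (rule hom_pairB)
 obtain h1 h2 where h: "braided B.Q f1 f2 h1 h2" "h1 qOmega = f2 qOmega" "h2 qOmega = f1 qOmega" "h1 qFt = H.vv gX" "h1 qK = H.vv gD" "h2 qE = H.vv gY"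
  by (rule H.braided_exists, rule that)
 note e = braided_unique[OF B.Q_calg braidedB h(1)]
 show "g1 qOmega = f2 qOmega" "g2 qOmega = f1 qOmega" using e[of qOmega] h by simp_all
 have v: "g1 qFt = H.vv gX" "g1 qK \<cdot> g2 qE = H.vv gW"
  using e(1)[of qFt] e(1)[of qK] e(2)[of qE] h new_alpha(1)[THEN arg_cong[where f = H.vv]] by simp_all
 show "f1 qK \<cdot> f1 qK \<cdot> g1 qFt \<cdot> f1 qOmega = f1 qK \<cdot> f1 qK \<cdot> f1 qFt \<cdot> f2 qOmega .-.- (f1 qFt \<cdot> f2 qOmega .-.- f1 qK \<cdot> f2 qFt \<cdot> f1 qOmega)
  .-.- f1 qFt \<cdot> f1 qFt \<cdot> (f1 qE \<cdot> f2 qOmega .-.- f1 qK \<cdot> f2 qE \<cdot> f1 qOmega)"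
  using P19[THEN arg_cong[where f = H.vv]] by (simp add: v H.vv_Om)
 show "(g1 qK \<cdot> g2 qE) \<cdot> f2 qOmega = f1 qK \<cdot> f2 qE \<cdot> f1 qOmega .+.+ f2 qK \<cdot> f2 qK \<cdot> (f1 qE \<cdot> f2 qOmega .-.- f1 qK \<cdot> f2 qE \<cdot> f1 qOmega)
  .-.- f2 qE \<cdot> f2 qE \<cdot> (f1 qFt \<cdot> f2 qOmega .-.- f1 qK \<cdot> f2 qFt \<cdot> f1 qOmega)"
  using P20[THEN arg_cong[where f = H.vv]] by (simp add: v H.vv_Om)
qed

abbreviation "\<omega>1 \<equiv> NB.\<omega> i"
abbreviation "\<omega>2 \<equiv> NB.\<omega> (i + 1)"

lemma fB [simp]: "x .: UQ ==> f1 x .: B.Q" "x .: UQ ==> f2 x .: B.Q" "\<omega>1 .: B.Q" "\<omega>2 .: B.Q"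
 using NB.fc[OF idx(3)] NB.fc[OF idx(4)] NB.\<omega>c idx(3,4) by auto

lemma gBc [simp]: "x .: UQ ==> g1 x .: B.Q" "x .: UQ ==> g2 x .: B.Q"
 using chomD(1)[OF commuting_pairD(1)[OF braidedD(2)[OF braidedB]]] chomD(1)[OF commuting_pairD(2)[OF braidedD(2)[OF braidedB]]] by auto

text \<open>The difference \<beta> at \<open>i\<close> with the common prefix \<open>NB.Kp i\<close>
  split off, as recorded in \<open>alphaB\<close>.\<close>

definition "bb \<nu> = f1 (NB.gx \<nu>) \<cdot> \<omega>1 .-.- f1 qK \<cdot> f2 (NB.gx \<nu>) \<cdot> \<omega>2" for \<nu>

lemma bb_closed [simp]: "bb \<nu> .: B.Q" by (simp add: bb_def)

lemma Omega_cancel: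
 assumes x: "x .: B.Q"
 shows "x \<cdot> f1 qOmega \<cdot> (\<omega>1 \<cdot> \<omega>2) = x \<cdot> \<omega>2" "x \<cdot> f2 qOmega \<cdot> (\<omega>1 \<cdot> \<omega>2) = x \<cdot> \<omega>1"
proof -
 note p = NB.\<omega>_props[OF idx(3)] NB.\<omega>_props[OF idx(4)]
 have "x \<cdot> f1 qOmega \<cdot> (\<omega>1 \<cdot> \<omega>2) = x \<cdot> (f1 qOmega \<cdot> \<omega>1) \<cdot> \<omega>2" using x by (simp add: B.Q.m_assoc)
 then show "x \<cdot> f1 qOmega \<cdot> (\<omega>1 \<cdot> \<omega>2) = x \<cdot> \<omega>2" using x p by simp
 have "\<omega>1 \<cdot> \<omega>2 = \<omega>2 \<cdot> \<omega>1" using NB.sc_\<omega>\<omega>[OF idx(3,4)] by (simp add: B.Q.sc_def)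
 then have "x \<cdot> f2 qOmega \<cdot> (\<omega>1 \<cdot> \<omega>2) = x \<cdot> (f2 qOmega \<cdot> \<omega>2) \<cdot> \<omega>1" using x by (simp add: B.Q.m_assoc)
 then show "x \<cdot> f2 qOmega \<cdot> (\<omega>1 \<cdot> \<omega>2) = x \<cdot> \<omega>1" using x p by simp
qed

lemma B_diff: "x .: B.Q ==> y .: B.Q ==> z .: B.Q ==> (x .-.- y) \<cdot> z = x \<cdot> z .-.- y \<cdot> z"
 "x .: B.Q ==> y .: B.Q ==> z .: B.Q ==> z \<cdot> (x .-.- y) = z \<cdot> x .-.- z \<cdot> y"
 "x .: B.Q ==> y .: B.Q ==> c *.* (x .-.- y) = c *.* x .-.- c *.* y"
 by (simp_all add: a_minus_def B.Q.l_distr B.Q.r_distr B.Q.l_minus B.Q.r_minus B.Q.csmult)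

lemma bb_eq: "(f1 (NB.gx \<nu>) \<cdot> f2 qOmega .-.- f1 qK \<cdot> f2 (NB.gx \<nu>) \<cdot> f1 qOmega) \<cdot> (\<omega>1 \<cdot> \<omega>2) = bb \<nu>"
 by (simp add: B_diff Omega_cancel bb_def)

lemma bb12: "(f1 qE \<cdot> f2 qOmega .-.- f1 qK \<cdot> f2 qE \<cdot> f1 qOmega) \<cdot> (\<omega>1 \<cdot> \<omega>2) = bb 1"
 "(f1 qFt \<cdot> f2 qOmega .-.- f1 qK \<cdot> f2 qFt \<cdot> f1 qOmega) \<cdot> (\<omega>1 \<cdot> \<omega>2) = bb 2"
 using bb_eq[of 1] bb_eq[of 2] by (simp_all add: NB.gx_def)

text \<open>At a character the squares of K and iKF in \<open>gB\<close> become the numbers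
  \<open>\<kappa>4\<close> and \<open>\<phi>4\<close>, so a polynomial identity turns into a linear
  relation with the \<beta>. \<open>g_KE\<close> is its counterpart for
  \<open>gB(4)\<close>.\<close>

lemma g1_Ft: "g1 qFt \<cdot> \<omega>2 = f1 qFt \<cdot> \<omega>1 .-.- (1 / \<kappa>4) *.* (bb 2 .+.+ \<phi>4 *.* bb 1)"
proof -
 let ?w = "\<omega>1 \<cdot> \<omega>2" and ?x1 = "f1 qE \<cdot> f2 qOmega .-.- f1 qK \<cdot> f2 qE \<cdot> f1 qOmega" and ?x2 = "f1 qFt \<cdot> f2 qOmega .-.- f1 qK \<cdot> f2 qFt \<cdot> f1 qOmega"
 have "\<kappa>4 *.* (g1 qFt \<cdot> \<omega>2) = (f1 qK \<cdot> f1 qK \<cdot> g1 qFt \<cdot> f1 qOmega) \<cdot> ?w"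
  by (simp add: Omega_cancel B.at_squares[OF idx(3)] B.Q.csmult)
 also have "\<dots> = \<kappa>4 *.* (f1 qFt \<cdot> \<omega>1) .-.- ?x2 \<cdot> ?w .-.- \<phi>4 *.* (?x1 \<cdot> ?w)"
  unfolding gB(3) by (simp add: B_diff(1)[of _ _ ?w] Omega_cancel B.at_squares[OF idx(3)] B.Q.csmult)
 finally have "\<kappa>4 *.* (g1 qFt \<cdot> \<omega>2) = \<kappa>4 *.* (f1 qFt \<cdot> \<omega>1) .-.- bb 2 .-.- \<phi>4 *.* bb 1" unfolding bb12 .
 then have "(1 / \<kappa>4) *.* (\<kappa>4 *.* (g1 qFt \<cdot> \<omega>2)) = (1 / \<kappa>4) *.* (\<kappa>4 *.* (f1 qFt \<cdot> \<omega>1) .-.- bb 2 .-.- \<phi>4 *.* bb 1)" by simp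
 then have "g1 qFt \<cdot> \<omega>2 = (1 / \<kappa>4) *.* (\<kappa>4 *.* (f1 qFt \<cdot> \<omega>1) .-.- bb 2 .-.- \<phi>4 *.* bb 1)" using kappa_ne(4) by (simp add: B.Q.csmult)
 then show ?thesis using kappa_ne(4) by (simp add: B_diff B.Q.csmult a_minus_def B.Q.minus_add B.Q.a_assoc)
qed

lemma g_KE: "g1 qK \<cdot> g2 qE \<cdot> \<omega>1 = f1 qK \<cdot> f2 qE \<cdot> \<omega>2 .+.+ (\<kappa>3 *.* bb 1 .-.- \<epsilon>3 *.* bb 2)"
proof -
 let ?w = "\<omega>1 \<cdot> \<omega>2" and ?x1 = "f1 qE \<cdot> f2 qOmega .-.- f1 qK \<cdot> f2 qE \<cdot> f1 qOmega" and ?x2 = "f1 qFt \<cdot> f2 qOmega .-.- f1 qK \<cdot> f2 qFt \<cdot> f1 qOmega"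
 have "g1 qK \<cdot> g2 qE \<cdot> \<omega>1 = (g1 qK \<cdot> g2 qE \<cdot> f2 qOmega) \<cdot> ?w" by (simp add: Omega_cancel)
 also have "\<dots> = f1 qK \<cdot> f2 qE \<cdot> \<omega>2 .+.+ \<kappa>3 *.* (?x1 \<cdot> ?w) .-.- \<epsilon>3 *.* (?x2 \<cdot> ?w)"
  unfolding gB(4) by (simp add: B_diff(1)[of _ _ ?w] B.Q.l_distr Omega_cancel B.at_squares[OF idx(4)] B.Q.csmult)
 finally show ?thesis unfolding bb12 by (simp add: a_minus_def B.Q.a_assoc)
qed

lemma As_Kp: "1 \<le> j ==> j \<le> i ==> As (NA.Kp j) = NB.Kp j"
proof (induction j rule: dec_induct)
 case base
 then show ?case using chomD(4)[OF A_sigma_hom] by (simp add: NA.Kp_simps(1) NB.Kp_simps(1))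
next
 case (step j)
 have j: "j \<in> {1..n}" "j \<noteq> i" "j \<noteq> i + 1" "j \<le> n" using step idx(2) by auto
 show ?case using step j NA.Kpc(1)[OF j(1)] by (simp add: NA.Kp_simps(2) NB.Kp_simps(2) chomD(2)[OF A_sigma_hom] A_sigma_at(3))
qed

lemma Kp_i: "NA.Kp (i + 1) = NA.Kp i .*~A.Q A.atq i qK" "NA.Kp (i + 2) = NA.Kp (i + 1) .*~A.Q A.atq (i + 1) qK"
 "NB.Kp (i + 1) = NB.Kp i \<cdot> f1 qK" "NB.Kp (i + 2) = NB.Kp (i + 1) \<cdot> f2 qK"
proof -
 have s: "Suc i = i + 1" "Suc (i + 1) = i + 2" by auto
 show "NA.Kp (i + 1) = NA.Kp i .*~A.Q A.atq i qK" "NA.Kp (i + 2) = NA.Kp (i + 1) .*~A.Q A.atq (i + 1) qK"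
  "NB.Kp (i + 1) = NB.Kp i \<cdot> f1 qK" "NB.Kp (i + 2) = NB.Kp (i + 1) \<cdot> f2 qK"
  using NA.Kp_simps(2)[of i] NA.Kp_simps(2)[of "i + 1"] NB.Kp_simps(2)[of i] NB.Kp_simps(2)[of "i + 1"] idx unfolding s by auto
qed

text \<open>The braiding preserves the product of the two K, so prefixes containing both of them do
  not change.\<close>

lemma As_Kp': "i + 2 \<le> j ==> j \<le> Suc n ==> As (NA.Kp j) = NB.Kp j"
proof (induction j rule: dec_induct)
 case base
 have k: "NA.Kp (i + 2) = NA.Kp i .*~A.Q A.atq i qK .*~A.Q A.atq (i + 1) qK" "NB.Kp (i + 2) = NB.Kp i \<cdot> f1 qK \<cdot> f2 qK"
  unfolding Kp_i by (rule refl)+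
 have c: "NA.Kp i .: A.Q" "A.atq i qK .: A.Q" "A.atq (i + 1) qK .: A.Q" "NB.Kp i .: B.Q"
  using NA.Kpc(1)[OF idx(3)] NB.Kpc(1)[OF idx(3)] NA.fc[OF idx(3)] NA.fc[OF idx(4)] by auto
 have "As (NA.Kp (i + 2)) = NB.Kp i \<cdot> (g1 qK \<cdot> g2 qK)"
  unfolding k using c As_Kp[OF idx(1) order_refl] by (simp add: chomD(2)[OF A_sigma_hom] A_sigma_at B.Q.m_assoc)
 then show ?case unfolding k(2) braidedD(8)[OF braidedB] using c by (simp add: B.Q.m_assoc)
next
 case (step j)
 have j: "j \<in> {1..n}" "j \<noteq> i" "j \<noteq> i + 1" "1 \<le> j" "j \<le> n" using step by auto
 show ?case using step j NA.Kpc(1)[OF j(1)] by (simp add: NA.Kp_simps(2) NB.Kp_simps(2) chomD(2)[OF A_sigma_hom] A_sigma_at(3))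
qed

lemma As_omega: assumes j: "j \<in> {1..n}" "k \<in> {1..n}" and e: "As (A.atq j qOmega) = B.atq k qOmega" shows "As (NA.\<omega> j) = NB.\<omega> k"
proof -
 note p = NA.\<omega>_props[OF j(1)] NB.\<omega>_props[OF j(2)]
 have "As (NA.\<omega> j) \<cdot> B.atq k qOmega = \<one>~B.Q"
  using chomD(2)[OF A_sigma_hom p(1), of "A.atq j qOmega"] NA.fc[OF j(1)] chomD(4)[OF A_sigma_hom] p(3) by (simp add: e)
 then show ?thesis using chomD(1)[OF A_sigma_hom p(1)] p(4,5) NB.fc[OF j(2)] by (intro B.Q.inv_unique[of "As (NA.\<omega> j)" "B.atq k qOmega"]) auto
qed

lemma As_omegas: "As (NA.\<omega> i) = \<omega>2" "As (NA.\<omega> (i + 1)) = \<omega>1" "[| j \<in> {1..n}; j \<noteq> i; j \<noteq> i + 1 |] ==> As (NA.\<omega> j) = NB.\<omega> j"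
 using As_omega idx A_sigma_at gB by simp_all

lemma As_alpha_gen: assumes j: "j \<in> {1..n}"
 shows "As (NA.\<alpha> j \<nu>) = As (NA.Kp j) \<cdot> As (A.atq j (NB.gx \<nu>)) \<cdot> As (NA.\<omega> j)"
proof -
 have c: "NA.Kp j .: A.Q" "A.atq j (NB.gx \<nu>) .: A.Q" "NA.\<omega> j .: A.Q" using NA.Kpc(1)[OF j] NA.fc[OF j] NA.\<omega>c[OF j] NB.gx_closed by auto
 have "NA.gx \<nu> = NB.gx \<nu>" by (simp add: NA.gx_def NB.gx_def)
 then show ?thesis unfolding NA.alpha_eq using c by (simp add: chomD(2)[OF A_sigma_hom])
qed

lemma As_alpha_other: "[| j \<in> {1..n}; j \<noteq> i; j \<noteq> i + 1 |] ==> As (NA.\<alpha> j \<nu>) = NB.\<alpha> j \<nu>"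
 using As_Kp[of j] As_Kp'[of j] NB.gx_closed[of \<nu>] unfolding As_alpha_gen NB.alpha_eq
 by (cases "j < i") (simp_all add: As_omegas(3) A_sigma_at(3))

lemma Kpi [simp]: "NB.Kp i .: B.Q" using NB.Kpc(1)[OF idx(3)] .

lemma alphaB: "NB.\<alpha> i \<nu> = NB.Kp i \<cdot> (f1 (NB.gx \<nu>) \<cdot> \<omega>1)" "NB.\<alpha> (i + 1) \<nu> = NB.Kp i \<cdot> (f1 qK \<cdot> f2 (NB.gx \<nu>) \<cdot> \<omega>2)" "NB.\<beta> i \<nu> = NB.Kp i \<cdot> bb \<nu>"
proof -
 show a: "NB.\<alpha> i \<nu> = NB.Kp i \<cdot> (f1 (NB.gx \<nu>) \<cdot> \<omega>1)" unfolding NB.alpha_eq by (simp add: B.Q.m_assoc)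
 note k = Kp_i(3)
 show b: "NB.\<alpha> (i + 1) \<nu> = NB.Kp i \<cdot> (f1 qK \<cdot> f2 (NB.gx \<nu>) \<cdot> \<omega>2)" unfolding NB.alpha_eq k by (simp add: B.Q.m_assoc)
 show "NB.\<beta> i \<nu> = NB.Kp i \<cdot> bb \<nu>" unfolding beta_def a b bb_def by (simp add: B_diff)
qed

text \<open>Two of the images follow directly from the equations in \<open>braided\<close> and are
  again of the form \<alpha>. The other two differ from an \<alpha> by a combination of the \<beta>
  at \<open>i\<close>, so differences of neighbours stay in the span.\<close>

lemma As_alpha:
 "As (NA.\<alpha> i 1) = NB.\<alpha> (i + 1) 1" "As (NA.\<alpha> i 2) = NB.\<alpha> i 2 .-.- (1 / \<kappa>4) *.* (NB.\<beta> i 2 .+.+ \<phi>4 *.* NB.\<beta> i 1)"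
 "As (NA.\<alpha> (i + 1) 1) = NB.\<alpha> (i + 1) 1 .+.+ (\<kappa>3 *.* NB.\<beta> i 1 .-.- \<epsilon>3 *.* NB.\<beta> i 2)" "As (NA.\<alpha> (i + 1) 2) = NB.\<alpha> i 2"
proof -
 have g: "NB.gx 1 = qE" "NB.gx 2 = qFt" by (simp_all add: NB.gx_def)
 have k: "As (NA.Kp i) = NB.Kp i" by (rule As_Kp[OF idx(1) order_refl])
 have k': "As (NA.Kp (i + 1)) = NB.Kp i \<cdot> g1 qK"
  unfolding Kp_i(1) using NA.Kpc(1)[OF idx(3)] NA.fc[OF idx(3)] k by (simp add: chomD(2)[OF A_sigma_hom] A_sigma_at)
 show "As (NA.\<alpha> i 1) = NB.\<alpha> (i + 1) 1"
  unfolding As_alpha_gen[OF idx(3)] alphaB g k As_omegas by (simp add: A_sigma_at braidedD(3)[OF braidedB] B.Q.m_assoc)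
 have "As (NA.\<alpha> i 2) = NB.Kp i \<cdot> (g1 qFt \<cdot> \<omega>2)"
  unfolding As_alpha_gen[OF idx(3)] g k As_omegas by (simp add: A_sigma_at B.Q.m_assoc)
 then show "As (NA.\<alpha> i 2) = NB.\<alpha> i 2 .-.- (1 / \<kappa>4) *.* (NB.\<beta> i 2 .+.+ \<phi>4 *.* NB.\<beta> i 1)"
  unfolding g1_Ft alphaB g by (simp add: B_diff B.Q.r_distr B.Q.csmult)
 have "As (NA.\<alpha> (i + 1) 1) = NB.Kp i \<cdot> (g1 qK \<cdot> g2 qE \<cdot> \<omega>1)"
  unfolding As_alpha_gen[OF idx(4)] g k' As_omegas by (simp add: A_sigma_at B.Q.m_assoc)
 then show "As (NA.\<alpha> (i + 1) 1) = NB.\<alpha> (i + 1) 1 .+.+ (\<kappa>3 *.* NB.\<beta> i 1 .-.- \<epsilon>3 *.* NB.\<beta> i 2)"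
  unfolding g_KE alphaB g by (simp add: B_diff B.Q.r_distr B.Q.csmult)
 have "As (NA.\<alpha> (i + 1) 2) = NB.Kp i \<cdot> (g1 qK \<cdot> g2 qFt \<cdot> \<omega>1)"
  unfolding As_alpha_gen[OF idx(4)] g k' As_omegas by (simp add: A_sigma_at B.Q.m_assoc)
 then show "As (NA.\<alpha> (i + 1) 2) = NB.\<alpha> i 2" unfolding braidedD(4)[OF braidedB] alphaB g .
qed

end

lemma (in ring) diff_lemmas:
 assumes "x .: R" "y .: R" "z .: R"
 shows "x .- (x .+ y) = .- y" "(x .- y) .- x = .- y" "x .- z = (x .- y) .+ (y .- z)" "(x .+ y) .- z = (x .- z) .+ y" "x .- (y .- z) = (x .- y) .+ z"
proof -
 show "x .- (x .+ y) = .- y" using assms by (simp add: a_minus_def minus_add r_neg2)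
 show "(x .- y) .- x = .- y" using assms by (simp add: a_minus_def a_comm[of x ".- y"] a_assoc r_neg)
 show "x .- z = (x .- y) .+ (y .- z)" using assms by (simp add: a_minus_def a_assoc r_neg1)
 show "(x .+ y) .- z = (x .- z) .+ y" using assms by (simp add: a_minus_def a_assoc a_comm[of y ".- z"])
 show "x .- (y .- z) = (x .- y) .+ z" using assms by (simp add: a_minus_def a_assoc minus_add)
qed

context nonsingular_crossing
begin

lemma As_minus: "x .: A.Q ==> y .: A.Q ==> As (x .-~A.Q y) = As x .-.- As y"
 using chomD_add(3)[OF A_sigma_hom A.Q_calg B.Q_calg] .

lemma i_idx: "i \<in> {1..<n}" using idx by simp

abbreviation "svi \<equiv> NB.sv i"

lemma svi_vals:
 "NB.\<beta> i 1 = svi (vector [0, 1])" "NB.\<beta> i 2 = svi (vector [- 1, 0])"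
 "\<kappa>3 *.* NB.\<beta> i 1 .-.- \<epsilon>3 *.* NB.\<beta> i 2 = svi (vector [\<epsilon>3, \<kappa>3])"
 "(1 / \<kappa>4) *.* (NB.\<beta> i 2 .+.+ \<phi>4 *.* NB.\<beta> i 1) = svi (vector [- 1 / \<kappa>4, \<phi>4 / \<kappa>4])"
proof -
 note b = NB.beta_closed[OF i_idx]
 show 1: "NB.\<beta> i 1 = svi (vector [0, 1])" and 2: "NB.\<beta> i 2 = svi (vector [- 1, 0])"
  using b by (simp_all add: NB.sv_def B.Q.csmult a_minus_def B.Q.uminus_csmult del: NB.beta_closed)
 show "\<kappa>3 *.* NB.\<beta> i 1 .-.- \<epsilon>3 *.* NB.\<beta> i 2 = svi (vector [\<epsilon>3, \<kappa>3])" by (simp add: NB.sv_def)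
 have "(1 / \<kappa>4) *.* (NB.\<beta> i 2 .+.+ \<phi>4 *.* NB.\<beta> i 1) = svi ((1 / \<kappa>4) *s (vector [- 1, 0] + \<phi>4 *s vector [0, 1]))"
  unfolding NB.sv_smult[OF i_idx] NB.sv_add[OF i_idx] 1 2 ..
 also have "(1 / \<kappa>4) *s (vector [- 1, 0] + \<phi>4 *s vector [0, 1]) = (vector [- 1 / \<kappa>4, \<phi>4 / \<kappa>4] :: complex ^ 2)"
  by (simp add: vec_eq_iff forall_2)
 finally show "(1 / \<kappa>4) *.* (NB.\<beta> i 2 .+.+ \<phi>4 *.* NB.\<beta> i 1) = svi (vector [- 1 / \<kappa>4, \<phi>4 / \<kappa>4])" .
qed

text \<open>A crossing changes only the block \<open>i\<close>. The pair holds the contributions of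
  \<open>\<beta> j 1\<close> and \<open>\<beta> j 2\<close> to that block, in the coordinates of
  \<open>sv\<close>; they vanish unless \<open>j\<close> is \<open>i\<close> or one of its
  neighbours.\<close>

definition "Lcoef j = (if j = i then (vector [- \<epsilon>3, - \<kappa>3] :: complex ^ 2, vector [1 / \<kappa>4, - \<phi>4 / \<kappa>4] :: complex ^ 2) else if j + 1 = i then (vector [0, 1], vector [- 1 / \<kappa>4, \<phi>4 / \<kappa>4])
 else if j = i + 1 then (vector [\<epsilon>3, \<kappa>3], vector [- 1, 0]) else (0, 0))"

lemma svi_minus: ".-~B.Q svi a = svi (- a)"
proof -
 have "(- 1) *s a = - a" by (simp add: vec_eq_iff)
 then show ?thesis using NB.sv_smult[OF i_idx, of "- 1" a] NB.sv_closed[OF i_idx, of a] by (simp add: B.Q.uminus_csmult del: NB.sv_closed)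
qed

lemma As_beta: assumes j: "j \<in> {1..<n}"
 shows "As (NA.\<beta> j 1) = (if j = i then \<zero>~B.Q else NB.\<beta> j 1) .+.+ svi (fst (Lcoef j))"
  "As (NA.\<beta> j 2) = (if j = i then \<zero>~B.Q else NB.\<beta> j 2) .+.+ svi (snd (Lcoef j))"
proof -
 have J: "j \<in> {1..n}" "j + 1 \<in> {1..n}" using j by auto
 have e: "As (NA.\<beta> j \<nu>) = As (NA.\<alpha> j \<nu>) .-.- As (NA.\<alpha> (j + 1) \<nu>)" for \<nu>
  unfolding beta_def using As_minus J by simp
 note ac = NB.alpha_closed[OF J(1)] NB.alpha_closed[OF J(2)] NB.alpha_closed[OF idx(3)] NB.alpha_closed[OF idx(4)]
 note sc [simp] = NB.sv_closed[OF i_idx]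
 consider "j = i" | "j + 1 = i" | "j = i + 1" | "j \<noteq> i" "j + 1 \<noteq> i" "j \<noteq> i + 1" by blast
 note cas = this
 have vn: "- (vector [a, b] :: complex ^ 2) = vector [- a, - b]" for a b by (simp add: vec_eq_iff forall_2)
 from cas show "As (NA.\<beta> j 1) = (if j = i then \<zero>~B.Q else NB.\<beta> j 1) .+.+ svi (fst (Lcoef j))"
 proof cases
  case 1
  have "As (NA.\<beta> i 1) = .-~B.Q svi (vector [\<epsilon>3, \<kappa>3])"
   unfolding e[unfolded 1] As_alpha svi_vals(3) by (rule B.Q.diff_lemmas(1)) (use ac in simp_all)
  then show ?thesis using 1 by (simp add: Lcoef_def svi_minus vn)
 next
  case 2
  have "As (NA.\<beta> j 1) = NB.\<alpha> j 1 .-.- NB.\<alpha> (i + 1) 1" unfolding e 2 As_alpha using As_alpha_other[OF J(1)] 2 by simp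
  also have "\<dots> = NB.\<beta> j 1 .+.+ NB.\<beta> i 1" unfolding beta_def 2 by (rule B.Q.diff_lemmas(3)) (use ac in auto)
  finally show ?thesis using 2 by (simp add: Lcoef_def svi_vals(1))
 next
  case 3
  have o: "As (NA.\<alpha> (j + 1) 1) = NB.\<alpha> (j + 1) 1" by (rule As_alpha_other[OF J(2)]) (use 3 in auto)
  have "As (NA.\<beta> j 1) = NB.\<beta> j 1 .+.+ svi (vector [\<epsilon>3, \<kappa>3])"
   unfolding e o unfolding 3 As_alpha svi_vals(3) unfolding beta_def by (rule B.Q.diff_lemmas(4)) (use ac 3 in auto)
  then show ?thesis using 3 by (simp add: Lcoef_def)
 next
  case 4
  have "As (NA.\<beta> j 1) = NB.\<beta> j 1" unfolding e unfolding beta_def using As_alpha_other[OF J(1)] As_alpha_other[OF J(2)] 4 by simp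
  then show ?thesis using 4 j NB.beta_closed[OF j] by (simp add: Lcoef_def NB.sv_zero[OF i_idx] del: NB.beta_closed)
 qed
 from cas show "As (NA.\<beta> j 2) = (if j = i then \<zero>~B.Q else NB.\<beta> j 2) .+.+ svi (snd (Lcoef j))"
 proof cases
  case 1
  have "As (NA.\<beta> i 2) = .-~B.Q svi (vector [- 1 / \<kappa>4, \<phi>4 / \<kappa>4])"
   unfolding e[unfolded 1] As_alpha svi_vals(4) by (rule B.Q.diff_lemmas(2)) (use ac in simp_all)
  then show ?thesis using 1 by (simp add: Lcoef_def svi_minus vn)
 next
  case 2
  have "As (NA.\<beta> j 2) = NB.\<alpha> j 2 .-.- (NB.\<alpha> i 2 .-.- svi (vector [- 1 / \<kappa>4, \<phi>4 / \<kappa>4]))" unfolding e 2 As_alpha svi_vals(4) using As_alpha_other[OF J(1)] 2 by simp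
  also have "\<dots> = NB.\<beta> j 2 .+.+ svi (vector [- 1 / \<kappa>4, \<phi>4 / \<kappa>4])" unfolding beta_def 2 by (rule B.Q.diff_lemmas(5)) (use ac in auto)
  finally show ?thesis using 2 by (simp add: Lcoef_def)
 next
  case 3
  have o: "As (NA.\<alpha> (j + 1) 2) = NB.\<alpha> (j + 1) 2" by (rule As_alpha_other[OF J(2)]) (use 3 in auto)
  have "As (NA.\<beta> j 2) = NB.\<beta> i 2 .+.+ NB.\<beta> j 2"
   unfolding e o unfolding 3 As_alpha unfolding beta_def by (rule B.Q.diff_lemmas(3)) (use ac 3 in auto)
  then show ?thesis using 3 NB.beta_closed[OF j, of 2] NB.beta_closed[OF i_idx, of 2] by (simp add: Lcoef_def svi_vals(2)[symmetric] B.Q.a_comm del: NB.beta_closed)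
 next
  case 4
  have "As (NA.\<beta> j 2) = NB.\<beta> j 2" unfolding e unfolding beta_def using As_alpha_other[OF J(1)] As_alpha_other[OF J(2)] 4 by simp
  then show ?thesis using 4 j NB.beta_closed[OF j] by (simp add: Lcoef_def NB.sv_zero[OF i_idx] del: NB.beta_closed)
 qed
qed

definition "L j a = a $ 2 *s fst (Lcoef j) - a $ 1 *s snd (Lcoef j)" for a :: "complex ^ 2"

lemma svi_diff: "svi (a - b) = svi a .-.- svi b"
 using NB.sv_add[OF i_idx, of a "- b"] by (simp add: a_minus_def svi_minus)

lemma As_sv: assumes j: "j \<in> {1..<n}"
 shows "As (NA.sv j a) = NB.sv j (if j = i then 0 else a) .+.+ svi (L j a)"
proof -
 note b = NA.beta_closed[OF j] and b' = NB.beta_closed[OF j] and hs = chomD[OF A_sigma_hom]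
 note sc = NB.sv_closed[OF i_idx]
 have "As (NA.sv j a) = (a $ 2) *.* As (NA.\<beta> j 1) .-.- (a $ 1) *.* As (NA.\<beta> j 2)"
  unfolding NA.sv_def using b by (simp add: As_minus hs del: NA.beta_closed)
 also have "\<dots> = NB.sv j (if j = i then 0 else a) .+.+ ((a $ 2) *.* svi (fst (Lcoef j)) .-.- (a $ 1) *.* svi (snd (Lcoef j)))"
 proof -
  have g: "x *.* (b1 .+.+ p) .-.- y *.* (b2 .+.+ q) = (x *.* b1 .-.- y *.* b2) .+.+ (x *.* p .-.- y *.* q)"
   if "b1 .: B.Q" "b2 .: B.Q" "p .: B.Q" "q .: B.Q" for x y b1 b2 p q
   using that by (simp add: B.Q.csmult a_minus_def B.Q.minus_add B.Q.a_ac)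
  have "(a $ 2) *.* (if j = i then \<zero>~B.Q else NB.\<beta> j 1) .-.- (a $ 1) *.* (if j = i then \<zero>~B.Q else NB.\<beta> j 2) = NB.sv j (if j = i then 0 else a)"
   using NB.sv_zero[OF i_idx] by (cases "j = i") (simp_all add: NB.sv_def B.Q.csmult(6) a_minus_def)
  then show ?thesis unfolding As_beta[OF j] by (subst g) (use sc b' in \<open>simp_all del: NB.beta_closed NB.sv_closed\<close>)
 qed
 also have "(a $ 2) *.* svi (fst (Lcoef j)) .-.- (a $ 1) *.* svi (snd (Lcoef j)) = svi (L j a)"
  unfolding L_def svi_diff NB.sv_smult[OF i_idx] ..
 finally show ?thesis .
qed

lemma L_other: "j \<noteq> i ==> j + 1 \<noteq> i ==> j \<noteq> i + 1 ==> L j a = 0"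
 by (simp add: L_def Lcoef_def)

lemma L_zero: "L j 0 = 0" by (simp add: L_def)

text \<open>With zero boundary values at 0 and \<open>n\<close>, the neighbours \<open>i - 1\<close>
  and \<open>i + 1\<close> may be included even if they lie outside \<open>{1..<n}\<close>.\<close>

lemma As_svs:
 assumes a0: "a 0 = 0" "a n = 0"
 shows "As (NA.svs a) = NB.svs (a(i := L (i - 1) (a (i - 1)) + L i (a i) + L (i + 1) (a (i + 1))))"
proof -
 have ine: "i - 1 \<noteq> i" "i - 1 \<noteq> i + 1" using idx(1) by auto
 let ?b = "L (i - 1) (a (i - 1)) + L i (a i) + L (i + 1) (a (i + 1))"
 let ?a0 = "%j. if j = i then 0 else a j"
 have fA: "(%j. NA.sv j (a j)) \<in> {1..<n} \<rightarrow> carrier A.Q" by (rule NA.sv_fun)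
 have f1: "(%j. NB.sv j (?a0 j)) \<in> {1..<n} \<rightarrow> carrier B.Q" by (rule NB.sv_fun)
 have f2: "(%j. svi (L j (a j))) \<in> {1..<n} \<rightarrow> carrier B.Q" using NB.sv_closed[OF i_idx] by blast
 have "As (NA.svs a) = finsum B.Q (%j. As (NA.sv j (a j))) {1..<n}"
  unfolding NA.svs_def by (rule chom_finsum[OF A_sigma_hom A.Q_calg B.Q_calg _ fA]) simp
 also have "\<dots> = finsum B.Q (%j. NB.sv j (?a0 j) .+.+ svi (L j (a j))) {1..<n}"
  by (rule B.Q.finsum_cong') (use f1 f2 As_sv in \<open>auto simp del: NB.sv_closed\<close>)
 also have "\<dots> = NB.svs ?a0 .+.+ finsum B.Q (%j. svi (L j (a j))) {1..<n}"
  unfolding NB.svs_def by (rule B.Q.finsum_addf[OF f1 f2])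
 also have "finsum B.Q (%j. svi (L j (a j))) {1..<n} = svi (\<Sum>j\<in>{1..<n}. L j (a j))"
  by (rule NB.sv_sum[OF _ i_idx, symmetric]) simp
 also have "(\<Sum>j\<in>{1..<n}. L j (a j)) = ?b"
 proof -
  have "(\<Sum>j\<in>{1..<n}. L j (a j)) = (\<Sum>j\<in>{0..n}. L j (a j))"
   by (rule sum.mono_neutral_left) (use a0 in \<open>auto simp: L_zero not_le dest!: le_neq_implies_less\<close>)
  also have "\<dots> = (\<Sum>j\<in>{i - 1, i, i + 1}. L j (a j))"
   by (rule sum.mono_neutral_right) (use idx in \<open>auto intro!: L_other\<close>)
  also have "\<dots> = ?b" using ine by (simp add: add.assoc)
  finally show ?thesis .
 qed
 also have "svi ?b = NB.svs (%j. if j = i then ?b else 0)" by (rule NB.svs_single[OF i_idx, symmetric])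
 also have "NB.svs ?a0 .+.+ NB.svs (%j. if j = i then ?b else 0) = NB.svs (a(i := ?b))"
  unfolding NB.svs_add[symmetric] by (rule NB.svs_cong) simp
 finally show ?thesis .
qed

text \<open>The three terms to be compared with the cocycle side in \<open>ac_crossing\<close>. The
  first two are multiplied by the plus matrix of the new color at \<open>i\<close> so that no
  inverse appears.\<close>

lemma L_matrix:
 "chi_plus (\<rho>' i) *v (L (i - 1) a) = a" "chi_plus (\<rho>' i) *v (L i a) = - (chi_minus (\<rho> i) *v a)" "L (i + 1) a = chi_minus (\<rho>' (i + 1)) *v a"
proof -
 note d = L_def Lcoef_def chi_plus_def chi_minus_def vec_eq_iff forall_2 matrix_vector_mult_def sum_2
 have ine: "i - 1 \<noteq> i" "i - 1 + 1 = i" using idx(1) by auto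
 show "chi_plus (\<rho>' i) *v (L (i - 1) a) = a" using ine kappa_ne by (simp add: d field_simps)
 show "chi_plus (\<rho>' i) *v (L i a) = - (chi_minus (\<rho> i) *v a)" 
  using kappa_ne coords(5,7) by (simp add: d) (simp add: field_simps)
 show "L (i + 1) a = chi_minus (\<rho>' (i + 1)) *v a" by (simp add: d)
qed

end

section \<open>Free groups\<close>

locale free_words = fixes X :: "'x set"
begin

abbreviation "W \<equiv> lists (X \<times> (UNIV :: bool set))"
abbreviation "F \<equiv> free_group X"
definition "cl w = free_rel X `` {w}"
abbreviation "stepr \<equiv> (cancel_step X \<union> (cancel_step X)\<inverse>)\<^sup>*"

lemma stepr_sym: "(u, v) \<in> stepr ==> (v, u) \<in> stepr"
proof -
 have "sym stepr" by (intro sym_rtrancl) (auto simp: sym_def)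
 then show "(u, v) \<in> stepr ==> (v, u) \<in> stepr" by (simp add: sym_def)
qed

lemma free_rel_iff: "(u, v) \<in> free_rel X \<longleftrightarrow> (u, v) \<in> stepr \<and> u \<in> W \<and> v \<in> W"
 by (auto simp: free_rel_def)

lemma free_rel_equiv: "equiv W (free_rel X)"
 by (rule equivI) (auto simp: free_rel_iff refl_on_def sym_def trans_def intro: stepr_sym rtrancl_trans)

lemma step_append: assumes "(u, v) \<in> stepr" "a \<in> W" "b \<in> W" shows "(a @ u @ b, a @ v @ b) \<in> stepr"
 using assms(1)
proof (induction rule: rtrancl_induct)
 case (step y z)
 have c: "(a @ y @ b, a @ z @ b) \<in> cancel_step X" if "(y, z) \<in> cancel_step X" for y z
 proof -
  obtain u v x t where t: "y = u @ [(x, t), (x, \<not> t)] @ v" "z = u @ v" "u \<in> W" "v \<in> W" "x \<in> X" using \<open>(y, z) \<in> cancel_step X\<close> unfolding cancel_step_def by blast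
  show ?thesis unfolding cancel_step_def
   by (rule CollectI, rule exI[of _ "a @ u"], rule exI[of _ "v @ b"], rule exI[of _ x], rule exI[of _ t]) (use t assms(2,3) in simp)
 qed
 then have "(a @ y @ b, a @ z @ b) \<in> cancel_step X \<union> (cancel_step X)\<inverse>" using step(2) by auto
 then show ?case using step.IH by (rule rtrancl_into_rtrancl[rotated])
qed simp

lemma cl_eq_iff: "u \<in> W ==> v \<in> W ==> cl u = cl v \<longleftrightarrow> (u, v) \<in> stepr"
 unfolding cl_def using eq_equiv_class_iff[OF free_rel_equiv] by (simp add: free_rel_iff)

lemma F_carrier: "carrier F = cl ` W"
 by (auto simp: free_group_def quotient_def cl_def)

lemma cl_closed [simp]: "w \<in> W ==> cl w .: F" by (simp add: F_carrier)

lemma F_one: "\<one>~F = cl []" by (simp add: free_group_def cl_def)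

lemma F_mult: assumes u: "u \<in> W" and v: "v \<in> W" shows "cl u .*~F cl v = cl (u @ v)"
proof -
 have "free_rel X `` {a @ b} = cl (u @ v)" if ab: "a \<in> cl u" "b \<in> cl v" for a b
 proof -
  have "(u, a) \<in> stepr" "(v, b) \<in> stepr" "a \<in> W" "b \<in> W" using ab by (auto simp: cl_def free_rel_iff)
  then have "(u @ v, a @ b) \<in> stepr" 
  proof -
   have "([] @ u @ v, [] @ a @ v) \<in> stepr" by (rule step_append[OF \<open>(u, a) \<in> stepr\<close> _ v]) simp
   moreover have "(a @ v @ [], a @ b @ []) \<in> stepr" by (rule step_append[OF \<open>(v, b) \<in> stepr\<close> \<open>a \<in> W\<close>]) simp
   ultimately show ?thesis using rtrancl_trans[of "u @ v" "a @ v" _ "a @ b"] by simp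
  qed
  then have "cl (u @ v) = cl (a @ b)" using u v \<open>a \<in> W\<close> \<open>b \<in> W\<close> by (subst cl_eq_iff) simp_all
  then show ?thesis by (simp add: cl_def)
 qed
 moreover have "u \<in> cl u" "v \<in> cl v" using u v by (auto simp: cl_def free_rel_iff)
 ultimately have "(\<Union>a\<in>cl u. \<Union>b\<in>cl v. free_rel X `` {a @ b}) = cl (u @ v)" by blast
 then show ?thesis by (simp add: free_group_def)
qed

lemma cancel: "u \<in> W ==> x \<in> X ==> cl ((x, b) # (x, \<not> b) # u) = cl u"
proof -
 assume u: "u \<in> W" "x \<in> X"
 have "((x, b) # (x, \<not> b) # u, u) \<in> cancel_step X"
  unfolding cancel_step_def by (rule CollectI, rule exI[of _ "[]"], rule exI[of _ u], rule exI[of _ x], rule exI[of _ b]) (use u in simp)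
 then have "((x, b) # (x, \<not> b) # u, u) \<in> stepr" by blast
 then show ?thesis using u by (subst cl_eq_iff) simp_all
qed

lemma cl_inverse: "w \<in> W ==> cl (rev (map (%(x, b). (x, \<not> b)) w) @ w) = cl []"
proof (induction w)
 case (Cons p w)
 obtain x b where p: "p = (x, b)" by (cases p)
 have w: "w \<in> W" "x \<in> X" using Cons.prems p by auto
 have r: "rev (map (%(x, b). (x, \<not> b)) w) \<in> W" using w by (auto simp: lists_eq_set)
 have "cl (rev (map (%(x, b). (x, \<not> b)) w) @ ((x, \<not> b) # (x, \<not> \<not> b) # w)) = cl (rev (map (%(x, b). (x, \<not> b)) w) @ w)"
  using F_mult[OF r, of "(x, \<not> b) # (x, \<not> \<not> b) # w"] F_mult[OF r w(1)] cancel[OF w, of "\<not> b"] w by simp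
 then show ?case using Cons.IH[OF w(1)] by (simp add: p)
qed simp

lemma F_group: "group F"
proof (rule groupI)
 fix x y z assume x: "x .: F" "y .: F" "z .: F"
 then obtain u v w where u: "x = cl u" "y = cl v" "z = cl w" "u \<in> W" "v \<in> W" "w \<in> W" by (auto simp: F_carrier)
 show "x .*~F y .: F" "x .*~F y .*~F z = x .*~F (y .*~F z)" using u by (simp_all add: F_mult)
next
 fix x assume "x .: F"
 then obtain u where u: "x = cl u" "u \<in> W" by (auto simp: F_carrier)
 show "\<one>~F .*~F x = x" using u by (simp add: F_one F_mult)
 have r: "rev (map (%(x, b). (x, \<not> b)) u) \<in> W" using u by (auto simp: lists_eq_set)
 show "\<exists>y\<in>carrier F. y .*~F x = \<one>~F"
  by (rule bexI[OF _ cl_closed[OF r]]) (use u r cl_inverse in \<open>simp add: F_mult F_one\<close>)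
qed (simp add: F_one)

sublocale F: group F by (rule F_group)

abbreviation "gn x \<equiv> cl [(x, True)]"

lemma gn_closed [simp]: "x \<in> X ==> gn x .: F" by simp

lemma inv_gn: "x \<in> X ==> inv~F gn x = cl [(x, False)]"
 using cancel[of "[]" x False] by (intro F.inv_equality) (simp_all add: F_mult F_one)

lemma F_induct:
 assumes g: "g .: F" and one: "P \<one>~F"
  and gen: "!!x g. [| x \<in> X; g .: F; P g |] ==> P (gn x .*~F g)"
  and inv: "!!x g. [| x \<in> X; g .: F; P g |] ==> P (inv~F gn x .*~F g)"
 shows "P g"
proof -
 obtain w where w: "g = cl w" "w \<in> W" using g by (auto simp: F_carrier)
 have "P (cl w)" using w(2)
 proof (induction w rule: list.induct)
  case Nil
  then show ?case using one by (simp add: F_one)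
 next
  case (Cons p w)
  obtain x b where p: "p = (x, b)" by (cases p)
  have x: "x \<in> X" "w \<in> W" using Cons.prems p by auto
  have "cl (p # w) = cl [p] .*~F cl w" using x p by (simp add: F_mult)
  then show ?case using gen[OF x(1) cl_closed[OF x(2)] Cons.IH[OF x(2)]] inv[OF x(1) cl_closed[OF x(2)] Cons.IH[OF x(2)]] inv_gn[OF x(1)] p by (cases b) simp_all
 qed
 then show ?thesis using w by simp
qed

lemma F_hom_eq:
 assumes G: "group G" and h: "h \<in> hom F G" "h' \<in> hom F G" and e: "!!x. x \<in> X ==> h (gn x) = h' (gn x)" and g: "g .: F"
 shows "h g = h' g"
proof -
 interpret h: group_hom F G h using G h F_group by (simp add: group_hom_def group_hom_axioms_def)
 interpret h': group_hom F G h' using G h F_group by (simp add: group_hom_def group_hom_axioms_def)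
 show ?thesis using g by (rule F_induct) (simp_all add: e)
qed

text \<open>Evaluation of words does not change when adjacent inverse letters are inserted or
  removed, so it descends to classes.\<close>

lemma F_lift:
 assumes G: "group G" and f: "!!x. x \<in> X ==> f x .: G"
 shows "\<exists>h\<in>hom F G. \<forall>x\<in>X. h (gn x) = f x"
proof -
 interpret G: group G by fact
 define e where "e p = (if snd p then f (fst p) else inv~G f (fst p))" for p
 define ev where "ev w = foldr (%p y. e p .*~G y) w \<one>~G" for w
 have ec: "e p .: G" if "p \<in> X \<times> UNIV" for p using f that by (auto simp: e_def)
 have ev: "ev [] = \<one>~G" "ev (p # w) = e p .*~G ev w" for p w by (simp_all add: ev_def)
 have evc: "ev w .: G" if "w \<in> W" for w using that by (induction w) (auto simp: ev intro!: ec G.m_closed)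
 have eva: "ev (u @ v) = ev u .*~G ev v" if "u \<in> W" "v \<in> W" for u v
  using that(1)
 proof (induction u)
  case (Cons p u)
  then have "e p .: G" "ev u .: G" "ev v .: G" using ec evc that(2) by auto
  then show ?case using Cons by (simp add: ev G.m_assoc)
 qed (use evc that(2) in \<open>simp add: ev\<close>)
 have ee: "e (x, b) .*~G (e (x, \<not> b) .*~G y) = y" if "x \<in> X" "y .: G" for x b y
  using f[OF that(1)] that(2) by (simp add: e_def G.m_assoc[symmetric])
 have st: "ev y = ev z" if yz: "(y, z) \<in> cancel_step X" for y z
 proof -
  obtain u v x t where t: "y = u @ [(x, t), (x, \<not> t)] @ v" "z = u @ v" "u \<in> W" "v \<in> W" "x \<in> X" using yz unfolding cancel_step_def by blast
  have m: "(x, t) # (x, \<not> t) # v \<in> W" using t by simp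
  have "ev ((x, t) # (x, \<not> t) # v) = ev v" unfolding ev using ee[OF t(5) evc[OF t(4)]] .
  then show ?thesis using eva[OF t(3) m] eva[OF t(3,4)] t(1,2) by simp
 qed
 have inv: "ev u = ev v" if "(u, v) \<in> stepr" for u v
  using that by (induction rule: rtrancl_induct) (auto dest: st)
 define h where "h A = ev (SOME w. w \<in> W \<and> A = cl w)" for A
 have h: "h (cl w) = ev w" if w: "w \<in> W" for w
 proof -
  define v where "v = (SOME v. v \<in> W \<and> cl w = cl v)"
  have v: "v \<in> W \<and> cl w = cl v" unfolding v_def by (rule someI_ex) (use w in blast)
  then have "(w, v) \<in> stepr" using cl_eq_iff[OF w] by blast
  from inv[OF this] show ?thesis by (simp add: h_def v_def)
 qed
 have "h \<in> hom F G"
 proof (rule homI)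
  show "h x .: G" if "x .: F" for x
  proof -
   have "x \<in> cl ` W" using that by (simp add: F_carrier)
   then show ?thesis by (rule imageE) (use h evc in simp)
  qed
  show "h (x .*~F y) = h x .*~G h y" if xy: "x .: F" "y .: F" for x y
  proof -
   obtain u v where u: "x = cl u" "y = cl v" "u \<in> W" "v \<in> W" using xy by (auto simp: F_carrier)
   then show ?thesis using h eva by (simp add: F_mult)
  qed
 qed
 moreover have "h (gn x) = f x" if "x \<in> X" for x using h[of "[(x, True)]"] f that by (simp add: ev e_def)
 ultimately show ?thesis by blast
qed

end

interpretation FW: free_words "{1..n}" for n :: nat .

lemma pi_group: "group (pi1 n)" unfolding pi1_def by (rule FW.F_group)

interpretation PI: group "pi1 n" for n :: nat by (rule pi_group)

lemma loop_x_gn: "loop_x n j = FW.gn n j" by (simp add: loop_x_def FW.cl_def)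

lemma loop_x_closed [simp]: "j \<in> {1..n} ==> loop_x n j .: (pi1 n)"
 unfolding pi1_def loop_x_gn by (rule FW.gn_closed)

lemma loop_y_closed [simp]: "k \<le> n ==> loop_y n k .: (pi1 n)"
 by (induction k) auto

lemma pi_hom_eq:
 assumes "group G" "h \<in> hom (pi1 n) G" "h' \<in> hom (pi1 n) G" "!!j. j \<in> {1..n} ==> h (loop_x n j) = h' (loop_x n j)" "g .: (pi1 n)"
 shows "h g = h' g"
 by (rule FW.F_hom_eq[OF assms(1) assms(2,3)[unfolded pi1_def] assms(4)[unfolded loop_x_gn] assms(5)[unfolded pi1_def]])

lemma pi_lift:
 assumes "group G" "!!j. j \<in> {1..n} ==> f j .: G"
 shows "\<exists>h\<in>hom (pi1 n) G. \<forall>j\<in>{1..n}. h (loop_x n j) = f j"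
 unfolding pi1_def loop_x_gn by (rule FW.F_lift[OF assms])

text \<open>The \<open>loop_y\<close> also generate, since \<open>loop_x n (Suc k)\<close> is
  recovered from two consecutive ones. On them the holonomy and the braid action take a simpler
  form.\<close>

lemma pi_hom_eq_y:
 assumes G: "group G" and h: "h \<in> hom (pi1 n) G" "h' \<in> hom (pi1 n) G" and e: "!!k. k \<in> {1..n} ==> h (loop_y n k) = h' (loop_y n k)" and g: "g .: (pi1 n)"
 shows "h g = h' g"
proof (rule pi_hom_eq[OF G h _ g])
 have hc: "h x .: G" "h' x .: G" if "x .: (pi1 n)" for x using h that by (simp_all add: hom_def Pi_iff)
 have o: "h \<one>~(pi1 n) = h' \<one>~(pi1 n)" using hom_one[OF h(1) pi_group G] hom_one[OF h(2) pi_group G] by simp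
 fix j assume j: "j \<in> {1..n}"
 obtain k where k: "j = Suc k" using j by (cases j) auto
 have c: "loop_x n j .: (pi1 n)" "loop_y n k .: (pi1 n)" using j k loop_x_closed[OF j] by auto
 have y: "h (loop_y n k) = h' (loop_y n k)"
 proof (cases "k = 0")
  case True
  then show ?thesis using o by simp
 next
  case False
  then show ?thesis using e[of k] k j by simp
 qed
 have m: "h (loop_y n j) = h (loop_x n j) .*~G h (loop_y n k)" "h' (loop_y n j) = h' (loop_x n j) .*~G h' (loop_y n k)"
  unfolding k loop_y.simps unfolding k[symmetric] using hom_mult[OF h(1) c] hom_mult[OF h(2) c] by simp_all
 have "h (loop_x n j) .*~G h (loop_y n k) = h' (loop_x n j) .*~G h (loop_y n k)"
  using e[OF j] unfolding m y .
 then show "h (loop_x n j) = h' (loop_x n j)" using group.right_cancel[OF G hc(1)[OF c(2)] hc(1)[OF c(1)] hc(2)[OF c(1)]] by simp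
qed

section \<open>Matrices, holonomy and cocycles\<close>

lemma matrix_inv_mult:
 assumes "invertible (A :: complex^2^2)" shows "A ** matrix_inv A = mat 1" "matrix_inv A ** A = mat 1"
proof -
 have "\<exists>B. A ** B = mat 1 \<and> B ** A = mat 1" using assms by (simp add: invertible_def)
 from someI_ex[OF this] show "A ** matrix_inv A = mat 1" "matrix_inv A ** A = mat 1" unfolding matrix_inv_def by auto
qed

lemma matrix_inv_cancel:
 assumes "invertible (A :: complex^2^2)"
 shows "A ** (matrix_inv A ** B) = B" "matrix_inv A ** (A ** B) = B" "A *v (matrix_inv A *v v) = v" "matrix_inv A *v (A *v v) = v"
 using matrix_inv_mult[OF assms] by (simp_all add: matrix_mul_assoc matrix_vector_mul_assoc)

lemma matrix_inv_unique: fixes A B :: "complex^2^2" assumes "A ** B = mat 1" "B ** A = mat 1" shows "matrix_inv A = B"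
proof -
 have i: "invertible A" using assms by (auto simp: invertible_def)
 have "matrix_inv A = matrix_inv A ** (A ** B)" using assms by simp
 also have "\<dots> = B" by (rule matrix_inv_cancel(2)[OF i])
 finally show ?thesis .
qed

lemma invertible_matrix_inv: "invertible (A :: complex^2^2) ==> invertible (matrix_inv A)"
 using matrix_inv_mult[of A] by (auto simp: invertible_def)

lemma matrix_inv_prod: fixes A B :: "complex^2^2" assumes "invertible A" "invertible B" shows "matrix_inv (A ** B) = matrix_inv B ** matrix_inv A"
proof (rule matrix_inv_unique)
 show "A ** B ** (matrix_inv B ** matrix_inv A) = mat 1" 
  using matrix_inv_cancel(1)[OF assms(2), of "matrix_inv A"] matrix_inv_mult[OF assms(1)] by (simp add: matrix_mul_assoc[symmetric])
 show "matrix_inv B ** matrix_inv A ** (A ** B) = mat 1"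
  using matrix_inv_cancel(2)[OF assms(1), of B] matrix_inv_mult[OF assms(2)] by (simp add: matrix_mul_assoc[symmetric])
qed

lemma GL2_sel [simp]: "carrier GL2 = {A. invertible A}" "A .*~GL2 B = A ** B" "\<one>~GL2 = mat 1"
 by (simp_all add: GL2_def)

lemma invertible_one: "invertible (mat 1 :: complex^2^2)"
 unfolding invertible_def by (rule exI[of _ "mat 1"]) simp

lemma GL2_group: "group GL2"
proof (rule groupI)
 fix A assume "A .: GL2"
 then show "\<exists>B\<in>carrier GL2. B .*~GL2 A = \<one>~GL2"
  using invertible_matrix_inv[of A] matrix_inv_mult[of A] by (intro bexI[of _ "matrix_inv A"]) simp_all
qed (simp_all add: invertible_mult matrix_mul_assoc invertible_one)

text \<open>The affine group of the two-dimensional complex space. A crossed homomorphism relative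
  to the holonomy is the translation part of a homomorphism into this group, so cocycles can be
  obtained from freeness of \<open>pi1\<close>.\<close>

definition aff :: "((complex^2^2) \<times> (complex^2)) monoid" where
 "aff = \<lparr>carrier = {A. invertible A} \<times> UNIV, mult = (%(A, v) (B, w). (A ** B, v + A *v w)), one = (mat 1, 0)\<rparr>"

lemma aff_group: "group aff"
proof (rule groupI)
 fix p assume "p .: aff"
 then obtain A v where p: "p = (A, v)" "invertible A" by (auto simp: aff_def)
 then show "\<exists>q\<in>carrier aff. q .*~aff p = \<one>~aff"
  using invertible_matrix_inv[of A] matrix_inv_mult[of A]
  by (intro bexI[of _ "(matrix_inv A, - (matrix_inv A *v v))"]) (simp_all add: aff_def)
qed (auto simp: aff_def invertible_mult matrix_mul_assoc invertible_one matrix_vector_mul_assoc matrix_vector_right_distrib add.assoc)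

text \<open>Needed for the holonomy of \<open>loop_y\<close>, which is \<open>plus_prefix\<close>
  times the inverse of this product.\<close>

primrec minus_prefix :: "obj => nat => complex^2^2" where
 "minus_prefix \<rho> 0 = mat 1"
| "minus_prefix \<rho> (Suc k) = minus_prefix \<rho> k ** chi_minus (\<rho> (Suc k))"

lemma chi_invertible: assumes "ch \<in> characters" shows "invertible (chi_plus ch)" "invertible (chi_minus ch)"
proof -
 note k = char_values(4)[OF assms]
 note d = chi_plus_def chi_minus_def vec_eq_iff forall_2 matrix_matrix_mult_def sum_2 mat_def
 show "invertible (chi_plus ch)" unfolding invertible_def
  by (rule exI[of _ "vector [vector [1 / chi_kappa ch, 0], vector [- chi_phi ch / chi_kappa ch, 1]]"]) (use k in \<open>simp add: d\<close>)
 show "invertible (chi_minus ch)" unfolding invertible_def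
  by (rule exI[of _ "vector [vector [1, - chi_epsilon ch / chi_kappa ch], vector [0, 1 / chi_kappa ch]]"]) (use k in \<open>simp add: d\<close>)
qed

context char_quot
begin

abbreviation "Pp \<equiv> plus_prefix \<rho>"
abbreviation "Mm \<equiv> minus_prefix \<rho>"
abbreviation "hol \<equiv> holonomy n \<rho>"
abbreviation "y \<equiv> loop_y n"
abbreviation "H1 \<equiv> Hlf n \<rho>"

lemma prefix_invertible: "k \<le> n ==> invertible (Pp k)" "k \<le> n ==> invertible (Mm k)"
 by (induction k) (simp_all add: invertible_one invertible_mult chi_invertible[OF char])

definition "Xm j = Pp (j - 1) ** psi (\<rho> j) ** matrix_inv (Pp (j - 1))"

lemma Xm_invertible: assumes j: "j \<in> {1..n}" shows "invertible (Xm j)"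
proof -
 have "j - 1 \<le> n" using j by auto
 then show ?thesis unfolding Xm_def psi_def
  by (intro invertible_mult invertible_matrix_inv prefix_invertible chi_invertible char j)
qed

lemma hol_spec: "hol \<in> hom (pi1 n) GL2" "hol \<in> extensional (carrier (pi1 n))" "j \<in> {1..n} ==> hol (loop_x n j) = Xm j"
proof -
 obtain h where h: "h \<in> hom (pi1 n) GL2" "\<forall>j\<in>{1..n}. h (loop_x n j) = Xm j"
  using pi_lift[OF GL2_group, of n Xm] Xm_invertible by auto
 let ?P = "%h. h \<in> hom (pi1 n) GL2 \<inter> extensional (carrier (pi1 n)) \<and> (\<forall>j\<in>{1..n}. h (loop_x n j) =
    plus_prefix \<rho> (j - 1) ** psi (\<rho> j) ** matrix_inv (plus_prefix \<rho> (j - 1)))"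
 have P: "?P (restrict h (carrier (pi1 n)))"
  using h by (auto simp: Xm_def hom_def)
 have uniq: "h' = restrict h (carrier (pi1 n))" if p: "?P h'" for h'
 proof (rule extensionalityI[of _ "carrier (pi1 n)"])
  show "h' \<in> extensional (carrier (pi1 n))" using p by auto
  show "h' x = restrict h (carrier (pi1 n)) x" if "x .: (pi1 n)" for x
   using pi_hom_eq[OF GL2_group _ h(1) _ that, of h'] p h(2) that by (simp add: Xm_def)
 qed simp
 have "?P hol" unfolding holonomy_def by (rule theI[of ?P, OF P uniq])
 then show "hol \<in> hom (pi1 n) GL2" "hol \<in> extensional (carrier (pi1 n))" "j \<in> {1..n} ==> hol (loop_x n j) = Xm j"
  by (auto simp: Xm_def)
qed

lemma hol_mult: "g .: (pi1 n) ==> g' .: (pi1 n) ==> hol (g .*~(pi1 n) g') = hol g ** hol g'"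
 using hol_spec(1) by (simp add: hom_def)

lemma hol_invertible: "g .: (pi1 n) ==> invertible (hol g)"
 using hol_spec(1) by (auto simp: hom_def)

lemma hol_one: "hol \<one>~(pi1 n) = mat 1"
 using hom_one[OF hol_spec(1) pi_group GL2_group] by simp

lemma hol_inv: assumes g: "g .: (pi1 n)" shows "hol (inv~(pi1 n) g) = matrix_inv (hol g)"
 using hol_mult[OF g PI.inv_closed[OF g]] hol_mult[OF PI.inv_closed[OF g] g] g
 by (intro matrix_inv_unique[symmetric]) (simp_all add: hol_one)

text \<open>Each \<psi> is conjugated by the plus prefix before it, so that the conjugations
  telescope in the product.\<close>

lemma hol_y: "k \<le> n ==> hol (y k) = Pp k ** matrix_inv (Mm k)"
proof (induction k)
 case 0
 then show ?case using hol_one matrix_inv_unique[of "mat 1" "mat 1"] by simp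
next
 case (Suc k)
 have j: "Suc k \<in> {1..n}" "k \<le> n" using Suc.prems by auto
 note i = prefix_invertible[OF j(2)] chi_invertible(2)[OF char[OF j(1)]]
 have "hol (y (Suc k)) = Xm (Suc k) ** (Pp k ** matrix_inv (Mm k))"
  using hol_mult[OF loop_x_closed[OF j(1)] loop_y_closed[OF j(2)]] Suc.IH[OF j(2)] hol_spec(3)[OF j(1)] by simp
 also have "\<dots> = Pp k ** psi (\<rho> (Suc k)) ** (matrix_inv (Pp k) ** (Pp k ** matrix_inv (Mm k)))"
  by (simp add: Xm_def matrix_mul_assoc)
 also have "\<dots> = Pp k ** psi (\<rho> (Suc k)) ** matrix_inv (Mm k)" by (simp add: matrix_inv_cancel[OF i(1)])
 finally show ?case by (simp add: psi_def matrix_inv_prod[OF i(2,3)] matrix_mul_assoc)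
qed

lemma H1D:
 assumes "c .: H1"
 shows "c \<in> extensional (carrier (pi1 n))" "!!g h. [| g .: (pi1 n); h .: (pi1 n) |] ==> c (g .*~(pi1 n) h) = c g + hol g *v c h" "c (y n) = 0"
  "c \<one>~(pi1 n) = 0" "!!g. g .: (pi1 n) ==> c (inv~(pi1 n) g) = - (matrix_inv (hol g) *v c g)"
proof -
 show 1: "c \<in> extensional (carrier (pi1 n))" "!!g h. [| g .: (pi1 n); h .: (pi1 n) |] ==> c (g .*~(pi1 n) h) = c g + hol g *v c h" "c (y n) = 0"
  using assms by (auto simp: Hlf_def PiE_def)
 show z: "c \<one>~(pi1 n) = 0" using 1(2)[of "\<one>~(pi1 n)" "\<one>~(pi1 n)"] by (simp add: hol_one)
 fix g assume g: "g .: (pi1 n)"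
 have "c (inv~(pi1 n) g) + matrix_inv (hol g) *v c g = 0" using 1(2)[OF PI.inv_closed[OF g] g] g z by (simp add: hol_inv)
 then show "c (inv~(pi1 n) g) = - (matrix_inv (hol g) *v c g)" by (simp add: eq_neg_iff_add_eq_0)
qed

lemma H1_aff_hom: assumes c: "c .: H1" shows "(%g. (hol g, c g)) \<in> hom (pi1 n) aff"
 by (rule homI) (simp_all add: aff_def hol_mult hol_invertible H1D(2)[OF c])

lemma H1_unique:
 assumes c: "c .: H1" "d .: H1" and e: "!!k. k \<in> {1..<n} ==> c (y k) = d (y k)" shows "c = d"
proof (rule extensionalityI[OF H1D(1)[OF c(1)] H1D(1)[OF c(2)]])
 fix g assume g: "g .: (pi1 n)"
 have "(hol g, c g) = (hol g, d g)"
 proof (rule pi_hom_eq_y[OF aff_group H1_aff_hom[OF c(1)] H1_aff_hom[OF c(2)] _ g])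
  fix k assume "k \<in> {1..n}"
  then show "(hol (y k), c (y k)) = (hol (y k), d (y k))" using e[of k] H1D(3)[OF c(1)] H1D(3)[OF c(2)] by (cases "k = n") auto
 qed
 then show "c g = d g" by simp
qed

text \<open>As \<open>loop_y\<close> at j is \<open>loop_x\<close> at j times \<open>loop_y\<close>
  at j - 1, prescribed values on the \<open>loop_y\<close> force those on the \<open>loop_x\<close>;
  freeness then provides the cocycle.\<close>

lemma H1_exists: "\<exists>c\<in>carrier H1. \<forall>k\<in>{1..<n}. c (y k) = b k"
proof -
 \<comment> \<open>The value at 0 belongs to the trivial loop, and the value at \<open>n\<close> is
   the boundary condition; both must be zero.\<close>
 define b' where "b' k = (if k \<in> {1..<n} then b k else 0)" for k
 obtain h where h: "h \<in> hom (pi1 n) aff" "\<forall>j\<in>{1..n}. h (loop_x n j) = (Xm j, b' j - Xm j *v b' (j - 1))"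
  using pi_lift[OF aff_group, of n "%j. (Xm j, b' j - Xm j *v b' (j - 1))"] Xm_invertible by (auto simp: aff_def)
 have hm: "h (g .*~(pi1 n) g') = (fst (h g) ** fst (h g'), snd (h g) + fst (h g) *v snd (h g'))" if "g .: (pi1 n)" "g' .: (pi1 n)" for g g'
  using h(1) that by (simp add: hom_def aff_def split_beta)
 have hi: "invertible (fst (h g))" if "g .: (pi1 n)" for g
 proof -
  have "h g .: aff" using h(1) that by (simp add: hom_def Pi_iff)
  then show ?thesis by (auto simp: aff_def)
 qed
 have f: "fst (h g) = hol g" if g: "g .: (pi1 n)" for g
 proof (rule pi_hom_eq[OF GL2_group _ hol_spec(1) _ g])
  show "(%g. fst (h g)) \<in> hom (pi1 n) GL2" by (rule homI) (simp_all add: hm hi)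
  show "fst (h (loop_x n j)) = hol (loop_x n j)" if "j \<in> {1..n}" for j using h(2) that by (simp add: hol_spec(3))
 qed
 let ?c = "\<lambda>g\<in>carrier (pi1 n). snd (h g)"
 have cy: "snd (h (y k)) = b' k" if "k \<le> n" for k
  using that
 proof (induction k)
  case 0
  then show ?case using hom_one[OF h(1) pi_group aff_group] by (simp add: aff_def b'_def)
 next
  case (Suc k)
  then have j: "Suc k \<in> {1..n}" "k \<le> n" by auto
  have x: "h (loop_x n (Suc k)) = (Xm (Suc k), b' (Suc k) - Xm (Suc k) *v b' k)" using h(2) j by simp
  show ?case using hm[OF loop_x_closed[OF j(1)] loop_y_closed[OF j(2)]] Suc.IH[OF j(2)] unfolding x by simp
 qed
 have "?c .: H1" using cy[of n] by (simp add: Hlf_def hm f b'_def)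
 moreover have "?c (y k) = b k" if "k \<in> {1..<n}" for k using cy[of k] that by (simp add: b'_def)
 ultimately show ?thesis by blast
qed

lemma H1_ops:
 assumes c: "c .: H1" and d: "d .: H1"
 shows "c .+~H1 d .: H1" "a *.~H1 c .: H1" "k \<le> n ==> (c .+~H1 d) (y k) = c (y k) + d (y k)" "k \<le> n ==> (a *.~H1 c) (y k) = a *s c (y k)"
proof -
 have s: "c .+~H1 d = (\<lambda>g\<in>carrier (pi1 n). c g + d g)" "a *.~H1 c = (\<lambda>g\<in>carrier (pi1 n). a *s c g)" by (simp_all add: Hlf_def)
 have m: "A *v (a *s v) = a *s (A *v v)" for A :: "complex^2^2" and v by (simp add: matrix_vector_mult_def vec_eq_iff forall_2 sum_2 algebra_simps)
 show "c .+~H1 d .: H1" unfolding s using H1D(2,3)[OF c] H1D(2,3)[OF d] by (simp add: Hlf_def matrix_vector_right_distrib)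
 show "a *.~H1 c .: H1" unfolding s using H1D(2,3)[OF c] by (simp add: Hlf_def m vector_add_ldistrib)
 show "k \<le> n ==> (c .+~H1 d) (y k) = c (y k) + d (y k)" "k \<le> n ==> (a *.~H1 c) (y k) = a *s c (y k)" unfolding s by simp_all
qed

lemma dual_basis: assumes j: "j \<in> {1..<n}"
 shows "dual_basis n \<rho> j \<mu> .: H1" "k \<in> {1..<n} ==> dual_basis n \<rho> j \<mu> (y k) = (if k = j then axis \<mu> 1 else 0)"
proof -
 let ?P = "%c. c .: H1 \<and> (\<forall>k\<in>{1..<n}. c (y k) = (if k = j then axis \<mu> 1 else 0))"
 obtain c where c: "?P c" using H1_exists[of "%k. if k = j then axis \<mu> 1 else 0"] by (elim bexE) blast
 have uniq: "c' = c" if p: "?P c'" for c'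
  by (rule H1_unique) (use p c in auto)
 have "?P (dual_basis n \<rho> j \<mu>)" unfolding dual_basis_def by (rule theI[of ?P, OF c uniq])
 then show "dual_basis n \<rho> j \<mu> .: H1" "k \<in> {1..<n} ==> dual_basis n \<rho> j \<mu> (y k) = (if k = j then axis \<mu> 1 else 0)" by auto
qed

lemma v_basis: assumes j: "j \<in> {1..<n}"
 shows "v_basis n \<rho> j \<nu> .: H1" "k \<in> {1..<n} ==> v_basis n \<rho> j \<nu> (y k) = (if k = j then Pp j *v axis (if \<nu> = 2 then 1 else 2) 1 else 0)"
proof -
 let ?r = "if \<nu> = 2 then 1 else 2 :: 2"
 note d = dual_basis[OF j] note o = H1_ops(2)[OF d(1) d(1)] H1_ops(4)[OF d(1) d(1)]
 show "v_basis n \<rho> j \<nu> .: H1" unfolding v_basis_def Let_def by (intro H1_ops(1) o)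
 assume k: "k \<in> {1..<n}"
 then have kn: "k \<le> n" by simp
 let ?p = "row ?r (transpose (Pp j))"
 have "v_basis n \<rho> j \<nu> (y k) = ?p $ 1 *s dual_basis n \<rho> j 1 (y k) + ?p $ 2 *s dual_basis n \<rho> j 2 (y k)"
  unfolding v_basis_def Let_def by (subst H1_ops(3)[OF o(1) o(1) kn]) (simp add: o(2)[OF kn])
 then show "v_basis n \<rho> j \<nu> (y k) = (if k = j then Pp j *v axis (if \<nu> = 2 then 1 else 2) 1 else 0)"
  unfolding d(2)[OF k] by (simp add: vec_eq_iff forall_2 matrix_vector_mult_def sum_2 row_def transpose_def axis_def)
qed

text \<open>Coordinates with respect to \<open>v_basis\<close>: entry 1 belongs to \<nu> = 2 and
  entry 2 to \<nu> = 1, as \<open>ac_v\<close> shows.\<close>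

definition "ac c k = matrix_inv (Pp k) *v c (y k)" for c :: cocycle

lemma ac_bound: assumes "c .: H1" shows "ac c 0 = 0" "ac c n = 0"
 using H1D(3,4)[OF assms] by (simp_all add: ac_def)

lemma ac_inverse: "k \<le> n ==> c (y k) = Pp k *v ac c k"
 by (simp add: ac_def matrix_inv_cancel[OF prefix_invertible(1)])

end

context nonsing_quot
begin

lemma Hchar_Hs: "Hchar n \<rho> = Hs" by (simp add: Hchar_def)

definition "phi0 c = svs (ac c)"

lemma ac_v: assumes j: "j \<in> {1..<n}" and k: "k \<in> {1..<n}" shows "ac (v_basis n \<rho> j \<nu>) k = (if k = j then axis (if \<nu> = 2 then 1 else 2) 1 else 0)"
 using j k unfolding ac_def v_basis(2)[OF j k] by (simp add: matrix_inv_cancel[OF prefix_invertible(1)])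

lemma phi0_v: assumes j: "j \<in> {1..<n}" shows "phi0 (v_basis n \<rho> j 1) = \<beta> j 1" "phi0 (v_basis n \<rho> j 2) = .-~Q \<beta> j 2"
proof -
 have p: "phi0 (v_basis n \<rho> j \<nu>) = sv j (axis (if \<nu> = 2 then 1 else 2) 1)" for \<nu>
  unfolding phi0_def svs_single[OF j, symmetric] by (rule svs_cong) (rule ac_v[OF j])
 note b = beta_closed[OF j]
 show "phi0 (v_basis n \<rho> j 1) = \<beta> j 1" "phi0 (v_basis n \<rho> j 2) = .-~Q \<beta> j 2"
  unfolding p using b by (simp_all add: sv_def axis_def Q.csmult a_minus_def del: beta_closed)
qed

lemma phi0_Hs: "phi0 c \<in> Hs" unfolding phi0_def by (rule svs_Hs)

lemma phi0_linear:
 assumes c: "c .: H1" and d: "d .: H1"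
 shows "phi0 (c .+~H1 d) = phi0 c .+~Q phi0 d" "phi0 (a *.~H1 c) = a *.~Q phi0 c"
proof -
 have m: "A *v (a *s v) = a *s (A *v v)" for A :: "complex^2^2" and v by (simp add: matrix_vector_mult_def vec_eq_iff forall_2 sum_2 algebra_simps)
 show "phi0 (c .+~H1 d) = phi0 c .+~Q phi0 d" unfolding phi0_def svs_add[symmetric]
  by (rule svs_cong) (simp add: ac_def H1_ops(3)[OF c d] matrix_vector_right_distrib)
 show "phi0 (a *.~H1 c) = a *.~Q phi0 c" unfolding phi0_def svs_smult[symmetric]
  by (rule svs_cong) (simp add: ac_def H1_ops(4)[OF c d] m)
qed

lemma phi0_inj: assumes c: "c .: H1" and d: "d .: H1" and e: "phi0 c = phi0 d" shows "c = d"
proof (rule H1_unique[OF c d])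
 fix k assume k: "k \<in> {1..<n}"
 let ?e = "c .+~H1 (- 1) *.~H1 d"
 have md: "(- 1) *.~H1 d .: H1" by (rule H1_ops(2)[OF d d])
 have "phi0 ?e = \<zero>~Q" unfolding phi0_linear(1)[OF c md] phi0_linear(2)[OF d d] e using svs_closed[of "ac d"]
  by (simp add: phi0_def Q.uminus_csmult[symmetric] Q.r_neg)
 then have z: "ac ?e k = 0" unfolding phi0_def by (rule svs_zero_iff[OF _ k])
 have kn: "k \<le> n" using k by simp
 have "?e (y k) = 0" unfolding ac_inverse[OF kn, of ?e] z by simp
 moreover have "(- 1) *s v = - v" for v :: "complex^2" by (simp add: vec_eq_iff)
 ultimately show "c (y k) = d (y k)" using H1_ops(3)[OF c md kn] H1_ops(4)[OF d d kn, of "- 1"] by simp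
qed

lemma phi0_surj: assumes v: "v \<in> Hs" shows "\<exists>c\<in>carrier H1. phi0 c = v"
proof -
 obtain a where a: "v = svs a" using Hs_svs[OF v] by (rule exE)
 obtain c where c: "c .: H1" "\<forall>k\<in>{1..<n}. c (y k) = Pp k *v a k" using H1_exists by (rule bexE)
 have "phi0 c = v" unfolding phi0_def a by (rule svs_cong) (use c in \<open>simp add: ac_def matrix_inv_cancel[OF prefix_invertible(1)]\<close>)
 then show ?thesis using c(1) by (rule bexI)
qed

abbreviation "lh \<equiv> lin_hom H1 (Q\<lparr>carrier := Hchar n \<rho>\<rparr>)"

lemma phi_spec: "phi n \<rho> \<in> lh" "c .: H1 ==> phi n \<rho> c = phi0 c"
proof -
 let ?P = "%f. f \<in> lh \<and> (\<forall>j\<in>{1..<n}. f (v_basis n \<rho> j 1) = \<beta> j 1 \<and> f (v_basis n \<rho> j 2) = .-~Q \<beta> j 2)"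
 let ?f = "restrict phi0 (carrier H1)"
 have f: "?f \<in> lh" unfolding lin_hom_def Hchar_Hs
  using H1_ops(1,2) phi0_linear phi0_Hs by auto
 have P: "?P ?f" using f phi0_v v_basis(1) by simp
 have uniq: "f = ?f" if p: "?P f" for f
 proof (rule extensionalityI[of _ "carrier H1"])
  show "f \<in> extensional (carrier H1)" using p by (auto simp: lin_hom_def PiE_def)
  have add: "f (c .+~H1 d) = f c .+~Q f d" and sm: "f (a *.~H1 c) = a *.~Q f c" and cl: "f c .: Q" if "c .: H1" "d .: H1" for c d a
  proof -
   have "f c \<in> Hs" using p that by (auto simp: lin_hom_def Hchar_Hs)
   then show "f c .: Q" using Hs_carrier by auto
  qed (use p that in \<open>auto simp: lin_hom_def\<close>)
  fix c assume c: "c .: H1"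
  have vv: "f (v_basis n \<rho> j \<nu>) = phi0 (v_basis n \<rho> j \<nu>)" if "j \<in> {1..<n}" "\<nu> \<in> {1, 2}" for j \<nu>
   using p phi0_v[OF that(1)] that by auto
  \<comment> \<open>Truncations of \<open>c\<close> to the blocks below \<open>m\<close>. Adding the
    block \<open>m\<close> as a combination of two basis vectors extends the agreement of
    \<open>f\<close> with \<open>phi0\<close>; at \<open>m = n\<close> the truncation is
    \<open>c\<close> itself.\<close>
  have "\<exists>d\<in>carrier H1. (\<forall>k\<in>{1..<n}. d (y k) = (if k < m then c (y k) else 0)) \<and> f d = phi0 d" if "m \<le> n" for m
   using that
  proof (induction m)
   case 0
   have z: "f (0 *.~H1 c) = phi0 (0 *.~H1 c)" unfolding sm[OF c c] phi0_linear(2)[OF c c] using cl[OF c c] svs_closed by (simp add: Q.csmult phi0_def)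
   have "\<forall>k\<in>{1..<n}. (0 *.~H1 c) (y k) = (if k < 0 then c (y k) else 0)" using H1_ops(4)[OF c c] by simp
   then show ?case using z by (intro bexI[OF _ H1_ops(2)[OF c c, of 0]] conjI)
  next
   case (Suc m)
   then obtain d where d: "d .: H1" "\<forall>k\<in>{1..<n}. d (y k) = (if k < m then c (y k) else 0)" "f d = phi0 d" by auto
   show ?case
   proof (cases "m = 0")
    case True
    then show ?thesis using d by (intro bexI[of _ d]) auto
   next
    case False
    then have m: "m \<in> {1..<n}" "m \<le> n" using Suc.prems by auto
    let ?a = "ac c m"
    let ?v = "%\<nu>. v_basis n \<rho> m \<nu>"
    note v = v_basis(1)[OF m(1)] note sv = H1_ops(2)[OF v v]
    let ?w = "(?a $ 2 *.~H1 ?v 1) .+~H1 (?a $ 1 *.~H1 ?v 2)"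
    have w: "?w .: H1" by (intro H1_ops(1) sv)
    have wy: "?w (y k) = (if k = m then c (y k) else 0)" if k: "k \<in> {1..<n}" for k
    proof -
     have kn: "k \<le> n" using k by simp
     have e: "?w (y k) = ?a $ 2 *s ?v 1 (y k) + ?a $ 1 *s ?v 2 (y k)" by (simp add: H1_ops(3)[OF sv sv kn] H1_ops(4)[OF v v kn])
     have "Pp m *v ?a = ?a $ 2 *s (Pp m *v axis 2 1) + ?a $ 1 *s (Pp m *v axis 1 1)"
      by (simp add: vec_eq_iff forall_2 matrix_vector_mult_def sum_2 axis_def algebra_simps)
     then show ?thesis unfolding e v_basis(2)[OF m(1) k] using ac_inverse[OF m(2), of c] by simp
    qed
    have fw: "f ?w = phi0 ?w" unfolding add[OF sv sv] sm[OF v v] phi0_linear(1)[OF sv sv] phi0_linear(2)[OF v v] using vv[OF m(1)] by simp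
    have "f (d .+~H1 ?w) = phi0 (d .+~H1 ?w)" unfolding add[OF d(1) w] phi0_linear(1)[OF d(1) w] fw d(3) ..
    moreover have "(d .+~H1 ?w) (y k) = (if k < Suc m then c (y k) else 0)" if k: "k \<in> {1..<n}" for k
    proof -
     have kn: "k \<le> n" using k by simp
     show ?thesis using wy[OF k] d(2) k by (simp add: H1_ops(3)[OF d(1) w kn] less_Suc_eq)
    qed
    ultimately show ?thesis by (intro bexI[OF _ H1_ops(1)[OF d(1) w]] conjI ballI)
   qed
  qed
  from this[OF order_refl] obtain d where d: "d .: H1" "\<forall>k\<in>{1..<n}. d (y k) = (if k < n then c (y k) else 0)" "f d = phi0 d" by (elim bexE conjE)
  have "d = c" by (rule H1_unique[OF d(1) c]) (use d(2) in simp)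
  then show "f c = ?f c" using d(3) c by simp
 qed simp
 have ph: "phi n \<rho> = ?f" unfolding phi_def Let_def by (rule the_equality[of ?P, OF P uniq])
 then show "phi n \<rho> \<in> lh" using f by simp
 show "c .: H1 ==> phi n \<rho> c = phi0 c" unfolding ph by simp
qed

end

section \<open>The action of a crossing on loops and cocycles\<close>

lemma artin_image_closed: assumes "1 \<le> i" "i < n" "j \<in> {1..n}" "g = Crossing i \<or> g = CrossingInv i"
 shows "artin_image n g j .: (pi1 n)"
proof -
 have i: "i \<in> {1..n}" "i + 1 \<in> {1..n}" using assms by auto
 note c = loop_x_closed[OF i(1)] loop_x_closed[OF i(2)] loop_x_closed[OF assms(3)]
 show ?thesis using assms(4) c by (elim disjE) simp_all
qed

lemma artin_spec:
 assumes i: "1 \<le> i" "i < n" and g: "g = Crossing i \<or> g = CrossingInv i"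
 shows "artin n g \<in> hom (pi1 n) (pi1 n)" "j \<in> {1..n} ==> artin n g (loop_x n j) = artin_image n g j"
proof -
 obtain h where h: "h \<in> hom (pi1 n) (pi1 n)" "\<forall>j\<in>{1..n}. h (loop_x n j) = artin_image n g j"
  using pi_lift[OF pi_group, of n "artin_image n g"] artin_image_closed[OF i _ g] by blast
 let ?P = "%h. h \<in> hom (pi1 n) (pi1 n) \<inter> extensional (carrier (pi1 n)) \<and> (\<forall>j\<in>{1..n}. h (loop_x n j) = artin_image n g j)"
 have P: "?P (restrict h (carrier (pi1 n)))"
  using h by (auto simp: hom_def)
 have uniq: "h' = restrict h (carrier (pi1 n))" if p: "?P h'" for h'
 proof (rule extensionalityI[of _ "carrier (pi1 n)"])
  show "h' \<in> extensional (carrier (pi1 n))" using p by auto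
  show "h' x = restrict h (carrier (pi1 n)) x" if "x .: (pi1 n)" for x
   using pi_hom_eq[OF pi_group _ h(1) _ that, of h'] p h(2) that by simp
 qed simp
 have "?P (artin n g)" unfolding artin_def by (rule theI[of ?P, OF P uniq])
 then show "artin n g \<in> hom (pi1 n) (pi1 n)" "j \<in> {1..n} ==> artin n g (loop_x n j) = artin_image n g j" by auto
qed

lemma pi_hom_props:
 assumes h: "h \<in> hom (pi1 n) (pi1 n)" and x: "x .: (pi1 n)"
 shows "h x .: (pi1 n)" "y .: (pi1 n) ==> h (x .*~(pi1 n) y) = h x .*~(pi1 n) h y" "h (inv~(pi1 n) x) = inv~(pi1 n) h x" "h \<one>~(pi1 n) = \<one>~(pi1 n)"
proof -
 show c: "h x .: (pi1 n)" and m: "y .: (pi1 n) ==> h (x .*~(pi1 n) y) = h x .*~(pi1 n) h y" using h x by (simp_all add: hom_def Pi_iff)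
 show o: "h \<one>~(pi1 n) = \<one>~(pi1 n)" by (rule hom_one[OF h pi_group pi_group])
 have "h (inv~(pi1 n) x) .*~(pi1 n) h x = \<one>~(pi1 n)" using hom_mult[OF h PI.inv_closed[OF x] x] x o by simp
 moreover have "h (inv~(pi1 n) x) .: (pi1 n)" using h PI.inv_closed[OF x] by (simp add: hom_def Pi_iff)
 ultimately show "h (inv~(pi1 n) x) = inv~(pi1 n) h x" using PI.inv_equality[OF _ c] by simp
qed

text \<open>Since y_(i-1) times the inverse of y_i is the inverse of x_i, the image of x_i y_(i-1)
  takes the stated form. For larger indices the changes of x_i and x_(i+1) cancel.\<close>

lemma artin_y:
 assumes i: "1 \<le> i" "i < n" and k: "k \<le> n"
 shows "artin n (Crossing i) (loop_y n k) = (if k = i then loop_y n (i - 1) .*~(pi1 n) inv~(pi1 n) loop_y n i .*~(pi1 n) loop_y n (i + 1) else loop_y n k)"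
proof -
 let ?h = "artin n (Crossing i)" and ?x = "loop_x n" and ?y = "loop_y n"
 note s = artin_spec[OF i disjI1[OF refl]]
 have I: "i \<in> {1..n}" "i + 1 \<in> {1..n}" "i - 1 \<le> n" "Suc (i - 1) = i" "i \<le> n" "Suc i \<le> n" using i by auto
 note c [simp] = loop_x_closed[OF I(1)] loop_x_closed[OF I(2)] loop_y_closed[OF I(3)] loop_y_closed[OF I(5)]
 have yi: "?y i = ?x i .*~(pi1 n) ?y (i - 1)" using loop_y.simps(2)[of n "i - 1"] unfolding I(4) .
 have yi1: "?y (i + 1) = ?x (i + 1) .*~(pi1 n) ?y i" using loop_y.simps(2)[of n i] unfolding Suc_eq_plus1 .
 have m: "?h (a .*~(pi1 n) b) = ?h a .*~(pi1 n) ?h b" if "a .: (pi1 n)" "b .: (pi1 n)" for a b using hom_mult[OF s(1) that] .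
 have low: "?h (?y k) = ?y k" if "k < i" for k using that
 proof (induction k)
  case 0
  then show ?case using pi_hom_props(4)[OF s(1), of "\<one>~(pi1 n)"] by simp
 next
  case (Suc k)
  then have "Suc k \<in> {1..n}" "Suc k \<noteq> i" "Suc k \<noteq> i + 1" "k \<le> n" using i by auto
  then show ?case using Suc s(2)[of "Suc k"] m by simp
 qed
 have li: "?h (?y (i - 1)) = ?y (i - 1)" by (rule low) (use i in simp)
 have "?y (i - 1) .*~(pi1 n) inv~(pi1 n) ?y i = inv~(pi1 n) ?x i"
  unfolding yi by (simp add: PI.inv_mult_group PI.m_assoc[symmetric])
 then have h1: "?h (?y i) = ?y (i - 1) .*~(pi1 n) inv~(pi1 n) ?y i .*~(pi1 n) ?y (i + 1)"
  unfolding yi1 unfolding yi using s(2)[OF I(1)] li by (simp add: m PI.m_assoc)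
 have h2: "?h (?y (i + 1)) = ?y (i + 1)"
 proof -
  have "?h (?y (i + 1)) = ?x i .*~(pi1 n) (inv~(pi1 n) ?x i .*~(pi1 n) (?x (i + 1) .*~(pi1 n) (?x i .*~(pi1 n) ?y (i - 1))))"
   unfolding yi1 yi using s(2)[OF I(1)] s(2)[OF I(2)] li by (simp add: m PI.m_assoc)
  also have "\<dots> = ?y (i + 1)" unfolding yi1 yi by (simp add: PI.m_assoc[symmetric])
  finally show ?thesis .
 qed
 have high: "?h (?y k) = ?y k" if "i + 1 \<le> k" "k \<le> n" for k using that
 proof (induction k rule: dec_induct)
  case base
  then show ?case using h2 by simp
 next
  case (step k)
  then have "Suc k \<in> {1..n}" "Suc k \<noteq> i" "Suc k \<noteq> i + 1" "k \<le> n" using i by auto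
  then show ?case using step s(2)[of "Suc k"] m by simp
 qed
 consider "k < i" | "k = i" | "i + 1 \<le> k" by linarith
 then show ?thesis using low high h1 k by cases auto
qed

lemma artin_inverse:
 assumes i: "1 \<le> i" "i < n" and g: "g .: (pi1 n)"
 shows "artin n (CrossingInv i) (artin n (Crossing i) g) = g" "artin n (Crossing i) (artin n (CrossingInv i) g) = g"
proof -
 let ?h = "artin n (Crossing i)" and ?k = "artin n (CrossingInv i)" and ?x = "loop_x n"
 note s = artin_spec[OF i disjI1[OF refl]] and t = artin_spec[OF i disjI2[OF refl]]
 have I: "i \<in> {1..n}" "i + 1 \<in> {1..n}" using i by auto
 note c [simp] = loop_x_closed[OF I(1)] loop_x_closed[OF I(2)]
 note hp = pi_hom_props[OF s(1)] and kp = pi_hom_props[OF t(1)]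
 have id: "(%g. g) \<in> hom (pi1 n) (pi1 n)" by (simp add: hom_def)
 have comp: "(%g. ?k (?h g)) \<in> hom (pi1 n) (pi1 n)" "(%g. ?h (?k g)) \<in> hom (pi1 n) (pi1 n)"
  using hp(1,2) kp(1,2) by (simp_all add: hom_def)
 have ca: "a .*~(pi1 n) (inv~(pi1 n) a .*~(pi1 n) b) = b" "inv~(pi1 n) a .*~(pi1 n) (a .*~(pi1 n) b) = b" if "a .: (pi1 n)" "b .: (pi1 n)" for a b
  using that by (simp_all add: PI.m_assoc[symmetric])
 have si: "?h (?x i) = inv~(pi1 n) ?x i .*~(pi1 n) (?x (i + 1) .*~(pi1 n) ?x i)" "?h (?x (i + 1)) = ?x i"
  using s(2)[OF I(1)] s(2)[OF I(2)] by (simp_all add: PI.m_assoc)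
 have ti: "?k (?x i) = ?x (i + 1)" "?k (?x (i + 1)) = ?x (i + 1) .*~(pi1 n) (?x i .*~(pi1 n) inv~(pi1 n) ?x (i + 1))"
  using t(2)[OF I(1)] t(2)[OF I(2)] by (simp_all add: PI.m_assoc)
 have other: "?h (?x j) = ?x j" "?k (?x j) = ?x j" if "j \<in> {1..n}" "j \<noteq> i" "j \<noteq> i + 1" for j using s(2)[OF that(1)] t(2)[OF that(1)] that by simp_all
 have 1: "?k (?h (?x i)) = ?x i" "?k (?h (?x (i + 1))) = ?x (i + 1)" unfolding si by (simp_all add: kp ti ca PI.m_assoc)
 have 2: "?h (?k (?x i)) = ?x i" "?h (?k (?x (i + 1))) = ?x (i + 1)" unfolding ti by (simp_all add: hp si ca PI.m_assoc)
 show "?k (?h g) = g"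
 proof (rule pi_hom_eq[OF pi_group comp(1) id _ g])
  fix j assume j: "j \<in> {1..n}"
  show "?k (?h (?x j)) = ?x j" using 1 other[OF j] by (cases "j = i \<or> j = i + 1") auto
 qed
 show "?h (?k g) = g"
 proof (rule pi_hom_eq[OF pi_group comp(2) id _ g])
  fix j assume j: "j \<in> {1..n}"
  show "?h (?k (?x j)) = ?x j" using 2 other[OF j] by (cases "j = i \<or> j = i + 1") auto
 qed
qed

context colored_crossing
begin

lemma prefix_low: "k < i ==> B.Pp k = A.Pp k \<and> B.Mm k = A.Mm k"
 by (induction k) (use other in auto)

lemma prefix_i: "A.Pp i = A.Pp (i - 1) ** chi_plus (\<rho> i)" "A.Mm i = A.Mm (i - 1) ** chi_minus (\<rho> i)" "B.Pp i = A.Pp (i - 1) ** chi_plus (\<rho>' i)" "B.Mm i = A.Mm (i - 1) ** chi_minus (\<rho>' i)"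
 "A.Pp (i + 1) = A.Pp i ** chi_plus (\<rho> (i + 1))" "A.Mm (i + 1) = B.Mm i ** chi_minus (\<rho>' (i + 1))" "B.Pp (i + 1) = A.Pp (i + 1)" "B.Mm (i + 1) = A.Mm (i + 1)"
proof -
 have s: "Suc (i - 1) = i" using idx(1) by simp
 have o: "B.Pp (i - 1) = A.Pp (i - 1)" "B.Mm (i - 1) = A.Mm (i - 1)" using prefix_low[of "i - 1"] idx(1) by auto
 note p = plus_prefix.simps(2)[of _ "i - 1", unfolded s] and m = minus_prefix.simps(2)[of _ "i - 1", unfolded s]
 note p1 = plus_prefix.simps(2)[of _ i, unfolded Suc_eq_plus1] and m1 = minus_prefix.simps(2)[of _ i, unfolded Suc_eq_plus1]
 show 1: "A.Pp i = A.Pp (i - 1) ** chi_plus (\<rho> i)" "A.Mm i = A.Mm (i - 1) ** chi_minus (\<rho> i)" by (rule p, rule m)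
 show 2: "B.Pp i = A.Pp (i - 1) ** chi_plus (\<rho>' i)" "B.Mm i = A.Mm (i - 1) ** chi_minus (\<rho>' i)" unfolding o[symmetric] by (rule p, rule m)
 show 3: "A.Pp (i + 1) = A.Pp i ** chi_plus (\<rho> (i + 1))" by (rule p1)
 show 4: "B.Pp (i + 1) = A.Pp (i + 1)" unfolding p1 1 2 matrix_mul_assoc[symmetric] sigma_matrices ..
 show 5: "B.Mm (i + 1) = A.Mm (i + 1)" unfolding m1 1 2 matrix_mul_assoc[symmetric] sigma_matrices ..
 show "A.Mm (i + 1) = B.Mm i ** chi_minus (\<rho>' (i + 1))" unfolding 5[symmetric] by (rule m1)
qed

text \<open>The first two coloring equations say that the products over the strands \<open>i\<close>
  and \<open>i + 1\<close> agree, so prefixes can differ only when they end between these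
  strands.\<close>

lemma prefix_other: assumes "k \<noteq> i" shows "B.Pp k = A.Pp k \<and> B.Mm k = A.Mm k"
proof (cases "k < i")
 case True
 then show ?thesis by (rule prefix_low)
next
 case False
 then have "i + 1 \<le> k" using assms by simp
 then show ?thesis
 proof (induction k rule: dec_induct)
  case base
  show ?case using prefix_i(7,8) by simp
 next
  case (step k)
  then show ?case using other[of "Suc k"] by simp
 qed
qed

lemma inv_i: "invertible (A.Pp i)" "invertible (A.Pp (i - 1))" "invertible (A.Mm i)" "invertible (A.Mm (i - 1))" "invertible (B.Pp i)" "invertible (B.Mm i)"
 "invertible (A.Mm (i + 1))" "invertible (chi_minus (\<rho> i))" "invertible (chi_plus (\<rho>' i))" "invertible (chi_minus (\<rho>' (i + 1)))" "invertible (chi_plus (\<rho> i))"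
proof -
 have I: "i \<le> n" "i - 1 \<le> n" "i + 1 \<le> n" using idx by auto
 show "invertible (A.Pp i)" "invertible (A.Pp (i - 1))" "invertible (A.Mm i)" "invertible (A.Mm (i - 1))" "invertible (B.Pp i)" "invertible (B.Mm i)" "invertible (A.Mm (i + 1))"
  by (intro A.prefix_invertible B.prefix_invertible I)+
 show "invertible (chi_minus (\<rho> i))" "invertible (chi_plus (\<rho>' i))" "invertible (chi_minus (\<rho>' (i + 1)))" "invertible (chi_plus (\<rho> i))"
  by (intro chi_invertible A.char B.char idx)+
qed

abbreviation "yi \<equiv> loop_y n (i - 1) .*~(pi1 n) inv~(pi1 n) loop_y n i"

lemma y_idx: "i - 1 \<le> n" "i \<le> n" "i + 1 \<le> n" using idx by auto

lemma y_cl [simp]: "loop_y n (i - 1) .: (pi1 n)" "loop_y n i .: (pi1 n)" "loop_y n (i + 1) .: (pi1 n)"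
 using loop_y_closed[OF y_idx(1)] loop_y_closed[OF y_idx(2)] loop_y_closed[OF y_idx(3)] .

lemma matrix_inv_inv: "invertible (M :: complex^2^2) ==> matrix_inv (matrix_inv M) = M"
 by (rule matrix_inv_unique) (simp_all add: matrix_inv_mult)

lemma hol_yi: "A.hol yi = A.Pp (i - 1) ** (chi_minus (\<rho> i) ** matrix_inv (A.Pp i))"
proof -
 have "A.hol yi = A.Pp (i - 1) ** (matrix_inv (A.Mm (i - 1)) ** (A.Mm i ** matrix_inv (A.Pp i)))"
  using A.hol_mult[of "loop_y n (i - 1)" "inv~(pi1 n) loop_y n i"]
  by (simp add: A.hol_inv A.hol_y[OF y_idx(1)] A.hol_y[OF y_idx(2)] matrix_inv_prod[OF inv_i(1) invertible_matrix_inv[OF inv_i(3)]] matrix_inv_inv[OF inv_i(3)] matrix_mul_assoc)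
 also have "A.Mm i ** matrix_inv (A.Pp i) = A.Mm (i - 1) ** (chi_minus (\<rho> i) ** matrix_inv (A.Pp i))"
  unfolding prefix_i(2) by (simp add: matrix_mul_assoc)
 finally show ?thesis by (simp add: matrix_inv_cancel[OF inv_i(4)])
qed

abbreviation "art \<equiv> artin n (Crossing i)"
abbreviation "artI \<equiv> artin n (CrossingInv i)"

lemmas art_spec = artin_spec[OF idx(1,2) disjI1[OF refl]]
lemmas artI_spec = artin_spec[OF idx(1,2) disjI2[OF refl]]
lemmas art_props = pi_hom_props[OF art_spec(1)] and artI_props = pi_hom_props[OF artI_spec(1)]

text \<open>The third coloring equation, in the form that moves the prefix through the crossing. It
  serves both for the holonomy and for the cocycles.\<close>

lemma key_matrix: "A.Pp (i - 1) ** (chi_minus (\<rho> i) ** chi_plus (\<rho> (i + 1))) = B.Pp i ** chi_minus (\<rho>' (i + 1))"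
 unfolding sigma_matrices(3) prefix_i(3) by (simp add: matrix_mul_assoc)

text \<open>It suffices to compare on the \<open>loop_y\<close>. All but the one at \<open>i\<close>
  are fixed and have equal prefixes; at \<open>i\<close> the inner plus prefix cancels and
  \<open>key_matrix\<close> applies.\<close>

lemma hol_art: assumes g: "g .: (pi1 n)" shows "A.hol (art g) = B.hol g"
proof (rule pi_hom_eq_y[OF GL2_group _ B.hol_spec(1) _ g])
 show "(%g. A.hol (art g)) \<in> hom (pi1 n) GL2" by (rule homI) (simp_all add: art_props A.hol_mult A.hol_invertible)
 fix k assume k: "k \<in> {1..n}"
 then have kn: "k \<le> n" by simp
 show "A.hol (art (loop_y n k)) = B.hol (loop_y n k)"
 proof (cases "k = i")
  case False
  then show ?thesis unfolding artin_y[OF idx(1,2) kn] using prefix_other[OF False] by (simp add: A.hol_y[OF kn] B.hol_y[OF kn])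
 next
  case True
  have "A.hol (art (loop_y n i)) = A.hol yi ** A.hol (loop_y n (i + 1))"
   unfolding artin_y[OF idx(1,2) y_idx(2)] using A.hol_mult[of yi "loop_y n (i + 1)"] by simp
  also have "\<dots> = A.Pp (i - 1) ** (chi_minus (\<rho> i) ** (matrix_inv (A.Pp i) ** (A.Pp i ** (chi_plus (\<rho> (i + 1)) ** matrix_inv (A.Mm (i + 1))))))"
   unfolding hol_yi A.hol_y[OF y_idx(3)] prefix_i(5) by (simp only: matrix_mul_assoc)
  also have "\<dots> = (A.Pp (i - 1) ** (chi_minus (\<rho> i) ** chi_plus (\<rho> (i + 1)))) ** matrix_inv (A.Mm (i + 1))"
   unfolding matrix_inv_cancel(2)[OF inv_i(1)] by (simp only: matrix_mul_assoc)
  also have "\<dots> = B.Pp i ** (chi_minus (\<rho>' (i + 1)) ** (matrix_inv (chi_minus (\<rho>' (i + 1))) ** matrix_inv (B.Mm i)))"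
   unfolding key_matrix prefix_i(6) matrix_inv_prod[OF inv_i(6,10)] by (simp only: matrix_mul_assoc)
  finally show ?thesis unfolding True B.hol_y[OF y_idx(2)] matrix_inv_cancel(1)[OF inv_i(10)] .
 qed
qed

text \<open>The cocycle rule along the three factors in \<open>artin_y\<close>. The holonomy of
  \<open>yi\<close> occurs twice because the value at an inverse is minus the inverse holonomy
  applied to the value.\<close>

lemma B_crossing:
 assumes c: "c .: A.H1"
 shows "B_gen n (\<rho>, Crossing i, \<rho>') c .: B.H1" "k \<le> n ==> k \<noteq> i ==> B_gen n (\<rho>, Crossing i, \<rho>') c (loop_y n k) = c (loop_y n k)"
  "B_gen n (\<rho>, Crossing i, \<rho>') c (loop_y n i) = c (loop_y n (i - 1)) - A.hol yi *v c (loop_y n i) + A.hol yi *v c (loop_y n (i + 1))"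
proof -
 let ?d = "\<lambda>a\<in>carrier (pi1 n). c (art a)"
 have b: "B_gen n (\<rho>, Crossing i, \<rho>') c = ?d" by (simp add: B_gen_def)
 note H = A.H1D[OF c]
 show 2: "B_gen n (\<rho>, Crossing i, \<rho>') c (loop_y n k) = c (loop_y n k)" if "k \<le> n" "k \<noteq> i" for k
  unfolding b using that by (simp add: artin_y[OF idx(1,2)])
 have "?d (loop_y n n) = 0" using 2[of n] H(3) idx unfolding b by simp
 then show "B_gen n (\<rho>, Crossing i, \<rho>') c .: B.H1"
  unfolding b by (simp add: Hlf_def art_props H(2) hol_art)
 have "?d (loop_y n i) = c yi + A.hol yi *v c (loop_y n (i + 1))"
  using H(2)[of yi "loop_y n (i + 1)"] by (simp add: artin_y[OF idx(1,2) y_idx(2)])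
 moreover have "c yi = c (loop_y n (i - 1)) - A.hol yi *v c (loop_y n i)"
 proof -
  have "c yi = c (loop_y n (i - 1)) + A.hol (loop_y n (i - 1)) *v - (matrix_inv (A.hol (loop_y n i)) *v c (loop_y n i))"
   using H(2)[of "loop_y n (i - 1)" "inv~(pi1 n) loop_y n i"] H(5)[of "loop_y n i"] by simp
  moreover have "M *v - v = - (M *v v)" for M :: "complex^2^2" and v by (simp add: matrix_vector_mult_def vec_eq_iff sum_2)
  ultimately show ?thesis using A.hol_mult[of "loop_y n (i - 1)" "inv~(pi1 n) loop_y n i"]
   by (simp add: A.hol_inv matrix_vector_mul_assoc)
 qed
 ultimately show "B_gen n (\<rho>, Crossing i, \<rho>') c (loop_y n i) = c (loop_y n (i - 1)) - A.hol yi *v c (loop_y n i) + A.hol yi *v c (loop_y n (i + 1))"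
  unfolding b by simp
qed

lemma B_crossing_inv:
 assumes c: "c .: B.H1"
 shows "B_gen n (\<rho>', CrossingInv i, \<rho>) c .: A.H1" "B_gen n (\<rho>, Crossing i, \<rho>') (B_gen n (\<rho>', CrossingInv i, \<rho>) c) = c"
proof -
 let ?d = "\<lambda>a\<in>carrier (pi1 n). c (artI a)"
 have b: "B_gen n (\<rho>', CrossingInv i, \<rho>) c = ?d" by (simp add: B_gen_def)
 note H = B.H1D[OF c]
 have hI: "B.hol (artI g) = A.hol g" if g: "g .: (pi1 n)" for g
  using hol_art[OF artI_props(1)[OF g]] artin_inverse(2)[OF idx(1,2) g] by simp
 have "art (loop_y n n) = loop_y n n" using artin_y[OF idx(1,2) order_refl] idx by simp
 then have "artI (loop_y n n) = loop_y n n" using artin_inverse(1)[OF idx(1,2) loop_y_closed[OF order_refl]] by simp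
 then show "B_gen n (\<rho>', CrossingInv i, \<rho>) c .: A.H1"
  unfolding b by (simp add: Hlf_def artI_props H(2,3) hI)
 show "B_gen n (\<rho>, Crossing i, \<rho>') (B_gen n (\<rho>', CrossingInv i, \<rho>) c) = c"
  unfolding b by (rule extensionalityI[OF _ H(1)]) (simp_all add: B_gen_def art_props artin_inverse(1)[OF idx(1,2)])
qed

end

context nonsingular_crossing
begin

text \<open>At \<open>i\<close> the formula of \<open>B_crossing\<close> is rewritten in
  coordinates: \<open>hol_yi\<close> simplifies the middle term and \<open>key_matrix\<close> the
  last one. After multiplication by the new prefix the three terms are those of
  \<open>L_matrix\<close>.\<close>

lemma ac_crossing:
 assumes c: "c .: A.H1" and k: "k \<le> n"
 shows "B.ac (B_gen n (\<rho>, Crossing i, \<rho>') c) k = ((A.ac c)(i := L (i - 1) (A.ac c (i - 1)) + L i (A.ac c i) + L (i + 1) (A.ac c (i + 1)))) k"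
proof (cases "k = i")
 case False
 then show ?thesis using B_crossing(2)[OF c k False] prefix_other[OF False] by (simp add: B.ac_def A.ac_def)
next
 case True
 let ?a = "A.ac c" and ?M = "chi_minus (\<rho> i)"
 let ?b = "L (i - 1) (?a (i - 1)) + L i (?a i) + L (i + 1) (?a (i + 1))"
 note y = A.ac_inverse[OF y_idx(1), of c] A.ac_inverse[OF y_idx(2), of c] A.ac_inverse[OF y_idx(3), of c]
 have h: "A.hol yi *v (A.Pp i *v v) = A.Pp (i - 1) *v (?M *v v)" for v
  unfolding hol_yi matrix_vector_mul_assoc[symmetric] by (simp add: matrix_inv_cancel[OF inv_i(1)])
 have h2: "A.hol yi *v (A.Pp (i + 1) *v v) = B.Pp i *v (chi_minus (\<rho>' (i + 1)) *v v)" for v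
  unfolding prefix_i(5) matrix_vector_mul_assoc[of "A.Pp i", symmetric] h unfolding matrix_vector_mul_assoc key_matrix[symmetric] matrix_mul_assoc ..
 have "B_gen n (\<rho>, Crossing i, \<rho>') c (loop_y n i) = A.Pp (i - 1) *v ?a (i - 1) - A.Pp (i - 1) *v (?M *v ?a i) + B.Pp i *v (chi_minus (\<rho>' (i + 1)) *v ?a (i + 1))"
  unfolding B_crossing(3)[OF c] y h h2 ..
 also have "\<dots> = B.Pp i *v ?b"
  unfolding prefix_i(3) matrix_vector_mul_assoc[symmetric] matrix_vector_right_distrib L_matrix
  by (simp add: matrix_vector_right_distrib matrix_vector_mult_def vec_eq_iff sum_2 algebra_simps)
 finally show ?thesis unfolding True by (simp add: B.ac_def matrix_inv_cancel[OF inv_i(5)])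
qed

lemma phi_crossing:
 assumes c: "c .: A.H1"
 shows "NB.phi0 (B_gen n (\<rho>, Crossing i, \<rho>') c) = As (NA.phi0 c)"
 unfolding NA.phi0_def NB.phi0_def As_svs[of "A.ac c", OF A.ac_bound[OF c]]
 by (rule NB.svs_cong) (use ac_crossing[OF c] in simp)

text \<open>The statement for the crossing, applied to the preimage cocycle; injectivity then undoes
  the map on the algebra side.\<close>

lemma phi_crossing_inv:
 assumes c: "c .: B.H1"
 shows "NA.phi0 (B_gen n (\<rho>', CrossingInv i, \<rho>) c) = inv_into (carrier A.Q) As (NB.phi0 c)"
proof -
 let ?d = "B_gen n (\<rho>', CrossingInv i, \<rho>) c"
 note d = B_crossing_inv[OF c]
 have "NB.phi0 c = As (NA.phi0 ?d)" using phi_crossing[OF d(1)] unfolding d(2) .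
 moreover have "NA.phi0 ?d .: A.Q" using NA.phi0_Hs NA.Hs_carrier by auto
 ultimately show ?thesis using inv_into_f_f[OF A_sigma_inj] by simp
qed

end

section \<open>From crossings to braids\<close>

lemma gen_intertwines:
 assumes g: "gen_colored n \<rho> g \<rho>'" and ns: "nonsingular n \<rho>"
 shows "nonsingular n \<rho>'" "c .: (Hlf n \<rho>) ==> B_gen n (\<rho>, g, \<rho>') c .: (Hlf n \<rho>')"
  "c .: (Hlf n \<rho>) ==> phi n \<rho>' (B_gen n (\<rho>, g, \<rho>') c) = A_gen n (\<rho>, g, \<rho>') (phi n \<rho> c)"
proof -
 have "nonsingular n \<rho>' \<and> (c .: (Hlf n \<rho>) \<longrightarrow> B_gen n (\<rho>, g, \<rho>') c .: (Hlf n \<rho>') \<and>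
  phi n \<rho>' (B_gen n (\<rho>, g, \<rho>') c) = A_gen n (\<rho>, g, \<rho>') (phi n \<rho> c))"
 proof (cases g)
  case (Crossing i)
  then have s: "sigma_colored n i \<rho> \<rho>'" using g by (simp add: gen_colored_def)
  interpret N: nonsingular_crossing n i \<rho> \<rho>' by (intro nonsingular_crossing.intro colored_crossing.intro nonsingular_crossing_axioms.intro s ns)
  show ?thesis using N.nonsingular_iff ns N.B_crossing(1) N.phi_crossing N.NA.phi_spec(2) N.NB.phi_spec(2) by (simp add: Crossing)
 next
  case (CrossingInv i)
  then have s: "sigma_colored n i \<rho>' \<rho>" using g by (simp add: gen_colored_def)
  interpret C: colored_crossing n i \<rho>' \<rho> by (rule colored_crossing.intro[OF s])
  have ns': "nonsingular n \<rho>'" using C.nonsingular_iff ns by simp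
  interpret N: nonsingular_crossing n i \<rho>' \<rho> by (intro nonsingular_crossing.intro colored_crossing.intro nonsingular_crossing_axioms.intro s ns')
  show ?thesis using ns' C.B_crossing_inv(1) N.phi_crossing_inv N.NA.phi_spec(2) N.NB.phi_spec(2) by (simp add: CrossingInv)
 qed
 then show "nonsingular n \<rho>'" "c .: (Hlf n \<rho>) ==> B_gen n (\<rho>, g, \<rho>') c .: (Hlf n \<rho>')"
  "c .: (Hlf n \<rho>) ==> phi n \<rho>' (B_gen n (\<rho>, g, \<rho>') c) = A_gen n (\<rho>, g, \<rho>') (phi n \<rho> c)" by auto
qed

text \<open>Induction along the word. Each generator hands on nonsingularity to its target, which is
  what the next generator requires.\<close>

lemma braid_intertwines:
 assumes "colored_braid n \<rho> w \<rho>'" "nonsingular n \<rho>" "c .: (Hlf n \<rho>)"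
 shows "B_braid n w c .: (Hlf n \<rho>') \<and> phi n \<rho>' (B_braid n w c) = A_braid n w (phi n \<rho> c)"
 using assms
proof (induction w arbitrary: \<rho> c)
 case (Cons p w)
 obtain \<rho>1 g \<rho>2 where p: "p = (\<rho>1, g, \<rho>2)" by (cases p)
 have s: "\<rho>1 = \<rho>" "gen_colored n \<rho> g \<rho>2" "colored_braid n \<rho>2 w \<rho>'" using Cons.prems(1) by (auto simp: p)
 note g = gen_intertwines[OF s(2) Cons.prems(2)]
 show ?case using Cons.IH[OF s(3) g(1) g(2)[OF Cons.prems(3)]] g(3)[OF Cons.prems(3)] by (simp add: p s(1))
qed simp

lemma colored_braid_objects: "colored_braid n \<rho> w \<rho>' ==> \<rho> \<in> objects n \<and> \<rho>' \<in> objects n"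
proof (induction w arbitrary: \<rho>)
 case (Cons p w)
 obtain \<rho>1 g \<rho>2 where p: "p = (\<rho>1, g, \<rho>2)" by (cases p)
 have "gen_colored n \<rho> g \<rho>2" "colored_braid n \<rho>2 w \<rho>'" using Cons.prems by (auto simp: p)
 then show ?case using Cons.IH by (cases g) (auto simp: gen_colored_def sigma_colored_def)
qed simp

theorem theorem1:
  fixes n :: nat
  assumes "n \<ge> 2"
  shows
    "(\<forall>\<rho>\<in>objects n. nonsingular n \<rho> \<longrightarrow>
        phi n \<rho> \<in> lin_hom (Hlf n \<rho>) ((UQchar n \<rho>)\<lparr>carrier := Hchar n \<rho>\<rparr>) \<and>
        (\<forall>j\<in>{1..<n}.
           phi n \<rho> (v_basis n \<rho> j 1) = beta (UQchar n \<rho>) (atchar n \<rho>) j 1 \<and>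
           phi n \<rho> (v_basis n \<rho> j 2) = \<ominus>\<^bsub>UQchar n \<rho>\<^esub> beta (UQchar n \<rho>) (atchar n \<rho>) j 2) \<and>
        inj_on (phi n \<rho>) (carrier (Hlf n \<rho>))) \<and>
     (\<forall>\<rho> \<beta> \<rho>'. colored_braid n \<rho> \<beta> \<rho>' \<and> nonsingular n \<rho> \<and> nonsingular n \<rho>' \<longrightarrow>
        B_braid n \<beta> \<in> carrier (Hlf n \<rho>) \<rightarrow> carrier (Hlf n \<rho>') \<and>
        A_braid n \<beta> \<in> Hchar n \<rho> \<rightarrow> Hchar n \<rho>' \<and>
        (\<forall>c\<in>carrier (Hlf n \<rho>). phi n \<rho>' (B_braid n \<beta> c) = A_braid n \<beta> (phi n \<rho> c))) \<and>
     is_clifford_algebra_on (UQlocn n) (Zn n) (Hn n) (Cn n) \<and>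
     (\<forall>d e c u. Cn_homog n d c \<and> q_homog e u \<longrightarrow>
        supercommute (UQlocn n) d e c (coproduct_loc n u))"
proof (intro conjI allI ballI impI)
 fix \<rho> assume r: "\<rho> \<in> objects n" "nonsingular n \<rho>"
 interpret N: nonsing_quot n \<rho> by (intro nonsing_quot.intro char_quot.intro nonsing_quot_axioms.intro r)
 show "phi n \<rho> \<in> lin_hom (Hlf n \<rho>) ((UQchar n \<rho>)\<lparr>carrier := Hchar n \<rho>\<rparr>)" by (rule N.phi_spec(1))
 show "inj_on (phi n \<rho>) (carrier (Hlf n \<rho>))" by (rule inj_onI) (use N.phi_spec(2) N.phi0_inj in simp)
 fix j assume "j \<in> {1..<n}"
 then show "phi n \<rho> (v_basis n \<rho> j 1) = beta (UQchar n \<rho>) (atchar n \<rho>) j 1"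
  "phi n \<rho> (v_basis n \<rho> j 2) = .-~(UQchar n \<rho>) beta (UQchar n \<rho>) (atchar n \<rho>) j 2"
  using N.phi_spec(2)[OF N.v_basis(1)] N.phi0_v by simp_all
next
 fix \<rho> \<beta> \<rho>' assume a: "colored_braid n \<rho> \<beta> \<rho>' \<and> nonsingular n \<rho> \<and> nonsingular n \<rho>'"
 then have b: "colored_braid n \<rho> \<beta> \<rho>'" "nonsingular n \<rho>" "nonsingular n \<rho>'" by auto
 note o = colored_braid_objects[OF b(1)]
 note i = braid_intertwines[OF b(1,2)]
 interpret N: nonsing_quot n \<rho> by (intro nonsing_quot.intro char_quot.intro nonsing_quot_axioms.intro b) (use o in simp)
 interpret N': nonsing_quot n \<rho>' by (intro nonsing_quot.intro char_quot.intro nonsing_quot_axioms.intro b) (use o in simp)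
 show "B_braid n \<beta> \<in> carrier (Hlf n \<rho>) \<rightarrow> carrier (Hlf n \<rho>')" using i by simp
 show "phi n \<rho>' (B_braid n \<beta> c) = A_braid n \<beta> (phi n \<rho> c)" if "c .: (Hlf n \<rho>)" for c using i[OF that] by simp
 show "A_braid n \<beta> \<in> Hchar n \<rho> \<rightarrow> Hchar n \<rho>'"
 proof
  fix v assume "v \<in> Hchar n \<rho>"
  \<comment> \<open>\<open>phi\<close> maps onto the span of the \<beta>, so invariance of that span
    follows from the intertwining relation.\<close>
  then obtain c where c: "c .: (Hlf n \<rho>)" "N.phi0 c = v" using N.phi0_surj unfolding N.Hchar_Hs by blast
  have "A_braid n \<beta> v = phi n \<rho>' (B_braid n \<beta> c)" using i[OF c(1)] N.phi_spec(2)[OF c(1)] c(2) by simp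
  also have "\<dots> = N'.phi0 (B_braid n \<beta> c)" by (rule N'.phi_spec(2)) (use i[OF c(1)] in simp)
  finally have "A_braid n \<beta> v = N'.phi0 (B_braid n \<beta> c)" .
  then show "A_braid n \<beta> v \<in> Hchar n \<rho>'" unfolding N'.Hchar_Hs using N'.phi0_Hs by simp
 qed
next
 show "is_clifford_algebra_on (UQlocn n) (Zn n) (Hn n) (Cn n)" by (rule clifford_Cn)
next
 fix d e c u assume "Cn_homog n d c \<and> q_homog e u"
 then show "supercommute (UQlocn n) d e c (coproduct_loc n u)" using supercommute_Cn[of n d c e u] assms by simp
qed

end
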